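(* Assume Vopěnka's principle. Let $\mathcal{M}$ be a combinatorial simplicial model category, and let $(C,\varepsilon)$ be an augmented, homotopy idempotent simplicial functor $C\colon\mathcal{M}\to\mathcal{M}$. Then there exists a set $\mathcal{X}$ of objects of $\mathcal{M}$ such that $C$ is equivalent to the homotopy cellularization with respect to $\mathcal{X}$; that is, $(C,\varepsilon)$ is an $\mathcal{X}$-cellularization.
   Context: Vopěnka's principle: no locally presentable category has a large discrete full subcategory (equivalently, there is no proper class of graphs with no homomorphisms between any two distinct members). A model category is combinatorial if it is cofibrantly generated and its underlying category is locally presentable. In a simplicial model category $\mathcal{M}$, $\mathrm{map}(-,-)$ denotes the simplicial mapping space, $\tilde A$ a (functorial) cofibrant replacement of $A$, and $\hat X$ a (functorial) fibrant replacement of $X$; for a map $f\colon X\to Y$, $\hat f\colon\hat X\to\hat Y$ is the induced map. Homotopy co-orthogonality: an object $A$ and a map $f\colon X\to Y$ are homotopy co-orthogonal, written $A\mathrel{{}_{\mathrm h}\!\top} f$, if $\hat f_*\colon\mathrm{map}(\tilde A,\hat X)\to\mathrm{map}(\tilde A,\hat Y)$ is a weak equivalence of simplicial sets. For a class $\mathcal{A}$ of objects, $\mathcal{A}^{{}_{\mathrm h}\!\top}$ is the class of all maps $f$ with $A\mathrel{{}_{\mathrm h}\!\top} f$ for all $A\in\mathcal{A}$; for a class $\mathcal{S}$ of maps, $\mathcal{S}^{{}_{\mathrm h}\!\top}$ is the class of all objects $A$ with $A\mathrel{{}_{\mathrm h}\!\top} f$ for all $f\in\mathcal{S}$. A homotopy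 endofunctor is one that preserves weak equivalences. An augmented, homotopy idempotent simplicial functor is a simplicially enriched homotopy endofunctor $C\colon\mathcal{M}\to\mathcal{M}$ with a natural transformation (of simplicial functors) $\varepsilon\colon C\to\mathrm{Id}$ such that $\varepsilon C\simeq C\varepsilon$ (for every $X$ the maps $\varepsilon_{CX}$ and $C(\varepsilon_X)$ from $CCX$ to $CX$ agree in the homotopy category) and $C\varepsilon\colon CC\to C$ is a weak equivalence on all objects. For a class $\mathcal{A}$ of objects of $\mathcal{M}$, an $\mathcal{A}$-cellularization (homotopy cellularization, or co-localization, with respect to $\mathcal{A}$) is a homotopy endofunctor $C\colon\mathcal{M}\to\mathcal{M}$ with a natural transformation $\varepsilon\colon C\to\mathrm{Id}$ such that $\varepsilon C\simeq C\varepsilon$ and $C\varepsilon\colon CC\to C$ is a weak equivalence on all objects, and such that for every $X$ in $\mathcal{M}$ the map $\varepsilon_X\colon CX\to X$ is in $\mathcal{A}^{{}_{\mathrm h}\!\top}$ and $CX\in(\mathcal{A}^{{}_{\mathrm h}\!\top})^{{}_{\mathrm h}\!\top}$. *)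

theory Defs
  imports "HOL-Homology.Simplices" "HOL-Library.FuncSet"
begin

section \<open>Sets and classes\<close>

text \<open>
  The set/class distinction is rendered by a type \<open>'v\<close> whose cardinality is strongly
  inaccessible, so that \<open>'v\<close> plays the role of a universe: classes are arbitrary
  subsets of \<open>'v\<close> (or of a type of the same cardinality), and sets are the
  subsets of cardinality strictly below that of \<open>'v\<close>. All categories have their objects and
  morphisms in \<open>'v\<close>.
\<close>

definition small :: "'v set \<Rightarrow> bool" where
  "small A \<longleftrightarrow> |A| <o |UNIV :: 'v set|"

definition inaccessible :: "'v itself \<Rightarrow> bool" where
  "inaccessible _ \<longleftrightarrow>
     natLeq <o |UNIV :: 'v set| \<and>
     (\<forall>A :: 'v set. small A \<longrightarrow> |Pow A| <o |UNIV :: 'v set| ) \<and>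
     (\<forall>(I :: 'v set) (A :: 'v \<Rightarrow> 'v set). small I \<and> (\<forall>i\<in>I. small (A i)) \<longrightarrow> small (\<Union>i\<in>I. A i))"

definition small_regular_cardinal :: "'v rel \<Rightarrow> bool" where
  "small_regular_cardinal r \<longleftrightarrow> Card_order r \<and> cinfinite r \<and> regularCard r \<and> small (Field r)"


section \<open>Categories and functors\<close>

record 'v cat =
  Ob :: "'v set"
  Ar :: "'v set"
  src :: "'v \<Rightarrow> 'v"
  tgt :: "'v \<Rightarrow> 'v"
  ide :: "'v \<Rightarrow> 'v"
  comp :: "'v \<Rightarrow> 'v \<Rightarrow> 'v"  (infixl \<open>\<cdot>\<index>\<close> 70)

definition Hom :: "('v, 'm) cat_scheme \<Rightarrow> 'v \<Rightarrow> 'v \<Rightarrow> 'v set" where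
  "Hom C X Y = {f \<in> Ar C. src C f = X \<and> tgt C f = Y}"

locale category =
  fixes C :: "('v, 'm) cat_scheme" (structure)
  assumes src_tgt: "f \<in> Ar C \<Longrightarrow> src C f \<in> Ob C \<and> tgt C f \<in> Ob C"
    and ide_in: "X \<in> Ob C \<Longrightarrow> ide C X \<in> Hom C X X"
    and comp_in: "f \<in> Hom C X Y \<Longrightarrow> g \<in> Hom C Y Z \<Longrightarrow> g \<cdot> f \<in> Hom C X Z"
    and ide_left: "f \<in> Hom C X Y \<Longrightarrow> ide C Y \<cdot> f = f"
    and ide_right: "f \<in> Hom C X Y \<Longrightarrow> f \<cdot> ide C X = f"
    and assoc: "f \<in> Hom C W X \<Longrightarrow> g \<in> Hom C X Y \<Longrightarrow> h \<in> Hom C Y Z \<Longrightarrow> (h \<cdot> g) \<cdot> f = h \<cdot> (g \<cdot> f)"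
    and locally_small: "X \<in> Ob C \<Longrightarrow> Y \<in> Ob C \<Longrightarrow> small (Hom C X Y)"

definition small_category :: "('v, 'm) cat_scheme \<Rightarrow> bool" where
  "small_category J \<longleftrightarrow> category J \<and> small (Ob J) \<and> small (Ar J)"

definition full_sub :: "('v, 'm) cat_scheme \<Rightarrow> 'v set \<Rightarrow> ('v, 'm) cat_scheme" where
  "full_sub C S = C\<lparr>Ob := S, Ar := {f \<in> Ar C. src C f \<in> S \<and> tgt C f \<in> S}\<rparr>"

record 'v cfun =
  fob :: "'v \<Rightarrow> 'v"
  far :: "'v \<Rightarrow> 'v"

definition is_functor :: "('v, 'm) cat_scheme \<Rightarrow> ('v, 'n) cat_scheme \<Rightarrow> 'v cfun \<Rightarrow> bool" where
  "is_functor C D F \<longleftrightarrow>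
     (\<forall>X\<in>Ob C. fob F X \<in> Ob D \<and> far F (ide C X) = ide D (fob F X)) \<and>
     (\<forall>f\<in>Ar C. far F f \<in> Hom D (fob F (src C f)) (fob F (tgt C f))) \<and>
     (\<forall>f\<in>Ar C. \<forall>g\<in>Ar C. tgt C f = src C g \<longrightarrow> far F (g \<cdot>\<^bsub>C\<^esub> f) = far F g \<cdot>\<^bsub>D\<^esub> far F f)"

definition id_fun :: "'v cfun" where
  "id_fun = \<lparr>fob = (\<lambda>X. X), far = (\<lambda>f. f)\<rparr>"

definition is_nat_trans ::
  "('v, 'm) cat_scheme \<Rightarrow> ('v, 'n) cat_scheme \<Rightarrow> 'v cfun \<Rightarrow> 'v cfun \<Rightarrow> ('v \<Rightarrow> 'v) \<Rightarrow> bool" where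
  "is_nat_trans C D F G \<eta> \<longleftrightarrow>
     (\<forall>X\<in>Ob C. \<eta> X \<in> Hom D (fob F X) (fob G X)) \<and>
     (\<forall>f\<in>Ar C. \<eta> (tgt C f) \<cdot>\<^bsub>D\<^esub> far F f = far G f \<cdot>\<^bsub>D\<^esub> \<eta> (src C f))"


section \<open>Limits and colimits\<close>

definition is_cocone ::
  "('v, 'm) cat_scheme \<Rightarrow> ('v, 'n) cat_scheme \<Rightarrow> 'v cfun \<Rightarrow> 'v \<Rightarrow> ('v \<Rightarrow> 'v) \<Rightarrow> bool" where
  "is_cocone C J D X \<iota> \<longleftrightarrow>
     X \<in> Ob C \<and> (\<forall>j\<in>Ob J. \<iota> j \<in> Hom C (fob D j) X) \<and>
     (\<forall>u\<in>Ar J. \<iota> (tgt J u) \<cdot>\<^bsub>C\<^esub> far D u = \<iota> (src J u))"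

definition is_colimit ::
  "('v, 'm) cat_scheme \<Rightarrow> ('v, 'n) cat_scheme \<Rightarrow> 'v cfun \<Rightarrow> 'v \<Rightarrow> ('v \<Rightarrow> 'v) \<Rightarrow> bool" where
  "is_colimit C J D X \<iota> \<longleftrightarrow>
     is_cocone C J D X \<iota> \<and>
     (\<forall>Y \<kappa>. is_cocone C J D Y \<kappa> \<longrightarrow>
        (\<exists>!h. h \<in> Hom C X Y \<and> (\<forall>j\<in>Ob J. h \<cdot>\<^bsub>C\<^esub> \<iota> j = \<kappa> j)))"

definition is_cone ::
  "('v, 'm) cat_scheme \<Rightarrow> ('v, 'n) cat_scheme \<Rightarrow> 'v cfun \<Rightarrow> 'v \<Rightarrow> ('v \<Rightarrow> 'v) \<Rightarrow> bool" where
  "is_cone C J D X \<pi> \<longleftrightarrow>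
     X \<in> Ob C \<and> (\<forall>j\<in>Ob J. \<pi> j \<in> Hom C X (fob D j)) \<and>
     (\<forall>u\<in>Ar J. far D u \<cdot>\<^bsub>C\<^esub> \<pi> (src J u) = \<pi> (tgt J u))"

definition is_limit ::
  "('v, 'm) cat_scheme \<Rightarrow> ('v, 'n) cat_scheme \<Rightarrow> 'v cfun \<Rightarrow> 'v \<Rightarrow> ('v \<Rightarrow> 'v) \<Rightarrow> bool" where
  "is_limit C J D X \<pi> \<longleftrightarrow>
     is_cone C J D X \<pi> \<and>
     (\<forall>Y \<kappa>. is_cone C J D Y \<kappa> \<longrightarrow>
        (\<exists>!h. h \<in> Hom C Y X \<and> (\<forall>j\<in>Ob J. \<pi> j \<cdot>\<^bsub>C\<^esub> h = \<kappa> j)))"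

definition cocomplete :: "('v, 'm) cat_scheme \<Rightarrow> bool" where
  "cocomplete C \<longleftrightarrow>
     (\<forall>(J :: 'v cat) D. small_category J \<and> is_functor J C D \<longrightarrow> (\<exists>X \<iota>. is_colimit C J D X \<iota>))"

definition complete_cat :: "('v, 'm) cat_scheme \<Rightarrow> bool" where
  "complete_cat C \<longleftrightarrow>
     (\<forall>(J :: 'v cat) D. small_category J \<and> is_functor J C D \<longrightarrow> (\<exists>X \<pi>. is_limit C J D X \<pi>))"

definition initial_ob :: "('v, 'm) cat_scheme \<Rightarrow> 'v \<Rightarrow> bool" where
  "initial_ob C I \<longleftrightarrow> I \<in> Ob C \<and> (\<forall>X\<in>Ob C. \<exists>!f. f \<in> Hom C I X)"

definition terminal_ob :: "('v, 'm) cat_scheme \<Rightarrow> 'v \<Rightarrow> bool" where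
  "terminal_ob C T \<longleftrightarrow> T \<in> Ob C \<and> (\<forall>X\<in>Ob C. \<exists>!f. f \<in> Hom C X T)"

text \<open>\<open>Hom(A, -)\<close> sends the colimit cocone \<open>(Y, \<iota>)\<close> to a colimit cocone in the
  category of sets.\<close>

definition hom_preserves_colimit ::
  "('v, 'm) cat_scheme \<Rightarrow> 'v \<Rightarrow> ('v, 'n) cat_scheme \<Rightarrow> 'v cfun \<Rightarrow> 'v \<Rightarrow> ('v \<Rightarrow> 'v) \<Rightarrow> bool" where
  "hom_preserves_colimit C A J D Y \<iota> \<longleftrightarrow>
     (\<forall>(T :: 'v set) t.
        small T \<and> (\<forall>j\<in>Ob J. \<forall>g\<in>Hom C A (fob D j). t j g \<in> T) \<and>
        (\<forall>u\<in>Ar J. \<forall>g\<in>Hom C A (fob D (src J u)). t (tgt J u) (far D u \<cdot>\<^bsub>C\<^esub> g) = t (src J u) g)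
        \<longrightarrow> (\<exists>!h. h \<in> Hom C A Y \<rightarrow>\<^sub>E T \<and>
                (\<forall>j\<in>Ob J. \<forall>g\<in>Hom C A (fob D j). h (\<iota> j \<cdot>\<^bsub>C\<^esub> g) = t j g)))"


section \<open>Locally presentable categories and Vopenka's principle\<close>

definition poset_category :: "('v, 'm) cat_scheme \<Rightarrow> bool" where
  "poset_category J \<longleftrightarrow> small_category J \<and>
     (\<forall>i\<in>Ob J. \<forall>j\<in>Ob J. \<forall>u\<in>Hom J i j. \<forall>v\<in>Hom J i j. u = v) \<and>
     (\<forall>i\<in>Ob J. \<forall>j\<in>Ob J. Hom J i j \<noteq> {} \<and> Hom J j i \<noteq> {} \<longrightarrow> i = j)"

definition directed_poset_category :: "'v rel \<Rightarrow> ('v, 'm) cat_scheme \<Rightarrow> bool" where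
  "directed_poset_category r J \<longleftrightarrow> poset_category J \<and>
     (\<forall>S\<subseteq>Ob J. |S| <o r \<longrightarrow> (\<exists>u\<in>Ob J. \<forall>s\<in>S. Hom J s u \<noteq> {}))"

definition presentable_ob :: "('v, 'm) cat_scheme \<Rightarrow> 'v rel \<Rightarrow> 'v \<Rightarrow> bool" where
  "presentable_ob C r A \<longleftrightarrow> A \<in> Ob C \<and>
     (\<forall>(J :: 'v cat) D Y \<iota>. directed_poset_category r J \<and> is_functor J C D \<and> is_colimit C J D Y \<iota>
        \<longrightarrow> hom_preserves_colimit C A J D Y \<iota>)"

definition locally_presentable :: "('v, 'm) cat_scheme \<Rightarrow> bool" where
  "locally_presentable C \<longleftrightarrow> category C \<and> cocomplete C \<and>
     (\<exists>r S. small_regular_cardinal r \<and> S \<subseteq> Ob C \<and> small S \<and> (\<forall>A\<in>S. presentable_ob C r A) \<and>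
        (\<forall>X\<in>Ob C. \<exists>(J :: 'v cat) D \<iota>. directed_poset_category r J \<and> is_functor J C D \<and>
           (\<forall>j\<in>Ob J. fob D j \<in> S) \<and> is_colimit C J D X \<iota>))"

definition discrete_full_on :: "('v, 'm) cat_scheme \<Rightarrow> 'v set \<Rightarrow> bool" where
  "discrete_full_on C D \<longleftrightarrow> D \<subseteq> Ob C \<and> (\<forall>X\<in>D. \<forall>Y\<in>D. \<forall>f\<in>Hom C X Y. X = Y \<and> f = ide C X)"

definition vopenka :: "'v itself \<Rightarrow> bool" where
  "vopenka _ \<longleftrightarrow>
     \<not> (\<exists>(K :: 'v cat) D. locally_presentable K \<and> discrete_full_on K D \<and> \<not> small D)"


section \<open>Model categories\<close>

record 'v model = "'v cat" +
  weq :: "'v set"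
  cof :: "'v set"
  fib :: "'v set"

definition square :: "('v, 'm) cat_scheme \<Rightarrow> 'v \<Rightarrow> 'v \<Rightarrow> 'v \<Rightarrow> 'v \<Rightarrow> bool" where
  "square C f g u v \<longleftrightarrow> f \<in> Ar C \<and> g \<in> Ar C \<and>
     u \<in> Hom C (src C f) (src C g) \<and> v \<in> Hom C (tgt C f) (tgt C g) \<and> v \<cdot>\<^bsub>C\<^esub> f = g \<cdot>\<^bsub>C\<^esub> u"

definition is_retract :: "('v, 'm) cat_scheme \<Rightarrow> 'v \<Rightarrow> 'v \<Rightarrow> bool" where
  "is_retract C f g \<longleftrightarrow> (\<exists>u v u' v'. square C f g u v \<and> square C g f u' v' \<and>
     u' \<cdot>\<^bsub>C\<^esub> u = ide C (src C f) \<and> v' \<cdot>\<^bsub>C\<^esub> v = ide C (tgt C f))"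

definition has_lifting :: "('v, 'm) cat_scheme \<Rightarrow> 'v \<Rightarrow> 'v \<Rightarrow> bool" where
  "has_lifting C i p \<longleftrightarrow> (\<forall>u v. square C i p u v \<longrightarrow>
     (\<exists>h\<in>Hom C (tgt C i) (src C p). h \<cdot>\<^bsub>C\<^esub> i = u \<and> p \<cdot>\<^bsub>C\<^esub> h = v))"

definition functorial_factorization :: "('v, 'm) cat_scheme \<Rightarrow> 'v set \<Rightarrow> 'v set \<Rightarrow> bool" where
  "functorial_factorization C \<L> \<R> \<longleftrightarrow> (\<exists>l r e.
     (\<forall>f\<in>Ar C. l f \<in> \<L> \<and> r f \<in> \<R> \<and>
        l f \<in> Hom C (src C f) (src C (r f)) \<and> r f \<in> Hom C (tgt C (l f)) (tgt C f) \<and>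
        r f \<cdot>\<^bsub>C\<^esub> l f = f \<and>
        e f f (ide C (src C f)) (ide C (tgt C f)) = ide C (tgt C (l f))) \<and>
     (\<forall>f g u v. square C f g u v \<longrightarrow>
        e f g u v \<in> Hom C (tgt C (l f)) (tgt C (l g)) \<and>
        e f g u v \<cdot>\<^bsub>C\<^esub> l f = l g \<cdot>\<^bsub>C\<^esub> u \<and> r g \<cdot>\<^bsub>C\<^esub> e f g u v = v \<cdot>\<^bsub>C\<^esub> r f) \<and>
     (\<forall>f g h u v u' v'. square C f g u v \<and> square C g h u' v' \<longrightarrow>
        e f h (u' \<cdot>\<^bsub>C\<^esub> u) (v' \<cdot>\<^bsub>C\<^esub> v) = e g h u' v' \<cdot>\<^bsub>C\<^esub> e f g u v))"

locale model_category = category M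
  for M :: "('v, 'm) model_scheme" (structure) +
  assumes weq_ar: "weq M \<subseteq> Ar M" and cof_ar: "cof M \<subseteq> Ar M" and fib_ar: "fib M \<subseteq> Ar M"
    and complete: "complete_cat M" and cocomplete: "cocomplete M"
    and two_of_three:
      "f \<in> Hom M X Y \<Longrightarrow> g \<in> Hom M Y Z \<Longrightarrow>
       (f \<in> weq M \<and> g \<in> weq M \<longrightarrow> g \<cdot> f \<in> weq M) \<and>
       (f \<in> weq M \<and> g \<cdot> f \<in> weq M \<longrightarrow> g \<in> weq M) \<and>
       (g \<in> weq M \<and> g \<cdot> f \<in> weq M \<longrightarrow> f \<in> weq M)"
    and retracts:
      "is_retract M f g \<Longrightarrow>
       (g \<in> weq M \<longrightarrow> f \<in> weq M) \<and> (g \<in> cof M \<longrightarrow> f \<in> cof M) \<and> (g \<in> fib M \<longrightarrow> f \<in> fib M)"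
    and lifting: "i \<in> cof M \<Longrightarrow> p \<in> fib M \<Longrightarrow> i \<in> weq M \<or> p \<in> weq M \<Longrightarrow> has_lifting M i p"
    and factorization1: "functorial_factorization M (cof M) (fib M \<inter> weq M)"
    and factorization2: "functorial_factorization M (cof M \<inter> weq M) (fib M)"

definition cofibrant :: "('v, 'm) model_scheme \<Rightarrow> 'v \<Rightarrow> bool" where
  "cofibrant M X \<longleftrightarrow> (\<exists>I i. initial_ob M I \<and> i \<in> Hom M I X \<and> i \<in> cof M)"

definition fibrant :: "('v, 'm) model_scheme \<Rightarrow> 'v \<Rightarrow> bool" where
  "fibrant M X \<longleftrightarrow> (\<exists>T p. terminal_ob M T \<and> p \<in> Hom M X T \<and> p \<in> fib M)"

definition cofibrant_replacement ::
  "('v, 'm) model_scheme \<Rightarrow> 'v cfun \<Rightarrow> ('v \<Rightarrow> 'v) \<Rightarrow> bool" where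
  "cofibrant_replacement M Q q \<longleftrightarrow> is_functor M M Q \<and> is_nat_trans M M Q id_fun q \<and>
     (\<forall>X\<in>Ob M. cofibrant M (fob Q X) \<and> q X \<in> weq M)"

definition fibrant_replacement ::
  "('v, 'm) model_scheme \<Rightarrow> 'v cfun \<Rightarrow> ('v \<Rightarrow> 'v) \<Rightarrow> bool" where
  "fibrant_replacement M R r \<longleftrightarrow> is_functor M M R \<and> is_nat_trans M M id_fun R r \<and>
     (\<forall>X\<in>Ob M. fibrant M (fob R X) \<and> r X \<in> weq M)"


subsection \<open>Transfinite composition, relative cell complexes, cofibrant generation\<close>

text \<open>A small poset category that is well ordered stands for an ordinal.\<close>

definition lt :: "('v, 'm) cat_scheme \<Rightarrow> 'v \<Rightarrow> 'v \<Rightarrow> bool" where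
  "lt J i j \<longleftrightarrow> i \<in> Ob J \<and> j \<in> Ob J \<and> i \<noteq> j \<and> Hom J i j \<noteq> {}"

definition ordinal_category :: "('v, 'm) cat_scheme \<Rightarrow> bool" where
  "ordinal_category J \<longleftrightarrow> poset_category J \<and>
     (\<forall>S\<subseteq>Ob J. S \<noteq> {} \<longrightarrow> (\<exists>m\<in>S. \<forall>s\<in>S. Hom J m s \<noteq> {}))"

definition is_succ :: "('v, 'm) cat_scheme \<Rightarrow> 'v \<Rightarrow> 'v \<Rightarrow> bool" where
  "is_succ J i j \<longleftrightarrow> lt J i j \<and> \<not> (\<exists>k. lt J i k \<and> lt J k j)"

definition is_limit_stage :: "('v, 'm) cat_scheme \<Rightarrow> 'v \<Rightarrow> bool" where
  "is_limit_stage J j \<longleftrightarrow> (\<exists>i. lt J i j) \<and> \<not> (\<exists>i. is_succ J i j)"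

definition the_arrow :: "('v, 'm) cat_scheme \<Rightarrow> 'v \<Rightarrow> 'v \<Rightarrow> 'v" where
  "the_arrow J i j = the_elem (Hom J i j)"

definition transfinite_sequence ::
  "('v, 'm) cat_scheme \<Rightarrow> ('v, 'n) cat_scheme \<Rightarrow> 'v cfun \<Rightarrow> bool" where
  "transfinite_sequence C J X \<longleftrightarrow> ordinal_category J \<and> is_functor J C X \<and>
     (\<forall>j. is_limit_stage J j \<longrightarrow>
        is_colimit C (full_sub J {i. lt J i j}) X (fob X j) (\<lambda>i. far X (the_arrow J i j)))"

text \<open>\<open>j\<close> is a pushout of \<open>i\<close> along \<open>u\<close>, with structure map \<open>v\<close>.\<close>

definition is_pushout :: "('v, 'm) cat_scheme \<Rightarrow> 'v \<Rightarrow> 'v \<Rightarrow> 'v \<Rightarrow> 'v \<Rightarrow> bool" where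
  "is_pushout C i u j v \<longleftrightarrow> square C i j u v \<and>
     (\<forall>Z. \<forall>a\<in>Hom C (tgt C i) Z. \<forall>b\<in>Hom C (src C j) Z. a \<cdot>\<^bsub>C\<^esub> i = b \<cdot>\<^bsub>C\<^esub> u \<longrightarrow>
        (\<exists>!h. h \<in> Hom C (tgt C j) Z \<and> h \<cdot>\<^bsub>C\<^esub> v = a \<and> h \<cdot>\<^bsub>C\<^esub> j = b))"

definition rel_cell :: "('v, 'm) cat_scheme \<Rightarrow> 'v set \<Rightarrow> 'v set" where
  "rel_cell C I = {f. \<exists>(J :: 'v cat) X Y \<iota> b.
     transfinite_sequence C J X \<and>
     (\<forall>i j. is_succ J i j \<longrightarrow> (\<exists>g\<in>I. \<exists>u v. is_pushout C g u (far X (the_arrow J i j)) v)) \<and>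
     is_colimit C J X Y \<iota> \<and> b \<in> Ob J \<and> (\<forall>j\<in>Ob J. Hom J b j \<noteq> {}) \<and> f = \<iota> b}"

text \<open>Filteredness of an ordinal with respect to the cardinal \<open>|K|\<close>.\<close>

definition filtered_ordinal :: "'v set \<Rightarrow> ('v, 'm) cat_scheme \<Rightarrow> bool" where
  "filtered_ordinal K J \<longleftrightarrow> ordinal_category J \<and> Ob J \<noteq> {} \<and> (\<forall>i\<in>Ob J. \<exists>j. lt J i j) \<and>
     (\<forall>S\<subseteq>Ob J. |S| \<le>o |K| \<longrightarrow> (\<exists>u\<in>Ob J. \<forall>s\<in>S. Hom J s u \<noteq> {}))"

definition small_relative_to :: "('v, 'm) cat_scheme \<Rightarrow> 'v set \<Rightarrow> 'v \<Rightarrow> bool" where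
  "small_relative_to C \<D> A \<longleftrightarrow> (\<exists>K :: 'v set. small K \<and>
     (\<forall>(J :: 'v cat) X Y \<iota>.
        filtered_ordinal K J \<and> transfinite_sequence C J X \<and>
        (\<forall>i j. is_succ J i j \<longrightarrow> far X (the_arrow J i j) \<in> \<D>) \<and> is_colimit C J X Y \<iota>
        \<longrightarrow> hom_preserves_colimit C A J X Y \<iota>))"

definition permits_small_object_argument :: "('v, 'm) cat_scheme \<Rightarrow> 'v set \<Rightarrow> bool" where
  "permits_small_object_argument C I \<longleftrightarrow>
     (\<forall>i\<in>I. small_relative_to C (rel_cell C I) (src C i))"

definition cofibrantly_generated :: "('v, 'm) model_scheme \<Rightarrow> bool" where
  "cofibrantly_generated M \<longleftrightarrow> (\<exists>I J. I \<subseteq> Ar M \<and> small I \<and> J \<subseteq> Ar M \<and> small J \<and>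
     permits_small_object_argument M I \<and> permits_small_object_argument M J \<and>
     fib M = {p \<in> Ar M. \<forall>j\<in>J. has_lifting M j p} \<and>
     fib M \<inter> weq M = {p \<in> Ar M. \<forall>i\<in>I. has_lifting M i p})"


section \<open>The homotopy category\<close>

text \<open>
  Morphisms of the localization at the weak equivalences are zigzags (paths of morphisms and
  of formal inverses of weak equivalences), read in the order of travel, modulo the congruence
  generated by the identity, composition and inversion relations.
\<close>

datatype 'v letter = Fwd 'v | Bwd 'v

fun zigzag :: "('v, 'm) model_scheme \<Rightarrow> 'v \<Rightarrow> 'v \<Rightarrow> 'v letter list \<Rightarrow> bool" where
  "zigzag M X Y [] \<longleftrightarrow> X \<in> Ob M \<and> X = Y"
| "zigzag M X Y (Fwd f # l) \<longleftrightarrow> f \<in> Ar M \<and> src M f = X \<and> zigzag M (tgt M f) Y l"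
| "zigzag M X Y (Bwd w # l) \<longleftrightarrow> w \<in> weq M \<and> tgt M w = X \<and> zigzag M (src M w) Y l"

inductive zigzag_eq ::
  "('v, 'm) model_scheme \<Rightarrow> 'v \<Rightarrow> 'v \<Rightarrow> 'v letter list \<Rightarrow> 'v letter list \<Rightarrow> bool" for M where
  zz_refl: "zigzag M X Y a \<Longrightarrow> zigzag_eq M X Y a a"
| zz_sym: "zigzag_eq M X Y a b \<Longrightarrow> zigzag_eq M X Y b a"
| zz_trans: "zigzag_eq M X Y a b \<Longrightarrow> zigzag_eq M X Y b c \<Longrightarrow> zigzag_eq M X Y a c"
| zz_cong: "zigzag M W X l \<Longrightarrow> zigzag_eq M X Y a b \<Longrightarrow> zigzag M Y Z r \<Longrightarrow>
    zigzag_eq M W Z (l @ a @ r) (l @ b @ r)"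
| zz_ide: "X \<in> Ob M \<Longrightarrow> zigzag_eq M X X [Fwd (ide M X)] []"
| zz_comp: "f \<in> Hom M X Y \<Longrightarrow> g \<in> Hom M Y Z \<Longrightarrow>
    zigzag_eq M X Z [Fwd f, Fwd g] [Fwd (g \<cdot>\<^bsub>M\<^esub> f)]"
| zz_inv1: "w \<in> weq M \<Longrightarrow> w \<in> Hom M X Y \<Longrightarrow> zigzag_eq M X X [Fwd w, Bwd w] []"
| zz_inv2: "w \<in> weq M \<Longrightarrow> w \<in> Hom M X Y \<Longrightarrow> zigzag_eq M Y Y [Bwd w, Fwd w] []"

definition agree_in_Ho :: "('v, 'm) model_scheme \<Rightarrow> 'v \<Rightarrow> 'v \<Rightarrow> 'v \<Rightarrow> 'v \<Rightarrow> bool" where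
  "agree_in_Ho M X Y f g \<longleftrightarrow>
     f \<in> Hom M X Y \<and> g \<in> Hom M X Y \<and> zigzag_eq M X Y [Fwd f] [Fwd g]"


section \<open>Simplicial sets\<close>

text \<open>The morphisms \<open>[m] \<rightarrow> [n]\<close> of the simplex category.\<close>

definition Delta :: "nat \<Rightarrow> nat \<Rightarrow> (nat \<Rightarrow> nat) set" where
  "Delta m n = {\<theta> \<in> {..m} \<rightarrow>\<^sub>E {..n}. mono_on {..m} \<theta>}"

text \<open>\<open>pull X m n \<theta>\<close> is the operator \<open>X\<^sub>n \<rightarrow> X\<^sub>m\<close> induced by \<open>\<theta> : [m] \<rightarrow> [n]\<close>.\<close>

record 'a sset =
  simplices :: "nat \<Rightarrow> 'a set"
  pull :: "nat \<Rightarrow> nat \<Rightarrow> (nat \<Rightarrow> nat) \<Rightarrow> 'a \<Rightarrow> 'a"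

locale simplicial_set =
  fixes X :: "'a sset"
  assumes pull_in: "\<theta> \<in> Delta m n \<Longrightarrow> x \<in> simplices X n \<Longrightarrow> pull X m n \<theta> x \<in> simplices X m"
    and pull_id: "x \<in> simplices X n \<Longrightarrow> pull X n n (\<lambda>i\<in>{..n}. i) x = x"
    and pull_comp: "\<phi> \<in> Delta l m \<Longrightarrow> \<theta> \<in> Delta m n \<Longrightarrow> x \<in> simplices X n \<Longrightarrow>
      pull X l n (compose {..l} \<theta> \<phi>) x = pull X l m \<phi> (pull X m n \<theta> x)"

definition small_sset :: "'v sset \<Rightarrow> bool" where
  "small_sset X \<longleftrightarrow> simplicial_set X \<and> (\<forall>n. small (simplices X n))"

definition simplicial_fun :: "'a sset \<Rightarrow> 'b sset \<Rightarrow> (nat \<Rightarrow> 'a \<Rightarrow> 'b) \<Rightarrow> bool" where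
  "simplicial_fun X Y f \<longleftrightarrow>
     (\<forall>n. \<forall>x\<in>simplices X n. f n x \<in> simplices Y n) \<and>
     (\<forall>m n. \<forall>\<theta>\<in>Delta m n. \<forall>x\<in>simplices X n. f m (pull X m n \<theta> x) = pull Y m n \<theta> (f n x))"

definition std_sset :: "nat \<Rightarrow> (nat \<Rightarrow> nat) sset" where
  "std_sset n = \<lparr>simplices = (\<lambda>m. Delta m n), pull = (\<lambda>l m \<phi> \<theta>. compose {..l} \<theta> \<phi>)\<rparr>"

definition horn :: "nat \<Rightarrow> nat \<Rightarrow> (nat \<Rightarrow> nat) sset" where
  "horn n k = (std_sset n)
     \<lparr>simplices := (\<lambda>m. {\<theta> \<in> Delta m n. \<exists>i\<le>n. i \<noteq> k \<and> i \<notin> \<theta> ` {..m}})\<rparr>"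

definition prod_sset :: "'a sset \<Rightarrow> 'b sset \<Rightarrow> ('a \<times> 'b) sset" where
  "prod_sset X Y = \<lparr>simplices = (\<lambda>n. simplices X n \<times> simplices Y n),
     pull = (\<lambda>m n \<theta>. map_prod (pull X m n \<theta>) (pull Y m n \<theta>))\<rparr>"

definition pullback_sset ::
  "'a sset \<Rightarrow> 'b sset \<Rightarrow> (nat \<Rightarrow> 'a \<Rightarrow> 'c) \<Rightarrow> (nat \<Rightarrow> 'b \<Rightarrow> 'c) \<Rightarrow> ('a \<times> 'b) sset" where
  "pullback_sset X Y f g = (prod_sset X Y)
     \<lparr>simplices := (\<lambda>n. {(x, y). x \<in> simplices X n \<and> y \<in> simplices Y n \<and> f n x = g n y})\<rparr>"

definition Kan_fibration :: "'a sset \<Rightarrow> 'b sset \<Rightarrow> (nat \<Rightarrow> 'a \<Rightarrow> 'b) \<Rightarrow> bool" where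
  "Kan_fibration X Y p \<longleftrightarrow> simplicial_fun X Y p \<and>
     (\<forall>n\<ge>1. \<forall>k\<le>n. \<forall>a b.
        simplicial_fun (horn n k) X a \<and> simplicial_fun (std_sset n) Y b \<and>
        (\<forall>m. \<forall>\<theta>\<in>simplices (horn n k) m. p m (a m \<theta>) = b m \<theta>) \<longrightarrow>
        (\<exists>c. simplicial_fun (std_sset n) X c \<and>
           (\<forall>m. \<forall>\<theta>\<in>simplices (horn n k) m. c m \<theta> = a m \<theta>) \<and>
           (\<forall>m. \<forall>\<theta>\<in>Delta m n. p m (c m \<theta>) = b m \<theta>)))"


subsection \<open>Geometric realization and weak equivalences\<close>

text \<open>The points of the coproduct of the \<open>X\<^sub>n \<times> \<Delta>\<^sup>n\<close> are written \<open>((n, x), t)\<close>.\<close>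

type_synonym 'a rpoint = "(nat \<times> 'a) \<times> (nat \<Rightarrow> real)"

definition simplex_space :: "nat \<Rightarrow> (nat \<Rightarrow> real) topology" where
  "simplex_space n = subtopology (powertop_real UNIV) (standard_simplex n)"

definition push_simplex :: "nat \<Rightarrow> (nat \<Rightarrow> nat) \<Rightarrow> (nat \<Rightarrow> real) \<Rightarrow> nat \<Rightarrow> real" where
  "push_simplex m \<theta> t = (\<lambda>j. \<Sum>i | i \<le> m \<and> \<theta> i = j. t i)"

definition presum :: "'a sset \<Rightarrow> 'a rpoint topology" where
  "presum X = sum_topology (\<lambda>(n, x). simplex_space n) {(n, x). x \<in> simplices X n}"

definition realization_step :: "'a sset \<Rightarrow> 'a rpoint rel" where
  "realization_step X =
     {(((m, pull X m n \<theta> x), t), ((n, x), push_simplex m \<theta> t)) | m n \<theta> x t.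
        \<theta> \<in> Delta m n \<and> x \<in> simplices X n \<and> t \<in> standard_simplex m}"

definition realization_rel :: "'a sset \<Rightarrow> 'a rpoint rel" where
  "realization_rel X = (realization_step X \<union> (realization_step X)\<inverse>)\<^sup>* \<inter>
     (topspace (presum X) \<times> topspace (presum X))"

definition realization :: "'a sset \<Rightarrow> 'a rpoint set topology" where
  "realization X = topology (\<lambda>U.
     U \<subseteq> topspace (presum X) // realization_rel X \<and> openin (presum X) (\<Union>U))"

lemma realization_rel_equiv: "equiv (topspace (presum X)) (realization_rel X)"
proof -
  have s: "sym ((realization_step X \<union> (realization_step X)\<inverse>)\<^sup>*)"
    by (intro sym_rtrancl sym_Un_converse)
  show ?thesis
    unfolding realization_rel_def
    by (rule equivI) (auto simp: refl_on_def intro: symI transI dest: symD[OF s] intro: rtrancl_trans)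
qed

lemma istopology_realization:
  "istopology (\<lambda>U. U \<subseteq> topspace (presum X) // realization_rel X \<and> openin (presum X) (\<Union>U))"
proof -
  have "\<Union>(S \<inter> T) = \<Union>S \<inter> \<Union>T"
    if "S \<subseteq> topspace (presum X) // realization_rel X" "T \<subseteq> topspace (presum X) // realization_rel X" for S T
    using that quotient_disj[OF realization_rel_equiv[of X]] by blast
  moreover have "\<Union>(\<Union>\<K>) = \<Union>(Union ` \<K>)" for \<K> :: "'a rpoint set set set" by blast
  ultimately show ?thesis
    unfolding istopology_def by (auto 4 3 intro: openin_Int openin_Union)
qed

lemma topspace_realization: "topspace (realization X) = topspace (presum X) // realization_rel X"
proof -
  have "openin (realization X) (topspace (presum X) // realization_rel X)"
    unfolding realization_def using istopology_realization[of X]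
    by (simp add: topology_inverse' Union_quotient[OF realization_rel_equiv])
  moreover have "openin (realization X) U \<Longrightarrow> U \<subseteq> topspace (presum X) // realization_rel X" for U
    unfolding realization_def using istopology_realization[of X] by (simp add: topology_inverse')
  ultimately show ?thesis by (metis openin_subset openin_topspace subset_antisym)
qed

definition realization_map ::
  "'b sset \<Rightarrow> (nat \<Rightarrow> 'a \<Rightarrow> 'b) \<Rightarrow> 'a rpoint set \<Rightarrow> 'b rpoint set" where
  "realization_map Y f c = realization_rel Y `` ((\<lambda>((n, x), t). ((n, f n x), t)) ` c)"

definition sphere_base :: "nat \<Rightarrow> real" where
  "sphere_base = (\<lambda>i. if i = 0 then 1 else 0)"

definition pointed_sphere :: "nat \<Rightarrow> 'a topology \<Rightarrow> 'a \<Rightarrow> ((nat \<Rightarrow> real) \<Rightarrow> 'a) \<Rightarrow> bool" where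
  "pointed_sphere n X x a \<longleftrightarrow> continuous_map (nsphere n) X a \<and> a sphere_base = x"

definition pointed_homotopic ::
  "nat \<Rightarrow> 'a topology \<Rightarrow> 'a \<Rightarrow> ((nat \<Rightarrow> real) \<Rightarrow> 'a) \<Rightarrow> ((nat \<Rightarrow> real) \<Rightarrow> 'a) \<Rightarrow> bool" where
  "pointed_homotopic n X x = homotopic_with (\<lambda>h. h sphere_base = x) (nsphere n) X"

text \<open>
  Bijectivity on \<open>\<pi>\<^sub>n\<close> for every \<open>n \<ge> 0\<close> and every base point, the elements of
  \<open>\<pi>\<^sub>n(X, x)\<close> being the pointed homotopy classes of maps \<open>S\<^sup>n \<rightarrow> X\<close>. For \<open>n = 0\<close> this is
  bijectivity on path components, provided that \<open>X\<close> is nonempty.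
\<close>

definition weak_homotopy_equivalence ::
  "'a topology \<Rightarrow> 'b topology \<Rightarrow> ('a \<Rightarrow> 'b) \<Rightarrow> bool" where
  "weak_homotopy_equivalence X Y f \<longleftrightarrow> continuous_map X Y f \<and>
     (topspace X = {} \<longrightarrow> topspace Y = {}) \<and>
     (\<forall>x\<in>topspace X. \<forall>n.
        (\<forall>b. pointed_sphere n Y (f x) b \<longrightarrow>
           (\<exists>a. pointed_sphere n X x a \<and> pointed_homotopic n Y (f x) (f \<circ> a) b)) \<and>
        (\<forall>a a'. pointed_sphere n X x a \<and> pointed_sphere n X x a' \<and>
           pointed_homotopic n Y (f x) (f \<circ> a) (f \<circ> a') \<longrightarrow> pointed_homotopic n X x a a'))"

definition sset_weq :: "'a sset \<Rightarrow> 'b sset \<Rightarrow> (nat \<Rightarrow> 'a \<Rightarrow> 'b) \<Rightarrow> bool" where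
  "sset_weq X Y f \<longleftrightarrow> simplicial_fun X Y f \<and>
     weak_homotopy_equivalence (realization X) (realization Y) (realization_map Y f)"


section \<open>Simplicial model categories\<close>

text \<open>\<open>scomp M X Y Z n\<close> is the composition \<open>map(Y, Z)\<^sub>n \<times> map(X, Y)\<^sub>n \<rightarrow> map(X, Z)\<^sub>n\<close>.\<close>

record 'v smodel = "'v model" +
  map_sp :: "'v \<Rightarrow> 'v \<Rightarrow> 'v sset"
  scomp :: "'v \<Rightarrow> 'v \<Rightarrow> 'v \<Rightarrow> nat \<Rightarrow> 'v \<Rightarrow> 'v \<Rightarrow> 'v"

text \<open>The totally degenerate \<open>n\<close>-simplex on a morphism, regarded as a vertex.\<close>

definition degen :: "('v, 'm) smodel_scheme \<Rightarrow> 'v \<Rightarrow> nat \<Rightarrow> 'v" where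
  "degen M f n = pull (map_sp M (src M f) (tgt M f)) n 0 (\<lambda>_\<in>{..n}. 0) f"

definition precomp :: "('v, 'm) smodel_scheme \<Rightarrow> 'v \<Rightarrow> 'v \<Rightarrow> nat \<Rightarrow> 'v \<Rightarrow> 'v" where
  "precomp M i Z n g = scomp M (src M i) (tgt M i) Z n g (degen M i n)"

definition postcomp :: "('v, 'm) smodel_scheme \<Rightarrow> 'v \<Rightarrow> 'v \<Rightarrow> nat \<Rightarrow> 'v \<Rightarrow> 'v" where
  "postcomp M W p n g = scomp M W (src M p) (tgt M p) n (degen M p n) g"

locale simplicial_category = category M
  for M :: "('v, 'm) smodel_scheme" (structure) +
  assumes map_sset: "X \<in> Ob M \<Longrightarrow> Y \<in> Ob M \<Longrightarrow> small_sset (map_sp M X Y)"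
    and map_vertices: "X \<in> Ob M \<Longrightarrow> Y \<in> Ob M \<Longrightarrow> simplices (map_sp M X Y) 0 = Hom M X Y"
    and scomp_simplicial: "X \<in> Ob M \<Longrightarrow> Y \<in> Ob M \<Longrightarrow> Z \<in> Ob M \<Longrightarrow>
      simplicial_fun (prod_sset (map_sp M Y Z) (map_sp M X Y)) (map_sp M X Z)
        (\<lambda>n (g, f). scomp M X Y Z n g f)"
    and scomp_vertices: "f \<in> Hom M X Y \<Longrightarrow> g \<in> Hom M Y Z \<Longrightarrow> scomp M X Y Z 0 g f = g \<cdot> f"
    and scomp_assoc: "W \<in> Ob M \<Longrightarrow> X \<in> Ob M \<Longrightarrow> Y \<in> Ob M \<Longrightarrow> Z \<in> Ob M \<Longrightarrow>
      f \<in> simplices (map_sp M W X) n \<Longrightarrow> g \<in> simplices (map_sp M X Y) n \<Longrightarrow>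
      h \<in> simplices (map_sp M Y Z) n \<Longrightarrow>
      scomp M W X Z n (scomp M X Y Z n h g) f = scomp M W Y Z n h (scomp M W X Y n g f)"
    and scomp_ide_left: "X \<in> Ob M \<Longrightarrow> Y \<in> Ob M \<Longrightarrow> f \<in> simplices (map_sp M X Y) n \<Longrightarrow>
      postcomp M X (ide M Y) n f = f"
    and scomp_ide_right: "X \<in> Ob M \<Longrightarrow> Y \<in> Ob M \<Longrightarrow> f \<in> simplices (map_sp M X Y) n \<Longrightarrow>
      precomp M (ide M X) Y n f = f"

text \<open>
  \<open>T\<close> is a tensor of \<open>X\<close> with \<open>K\<close>, with unit \<open>u : K \<rightarrow> map(X, T)\<close>: the simplicial map
  \<open>map(T, Y) \<rightarrow> Map(K, map(X, Y))\<close> induced by \<open>u\<close> is an isomorphism for every \<open>Y\<close>, the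
  \<open>n\<close>-simplices of the simplicial function complex \<open>Map(K, L)\<close> being the simplicial maps
  \<open>K \<times> \<Delta>[n] \<rightarrow> L\<close>. Cotensors are dual.
\<close>

definition is_tensor ::
  "('v, 'm) smodel_scheme \<Rightarrow> 'v \<Rightarrow> 'v sset \<Rightarrow> 'v \<Rightarrow> (nat \<Rightarrow> 'v \<Rightarrow> 'v) \<Rightarrow> bool" where
  "is_tensor M X K T u \<longleftrightarrow> T \<in> Ob M \<and> simplicial_fun K (map_sp M X T) u \<and>
     (\<forall>Y\<in>Ob M. \<forall>n h. simplicial_fun (prod_sset K (std_sset n)) (map_sp M X Y) h \<longrightarrow>
        (\<exists>!g. g \<in> simplices (map_sp M T Y) n \<and>
           (\<forall>m. \<forall>k\<in>simplices K m. \<forall>\<theta>\<in>Delta m n.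
              h m (k, \<theta>) = scomp M X T Y m (pull (map_sp M T Y) m n \<theta> g) (u m k))))"

definition is_cotensor ::
  "('v, 'm) smodel_scheme \<Rightarrow> 'v \<Rightarrow> 'v sset \<Rightarrow> 'v \<Rightarrow> (nat \<Rightarrow> 'v \<Rightarrow> 'v) \<Rightarrow> bool" where
  "is_cotensor M Y K E u \<longleftrightarrow> E \<in> Ob M \<and> simplicial_fun K (map_sp M E Y) u \<and>
     (\<forall>X\<in>Ob M. \<forall>n h. simplicial_fun (prod_sset K (std_sset n)) (map_sp M X Y) h \<longrightarrow>
        (\<exists>!g. g \<in> simplices (map_sp M X E) n \<and>
           (\<forall>m. \<forall>k\<in>simplices K m. \<forall>\<theta>\<in>Delta m n.
              h m (k, \<theta>) = scomp M X E Y m (u m k) (pull (map_sp M X E) m n \<theta> g))))"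

definition corner_target :: "('v, 'm) smodel_scheme \<Rightarrow> 'v \<Rightarrow> 'v \<Rightarrow> ('v \<times> 'v) sset" where
  "corner_target M i p =
     pullback_sset (map_sp M (src M i) (src M p)) (map_sp M (tgt M i) (tgt M p))
       (postcomp M (src M i) p) (precomp M i (tgt M p))"

definition corner_map :: "('v, 'm) smodel_scheme \<Rightarrow> 'v \<Rightarrow> 'v \<Rightarrow> nat \<Rightarrow> 'v \<Rightarrow> 'v \<times> 'v" where
  "corner_map M i p n g = (precomp M i (src M p) n g, postcomp M (tgt M i) p n g)"

locale simplicial_model_category = model_category M + simplicial_category M
  for M :: "('v, 'm) smodel_scheme" (structure) +
  assumes tensors: "X \<in> Ob M \<Longrightarrow> small_sset K \<Longrightarrow> \<exists>T u. is_tensor M X K T u"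
    and cotensors: "Y \<in> Ob M \<Longrightarrow> small_sset K \<Longrightarrow> \<exists>E u. is_cotensor M Y K E u"
    and corner: "i \<in> cof M \<Longrightarrow> p \<in> fib M \<Longrightarrow>
      Kan_fibration (map_sp M (tgt M i) (src M p)) (corner_target M i p) (corner_map M i p) \<and>
      (i \<in> weq M \<or> p \<in> weq M \<longrightarrow>
       sset_weq (map_sp M (tgt M i) (src M p)) (corner_target M i p) (corner_map M i p))"

definition combinatorial :: "('v, 'm) model_scheme \<Rightarrow> bool" where
  "combinatorial M \<longleftrightarrow> model_category M \<and> cofibrantly_generated M \<and> locally_presentable M"


section \<open>Homotopy co-orthogonality\<close>

text \<open>\<open>Q\<close> and \<open>R\<close> are the chosen cofibrant and fibrant replacement functors.\<close>

definition h_coorthogonal ::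
  "('v, 'm) smodel_scheme \<Rightarrow> 'v cfun \<Rightarrow> 'v cfun \<Rightarrow> 'v \<Rightarrow> 'v \<Rightarrow> bool" where
  "h_coorthogonal M Q R A f \<longleftrightarrow>
     sset_weq (map_sp M (fob Q A) (fob R (src M f))) (map_sp M (fob Q A) (fob R (tgt M f)))
       (postcomp M (fob Q A) (far R f))"

definition coorth_maps :: "('v, 'm) smodel_scheme \<Rightarrow> 'v cfun \<Rightarrow> 'v cfun \<Rightarrow> 'v set \<Rightarrow> 'v set" where
  "coorth_maps M Q R \<A> = {f \<in> Ar M. \<forall>A\<in>\<A>. h_coorthogonal M Q R A f}"

definition coorth_obs :: "('v, 'm) smodel_scheme \<Rightarrow> 'v cfun \<Rightarrow> 'v cfun \<Rightarrow> 'v set \<Rightarrow> 'v set" where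
  "coorth_obs M Q R \<S> = {A \<in> Ob M. \<forall>f\<in>\<S>. h_coorthogonal M Q R A f}"


section \<open>Homotopy idempotent functors and cellularizations\<close>

definition homotopy_endofunctor :: "('v, 'm) model_scheme \<Rightarrow> 'v cfun \<Rightarrow> bool" where
  "homotopy_endofunctor M F \<longleftrightarrow> is_functor M M F \<and> (\<forall>w\<in>weq M. far F w \<in> weq M)"

definition homotopy_idempotent :: "('v, 'm) model_scheme \<Rightarrow> 'v cfun \<Rightarrow> ('v \<Rightarrow> 'v) \<Rightarrow> bool" where
  "homotopy_idempotent M F \<epsilon> \<longleftrightarrow> (\<forall>X\<in>Ob M.
     agree_in_Ho M (fob F (fob F X)) (fob F X) (\<epsilon> (fob F X)) (far F (\<epsilon> X)) \<and>
     far F (\<epsilon> X) \<in> weq M)"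

definition is_cellularization ::
  "('v, 'm) smodel_scheme \<Rightarrow> 'v cfun \<Rightarrow> 'v cfun \<Rightarrow> 'v set \<Rightarrow> 'v cfun \<Rightarrow> ('v \<Rightarrow> 'v) \<Rightarrow> bool" where
  "is_cellularization M Q R \<A> F \<epsilon> \<longleftrightarrow>
     homotopy_endofunctor M F \<and> is_nat_trans M M F id_fun \<epsilon> \<and> homotopy_idempotent M F \<epsilon> \<and>
     (\<forall>X\<in>Ob M. \<epsilon> X \<in> coorth_maps M Q R \<A> \<and>
        fob F X \<in> coorth_obs M Q R (coorth_maps M Q R \<A>))"

record 'v sfun =
  sob :: "'v \<Rightarrow> 'v"
  smor :: "'v \<Rightarrow> 'v \<Rightarrow> nat \<Rightarrow> 'v \<Rightarrow> 'v"

definition simplicial_endofunctor :: "('v, 'm) smodel_scheme \<Rightarrow> 'v sfun \<Rightarrow> bool" where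
  "simplicial_endofunctor M C \<longleftrightarrow>
     (\<forall>X\<in>Ob M. sob C X \<in> Ob M \<and> smor C X X 0 (ide M X) = ide M (sob C X)) \<and>
     (\<forall>X\<in>Ob M. \<forall>Y\<in>Ob M.
        simplicial_fun (map_sp M X Y) (map_sp M (sob C X) (sob C Y)) (smor C X Y)) \<and>
     (\<forall>X\<in>Ob M. \<forall>Y\<in>Ob M. \<forall>Z\<in>Ob M. \<forall>n.
        \<forall>f\<in>simplices (map_sp M X Y) n. \<forall>g\<in>simplices (map_sp M Y Z) n.
          smor C X Z n (scomp M X Y Z n g f) =
          scomp M (sob C X) (sob C Y) (sob C Z) n (smor C Y Z n g) (smor C X Y n f))"

definition underlying_fun :: "('v, 'm) smodel_scheme \<Rightarrow> 'v sfun \<Rightarrow> 'v cfun" where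
  "underlying_fun M C = \<lparr>fob = sob C, far = (\<lambda>f. smor C (src M f) (tgt M f) 0 f)\<rparr>"

definition simplicial_augmentation ::
  "('v, 'm) smodel_scheme \<Rightarrow> 'v sfun \<Rightarrow> ('v \<Rightarrow> 'v) \<Rightarrow> bool" where
  "simplicial_augmentation M C \<epsilon> \<longleftrightarrow>
     (\<forall>X\<in>Ob M. \<epsilon> X \<in> Hom M (sob C X) X) \<and>
     (\<forall>X\<in>Ob M. \<forall>Y\<in>Ob M. \<forall>n. \<forall>g\<in>simplices (map_sp M X Y) n.
        postcomp M (sob C X) (\<epsilon> Y) n (smor C X Y n g) = precomp M (\<epsilon> X) Y n g)"

definition augmented_homotopy_idempotent_simplicial_functor ::
  "('v, 'm) smodel_scheme \<Rightarrow> 'v sfun \<Rightarrow> ('v \<Rightarrow> 'v) \<Rightarrow> bool" where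
  "augmented_homotopy_idempotent_simplicial_functor M C \<epsilon> \<longleftrightarrow>
     simplicial_endofunctor M C \<and> homotopy_endofunctor M (underlying_fun M C) \<and>
     simplicial_augmentation M C \<epsilon> \<and> homotopy_idempotent M (underlying_fun M C) \<epsilon>"

end

theory Submission
  imports Defs "HOL-Analysis.Lebesgue_Measure"
begin

text \<open>
  Suppose that no set of objects \<open>CU\<close> detects the maps inverted by \<open>C\<close>. By recursion one gets a
  proper class of maps \<open>f\<^sub>\<alpha>\<close> that are not inverted by \<open>C\<close>, although the values of \<open>C\<close> on the
  sources and targets of the earlier \<open>f\<^sub>\<beta>\<close> are co-orthogonal to \<open>f\<^sub>\<alpha>\<close>. Replace \<open>C f\<^sub>\<alpha>\<close> by a
  fibration \<open>p\<^sub>\<alpha>\<close> between bifibrant objects; since it is no weak equivalence, it fails to lift against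
  a generating cofibration \<open>i\<close>, which can be taken independent of \<open>\<alpha>\<close>. Vopenka's principle, applied to
  the squares without a lift, gives \<open>\<beta> < \<alpha>\<close> and a map \<open>(h, k)\<close> from the square of \<open>p\<^sub>\<beta>\<close> to that of
  \<open>p\<^sub>\<alpha>\<close>. By co-orthogonality \<open>k\<close> lifts to a map \<open>l\<close> along \<open>p\<^sub>\<alpha>\<close>, and \<open>l p\<^sub>\<beta>\<close> is homotopic to \<open>h\<close> over
  the target of \<open>p\<^sub>\<alpha>\<close>; the homotopy lifting property of the corner map of \<open>i\<close> and \<open>p\<^sub>\<alpha>\<close> then yields a
  lift in the square of \<open>p\<^sub>\<alpha>\<close>.

  No homotopy theory of simplicial sets beyond low-dimensional horn filling is needed: a Kan fibration
  that is a weak equivalence is compared with the local system of the components of its fibres.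
\<close>

section \<open>Small sets\<close>

text \<open>A map inverted by \<open>C\<close> is co-orthogonal to every value of \<open>C\<close>
  for formal reasons; it is the converse, with a mere set of values, that costs Vopenka's principle.
  The formal part already meets an obstacle: \<open>\<epsilon> C\<close> and
  \<open>C \<epsilon>\<close> agree only up to zigzags, so a map that becomes equal to a weak
  equivalence in the homotopy category has to be shown to be one. The functor pi_0 map(A, R -),
  extended to zigzags, does this. Vopenka's principle by itself yields some map between two members
  of a large family, in either direction or from a member to itself, whereas co-orthogonality helps
  only from an earlier to a later one. Therefore the squares become labelled graphs to which rigid
  well-orders of increasing height are attached. One generating cofibration serves for a proper
  class of indices because the generating set is small. Weak equivalences of simplicial sets are
  defined by the homotopy groups of realizations. Higher groups occur only in formal cancellation;
  what is used concretely is lifting of paths and loops, and this is what transport in a local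
  system can see.\<close>

definition smaller :: "'v itself \<Rightarrow> 'b set \<Rightarrow> bool" where
  "smaller _ A \<longleftrightarrow> |A| <o |UNIV :: 'v set|"

text \<open>Smallness is measured against \<open>'v\<close> for sets of every type, because edge
  sets, function spaces and codes live outside \<open>'v\<close>; the fixed \<open>itself\<close>
  argument carries the type variable into the abbreviation \<open>sm\<close>.\<close>

locale universe =
  fixes universe_type :: "'v itself"
  assumes inacc: "inaccessible TYPE('v)"
begin

abbreviation sm :: "'b set \<Rightarrow> bool" where "sm A \<equiv> smaller universe_type A"

lemma sm_def: "sm A \<longleftrightarrow> |A| <o |UNIV :: 'v set|"
  by (simp add: smaller_def)

lemma sm_small: "sm (A :: 'v set) \<longleftrightarrow> small A"
  by (simp add: small_def sm_def)

lemma sm_mono: "A \<subseteq> B \<Longrightarrow> sm B \<Longrightarrow> sm A"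
  unfolding sm_def using card_of_mono1 ordLeq_ordLess_trans by blast

lemma sm_image: "sm A \<Longrightarrow> sm (f ` A)"
  unfolding sm_def using card_of_image ordLeq_ordLess_trans by blast

lemma sm_inj: "inj_on f A \<Longrightarrow> f ` A \<subseteq> B \<Longrightarrow> sm B \<Longrightarrow> sm A"
  unfolding sm_def by (metis card_of_ordLeq ordLeq_ordLess_trans)

lemma infinite_UNIV: "infinite (UNIV :: 'v set)"
  using inacc unfolding inaccessible_def
  by (meson infinite_iff_natLeq_ordLeq ordLess_imp_ordLeq)

lemma sm_nat: "sm (A :: nat set)"
proof -
  have "|UNIV :: nat set| <o |UNIV :: 'v set|"
    using inacc unfolding inaccessible_def by (blast intro: ordIso_ordLess_trans[OF card_of_nat])
  then show ?thesis using sm_mono[of A UNIV] unfolding sm_def by blast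
qed

lemma sm_finite: "finite A \<Longrightarrow> sm A"
  using infinite_UNIV by (simp add: finite_ordLess_infinite2 sm_def)

text \<open>Otherwise \<open>'v\<close> embeds into the union. The preimages of the sets
  \<open>A i\<close> under this embedding, reindexed by an injection of \<open>I\<close> into
  \<open>'v\<close>, would cover \<open>'v\<close> by few small sets, against the regularity clause
  of \<open>inaccessible\<close>.\<close>

lemma sm_UNION:
  fixes A :: "'i \<Rightarrow> 'b set"
  assumes I: "sm I" and A: "\<And>i. i \<in> I \<Longrightarrow> sm (A i)"
  shows "sm (\<Union>i\<in>I. A i)"
proof (rule ccontr)
  assume "\<not> ?thesis"
  then have "|UNIV :: 'v set| \<le>o |\<Union>i\<in>I. A i|"
    by (simp add: sm_def not_ordLess_iff_ordLeq)
  then obtain f :: "'v \<Rightarrow> 'b" where f: "inj f" "range f \<subseteq> (\<Union>i\<in>I. A i)"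
    by (meson card_of_ordLeq)
  have "|I| \<le>o |UNIV :: 'v set|" using I ordLess_imp_ordLeq unfolding sm_def by blast
  then obtain g :: "'i \<Rightarrow> 'v" where g: "inj_on g I"
    using card_of_ordLeq[of I "UNIV :: 'v set"] by auto
  define B where "B v = f -` A (inv_into I g v)" for v
  have "small (g ` I)" using sm_image[OF I] by (simp flip: sm_small)
  moreover have "small (B v)" if "v \<in> g ` I" for v
  proof -
    have "sm (A (inv_into I g v))" using that A by (simp add: inv_into_into)
    then show ?thesis unfolding B_def sm_small[symmetric]
      using f(1) by (intro sm_inj[of f]) (auto simp: inj_on_def)
  qed
  ultimately have "small (\<Union>v\<in>g ` I. B v)"
    using inacc unfolding inaccessible_def by blast
  moreover have "(\<Union>v\<in>g ` I. B v) = UNIV"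
    using f(2) g unfolding B_def by (fastforce simp: inv_into_f_f)
  ultimately show False by (simp add: small_def ordLess_irreflexive)
qed

lemma sm_Un: "sm A \<Longrightarrow> sm B \<Longrightarrow> sm (A \<union> B)"
  by (simp add: card_of_Un_ordLess_infinite infinite_UNIV sm_def)

lemma sm_insert: "sm B \<Longrightarrow> sm (insert a B)"
  using sm_Un[OF sm_finite[of "{a}"]] by simp

lemma sm_Sigma: "sm A \<Longrightarrow> (\<And>a. a \<in> A \<Longrightarrow> sm (B a)) \<Longrightarrow> sm (Sigma A B)"
  unfolding Sigma_def by (intro sm_UNION) (auto intro: sm_finite)

lemma sm_Pow:
  assumes "sm A" shows "sm (Pow A)"
proof -
  have "|A| \<le>o |UNIV :: 'v set|" using assms ordLess_imp_ordLeq unfolding sm_def by blast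
  then obtain g :: "'a \<Rightarrow> 'v" where g: "inj_on g A"
    using card_of_ordLeq[of A "UNIV :: 'v set"] by auto
  have "small (g ` A)" using sm_image[OF assms] by (simp flip: sm_small)
  then have "sm (Pow (g ` A))" using inacc unfolding inaccessible_def sm_def by blast
  then show ?thesis
    using inj_on_image_Pow[OF g] by (rule_tac sm_inj[of "image g"]) auto
qed

lemma sm_PiE:
  assumes "sm A" "\<And>a. a \<in> A \<Longrightarrow> sm (B a)" shows "sm (Pi\<^sub>E A B)"
proof (rule sm_inj)
  show "inj_on (\<lambda>f. (\<lambda>a. (a, f a)) ` A) (Pi\<^sub>E A B)"
  proof (rule inj_onI)
    fix f g assume fg: "f \<in> Pi\<^sub>E A B" "g \<in> Pi\<^sub>E A B" "(\<lambda>a. (a, f a)) ` A = (\<lambda>a. (a, g a)) ` A"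
    show "f = g" by (rule PiE_ext[OF fg(1,2)]) (use fg(3) in auto)
  qed
  show "(\<lambda>f. (\<lambda>a. (a, f a)) ` A) ` Pi\<^sub>E A B \<subseteq> Pow (Sigma A B)" by auto
  show "sm (Pow (Sigma A B))" by (intro sm_Pow sm_Sigma assms)
qed

section \<open>The universe as a well-ordered class with small initial segments\<close>

definition below :: "'v \<Rightarrow> 'v \<Rightarrow> bool" where
  "below a b \<longleftrightarrow> (a, b) \<in> |UNIV :: 'v set| \<and> a \<noteq> b"

lemma Card_UNIV: "Card_order |UNIV :: 'v set|" "Field |UNIV :: 'v set| = UNIV"
  by (auto simp: card_of_Card_order Field_card_of)

lemma Well_UNIV: "Well_order |UNIV :: 'v set|" by (simp add: card_of_Well_order)

lemma below_irrefl: "\<not> below a a" by (simp add: below_def)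

lemma below_trans: "below a b \<Longrightarrow> below b c \<Longrightarrow> below a c"
  using Well_UNIV unfolding below_def well_order_on_def linear_order_on_def partial_order_on_def
    preorder_on_def by (metis antisymD transE)

lemma below_asym: "below a b \<Longrightarrow> \<not> below b a"
  using below_trans below_irrefl by blast

lemma below_linear: "below a b \<or> a = b \<or> below b a"
  using Well_UNIV Card_UNIV(2)
  unfolding below_def well_order_on_def linear_order_on_def total_on_def by auto

lemma wf_below: "wf {(a, b). below a b}"
proof -
  have "{(a, b). below a b} = |UNIV :: 'v set| - Id" by (auto simp: below_def)
  then show ?thesis using Well_UNIV unfolding well_order_on_def by simp
qed

lemma small_below: "small {a. below a b}"
proof -
  have "|underS |UNIV :: 'v set| b| <o |UNIV :: 'v set|"
    using card_of_underS[OF Card_UNIV(1), of b] Card_UNIV(2) by simp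
  moreover have "underS |UNIV :: 'v set| b = {a. below a b}"
    by (auto simp: below_def underS_def)
  ultimately show ?thesis by (simp add: small_def)
qed

text \<open>Without a strict bound, the closed initial segments ending at elements of
  \<open>A\<close> would exhaust \<open>'v\<close>, a small union of small sets.\<close>

lemma small_bounded:
  assumes "small (A :: 'v set)" obtains b where "\<And>a. a \<in> A \<Longrightarrow> below a b"
proof (rule ccontr)
  assume "\<not> thesis"
  then have "\<exists>a\<in>A. \<not> below a b" for b using that by blast
  then have "(\<Union>a\<in>A. insert a {b. below b a}) = UNIV"
    using below_linear by blast
  moreover have "sm (\<Union>a\<in>A. insert a {b. below b a})"
    using assms small_below by (intro sm_UNION sm_insert) (auto simp flip: sm_small)
  ultimately show False by (simp add: sm_def ordLess_irreflexive)
qed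

text \<open>Each small set lies in the power set of an initial segment; such a power set is small,
  and there are only as many segments as elements. This is what leaves room in \<open>'v\<close> for
  codes of graphs and of graph maps.\<close>

lemma card_small_sets: "|{A :: 'v set. small A}| \<le>o |UNIV :: 'v set|"
proof -
  have "{A :: 'v set. small A} \<subseteq> (\<Union>b\<in>UNIV. Pow {a. below a b})"
  proof
    fix A :: "'v set" assume "A \<in> {A. small A}"
    then obtain b where "\<And>a. a \<in> A \<Longrightarrow> below a b" using small_bounded by blast
    then show "A \<in> (\<Union>b\<in>UNIV. Pow {a. below a b})" by auto
  qed
  moreover have "|Pow {a. below a b}| \<le>o |UNIV :: 'v set|" for b
    using sm_Pow[OF small_below[folded sm_small]] unfolding sm_def by (rule ordLess_imp_ordLeq)
  then have "|\<Union>b\<in>(UNIV :: 'v set). Pow {a. below a b}| \<le>o |UNIV :: 'v set|"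
    by (intro card_of_UNION_ordLeq_infinite[OF infinite_UNIV card_of_refl[THEN ordIso_imp_ordLeq]]) auto
  ultimately show ?thesis using card_of_mono1 ordLeq_transitive by blast
qed

lemma card_small_subsets:
  assumes "|UNIV :: 'b set| \<le>o |UNIV :: 'v set|"
  shows "|{A :: 'b set. sm A}| \<le>o |UNIV :: 'v set|"
proof -
  obtain g :: "'b \<Rightarrow> 'v" where g: "inj g" using assms card_of_ordLeq[of "UNIV :: 'b set" "UNIV :: 'v set"] by auto
  have "inj_on (image g) {A :: 'b set. sm A}" using g by (simp add: inj_image_eq_iff inj_on_def)
  moreover have "image g ` {A :: 'b set. sm A} \<subseteq> {A. small A}"
    using sm_image by (auto simp: sm_small[symmetric])
  ultimately have "|{A :: 'b set. sm A}| \<le>o |{A :: 'v set. small A}|"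
    using card_of_ordLeq by blast
  then show ?thesis using card_small_sets ordLeq_transitive by blast
qed

lemma card_prod_UNIV:
  assumes "|UNIV :: 'a set| \<le>o |UNIV :: 'v set|" "|UNIV :: 'b set| \<le>o |UNIV :: 'v set|"
  shows "|UNIV :: ('a \<times> 'b) set| \<le>o |UNIV :: 'v set|"
proof -
  obtain f :: "'a \<Rightarrow> 'v" and g :: "'b \<Rightarrow> 'v" where "inj f" "inj g"
    using assms card_of_ordLeq[of "UNIV :: 'a set" "UNIV :: 'v set"]
      card_of_ordLeq[of "UNIV :: 'b set" "UNIV :: 'v set"] by auto
  then have "inj (map_prod f g)" by (simp add: prod.inj_map)
  then have "|UNIV :: ('a \<times> 'b) set| \<le>o |UNIV \<times> UNIV :: ('v \<times> 'v) set|"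
    using card_of_ordLeq[of "UNIV :: ('a \<times> 'b) set" "UNIV \<times> UNIV :: ('v \<times> 'v) set"] by auto
  then show ?thesis
    using card_of_Times_same_infinite[OF infinite_UNIV] ordLeq_ordIso_trans by blast
qed

lemma card_UNIV_self: "|UNIV :: 'v set| \<le>o |UNIV :: 'v set|" "|UNIV :: nat set| \<le>o |UNIV :: 'v set|"
  using ordLess_imp_ordLeq[OF sm_nat[of UNIV, unfolded sm_def]] by auto

lemma inj_exists:
  assumes "|A| \<le>o |UNIV :: 'v set|" obtains c :: "'a \<Rightarrow> 'v" where "inj_on c A"
proof -
  have "\<exists>c :: 'a \<Rightarrow> 'v. inj_on c A \<and> c ` A \<subseteq> UNIV"
    using assms card_of_ordLeq[of A "UNIV :: 'v set"] by blast
  then show ?thesis using that by blast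
qed

end

section \<open>The category of labelled graphs\<close>

type_synonym 'v graph = "'v set \<times> ('v \<times> 'v \<times> 'v) set"

definition graphs :: "'v set \<Rightarrow> 'v graph set" where
  "graphs L = {(V, E). small V \<and> E \<subseteq> L \<times> V \<times> V}"

definition ghom :: "'v graph \<Rightarrow> 'v graph \<Rightarrow> ('v \<Rightarrow> 'v) set" where
  "ghom G H = {f \<in> fst G \<rightarrow>\<^sub>E fst H. \<forall>l x y. (l, x, y) \<in> snd G \<longrightarrow> (l, f x, f y) \<in> snd H}"

definition garrows :: "'v set \<Rightarrow> ('v graph \<times> 'v graph \<times> ('v \<Rightarrow> 'v)) set" where
  "garrows L = {(G, H, f). G \<in> graphs L \<and> H \<in> graphs L \<and> f \<in> ghom G H}"

lemma ghom_comp: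
  assumes "G \<in> graphs L" "f \<in> ghom G H" "g \<in> ghom H K" shows "compose (fst G) g f \<in> ghom G K"
proof -
  have "x \<in> fst G \<and> y \<in> fst G" if "(l, x, y) \<in> snd G" for l x y
    using assms(1) that by (auto simp: graphs_def)
  then show ?thesis
    using assms(2,3) unfolding ghom_def by (auto simp: compose_def PiE_def Pi_def extensional_def)
qed

lemma ghom_id: "G \<in> graphs L \<Longrightarrow> (\<lambda>v\<in>fst G. v) \<in> ghom G G"
  unfolding ghom_def graphs_def by auto

text \<open>Vopenka's principle quantifies over categories whose objects and arrows are elements of
  the universe, so graphs and arrows are transported along arbitrary injections \<open>co\<close>
  and \<open>ca\<close>. Arrows are coded as triples because a function alone does not determine its
  target. The injection \<open>pr\<close> names the vertices of disjoint unions, which the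
  construction of colimits requires.\<close>

locale graph_category = universe +
  fixes L :: "'a set" and co :: "'a graph \<Rightarrow> 'a"
    and ca :: "'a graph \<times> 'a graph \<times> ('a \<Rightarrow> 'a) \<Rightarrow> 'a" and pr :: "'a \<times> 'a \<Rightarrow> 'a"
  assumes labels: "small L" and co: "inj_on co (graphs L)" and ca: "inj_on ca (garrows L)"
    and pr: "inj pr"
begin

definition gr :: "'a \<Rightarrow> 'a graph" where "gr = inv_into (graphs L) co"
definition dec :: "'a \<Rightarrow> 'a graph \<times> 'a graph \<times> ('a \<Rightarrow> 'a)" where "dec = inv_into (garrows L) ca"
definition fn :: "'a \<Rightarrow> 'a \<Rightarrow> 'a" where "fn m = snd (snd (dec m))"
definition VV :: "'a \<Rightarrow> 'a set" where "VV X = fst (gr X)"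
definition EE :: "'a \<Rightarrow> ('a \<times> 'a \<times> 'a) set" where "EE X = snd (gr X)"
definition arr :: "'a \<Rightarrow> 'a \<Rightarrow> ('a \<Rightarrow> 'a) \<Rightarrow> 'a" where "arr X Y f = ca (gr X, gr Y, f)"

definition GC :: "'a cat" where
  "GC = \<lparr>Ob = co ` graphs L, Ar = ca ` garrows L, src = (\<lambda>m. co (fst (dec m))),
     tgt = (\<lambda>m. co (fst (snd (dec m)))), ide = (\<lambda>X. arr X X (\<lambda>v\<in>VV X. v)),
     comp = (\<lambda>n m. ca (fst (dec m), fst (snd (dec n)), compose (fst (fst (dec m))) (fn n) (fn m)))\<rparr>"

lemma Ob_GC: "X \<in> Ob GC \<Longrightarrow> gr X \<in> graphs L \<and> co (gr X) = X"
  by (auto simp: GC_def gr_def inv_into_into f_inv_into_f)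

lemma co_Ob: "G \<in> graphs L \<Longrightarrow> co G \<in> Ob GC" by (simp add: GC_def)
lemma gr_co: "G \<in> graphs L \<Longrightarrow> gr (co G) = G" by (simp add: gr_def co)
lemma VV_co: "(V, E) \<in> graphs L \<Longrightarrow> VV (co (V, E)) = V" by (simp add: VV_def gr_co)
lemma EE_co: "(V, E) \<in> graphs L \<Longrightarrow> EE (co (V, E)) = E" by (simp add: EE_def gr_co)
lemma EE_VV: "X \<in> Ob GC \<Longrightarrow> (l, x, y) \<in> EE X \<Longrightarrow> l \<in> L \<and> x \<in> VV X \<and> y \<in> VV X"
  using Ob_GC[of X] by (auto simp: EE_def VV_def graphs_def)
lemma small_VV: "X \<in> Ob GC \<Longrightarrow> small (VV X)"
  using Ob_GC[of X] by (auto simp: VV_def graphs_def)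

lemma ghom_gr: "f \<in> ghom (gr X) (gr Y) \<longleftrightarrow>
    f \<in> VV X \<rightarrow>\<^sub>E VV Y \<and> (\<forall>l x y. (l, x, y) \<in> EE X \<longrightarrow> (l, f x, f y) \<in> EE Y)"
  by (simp add: ghom_def VV_def EE_def)

lemma arr_Hom:
  assumes "X \<in> Ob GC" "Y \<in> Ob GC" "f \<in> ghom (gr X) (gr Y)"
  shows "arr X Y f \<in> Hom GC X Y" "fn (arr X Y f) = f" "dec (arr X Y f) = (gr X, gr Y, f)"
proof -
  have *: "(gr X, gr Y, f) \<in> garrows L" using assms Ob_GC by (auto simp: garrows_def)
  then show d: "dec (arr X Y f) = (gr X, gr Y, f)" by (simp add: dec_def arr_def ca)
  then show "fn (arr X Y f) = f" by (simp add: fn_def)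
  show "arr X Y f \<in> Hom GC X Y"
    using * assms Ob_GC d by (auto simp: Hom_def GC_def arr_def)
qed

lemma Hom_GC: "m \<in> Hom GC X Y \<longleftrightarrow>
    X \<in> Ob GC \<and> Y \<in> Ob GC \<and> fn m \<in> ghom (gr X) (gr Y) \<and> m = arr X Y (fn m)"
proof
  assume m: "m \<in> Hom GC X Y"
  then obtain G H f where f: "m = ca (G, H, f)" "(G, H, f) \<in> garrows L"
    by (auto simp: Hom_def GC_def)
  then have d: "dec m = (G, H, f)" by (simp add: dec_def ca)
  have G: "G \<in> graphs L" "H \<in> graphs L" "f \<in> ghom G H" using f by (auto simp: garrows_def)
  have "X = co G" "Y = co H" using m d by (auto simp: Hom_def GC_def)
  then show "X \<in> Ob GC \<and> Y \<in> Ob GC \<and> fn m \<in> ghom (gr X) (gr Y) \<and> m = arr X Y (fn m)"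
    using G d f by (auto simp: co_Ob gr_co fn_def arr_def)
next
  assume "X \<in> Ob GC \<and> Y \<in> Ob GC \<and> fn m \<in> ghom (gr X) (gr Y) \<and> m = arr X Y (fn m)"
  then show "m \<in> Hom GC X Y" using arr_Hom(1) by metis
qed

lemma Hom_fn:
  assumes "m \<in> Hom GC X Y"
  shows "X \<in> Ob GC" "Y \<in> Ob GC" "fn m \<in> VV X \<rightarrow>\<^sub>E VV Y"
    "\<And>v. v \<in> VV X \<Longrightarrow> fn m v \<in> VV Y"
    "\<And>l x y. (l, x, y) \<in> EE X \<Longrightarrow> (l, fn m x, fn m y) \<in> EE Y"
    "fn m \<in> ghom (gr X) (gr Y)"
  using assms unfolding Hom_GC ghom_gr by auto

lemma Hom_eqI:
  assumes "m \<in> Hom GC X Y" "n \<in> Hom GC X Y" "\<And>v. v \<in> VV X \<Longrightarrow> fn m v = fn n v"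
  shows "m = n"
proof -
  have "fn m = fn n" by (rule PiE_ext[OF Hom_fn(3)[OF assms(1)] Hom_fn(3)[OF assms(2)]]) (fact assms(3))
  then show ?thesis using assms(1,2) unfolding Hom_GC by metis
qed

lemma comp_GC:
  assumes "m \<in> Hom GC X Y" "n \<in> Hom GC Y Z"
  shows "n \<cdot>\<^bsub>GC\<^esub> m = arr X Z (compose (VV X) (fn n) (fn m))"
    and "n \<cdot>\<^bsub>GC\<^esub> m \<in> Hom GC X Z" and "fn (n \<cdot>\<^bsub>GC\<^esub> m) = compose (VV X) (fn n) (fn m)"
proof -
  have d: "dec m = (gr X, gr Y, fn m)" "dec n = (gr Y, gr Z, fn n)"
    using assms arr_Hom(3) unfolding Hom_GC by metis+
  show c: "n \<cdot>\<^bsub>GC\<^esub> m = arr X Z (compose (VV X) (fn n) (fn m))"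
    by (simp add: GC_def d arr_def VV_def)
  have "compose (VV X) (fn n) (fn m) \<in> ghom (gr X) (gr Z)"
    using ghom_comp[of "gr X" L "fn m" "gr Y" "fn n" "gr Z"] assms Ob_GC[of X] unfolding Hom_GC VV_def by blast
  then show "n \<cdot>\<^bsub>GC\<^esub> m \<in> Hom GC X Z" "fn (n \<cdot>\<^bsub>GC\<^esub> m) = compose (VV X) (fn n) (fn m)"
    unfolding c using arr_Hom assms Hom_fn(1,2) by auto
qed

lemma fn_comp: "m \<in> Hom GC X Y \<Longrightarrow> n \<in> Hom GC Y Z \<Longrightarrow> v \<in> VV X \<Longrightarrow> fn (n \<cdot>\<^bsub>GC\<^esub> m) v = fn n (fn m v)"
  by (simp only: comp_GC(3) compose_eq)

lemma id_ghom: "X \<in> Ob GC \<Longrightarrow> (\<lambda>v\<in>VV X. v) \<in> ghom (gr X) (gr X)"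
  using Ob_GC[of X] ghom_id[of "gr X" L] by (simp add: VV_def)

lemma ide_GC:
  assumes "X \<in> Ob GC"
  shows "ide GC X \<in> Hom GC X X" "fn (ide GC X) = (\<lambda>v\<in>VV X. v)"
  using arr_Hom[OF assms assms id_ghom[OF assms]] by (auto simp: GC_def)

lemma category_GC: "category GC"
proof
  fix f assume "f \<in> Ar GC"
  then have "f \<in> Hom GC (src GC f) (tgt GC f)" by (simp add: Hom_def)
  then show "src GC f \<in> Ob GC \<and> tgt GC f \<in> Ob GC" using Hom_fn by blast
next
  fix X assume "X \<in> Ob GC" then show "ide GC X \<in> Hom GC X X" by (rule ide_GC)
next
  fix f g X Y Z assume "f \<in> Hom GC X Y" "g \<in> Hom GC Y Z"
  then show "g \<cdot>\<^bsub>GC\<^esub> f \<in> Hom GC X Z" by (rule comp_GC)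
next
  fix f X Y assume f: "f \<in> Hom GC X Y"
  then have i: "ide GC X \<in> Hom GC X X" "ide GC Y \<in> Hom GC Y Y" using Hom_fn ide_GC by auto
  show "ide GC Y \<cdot>\<^bsub>GC\<^esub> f = f"
    by (rule Hom_eqI[OF comp_GC(2)[OF f i(2)] f])
      (use f i Hom_fn ide_GC in \<open>auto simp: fn_comp[OF f i(2)]\<close>)
  show "f \<cdot>\<^bsub>GC\<^esub> ide GC X = f"
    by (rule Hom_eqI[OF comp_GC(2)[OF i(1) f] f])
      (use f i Hom_fn ide_GC in \<open>auto simp: fn_comp[OF i(1) f]\<close>)
next
  fix f g h W X Y Z assume f: "f \<in> Hom GC W X" "g \<in> Hom GC X Y" "h \<in> Hom GC Y Z"
  note c = comp_GC(2)[OF f(1,2)] comp_GC(2)[OF f(2,3)]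
  show "h \<cdot>\<^bsub>GC\<^esub> g \<cdot>\<^bsub>GC\<^esub> f = h \<cdot>\<^bsub>GC\<^esub> (g \<cdot>\<^bsub>GC\<^esub> f)"
    by (rule Hom_eqI[OF comp_GC(2)[OF f(1) c(2)] comp_GC(2)[OF c(1) f(3)]])
      (simp add: fn_comp[OF f(1) c(2)] fn_comp[OF c(1) f(3)] fn_comp[OF f(1,2)] fn_comp[OF f(2,3)]
        Hom_fn(4)[OF f(1)])
next
  fix X Y assume X: "X \<in> Ob GC" "Y \<in> Ob GC"
  have "Hom GC X Y \<subseteq> arr X Y ` (VV X \<rightarrow>\<^sub>E VV Y)"
  proof
    fix m assume "m \<in> Hom GC X Y"
    then have "m = arr X Y (fn m)" "fn m \<in> VV X \<rightarrow>\<^sub>E VV Y" using Hom_fn(3) unfolding Hom_GC by auto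
    then show "m \<in> arr X Y ` (VV X \<rightarrow>\<^sub>E VV Y)" by blast
  qed
  moreover have "sm (VV X \<rightarrow>\<^sub>E VV Y)"
    using X by (intro sm_PiE) (auto simp: sm_small small_VV)
  ultimately show "small (Hom GC X Y)"
    using sm_mono sm_image sm_small by metis
qed

subsection \<open>Colimits\<close>

definition cstep :: "('a, 'n) cat_scheme \<Rightarrow> 'a cfun \<Rightarrow> ('a \<times> 'a) rel" where
  "cstep J D = {((src J u, v), (tgt J u, fn (far D u) v)) | u v. u \<in> Ar J \<and> v \<in> VV (fob D (src J u))}"

definition crel :: "('a, 'n) cat_scheme \<Rightarrow> 'a cfun \<Rightarrow> ('a \<times> 'a) rel" where
  "crel J D = (cstep J D \<union> (cstep J D)\<inverse>)\<^sup>*"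

text \<open>Vertices must be elements of the universe, so a class of the generated equivalence is
  represented by a chosen member, coded by \<open>pr\<close>, instead of the class itself. The
  choice depends only on the class because \<open>SOME\<close> is applied to equal
  predicates.\<close>

definition cq :: "('a, 'n) cat_scheme \<Rightarrow> 'a cfun \<Rightarrow> 'a \<times> 'a \<Rightarrow> 'a" where
  "cq J D p = pr (SOME p'. (p, p') \<in> crel J D)"

definition cgraph :: "('a, 'n) cat_scheme \<Rightarrow> 'a cfun \<Rightarrow> 'a graph" where
  "cgraph J D = (cq J D ` (SIGMA j:Ob J. VV (fob D j)),
     {(l, cq J D (j, x), cq J D (j, y)) | l j x y. j \<in> Ob J \<and> (l, x, y) \<in> EE (fob D j)})"

definition cinc :: "('a, 'n) cat_scheme \<Rightarrow> 'a cfun \<Rightarrow> 'a \<Rightarrow> 'a" where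
  "cinc J D j = arr (fob D j) (co (cgraph J D)) (\<lambda>v\<in>VV (fob D j). cq J D (j, v))"

lemma crel_refl: "(p, p) \<in> crel J D" by (simp add: crel_def)
lemma crel_sym: "(p, p') \<in> crel J D \<Longrightarrow> (p', p) \<in> crel J D"
  unfolding crel_def by (meson sym_Un_converse sym_rtrancl symD)
lemma crel_trans: "(p, p') \<in> crel J D \<Longrightarrow> (p', p'') \<in> crel J D \<Longrightarrow> (p, p'') \<in> crel J D"
  unfolding crel_def by (rule rtrancl_trans)

lemma cq_eq: "cq J D p = cq J D p' \<longleftrightarrow> (p, p') \<in> crel J D"
proof
  assume "cq J D p = cq J D p'"
  then have "(SOME p'. (p, p') \<in> crel J D) = (SOME p''. (p', p'') \<in> crel J D)"
    using pr by (simp add: cq_def inj_eq)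
  moreover have "(p, SOME p'. (p, p') \<in> crel J D) \<in> crel J D"
      "(p', SOME p''. (p', p'') \<in> crel J D) \<in> crel J D"
    by (rule someI, rule crel_refl)+
  ultimately show "(p, p') \<in> crel J D" using crel_sym crel_trans by metis
next
  assume "(p, p') \<in> crel J D"
  then have "(\<lambda>x. (p, x) \<in> crel J D) = (\<lambda>x. (p', x) \<in> crel J D)"
    using crel_sym crel_trans by blast
  then show "cq J D p = cq J D p'" by (simp add: cq_def)
qed

context
  fixes J :: "('a, 'n) cat_scheme" and D :: "'a cfun"
  assumes J: "small_category J" and D: "is_functor J GC D"
begin

lemma fob_Ob: "j \<in> Ob J \<Longrightarrow> fob D j \<in> Ob GC" using D by (simp add: is_functor_def)
lemma far_Hom: "u \<in> Hom J i j \<Longrightarrow> far D u \<in> Hom GC (fob D i) (fob D j)"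
  using D by (auto simp: is_functor_def Hom_def)
lemma Hom_J: "u \<in> Hom J i j \<Longrightarrow> i \<in> Ob J \<and> j \<in> Ob J"
  using J category.src_tgt[of J u] by (auto simp: small_category_def Hom_def)

lemma cgraph_graphs: "cgraph J D \<in> graphs L"
proof -
  have "sm (cq J D ` (SIGMA j:Ob J. VV (fob D j)))"
    using J fob_Ob by (intro sm_image sm_Sigma) (auto simp: sm_small small_VV small_category_def)
  then show ?thesis
    using EE_VV[OF fob_Ob] by (fastforce simp: cgraph_def graphs_def sm_small)
qed

lemma VV_cgraph: "VV (co (cgraph J D)) = cq J D ` (SIGMA j:Ob J. VV (fob D j))"
  and EE_cgraph: "EE (co (cgraph J D)) =
    {(l, cq J D (j, x), cq J D (j, y)) | l j x y. j \<in> Ob J \<and> (l, x, y) \<in> EE (fob D j)}"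
  using VV_co[OF cgraph_graphs[unfolded cgraph_def]] EE_co[OF cgraph_graphs[unfolded cgraph_def]]
  by (simp_all only: cgraph_def)

lemma cinc_Hom:
  assumes j: "j \<in> Ob J"
  shows "cinc J D j \<in> Hom GC (fob D j) (co (cgraph J D))"
    and "v \<in> VV (fob D j) \<Longrightarrow> fn (cinc J D j) v = cq J D (j, v)"
proof -
  have "(\<lambda>v\<in>VV (fob D j). cq J D (j, v)) \<in> ghom (gr (fob D j)) (gr (co (cgraph J D)))"
    unfolding ghom_gr VV_cgraph EE_cgraph using j EE_VV[OF fob_Ob[OF j]] by fastforce
  from arr_Hom(1,2)[OF fob_Ob[OF j] co_Ob[OF cgraph_graphs] this]
  show "cinc J D j \<in> Hom GC (fob D j) (co (cgraph J D))"
    and "v \<in> VV (fob D j) \<Longrightarrow> fn (cinc J D j) v = cq J D (j, v)"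
    by (simp_all add: cinc_def)
qed

text \<open>Induction along the zigzag of generating steps, each of which the cocone condition
  respects. The statement also records that the zigzag stays inside the diagram.\<close>

lemma cocone_crel:
  assumes c: "is_cocone GC J D Y \<kappa>" and r: "((i, v), (j, w)) \<in> crel J D"
    and i: "i \<in> Ob J" "v \<in> VV (fob D i)"
  shows "j \<in> Ob J \<and> w \<in> VV (fob D j) \<and> fn (\<kappa> i) v = fn (\<kappa> j) w"
  using r unfolding crel_def
proof (induction "(j, w)" arbitrary: j w rule: rtrancl_induct)
  case base then show ?case using i by auto
next
  case (step p)
  obtain j' w' where p: "p = (j', w')" by (cases p)
  have IH: "j' \<in> Ob J" "w' \<in> VV (fob D j')" "fn (\<kappa> i) v = fn (\<kappa> j') w'"
    using step(3)[OF p] by auto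
  have *: "src J u \<in> Ob J \<and> tgt J u \<in> Ob J \<and> fn (far D u) a \<in> VV (fob D (tgt J u)) \<and>
      fn (\<kappa> (src J u)) a = fn (\<kappa> (tgt J u)) (fn (far D u) a)"
    if u: "u \<in> Ar J" and a: "a \<in> VV (fob D (src J u))" for u a
  proof -
    have uH: "u \<in> Hom J (src J u) (tgt J u)" using u by (simp add: Hom_def)
    note h = far_Hom[OF uH] and o = Hom_J[OF uH]
    have "\<kappa> (tgt J u) \<cdot>\<^bsub>GC\<^esub> far D u = \<kappa> (src J u)"
      "\<kappa> (tgt J u) \<in> Hom GC (fob D (tgt J u)) Y"
      using c u o by (auto simp: is_cocone_def)
    then show ?thesis using fn_comp[OF h _ a] Hom_fn(4)[OF h a] o by metis
  qed
  from step(2) show ?case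
    unfolding p cstep_def using * IH by auto
qed

lemma cgraph_colimit: "is_colimit GC J D (co (cgraph J D)) (cinc J D)"
  unfolding is_colimit_def
proof (intro conjI allI impI)
  show "is_cocone GC J D (co (cgraph J D)) (cinc J D)"
    unfolding is_cocone_def
  proof (intro conjI ballI)
    show "co (cgraph J D) \<in> Ob GC" by (rule co_Ob[OF cgraph_graphs])
    show "cinc J D j \<in> Hom GC (fob D j) (co (cgraph J D))" if "j \<in> Ob J" for j
      using cinc_Hom that by blast
    fix u assume u: "u \<in> Ar J"
    then have uH: "u \<in> Hom J (src J u) (tgt J u)" by (simp add: Hom_def)
    note h = far_Hom[OF uH] and o = Hom_J[OF uH]
    note ct = cinc_Hom(1)[OF conjunct2[OF o]] and cs = cinc_Hom(1)[OF conjunct1[OF o]]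
    show "cinc J D (tgt J u) \<cdot>\<^bsub>GC\<^esub> far D u = cinc J D (src J u)"
    proof (rule Hom_eqI[OF comp_GC(2)[OF h ct] cs])
      fix v assume v: "v \<in> VV (fob D (src J u))"
      have "((src J u, v), (tgt J u, fn (far D u) v)) \<in> crel J D"
        using u v unfolding crel_def cstep_def by blast
      then show "fn (cinc J D (tgt J u) \<cdot>\<^bsub>GC\<^esub> far D u) v = fn (cinc J D (src J u)) v"
        using fn_comp[OF h ct v] cinc_Hom(2) o v Hom_fn(4)[OF h v] cq_eq by metis
    qed
  qed
next
  fix Y \<kappa> assume c: "is_cocone GC J D Y \<kappa>"
  then have Y: "Y \<in> Ob GC" and kH: "\<And>j. j \<in> Ob J \<Longrightarrow> \<kappa> j \<in> Hom GC (fob D j) Y"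
    by (auto simp: is_cocone_def)
  \<comment> \<open>\<open>h\<close> is read off an arbitrary representative;
    \<open>cocone_crel\<close> makes the value independent of it.\<close>
  define h where "h = (\<lambda>w\<in>VV (co (cgraph J D)).
    let p = (SOME p. p \<in> (SIGMA j:Ob J. VV (fob D j)) \<and> w = cq J D p) in fn (\<kappa> (fst p)) (snd p))"
  have h: "h (cq J D (j, v)) = fn (\<kappa> j) v" if j: "j \<in> Ob J" "v \<in> VV (fob D j)" for j v
  proof -
    let ?P = "\<lambda>p. p \<in> (SIGMA j:Ob J. VV (fob D j)) \<and> cq J D (j, v) = cq J D p"
    have "?P (j, v)" using j by auto
    then have P: "?P (SOME p. ?P p)" by (rule someI)
    obtain i w where iw: "(SOME p. ?P p) = (i, w)" by (cases "SOME p. ?P p")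
    have "((j, v), (i, w)) \<in> crel J D" using P[unfolded iw] unfolding cq_eq by blast
    then have "fn (\<kappa> j) v = fn (\<kappa> i) w" using cocone_crel[OF c _ j] by blast
    moreover have "cq J D (j, v) \<in> VV (co (cgraph J D))" using j by (auto simp: VV_cgraph)
    ultimately show ?thesis unfolding h_def by (simp add: iw)
  qed
  have hh: "h \<in> ghom (gr (co (cgraph J D))) (gr Y)"
    unfolding ghom_gr
  proof (intro conjI allI impI)
    show "h \<in> VV (co (cgraph J D)) \<rightarrow>\<^sub>E VV Y"
    proof
      fix w assume "w \<in> VV (co (cgraph J D))"
      then show "h w \<in> VV Y" using h Hom_fn(4)[OF kH] by (auto simp: VV_cgraph)
    qed (simp add: h_def)
    fix l x y assume "(l, x, y) \<in> EE (co (cgraph J D))"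
    then show "(l, h x, h y) \<in> EE Y"
      unfolding EE_cgraph using h Hom_fn(5)[OF kH] EE_VV[OF fob_Ob] by force
  qed
  note hA = arr_Hom[OF co_Ob[OF cgraph_graphs] Y hh]
  show "\<exists>!h. h \<in> Hom GC (co (cgraph J D)) Y \<and> (\<forall>j\<in>Ob J. h \<cdot>\<^bsub>GC\<^esub> cinc J D j = \<kappa> j)"
  proof (rule ex1I[of _ "arr (co (cgraph J D)) Y h"], intro conjI ballI)
    show "arr (co (cgraph J D)) Y h \<in> Hom GC (co (cgraph J D)) Y" by (rule hA)
    fix j assume j: "j \<in> Ob J"
    show "arr (co (cgraph J D)) Y h \<cdot>\<^bsub>GC\<^esub> cinc J D j = \<kappa> j"
      by (rule Hom_eqI[OF comp_GC(2)[OF cinc_Hom(1)[OF j] hA(1)] kH[OF j]])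
        (use j h hA(2) in \<open>simp add: fn_comp[OF cinc_Hom(1)[OF j] hA(1)] cinc_Hom(2)\<close>)
  next
    fix g assume g: "g \<in> Hom GC (co (cgraph J D)) Y \<and> (\<forall>j\<in>Ob J. g \<cdot>\<^bsub>GC\<^esub> cinc J D j = \<kappa> j)"
    show "g = arr (co (cgraph J D)) Y h"
    proof (rule Hom_eqI[OF conjunct1[OF g] hA(1)])
      fix v assume "v \<in> VV (co (cgraph J D))"
      then obtain j w where j: "j \<in> Ob J" "w \<in> VV (fob D j)" "v = cq J D (j, w)"
        by (auto simp: VV_cgraph)
      have "fn g v = fn (g \<cdot>\<^bsub>GC\<^esub> cinc J D j) w"
        using fn_comp[OF cinc_Hom(1)[OF j(1)] conjunct1[OF g] j(2)] cinc_Hom(2)[OF j(1,2)] j(3) by simp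
      then show "fn g v = fn (arr (co (cgraph J D)) Y h) v" using g j h hA(2) by simp
    qed
  qed
qed

text \<open>An arbitrary colimit is compared with the explicit one: the mutually induced maps
  satisfy \<open>\<psi> \<cdot> \<phi> = ide\<close> by uniqueness, so the description of vertices,
  edges and identifications in \<open>cgraph\<close> transfers to \<open>Y\<close>.\<close>

lemma colimit_GC_facts:
  assumes c: "is_colimit GC J D Y \<iota>"
  shows "\<And>v. v \<in> VV Y \<Longrightarrow> \<exists>j\<in>Ob J. \<exists>w\<in>VV (fob D j). v = fn (\<iota> j) w"
    and "\<And>l x y. (l, x, y) \<in> EE Y \<Longrightarrow>
      \<exists>j\<in>Ob J. \<exists>a b. (l, a, b) \<in> EE (fob D j) \<and> x = fn (\<iota> j) a \<and> y = fn (\<iota> j) b"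
    and "\<And>i j v w. i \<in> Ob J \<Longrightarrow> v \<in> VV (fob D i) \<Longrightarrow> j \<in> Ob J \<Longrightarrow> w \<in> VV (fob D j) \<Longrightarrow>
      fn (\<iota> i) v = fn (\<iota> j) w \<Longrightarrow> ((i, v), (j, w)) \<in> crel J D"
proof -
  let ?C = "co (cgraph J D)"
  note cg = cgraph_colimit
  have cY: "is_cocone GC J D Y \<iota>" and cC: "is_cocone GC J D ?C (cinc J D)"
    using c cg by (simp_all add: is_colimit_def)
  then have iH: "\<And>j. j \<in> Ob J \<Longrightarrow> \<iota> j \<in> Hom GC (fob D j) Y" by (auto simp: is_cocone_def)
  obtain \<phi> where \<phi>: "\<phi> \<in> Hom GC Y ?C" "\<And>j. j \<in> Ob J \<Longrightarrow> \<phi> \<cdot>\<^bsub>GC\<^esub> \<iota> j = cinc J D j"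
    using c cC unfolding is_colimit_def by blast
  obtain \<psi> where \<psi>: "\<psi> \<in> Hom GC ?C Y" "\<And>j. j \<in> Ob J \<Longrightarrow> \<psi> \<cdot>\<^bsub>GC\<^esub> cinc J D j = \<iota> j"
    using cg cY unfolding is_colimit_def by blast
  interpret category GC by (rule category_GC)
  have "(\<psi> \<cdot>\<^bsub>GC\<^esub> \<phi>) \<cdot>\<^bsub>GC\<^esub> \<iota> j = \<iota> j" if "j \<in> Ob J" for j
    using assoc[OF iH[OF that] \<phi>(1) \<psi>(1)] \<phi>(2) \<psi>(2) that by simp
  moreover have "ide GC Y \<cdot>\<^bsub>GC\<^esub> \<iota> j = \<iota> j" if "j \<in> Ob J" for j
    using ide_left[OF iH[OF that]] by simp
  moreover have "\<exists>!h. h \<in> Hom GC Y Y \<and> (\<forall>j\<in>Ob J. h \<cdot>\<^bsub>GC\<^esub> \<iota> j = \<iota> j)"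
    using c cY by (simp add: is_colimit_def)
  ultimately have id: "\<psi> \<cdot>\<^bsub>GC\<^esub> \<phi> = ide GC Y"
    using comp_in[OF \<phi>(1) \<psi>(1)] ide_in[OF Hom_fn(1)[OF \<phi>(1)]] by metis
  have Y: "Y \<in> Ob GC" using Hom_fn(1)[OF \<phi>(1)] .
  have \<psi>\<phi>: "fn \<psi> (fn \<phi> v) = v" if "v \<in> VV Y" for v
    using fn_comp[OF \<phi>(1) \<psi>(1) that] ide_GC(2)[OF Y] that by (simp add: id)
  have \<psi>q: "fn \<psi> (cq J D (j, w)) = fn (\<iota> j) w" if "j \<in> Ob J" "w \<in> VV (fob D j)" for j w
    using fn_comp[OF cinc_Hom(1)[OF that(1)] \<psi>(1) that(2)] \<psi>(2) cinc_Hom(2) that by simp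
  have \<phi>q: "fn \<phi> (fn (\<iota> j) w) = cq J D (j, w)" if "j \<in> Ob J" "w \<in> VV (fob D j)" for j w
    using fn_comp[OF iH[OF that(1)] \<phi>(1) that(2)] \<phi>(2) cinc_Hom(2) that by simp
  show "\<exists>j\<in>Ob J. \<exists>w\<in>VV (fob D j). v = fn (\<iota> j) w" if v: "v \<in> VV Y" for v
  proof -
    have "fn \<phi> v \<in> VV ?C" using Hom_fn(4)[OF \<phi>(1) v] .
    then obtain j w where "j \<in> Ob J" "w \<in> VV (fob D j)" "fn \<phi> v = cq J D (j, w)"
      by (auto simp: VV_cgraph)
    then show ?thesis using \<psi>q \<psi>\<phi>[OF v] by metis
  qed
  show "\<exists>j\<in>Ob J. \<exists>a b. (l, a, b) \<in> EE (fob D j) \<and> x = fn (\<iota> j) a \<and> y = fn (\<iota> j) b"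
    if e: "(l, x, y) \<in> EE Y" for l x y
  proof -
    have xy: "x \<in> VV Y" "y \<in> VV Y" using EE_VV[OF Y e] by auto
    have "(l, fn \<phi> x, fn \<phi> y) \<in> EE ?C" using Hom_fn(5)[OF \<phi>(1) e] .
    then obtain j a b where j: "j \<in> Ob J" "(l, a, b) \<in> EE (fob D j)"
      "fn \<phi> x = cq J D (j, a)" "fn \<phi> y = cq J D (j, b)"
      by (auto simp: EE_cgraph)
    then show ?thesis using \<psi>q \<psi>\<phi> xy EE_VV[OF fob_Ob[OF j(1)] j(2)] by metis
  qed
  show "((i, v), (j, w)) \<in> crel J D" if "i \<in> Ob J" "v \<in> VV (fob D i)" "j \<in> Ob J" "w \<in> VV (fob D j)"
      "fn (\<iota> i) v = fn (\<iota> j) w" for i j v w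
    using that \<phi>q cq_eq by metis
qed

end

lemma cocomplete_GC: "cocomplete GC"
  unfolding cocomplete_def using cgraph_colimit by blast

end

context graph_category
begin

subsection \<open>Finite graphs are finitely presentable\<close>

context
  fixes J :: "('a, 'n) cat_scheme" and D :: "'a cfun"
  assumes poset: "poset_category J"
    and dir: "\<And>S. S \<subseteq> Ob J \<Longrightarrow> finite S \<Longrightarrow> \<exists>u\<in>Ob J. \<forall>s\<in>S. Hom J s u \<noteq> {}"
    and D: "is_functor J GC D"
begin

lemma J: "small_category J" using poset by (simp add: poset_category_def)

text \<open>Hom-sets of a poset category have at most one element, so transition maps can be indexed
  by their two ends and arrows need not be named.\<close>

definition tr :: "'a \<Rightarrow> 'a \<Rightarrow> 'a" where "tr i k = far D (SOME u. u \<in> Hom J i k)"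

lemma tr_far: "u \<in> Hom J i k \<Longrightarrow> far D u = tr i k"
proof -
  assume u: "u \<in> Hom J i k"
  then have "(SOME u. u \<in> Hom J i k) \<in> Hom J i k" by (rule someI)
  then have "(SOME u. u \<in> Hom J i k) = u"
    using u poset Hom_J[OF J D u] unfolding poset_category_def by blast
  then show ?thesis by (simp add: tr_def)
qed

lemma tr_Hom: "Hom J i k \<noteq> {} \<Longrightarrow> tr i k \<in> Hom GC (fob D i) (fob D k)"
  using far_Hom[OF J D] tr_far by fastforce

lemma le_trans: "Hom J i j \<noteq> {} \<Longrightarrow> Hom J j k \<noteq> {} \<Longrightarrow> Hom J i k \<noteq> {}"
  using J category.comp_in[of J] unfolding small_category_def by blast

lemma tr_tr:
  assumes "Hom J i j \<noteq> {}" "Hom J j k \<noteq> {}" "v \<in> VV (fob D i)"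
  shows "fn (tr j k) (fn (tr i j) v) = fn (tr i k) v"
proof -
  obtain u w where uw: "u \<in> Hom J i j" "w \<in> Hom J j k" using assms by auto
  then have c: "w \<cdot>\<^bsub>J\<^esub> u \<in> Hom J i k"
    using J category.comp_in[of J] unfolding small_category_def by blast
  have "far D (w \<cdot>\<^bsub>J\<^esub> u) = far D w \<cdot>\<^bsub>GC\<^esub> far D u"
    using uw D by (auto simp: is_functor_def Hom_def)
  then show ?thesis
    using fn_comp[OF tr_Hom[OF assms(1)] tr_Hom[OF assms(2)] assms(3)] tr_far[OF uw(1)] tr_far[OF uw(2)]
      tr_far[OF c] by simp
qed

text \<open>Follow the zigzag and keep a stage at which the two ends have become equal. A step along
  an arrow is absorbed by a common upper bound of that stage and the new index; a step against an
  arrow keeps the stage.\<close>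

lemma crel_merge:
  assumes r: "((i, v), (j, w)) \<in> crel J D" and i: "i \<in> Ob J" "v \<in> VV (fob D i)"
  shows "j \<in> Ob J \<and> w \<in> VV (fob D j) \<and>
    (\<exists>k\<in>Ob J. Hom J i k \<noteq> {} \<and> Hom J j k \<noteq> {} \<and> fn (tr i k) v = fn (tr j k) w)"
  using r unfolding crel_def
proof (induction "(j, w)" arbitrary: j w rule: rtrancl_induct)
  case base
  have "Hom J i i \<noteq> {}" using J i category.ide_in[of J i] by (auto simp: small_category_def)
  then show ?case using i by blast
next
  case (step p)
  obtain j' w' where p: "p = (j', w')" by (cases p)
  obtain k where IH: "j' \<in> Ob J" "w' \<in> VV (fob D j')" "k \<in> Ob J" "Hom J i k \<noteq> {}" "Hom J j' k \<noteq> {}"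
      "fn (tr i k) v = fn (tr j' k) w'"
    using step(3)[OF p] by auto
  from step(2) consider
    (f) u where "u \<in> Hom J j' j" "w = fn (far D u) w'"
  | (b) u where "u \<in> Hom J j j'" "w' = fn (far D u) w" "w \<in> VV (fob D j)"
    unfolding p cstep_def Hom_def by auto
  then show ?case
  proof cases
    case f
    then have w: "w = fn (tr j' j) w'" and n: "Hom J j' j \<noteq> {}" using tr_far by auto
    have j: "j \<in> Ob J" using Hom_J[OF J D f(1)] by simp
    obtain m where m: "m \<in> Ob J" "Hom J k m \<noteq> {}" "Hom J j m \<noteq> {}"
      using dir[of "{k, j}"] IH(3) j by auto
    have "fn (tr i m) v = fn (tr j m) w"
      using tr_tr[OF IH(4) m(2) i(2)] tr_tr[OF IH(5) m(2) IH(2)] tr_tr[OF n m(3) IH(2)] IH(6) w by simp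
    then show ?thesis using j m le_trans[OF IH(4) m(2)] Hom_fn(4)[OF tr_Hom[OF n] IH(2)] w by blast
  next
    case b
    then have w: "w' = fn (tr j j') w" and n: "Hom J j j' \<noteq> {}" using tr_far by auto
    have j: "j \<in> Ob J" using Hom_J[OF J D b(1)] by simp
    have "fn (tr i k) v = fn (tr j k) w" using IH(6) w tr_tr[OF n IH(5) b(3)] by simp
    then show ?thesis using j b IH le_trans[OF n IH(5)] by blast
  qed
qed

context
  fixes A Y :: 'a and \<iota> :: "'a \<Rightarrow> 'a"
  assumes A: "A \<in> Ob GC" "finite (VV A)" "finite (EE A)" and col: "is_colimit GC J D Y \<iota>"
begin

lemma iota_Hom: "j \<in> Ob J \<Longrightarrow> \<iota> j \<in> Hom GC (fob D j) Y"
  using col by (auto simp: is_colimit_def is_cocone_def)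

lemma iota_tr:
  assumes "Hom J j k \<noteq> {}" "v \<in> VV (fob D j)" shows "fn (\<iota> k) (fn (tr j k) v) = fn (\<iota> j) v"
proof -
  obtain u where u: "u \<in> Hom J j k" using assms by blast
  then have "\<iota> k \<cdot>\<^bsub>GC\<^esub> far D u = \<iota> j"
    using col by (auto simp: is_colimit_def is_cocone_def Hom_def)
  then show ?thesis
    using fn_comp[OF tr_Hom[OF assms(1)] iota_Hom assms(2)] tr_far[OF u] Hom_J[OF J D u] by metis
qed

lemma iota_merge:
  assumes "i \<in> Ob J" "v \<in> VV (fob D i)" "j \<in> Ob J" "w \<in> VV (fob D j)" "fn (\<iota> i) v = fn (\<iota> j) w"
  shows "\<exists>k\<in>Ob J. Hom J i k \<noteq> {} \<and> Hom J j k \<noteq> {} \<and> fn (tr i k) v = fn (tr j k) w"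
  using crel_merge[OF colimit_GC_facts(3)[OF J D col assms] assms(1,2)] by blast

text \<open>Vertices and edges of \<open>A\<close> are finitely many, each is lifted at some stage,
  and directedness provides one stage beyond all of these.\<close>

lemma factor_through_stage:
  assumes g: "g \<in> Hom GC A Y"
  shows "\<exists>j\<in>Ob J. \<exists>g'\<in>Hom GC A (fob D j). \<iota> j \<cdot>\<^bsub>GC\<^esub> g' = g"
proof -
  have "\<exists>p. fst p \<in> Ob J \<and> snd p \<in> VV (fob D (fst p)) \<and> fn (\<iota> (fst p)) (snd p) = fn g v" if "v \<in> VV A" for v
    using colimit_GC_facts(1)[OF J D col Hom_fn(4)[OF g that]] by fastforce
  then obtain P where P: "\<And>v. v \<in> VV A \<Longrightarrow>
      fst (P v) \<in> Ob J \<and> snd (P v) \<in> VV (fob D (fst (P v))) \<and> fn (\<iota> (fst (P v))) (snd (P v)) = fn g v"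
    by metis
  \<comment> \<open>An edge of \<open>A\<close> goes to an edge of \<open>Y\<close> and hence comes
    from an edge at a stage \<open>j\<close>, but its ends there may differ from the lifts chosen by
    \<open>P\<close>. They have the same image in \<open>Y\<close>, so they merge with them
    later.\<close>
  have "\<exists>k\<in>Ob J. \<exists>a b. (l, a, b) \<in> EE (fob D k) \<and> Hom J (fst (P x)) k \<noteq> {} \<and> Hom J (fst (P y)) k \<noteq> {} \<and>
      fn (tr (fst (P x)) k) (snd (P x)) = a \<and> fn (tr (fst (P y)) k) (snd (P y)) = b"
    if e: "(l, x, y) \<in> EE A" for l x y
  proof -
    have xy: "x \<in> VV A" "y \<in> VV A" using EE_VV[OF A(1) e] by auto
    obtain j a b where j: "j \<in> Ob J" "(l, a, b) \<in> EE (fob D j)" "fn g x = fn (\<iota> j) a" "fn g y = fn (\<iota> j) b"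
      using colimit_GC_facts(2)[OF J D col Hom_fn(5)[OF g e]] by blast
    have ab: "a \<in> VV (fob D j)" "b \<in> VV (fob D j)" using EE_VV[OF fob_Ob[OF J D j(1)] j(2)] by auto
    obtain k1 where k1: "k1 \<in> Ob J" "Hom J (fst (P x)) k1 \<noteq> {}" "Hom J j k1 \<noteq> {}"
        "fn (tr (fst (P x)) k1) (snd (P x)) = fn (tr j k1) a"
      using iota_merge[of "fst (P x)" "snd (P x)" j a] P[OF xy(1)] j ab by auto
    obtain k2 where k2: "k2 \<in> Ob J" "Hom J (fst (P y)) k2 \<noteq> {}" "Hom J j k2 \<noteq> {}"
        "fn (tr (fst (P y)) k2) (snd (P y)) = fn (tr j k2) b"
      using iota_merge[of "fst (P y)" "snd (P y)" j b] P[OF xy(2)] j ab by auto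
    obtain k where k: "k \<in> Ob J" "Hom J k1 k \<noteq> {}" "Hom J k2 k \<noteq> {}"
      using dir[of "{k1, k2}"] k1(1) k2(1) by auto
    have "fn (tr (fst (P x)) k) (snd (P x)) = fn (tr j k) a"
      using tr_tr[OF k1(2) k(2)] tr_tr[OF k1(3) k(2) ab(1)] k1(4) P[OF xy(1)] by metis
    moreover have "fn (tr (fst (P y)) k) (snd (P y)) = fn (tr j k) b"
      using tr_tr[OF k2(2) k(3)] tr_tr[OF k2(3) k(3) ab(2)] k2(4) P[OF xy(2)] by metis
    moreover have "(l, fn (tr j k) a, fn (tr j k) b) \<in> EE (fob D k)"
      using Hom_fn(5)[OF tr_Hom[OF le_trans[OF k1(3) k(2)]] j(2)] .
    ultimately show ?thesis using k le_trans[OF k1(2) k(2)] le_trans[OF k2(2) k(3)] by blast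
  qed
  then have "\<forall>e\<in>EE A. \<exists>k. k \<in> Ob J \<and> (fst e, fn (tr (fst (P (fst (snd e)))) k) (snd (P (fst (snd e)))),
      fn (tr (fst (P (snd (snd e)))) k) (snd (P (snd (snd e))))) \<in> EE (fob D k) \<and>
      Hom J (fst (P (fst (snd e)))) k \<noteq> {} \<and> Hom J (fst (P (snd (snd e)))) k \<noteq> {}"
    by force
  from bchoice[OF this] obtain K where K': "\<forall>e\<in>EE A. K e \<in> Ob J \<and>
      (fst e, fn (tr (fst (P (fst (snd e)))) (K e)) (snd (P (fst (snd e)))),
      fn (tr (fst (P (snd (snd e)))) (K e)) (snd (P (snd (snd e))))) \<in> EE (fob D (K e)) \<and>
      Hom J (fst (P (fst (snd e)))) (K e) \<noteq> {} \<and> Hom J (fst (P (snd (snd e)))) (K e) \<noteq> {}"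
    by blast
  have K: "\<And>l x y. (l, x, y) \<in> EE A \<Longrightarrow> K (l, x, y) \<in> Ob J \<and>
      (l, fn (tr (fst (P x)) (K (l, x, y))) (snd (P x)), fn (tr (fst (P y)) (K (l, x, y))) (snd (P y)))
        \<in> EE (fob D (K (l, x, y))) \<and>
      Hom J (fst (P x)) (K (l, x, y)) \<noteq> {} \<and> Hom J (fst (P y)) (K (l, x, y)) \<noteq> {}"
    using K' by force
  have "(fst \<circ> P) ` VV A \<union> K ` EE A \<subseteq> Ob J" using P K by auto
  moreover have "finite ((fst \<circ> P) ` VV A \<union> K ` EE A)" using A by simp
  ultimately obtain k where k: "k \<in> Ob J" and kb: "\<forall>s\<in>(fst \<circ> P) ` VV A \<union> K ` EE A. Hom J s k \<noteq> {}"
    using dir by blast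
  define f where "f = (\<lambda>v\<in>VV A. fn (tr (fst (P v)) k) (snd (P v)))"
  have kP: "v \<in> VV A \<Longrightarrow> Hom J (fst (P v)) k \<noteq> {}" for v using kb by auto
  have "f \<in> ghom (gr A) (gr (fob D k))"
    unfolding ghom_gr
  proof (intro conjI allI impI)
    show "f \<in> VV A \<rightarrow>\<^sub>E VV (fob D k)"
      unfolding f_def using P Hom_fn(4)[OF tr_Hom[OF kP]] by auto
    fix l x y assume e: "(l, x, y) \<in> EE A"
    have xy: "x \<in> VV A" "y \<in> VV A" using EE_VV[OF A(1) e] by auto
    have n: "Hom J (K (l, x, y)) k \<noteq> {}" using kb e by blast
    note Ke = K[OF e]
    have "(l, fn (tr (K (l, x, y)) k) (fn (tr (fst (P x)) (K (l, x, y))) (snd (P x))),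
        fn (tr (K (l, x, y)) k) (fn (tr (fst (P y)) (K (l, x, y))) (snd (P y)))) \<in> EE (fob D k)"
      using Hom_fn(5)[OF tr_Hom[OF n]] Ke by blast
    moreover have "fn (tr (K (l, x, y)) k) (fn (tr (fst (P x)) (K (l, x, y))) (snd (P x))) = f x"
      using tr_tr[OF _ n] Ke P[OF xy(1)] xy by (simp add: f_def)
    moreover have "fn (tr (K (l, x, y)) k) (fn (tr (fst (P y)) (K (l, x, y))) (snd (P y))) = f y"
      using tr_tr[OF _ n] Ke P[OF xy(2)] xy by (simp add: f_def)
    ultimately show "(l, f x, f y) \<in> EE (fob D k)" by simp
  qed
  note a = arr_Hom[OF A(1) fob_Ob[OF J D k] this]
  have "\<iota> k \<cdot>\<^bsub>GC\<^esub> arr A (fob D k) f = g"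
  proof (rule Hom_eqI[OF comp_GC(2)[OF a(1) iota_Hom[OF k]] g])
    fix v assume v: "v \<in> VV A"
    show "fn (\<iota> k \<cdot>\<^bsub>GC\<^esub> arr A (fob D k) f) v = fn g v"
      unfolding fn_comp[OF a(1) iota_Hom[OF k] v] a(2)
      using iota_tr[OF kP[OF v]] P[OF v] v by (simp add: f_def)
  qed
  then show ?thesis using k a(1) by blast
qed

text \<open>The two images of each vertex merge at some stage; there are finitely many vertices, so
  one stage serves all.\<close>

lemma factor_unique:
  assumes j: "i \<in> Ob J" "j \<in> Ob J" and g: "g \<in> Hom GC A (fob D i)" "h \<in> Hom GC A (fob D j)"
    and e: "\<iota> i \<cdot>\<^bsub>GC\<^esub> g = \<iota> j \<cdot>\<^bsub>GC\<^esub> h"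
  shows "\<exists>k u w. u \<in> Hom J i k \<and> w \<in> Hom J j k \<and> far D u \<cdot>\<^bsub>GC\<^esub> g = far D w \<cdot>\<^bsub>GC\<^esub> h"
proof -
  have "\<exists>k. k \<in> Ob J \<and> Hom J i k \<noteq> {} \<and> Hom J j k \<noteq> {} \<and> fn (tr i k) (fn g v) = fn (tr j k) (fn h v)"
    if v: "v \<in> VV A" for v
  proof -
    have "fn (\<iota> i) (fn g v) = fn (\<iota> j) (fn h v)"
      using e fn_comp[OF g(1) iota_Hom[OF j(1)] v] fn_comp[OF g(2) iota_Hom[OF j(2)] v] by simp
    then show ?thesis
      using iota_merge[OF j(1) Hom_fn(4)[OF g(1) v] j(2) Hom_fn(4)[OF g(2) v]] by blast
  qed
  then obtain K where K: "\<And>v. v \<in> VV A \<Longrightarrow> K v \<in> Ob J \<and> Hom J i (K v) \<noteq> {} \<and> Hom J j (K v) \<noteq> {} \<and>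
      fn (tr i (K v)) (fn g v) = fn (tr j (K v)) (fn h v)" by metis
  have "insert i (insert j (K ` VV A)) \<subseteq> Ob J" "finite (insert i (insert j (K ` VV A)))"
    using K j A by auto
  then obtain k where k: "k \<in> Ob J" and kb: "\<forall>s\<in>insert i (insert j (K ` VV A)). Hom J s k \<noteq> {}"
    using dir by blast
  obtain u w where uw: "u \<in> Hom J i k" "w \<in> Hom J j k" using kb by blast
  have n: "Hom J i k \<noteq> {}" "Hom J j k \<noteq> {}" using kb by auto
  have "tr i k \<cdot>\<^bsub>GC\<^esub> g = tr j k \<cdot>\<^bsub>GC\<^esub> h"
  proof (rule Hom_eqI[OF comp_GC(2)[OF g(1) tr_Hom[OF n(1)]] comp_GC(2)[OF g(2) tr_Hom[OF n(2)]]])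
    fix v assume v: "v \<in> VV A"
    have nk: "Hom J (K v) k \<noteq> {}" using kb v by blast
    note Kv = K[OF v]
    have "fn (tr i k) (fn g v) = fn (tr (K v) k) (fn (tr i (K v)) (fn g v))"
      using tr_tr[OF _ nk Hom_fn(4)[OF g(1) v]] Kv by simp
    also have "\<dots> = fn (tr j k) (fn h v)"
      using tr_tr[OF _ nk Hom_fn(4)[OF g(2) v]] Kv by simp
    finally show "fn (tr i k \<cdot>\<^bsub>GC\<^esub> g) v = fn (tr j k \<cdot>\<^bsub>GC\<^esub> h) v"
      by (simp add: fn_comp[OF g(1) tr_Hom[OF n(1)] v] fn_comp[OF g(2) tr_Hom[OF n(2)] v])
  qed
  then show ?thesis using uw tr_far by metis
qed

text \<open>A compatible family on the stages is a function on maps into the colimit, since every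
  such map factors through a stage and two factorizations become equal later.\<close>

lemma finite_graph_preserves: "hom_preserves_colimit GC A J D Y \<iota>"
  unfolding hom_preserves_colimit_def
proof (intro allI impI, elim conjE)
  fix T :: "'a set" and t
  assume T: "small T" and tT: "\<forall>j\<in>Ob J. \<forall>g\<in>Hom GC A (fob D j). t j g \<in> T"
    and tc: "\<forall>u\<in>Ar J. \<forall>g\<in>Hom GC A (fob D (src J u)). t (tgt J u) (far D u \<cdot>\<^bsub>GC\<^esub> g) = t (src J u) g"
  let ?P = "\<lambda>g p. fst p \<in> Ob J \<and> snd p \<in> Hom GC A (fob D (fst p)) \<and> \<iota> (fst p) \<cdot>\<^bsub>GC\<^esub> snd p = g"
  have "\<forall>g\<in>Hom GC A Y. \<exists>p. ?P g p" using factor_through_stage by fastforce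
  from bchoice[OF this] obtain ch where ex: "\<forall>g\<in>Hom GC A Y. ?P g (ch g)" by blast
  have wd: "t i g = t j h" if ij: "i \<in> Ob J" "j \<in> Ob J" "g \<in> Hom GC A (fob D i)" "h \<in> Hom GC A (fob D j)"
      "\<iota> i \<cdot>\<^bsub>GC\<^esub> g = \<iota> j \<cdot>\<^bsub>GC\<^esub> h" for i j g h
  proof -
    obtain k u w where u: "u \<in> Hom J i k" "w \<in> Hom J j k" "far D u \<cdot>\<^bsub>GC\<^esub> g = far D w \<cdot>\<^bsub>GC\<^esub> h"
      using factor_unique[OF ij] by blast
    have "t k (far D u \<cdot>\<^bsub>GC\<^esub> g) = t i g" using u(1) tc ij(3) unfolding Hom_def[of J] by blast
    moreover have "t k (far D w \<cdot>\<^bsub>GC\<^esub> h) = t j h" using u(2) tc ij(4) unfolding Hom_def[of J] by blast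
    ultimately have "t k (far D u \<cdot>\<^bsub>GC\<^esub> g) = t i g" "t k (far D w \<cdot>\<^bsub>GC\<^esub> h) = t j h" by auto
    then show ?thesis using u by simp
  qed
  define H where "H = (\<lambda>g\<in>Hom GC A Y. t (fst (ch g)) (snd (ch g)))"
  interpret category GC by (rule category_GC)
  show "\<exists>!h. h \<in> Hom GC A Y \<rightarrow>\<^sub>E T \<and> (\<forall>j\<in>Ob J. \<forall>g\<in>Hom GC A (fob D j). h (\<iota> j \<cdot>\<^bsub>GC\<^esub> g) = t j g)"
  proof (rule ex1I[of _ H], intro conjI ballI)
    show "H \<in> Hom GC A Y \<rightarrow>\<^sub>E T"
      unfolding H_def restrict_PiE_iff using ex tT by blast
    fix j g assume j: "j \<in> Ob J" "g \<in> Hom GC A (fob D j)"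
    have gY: "\<iota> j \<cdot>\<^bsub>GC\<^esub> g \<in> Hom GC A Y" using comp_in[OF j(2) iota_Hom[OF j(1)]] .
    have "t (fst (ch (\<iota> j \<cdot>\<^bsub>GC\<^esub> g))) (snd (ch (\<iota> j \<cdot>\<^bsub>GC\<^esub> g))) = t j g"
      using bspec[OF ex gY] j by (intro wd) auto
    then show "H (\<iota> j \<cdot>\<^bsub>GC\<^esub> g) = t j g" using gY by (simp add: H_def)
  next
    fix h assume h: "h \<in> Hom GC A Y \<rightarrow>\<^sub>E T \<and> (\<forall>j\<in>Ob J. \<forall>g\<in>Hom GC A (fob D j). h (\<iota> j \<cdot>\<^bsub>GC\<^esub> g) = t j g)"
    show "h = H"
    proof
      fix g show "h g = H g"
      proof (cases "g \<in> Hom GC A Y")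
        case True
        then have "h (\<iota> (fst (ch g)) \<cdot>\<^bsub>GC\<^esub> snd (ch g)) = t (fst (ch g)) (snd (ch g))"
          using bspec[OF ex True] h by blast
        then show ?thesis using bspec[OF ex True] True by (simp add: H_def)
      next
        case False
        then show ?thesis using h by (auto simp: H_def PiE_def extensional_def)
      qed
    qed
  qed
qed

end

end

end

context graph_category
begin

subsection \<open>Local presentability\<close>

definition fin_obs :: "'a set" where
  "fin_obs = {X \<in> Ob GC. finite (VV X) \<and> finite (EE X)}"

definition subobs :: "'a \<Rightarrow> 'a set" where
  "subobs X = {A \<in> fin_obs. VV A \<subseteq> VV X \<and> EE A \<subseteq> EE X}"

text \<open>The arrows are only the inclusions; this makes the finite subgraphs a poset directed by
  finite unions.\<close>

definition subcat :: "'a \<Rightarrow> 'a cat" where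
  "subcat X = GC\<lparr>Ob := subobs X, Ar := {m \<in> Ar GC. src GC m \<in> subobs X \<and> tgt GC m \<in> subobs X \<and>
     (\<forall>v\<in>VV (src GC m). fn m v = v)}\<rparr>"

lemma Hom_subcat: "m \<in> Hom (subcat X) A B \<longleftrightarrow>
    m \<in> Hom GC A B \<and> A \<in> subobs X \<and> B \<in> subobs X \<and> (\<forall>v\<in>VV A. fn m v = v)"
  by (auto simp: subcat_def Hom_def)

lemma incl_exists:
  assumes "A \<in> Ob GC" "B \<in> Ob GC" "VV A \<subseteq> VV B" "EE A \<subseteq> EE B"
  shows "\<exists>m\<in>Hom GC A B. \<forall>v\<in>VV A. fn m v = v"
proof -
  have "(\<lambda>v\<in>VV A. v) \<in> ghom (gr A) (gr B)"
    unfolding ghom_gr using assms EE_VV[OF assms(1)] by fastforce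
  note a = arr_Hom(1,2)[OF assms(1,2) this]
  show ?thesis by (rule bexI[OF _ a(1)]) (simp add: a(2))
qed

lemma incl_iff:
  assumes "A \<in> subobs X" "B \<in> subobs X"
  shows "Hom (subcat X) A B \<noteq> {} \<longleftrightarrow> VV A \<subseteq> VV B \<and> EE A \<subseteq> EE B"
proof
  assume "Hom (subcat X) A B \<noteq> {}"
  then obtain m where m: "m \<in> Hom GC A B" "\<forall>v\<in>VV A. fn m v = v" unfolding ex_in_conv[symmetric] Hom_subcat by blast
  then show "VV A \<subseteq> VV B \<and> EE A \<subseteq> EE B"
    using Hom_fn(4)[OF m(1)] Hom_fn(5)[OF m(1)] EE_VV[OF Hom_fn(1)[OF m(1)]] by fastforce
next
  assume "VV A \<subseteq> VV B \<and> EE A \<subseteq> EE B"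
  then show "Hom (subcat X) A B \<noteq> {}"
    unfolding ex_in_conv[symmetric] Hom_subcat
    using incl_exists[of A B] assms by (auto simp: subobs_def fin_obs_def)
qed

lemma Ob_ext: "A \<in> Ob GC \<Longrightarrow> B \<in> Ob GC \<Longrightarrow> VV A = VV B \<Longrightarrow> EE A = EE B \<Longrightarrow> A = B"
  using Ob_GC[of A] Ob_GC[of B] by (metis VV_def EE_def prod_eqI)

lemma comp_subcat: "n \<cdot>\<^bsub>subcat X\<^esub> m = n \<cdot>\<^bsub>GC\<^esub> m" by (simp add: subcat_def)

text \<open>Smallness comes from the power sets of the vertex and edge sets of \<open>X\<close>,
  antisymmetry from the fact that an object is determined by these two sets.\<close>

lemma poset_subcat:
  assumes X: "X \<in> Ob GC" shows "poset_category (subcat X)"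
proof -
  interpret category GC by (rule category_GC)
  have obs: "Ob (subcat X) = subobs X" by (simp add: subcat_def)
  have cl: "A \<in> Ob GC" if "A \<in> subobs X" for A using that by (simp add: subobs_def fin_obs_def)
  have sub_obs: "subobs X \<subseteq> co ` (Pow (VV X) \<times> Pow (EE X))"
  proof
    fix A assume A: "A \<in> subobs X"
    then have "gr A \<in> Pow (VV X) \<times> Pow (EE X)"
      by (cases "gr A") (auto simp: subobs_def VV_def EE_def)
    then show "A \<in> co ` (Pow (VV X) \<times> Pow (EE X))"
      using Ob_GC[OF cl[OF A]] by (metis imageI)
  qed
  have "EE X \<subseteq> L \<times> VV X \<times> VV X" using EE_VV[OF X] by auto
  then have "sm (EE X)"
    by (rule sm_mono) (intro sm_Sigma; simp add: sm_small labels small_VV[OF X])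
  then have so: "small (subobs X)"
    using sm_mono[OF sub_obs] sm_image[of "Pow (VV X) \<times> Pow (EE X)" co]
    by (simp add: sm_small[symmetric] sm_Sigma sm_Pow small_VV[OF X, folded sm_small])
  have "Ar (subcat X) \<subseteq> (\<Union>A\<in>subobs X. \<Union>B\<in>subobs X. Hom GC A B)"
    by (auto simp: subcat_def Hom_def)
  then have sa: "small (Ar (subcat X))"
    using so cl locally_small unfolding sm_small[symmetric] by (elim sm_mono) (intro sm_UNION; blast)
  have "category (subcat X)"
  proof
    show "src (subcat X) f \<in> Ob (subcat X) \<and> tgt (subcat X) f \<in> Ob (subcat X)" if "f \<in> Ar (subcat X)" for f
      using that by (auto simp: subcat_def)
    show "ide (subcat X) A \<in> Hom (subcat X) A A" if "A \<in> Ob (subcat X)" for A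
    proof -
      have A: "A \<in> Ob GC" "A \<in> subobs X" using that cl by (auto simp: obs)
      then show ?thesis
        using ide_GC[OF A(1)] unfolding Hom_subcat by (simp add: subcat_def)
    qed
    show "g \<cdot>\<^bsub>subcat X\<^esub> f \<in> Hom (subcat X) A C"
      if "f \<in> Hom (subcat X) A B" "g \<in> Hom (subcat X) B C" for f g A B C
    proof -
      have f: "f \<in> Hom GC A B" "g \<in> Hom GC B C" using that by (auto simp: Hom_subcat)
      then show ?thesis
        using that comp_in[OF f] fn_comp[OF f] Hom_fn(4)[OF f(1)] unfolding Hom_subcat comp_subcat by auto
    qed
    show "ide (subcat X) B \<cdot>\<^bsub>subcat X\<^esub> f = f" if "f \<in> Hom (subcat X) A B" for f A B
      using that ide_left[of f A B] unfolding Hom_subcat comp_subcat by (simp add: subcat_def)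
    show "f \<cdot>\<^bsub>subcat X\<^esub> ide (subcat X) A = f" if "f \<in> Hom (subcat X) A B" for f A B
      using that ide_right[of f A B] unfolding Hom_subcat comp_subcat by (simp add: subcat_def)
    show "h \<cdot>\<^bsub>subcat X\<^esub> g \<cdot>\<^bsub>subcat X\<^esub> f = h \<cdot>\<^bsub>subcat X\<^esub> (g \<cdot>\<^bsub>subcat X\<^esub> f)"
      if "f \<in> Hom (subcat X) A B" "g \<in> Hom (subcat X) B C" "h \<in> Hom (subcat X) C D" for f g h A B C D
      using that assoc[of f A B g C h D] unfolding Hom_subcat comp_subcat by blast
    show "small (Hom (subcat X) A B)" if "A \<in> Ob (subcat X)" "B \<in> Ob (subcat X)" for A B
    proof -
      have "sm (Hom GC A B)" using locally_small[of A B] that cl by (simp add: obs sm_small)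
      moreover have "Hom (subcat X) A B \<subseteq> Hom GC A B" by (auto simp: Hom_subcat)
      ultimately show ?thesis using sm_mono sm_small by blast
    qed
  qed
  then have "small_category (subcat X)" using so sa obs by (simp add: small_category_def)
  moreover have "u = v" if "u \<in> Hom (subcat X) A B" "v \<in> Hom (subcat X) A B" for u v A B
    using that Hom_eqI[of u A B v] unfolding Hom_subcat by auto
  moreover have "A = B" if "A \<in> subobs X" "B \<in> subobs X" "Hom (subcat X) A B \<noteq> {}" "Hom (subcat X) B A \<noteq> {}" for A B
    using that incl_iff[of A X B] incl_iff[of B X A] Ob_ext[of A B] cl by blast
  ultimately show ?thesis unfolding poset_category_def obs by blast
qed

lemma subcat_directed:
  assumes X: "X \<in> Ob GC" and S: "S \<subseteq> subobs X" "finite S"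
  shows "\<exists>u\<in>subobs X. \<forall>s\<in>S. Hom (subcat X) s u \<noteq> {}"
proof -
  define V E where "V = (\<Union>s\<in>S. VV s)" and "E = (\<Union>s\<in>S. EE s)"
  have fin: "finite V" "finite E" using S by (auto simp: V_def E_def subobs_def fin_obs_def)
  have "E \<subseteq> L \<times> V \<times> V" unfolding V_def E_def using S EE_VV by (fastforce simp: subobs_def fin_obs_def)
  then have g: "(V, E) \<in> graphs L" using sm_finite[OF fin(1)] by (simp add: graphs_def sm_small)
  have VE: "VV (co (V, E)) = V" "EE (co (V, E)) = E" using VV_co[OF g] EE_co[OF g] by auto
  have u: "co (V, E) \<in> subobs X"
    using S fin co_Ob[OF g] unfolding subobs_def fin_obs_def mem_Collect_eq VE
    by (auto simp: V_def E_def subobs_def)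
  show ?thesis
  proof (intro bexI[OF _ u] ballI)
    fix s assume s: "s \<in> S"
    have "VV s \<subseteq> V" "EE s \<subseteq> E" using s by (auto simp: V_def E_def)
    then show "Hom (subcat X) s (co (V, E)) \<noteq> {}" using incl_iff[of s X "co (V, E)"] s S(1) u VE by auto
  qed
qed

context
  fixes N :: "'a set" and Z :: 'a
  assumes N: "infinite N" "small N" and Z: "Z \<in> Ob GC"
begin

text \<open>The finite subgraphs of all graphs form a proper class. Moving their vertices
  injectively into a fixed infinite small set \<open>N\<close> replaces them by isomorphic copies
  taken from a set, as local presentability demands.\<close>

definition rho :: "'a \<Rightarrow> 'a \<Rightarrow> 'a" where
  "rho A = (SOME f. inj_on f (VV A) \<and> f ` VV A \<subseteq> N)"

definition ren :: "'a \<Rightarrow> 'a" where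
  "ren A = co (rho A ` VV A, (\<lambda>(l, x, y). (l, rho A x, rho A y)) ` EE A)"

lemma rho:
  assumes "A \<in> subobs Z" shows "inj_on (rho A) (VV A)" "rho A ` VV A \<subseteq> N"
proof -
  have "finite (VV A)" using assms by (simp add: subobs_def fin_obs_def)
  then have "\<exists>f. inj_on f (VV A) \<and> f ` VV A \<subseteq> N"
    using N(1) by (meson card_of_ordLeq finite_ordLess_infinite2 ordLess_imp_ordLeq)
  then have "inj_on (rho A) (VV A) \<and> rho A ` VV A \<subseteq> N" unfolding rho_def by (rule someI_ex)
  then show "inj_on (rho A) (VV A)" "rho A ` VV A \<subseteq> N" by auto
qed

lemma ren:
  assumes A: "A \<in> subobs Z"
  shows "ren A \<in> fin_obs" "VV (ren A) = rho A ` VV A" "EE (ren A) = (\<lambda>(l, x, y). (l, rho A x, rho A y)) ` EE A"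
proof -
  have A': "A \<in> Ob GC" "finite (VV A)" "finite (EE A)" using A by (auto simp: subobs_def fin_obs_def)
  have g: "(rho A ` VV A, (\<lambda>(l, x, y). (l, rho A x, rho A y)) ` EE A) \<in> graphs L"
    using sm_finite[of "rho A ` VV A"] A' EE_VV[OF A'(1)] by (fastforce simp: graphs_def sm_small)
  show "VV (ren A) = rho A ` VV A" "EE (ren A) = (\<lambda>(l, x, y). (l, rho A x, rho A y)) ` EE A"
    using VV_co[OF g] EE_co[OF g] by (auto simp: ren_def)
  then show "ren A \<in> fin_obs" using A' co_Ob[OF g] by (simp add: fin_obs_def ren_def)
qed

definition subdiag :: "'a cfun" where
  "subdiag = \<lparr>fob = ren, far = (\<lambda>m. arr (ren (src GC m)) (ren (tgt GC m))
     (\<lambda>w\<in>VV (ren (src GC m)). rho (tgt GC m) (inv_into (VV (src GC m)) (rho (src GC m)) w)))\<rparr>"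

definition subinc :: "'a \<Rightarrow> 'a" where
  "subinc A = arr (ren A) Z (\<lambda>w\<in>VV (ren A). inv_into (VV A) (rho A) w)"

lemma far_subdiag:
  assumes m: "m \<in> Hom (subcat Z) A B"
  shows "far subdiag m \<in> Hom GC (ren A) (ren B)"
    and "v \<in> VV A \<Longrightarrow> fn (far subdiag m) (rho A v) = rho B v"
proof -
  have A: "A \<in> subobs Z" "B \<in> subobs Z" using m by (auto simp: Hom_subcat)
  have sub: "VV A \<subseteq> VV B" "EE A \<subseteq> EE B" using incl_iff[OF A] m by auto
  have "m \<in> Hom GC A B" using m by (simp add: Hom_subcat)
  then have st: "src GC m = A" "tgt GC m = B" by (auto simp: Hom_def)
  note rA = rho[OF A(1)]
  have AO: "A \<in> Ob GC" using A by (simp add: subobs_def fin_obs_def)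
  let ?f = "\<lambda>w\<in>VV (ren A). rho B (inv_into (VV A) (rho A) w)"
  have f: "?f (rho A v) = rho B v" if "v \<in> VV A" for v using that rA by (simp add: ren[OF A(1)])
  have "?f \<in> ghom (gr (ren A)) (gr (ren B))"
    unfolding ghom_gr
  proof (intro conjI allI impI)
    show "?f \<in> VV (ren A) \<rightarrow>\<^sub>E VV (ren B)"
      unfolding restrict_PiE_iff using rA sub by (auto simp: ren[OF A(1)] ren[OF A(2)])
    fix l x y assume "(l, x, y) \<in> EE (ren A)"
    then obtain a b where ab: "(l, a, b) \<in> EE A" "x = rho A a" "y = rho A b" by (auto simp: ren[OF A(1)])
    then show "(l, ?f x, ?f y) \<in> EE (ren B)"
      using f EE_VV[OF AO ab(1)] sub by (force simp: ren(3)[OF A(2)])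
  qed
  from arr_Hom(1,2)[OF _ _ this] ren(1)[OF A(1)] ren(1)[OF A(2)]
  show "far subdiag m \<in> Hom GC (ren A) (ren B)"
    "v \<in> VV A \<Longrightarrow> fn (far subdiag m) (rho A v) = rho B v"
    using f by (auto simp: subdiag_def st fin_obs_def)
qed

lemma subinc:
  assumes A: "A \<in> subobs Z"
  shows "subinc A \<in> Hom GC (ren A) Z" and "v \<in> VV A \<Longrightarrow> fn (subinc A) (rho A v) = v"
proof -
  note rA = rho[OF A]
  have A': "VV A \<subseteq> VV Z" "EE A \<subseteq> EE Z" "A \<in> Ob GC" using A by (auto simp: subobs_def fin_obs_def)
  let ?f = "\<lambda>w\<in>VV (ren A). inv_into (VV A) (rho A) w"
  have f: "?f (rho A v) = v" if "v \<in> VV A" for v using that rA by (simp add: ren[OF A(1)])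
  have "?f \<in> ghom (gr (ren A)) (gr Z)"
    unfolding ghom_gr
  proof (intro conjI allI impI)
    show "?f \<in> VV (ren A) \<rightarrow>\<^sub>E VV Z"
      unfolding restrict_PiE_iff using rA A' by (auto simp: ren[OF A])
    fix l x y assume "(l, x, y) \<in> EE (ren A)"
    then obtain a b where ab: "(l, a, b) \<in> EE A" "x = rho A a" "y = rho A b" by (auto simp: ren[OF A])
    then show "(l, ?f x, ?f y) \<in> EE Z" using f EE_VV[OF A'(3) ab(1)] A' by auto
  qed
  from arr_Hom(1,2)[OF _ Z this] ren(1)[OF A]
  show "subinc A \<in> Hom GC (ren A) Z" "v \<in> VV A \<Longrightarrow> fn (subinc A) (rho A v) = v"
    using f by (auto simp: subinc_def fin_obs_def)
qed

lemma subdiag_functor: "is_functor (subcat Z) GC subdiag"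
proof -
  have fob: "fob subdiag = ren" by (simp add: subdiag_def)
  have idf: "far subdiag (ide (subcat Z) A) = ide GC (ren A)" if A: "A \<in> subobs Z" for A
  proof -
    have rA: "ren A \<in> Ob GC" using ren(1)[OF A] by (simp add: fin_obs_def)
    have i: "ide (subcat Z) A \<in> Hom (subcat Z) A A"
      using poset_subcat[OF Z] A category.ide_in[of "subcat Z" A]
      by (simp add: poset_category_def small_category_def) (simp add: subcat_def)
    show ?thesis
      by (rule Hom_eqI[OF far_subdiag(1)[OF i] ide_GC(1)[OF rA]])
        (use far_subdiag(2)[OF i] ide_GC(2)[OF rA] in \<open>auto simp: ren(2)[OF A]\<close>)
  qed
  have cmp: "far subdiag (g \<cdot>\<^bsub>subcat Z\<^esub> f) = far subdiag g \<cdot>\<^bsub>GC\<^esub> far subdiag f"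
    if f: "f \<in> Hom (subcat Z) A B" "g \<in> Hom (subcat Z) B C" for f g A B C
  proof -
    have gf: "g \<cdot>\<^bsub>subcat Z\<^esub> f \<in> Hom (subcat Z) A C"
      using poset_subcat[OF Z] f category.comp_in[of "subcat Z"]
      by (simp add: poset_category_def small_category_def)
    have A: "A \<in> subobs Z" using f by (simp add: Hom_subcat)
    have "Hom (subcat Z) A B \<noteq> {}" using f(1) by blast
    moreover have "B \<in> subobs Z" using f(1) by (simp add: Hom_subcat)
    ultimately have AB: "VV A \<subseteq> VV B" using incl_iff[of A Z B] A by auto
    show ?thesis
    proof (rule Hom_eqI[OF far_subdiag(1)[OF gf] comp_GC(2)[OF far_subdiag(1)[OF f(1)] far_subdiag(1)[OF f(2)]]])
      fix w assume w: "w \<in> VV (ren A)"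
      then obtain v where v: "v \<in> VV A" "w = rho A v" by (auto simp: ren(2)[OF A])
      then show "fn (far subdiag (g \<cdot>\<^bsub>subcat Z\<^esub> f)) w = fn (far subdiag g \<cdot>\<^bsub>GC\<^esub> far subdiag f) w"
        using fn_comp[OF far_subdiag(1)[OF f(1)] far_subdiag(1)[OF f(2)] w] AB
          far_subdiag(2)[OF gf] far_subdiag(2)[OF f(1)] far_subdiag(2)[OF f(2)] by auto
    qed
  qed
  show ?thesis
    unfolding is_functor_def
  proof (intro conjI ballI impI)
    fix A assume "A \<in> Ob (subcat Z)"
    then have A: "A \<in> subobs Z" by (simp add: subcat_def)
    show "fob subdiag A \<in> Ob GC" using ren(1)[OF A] by (simp add: fob fin_obs_def)
    show "far subdiag (ide (subcat Z) A) = ide GC (fob subdiag A)" using idf[OF A] by (simp add: fob)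
  next
    fix f assume "f \<in> Ar (subcat Z)"
    then have f: "f \<in> Hom (subcat Z) (src (subcat Z) f) (tgt (subcat Z) f)" by (simp add: Hom_def)
    show "far subdiag f \<in> Hom GC (fob subdiag (src (subcat Z) f)) (fob subdiag (tgt (subcat Z) f))"
      using far_subdiag(1)[OF f] by (simp add: fob)
    fix g assume g: "g \<in> Ar (subcat Z)" "tgt (subcat Z) f = src (subcat Z) g"
    show "far subdiag (g \<cdot>\<^bsub>subcat Z\<^esub> f) = far subdiag g \<cdot>\<^bsub>GC\<^esub> far subdiag f"
      by (rule cmp[OF f, of _ "tgt (subcat Z) g"]) (use g in \<open>simp add: Hom_def\<close>)
  qed
qed

text \<open>Every vertex and every edge lies in a finite subgraph: one-vertex subgraphs determine
  the induced map, and subgraphs with a single edge show that it respects edges.\<close>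

lemma subdiag_colimit: "is_colimit GC (subcat Z) subdiag Z subinc"
  unfolding is_colimit_def
proof (intro conjI allI impI)
  have obs: "Ob (subcat Z) = subobs Z" and fob: "fob subdiag = ren" by (simp_all add: subcat_def subdiag_def)
  show "is_cocone GC (subcat Z) subdiag Z subinc"
    unfolding is_cocone_def obs fob
  proof (intro conjI ballI)
    show "Z \<in> Ob GC" by (rule Z)
    show "subinc A \<in> Hom GC (ren A) Z" if "A \<in> subobs Z" for A using subinc that by blast
    fix u assume "u \<in> Ar (subcat Z)"
    then have u: "u \<in> Hom (subcat Z) (src (subcat Z) u) (tgt (subcat Z) u)" by (simp add: Hom_def)
    then have st: "src (subcat Z) u \<in> subobs Z" "tgt (subcat Z) u \<in> subobs Z" by (auto simp: Hom_subcat)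
    have sub: "VV (src (subcat Z) u) \<subseteq> VV (tgt (subcat Z) u)" using incl_iff[OF st] u by auto
    note fu = far_subdiag[OF u] and s1 = subinc[OF st(1)] and s2 = subinc[OF st(2)]
    show "subinc (tgt (subcat Z) u) \<cdot>\<^bsub>GC\<^esub> far subdiag u = subinc (src (subcat Z) u)"
    proof (rule Hom_eqI[OF comp_GC(2)[OF fu(1) s2(1)] s1(1)])
      fix w assume w: "w \<in> VV (ren (src (subcat Z) u))"
      then obtain v where "v \<in> VV (src (subcat Z) u)" "w = rho (src (subcat Z) u) v"
        by (auto simp: ren(2)[OF st(1)])
      then show "fn (subinc (tgt (subcat Z) u) \<cdot>\<^bsub>GC\<^esub> far subdiag u) w = fn (subinc (src (subcat Z) u)) w"
        using fn_comp[OF fu(1) s2(1) w] fu(2) s1(2) s2(2) sub by auto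
    qed
  qed
  fix Y \<kappa> assume c: "is_cocone GC (subcat Z) subdiag Y \<kappa>"
  then have Y: "Y \<in> Ob GC" and kH: "\<And>A. A \<in> subobs Z \<Longrightarrow> \<kappa> A \<in> Hom GC (ren A) Y"
    and kc: "\<And>u. u \<in> Ar (subcat Z) \<Longrightarrow> \<kappa> (tgt (subcat Z) u) \<cdot>\<^bsub>GC\<^esub> far subdiag u = \<kappa> (src (subcat Z) u)"
    by (auto simp: is_cocone_def obs fob)
  define pt where "pt v = co ({v}, {})" for v :: 'a
  have ptg: "({v}, {}) \<in> graphs L" for v using sm_finite[of "{v}"] by (simp add: graphs_def sm_small)
  have pt: "VV (pt v) = {v}" "EE (pt v) = {}" for v using VV_co[OF ptg] EE_co[OF ptg] by (auto simp: pt_def)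
  have pts: "pt v \<in> subobs Z" if "v \<in> VV Z" for v
    using that co_Ob[OF ptg, of v] pt[of v] unfolding subobs_def fin_obs_def pt_def[symmetric] by simp
  define h where "h = (\<lambda>v\<in>VV Z. fn (\<kappa> (pt v)) (rho (pt v) v))"
  have h: "fn (\<kappa> A) (rho A v) = h v" if A: "A \<in> subobs Z" and v: "v \<in> VV A" for A v
  proof -
    have vZ: "v \<in> VV Z" using A v by (auto simp: subobs_def)
    have "Hom (subcat Z) (pt v) A \<noteq> {}" using incl_iff[OF pts[OF vZ] A] pt v by simp
    then obtain u where u: "u \<in> Hom (subcat Z) (pt v) A" by blast
    have "\<kappa> A \<cdot>\<^bsub>GC\<^esub> far subdiag u = \<kappa> (pt v)" using kc[of u] u by (auto simp: Hom_def)
    moreover have "rho (pt v) v \<in> VV (ren (pt v))" using pt by (simp add: ren(2)[OF pts[OF vZ]])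
    ultimately show ?thesis
      using fn_comp[OF far_subdiag(1)[OF u] kH[OF A], of "rho (pt v) v"] far_subdiag(2)[OF u, of v] pt vZ
      by (simp add: h_def)
  qed
  have hh: "h \<in> ghom (gr Z) (gr Y)"
    unfolding ghom_gr
  proof (intro conjI allI impI)
    show "h \<in> VV Z \<rightarrow>\<^sub>E VV Y"
      unfolding h_def restrict_PiE_iff
    proof
      fix v assume v: "v \<in> VV Z"
      have "rho (pt v) v \<in> VV (ren (pt v))" using pt by (simp add: ren(2)[OF pts[OF v]])
      then show "fn (\<kappa> (pt v)) (rho (pt v) v) \<in> VV Y" using Hom_fn(4)[OF kH[OF pts[OF v]]] by blast
    qed
    fix l x y assume e: "(l, x, y) \<in> EE Z"
    define A where "A = co ({x, y}, {(l, x, y)})"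
    have xy: "l \<in> L" "x \<in> VV Z" "y \<in> VV Z" using EE_VV[OF Z e] by auto
    have g: "({x, y}, {(l, x, y)}) \<in> graphs L"
      using sm_finite[of "{x, y}"] xy by (simp add: graphs_def sm_small)
    have AVE: "VV A = {x, y}" "EE A = {(l, x, y)}" using VV_co[OF g] EE_co[OF g] by (auto simp: A_def)
    have A: "A \<in> subobs Z"
      using co_Ob[OF g] AVE xy e unfolding subobs_def fin_obs_def A_def[symmetric] by simp
    have "(l, rho A x, rho A y) \<in> EE (ren A)" by (simp add: ren(3)[OF A] AVE)
    then have "(l, fn (\<kappa> A) (rho A x), fn (\<kappa> A) (rho A y)) \<in> EE Y" by (rule Hom_fn(5)[OF kH[OF A]])
    then show "(l, h x, h y) \<in> EE Y" using h[OF A] AVE by simp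
  qed
  note hA = arr_Hom[OF Z Y hh]
  show "\<exists>!h. h \<in> Hom GC Z Y \<and> (\<forall>j\<in>Ob (subcat Z). h \<cdot>\<^bsub>GC\<^esub> subinc j = \<kappa> j)"
    unfolding obs
  proof (rule ex1I[of _ "arr Z Y h"], intro conjI ballI)
    show "arr Z Y h \<in> Hom GC Z Y" by (rule hA)
    fix A assume A: "A \<in> subobs Z"
    show "arr Z Y h \<cdot>\<^bsub>GC\<^esub> subinc A = \<kappa> A"
    proof (rule Hom_eqI[OF comp_GC(2)[OF subinc(1)[OF A] hA(1)] kH[OF A]])
      fix w assume w: "w \<in> VV (ren A)"
      then show "fn (arr Z Y h \<cdot>\<^bsub>GC\<^esub> subinc A) w = fn (\<kappa> A) w"
        using fn_comp[OF subinc(1)[OF A] hA(1) w] subinc(2)[OF A] h[OF A] hA(2) by (auto simp: ren(2)[OF A])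
    qed
  next
    fix g assume g: "g \<in> Hom GC Z Y \<and> (\<forall>j\<in>subobs Z. g \<cdot>\<^bsub>GC\<^esub> subinc j = \<kappa> j)"
    show "g = arr Z Y h"
    proof (rule Hom_eqI[OF conjunct1[OF g] hA(1)])
      fix v assume v: "v \<in> VV Z"
      have w: "rho (pt v) v \<in> VV (ren (pt v))" using pt by (simp add: ren(2)[OF pts[OF v]])
      have "fn g v = fn (g \<cdot>\<^bsub>GC\<^esub> subinc (pt v)) (rho (pt v) v)"
        using fn_comp[OF subinc(1)[OF pts[OF v]] conjunct1[OF g] w] subinc(2)[OF pts[OF v], of v] pt by simp
      then show "fn g v = fn (arr Z Y h) v" using g pts[OF v] hA(2) v by (simp add: h_def)
    qed
  qed
qed

end

text \<open>The cardinal is that of a countable set \<open>N\<close>. Finite graphs on vertices from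
  \<open>N\<close> are finitely presentable and form a set, since there are few labels, and each
  graph is the directed colimit of renamed copies of its finite subgraphs.\<close>

lemma locally_presentable_GC: "locally_presentable GC"
proof -
  obtain f :: "nat \<Rightarrow> 'a" where f: "inj f"
    using infinite_UNIV infinite_countable_subset by blast
  define N where "N = range f"
  have N: "infinite N" "small N"
    using f sm_image[OF sm_nat[of UNIV], of f] by (auto simp: N_def finite_image_iff sm_small)
  have Nn: "natLeq =o |N|"
    using card_of_nat ordIso_transitive ordIso_symmetric card_of_ordIsoI[OF inj_on_imp_bij_betw[OF f]]
    unfolding N_def by metis
  have reg: "small_regular_cardinal |N|"
    unfolding small_regular_cardinal_def
    using N regularCard_ordIso[OF Nn natLeq_Cinfinite regularCard_natLeq] card_of_Card_order
    by (auto simp: cinfinite_def Field_card_of)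
  have fin: "finite S \<longleftrightarrow> |S| <o |N|" for S :: "'a set"
    using Nn finite_iff_ordLess_natLeq ordIso_symmetric ordLess_ordIso_trans by metis
  define S where "S = {A \<in> fin_obs. VV A \<subseteq> N}"
  have "S \<subseteq> co ` (Pow N \<times> Pow (L \<times> N \<times> N))"
  proof
    fix A assume A: "A \<in> S"
    then have AO: "A \<in> Ob GC" by (simp add: S_def fin_obs_def)
    have "gr A \<in> Pow N \<times> Pow (L \<times> N \<times> N)"
      using A EE_VV[OF AO] by (cases "gr A") (fastforce simp: S_def VV_def EE_def)
    then show "A \<in> co ` (Pow N \<times> Pow (L \<times> N \<times> N))" using Ob_GC[OF AO] by (metis imageI)
  qed
  then have "sm S"
    using N(2) labels by (elim sm_mono) (intro sm_image sm_Sigma sm_Pow; simp add: sm_small)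
  then have S: "small S" by (simp add: sm_small)
  have pres: "presentable_ob GC |N| A" if A: "A \<in> S" for A
    unfolding presentable_ob_def
  proof (intro conjI allI impI, goal_cases)
    case 1 show ?case using A by (simp add: S_def fin_obs_def)
  next
    case (2 J D Y \<iota>)
    have "\<exists>u\<in>Ob J. \<forall>s\<in>T. Hom J s u \<noteq> {}" if "T \<subseteq> Ob J" "finite T" for T
      using 2 that fin[of T] unfolding directed_poset_category_def by blast
    then show ?case
      using 2 A unfolding directed_poset_category_def
      by (intro finite_graph_preserves) (auto simp: S_def fin_obs_def)
  qed
  have "\<exists>(J :: 'a cat) D \<iota>. directed_poset_category |N| J \<and> is_functor J GC D \<and>
      (\<forall>j\<in>Ob J. fob D j \<in> S) \<and> is_colimit GC J D X \<iota>" if X: "X \<in> Ob GC" for X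
  proof (intro exI conjI)
    have obs: "Ob (subcat X) = subobs X" by (simp add: subcat_def)
    show "directed_poset_category |N| (subcat X)"
      unfolding directed_poset_category_def obs
      using poset_subcat[OF X] subcat_directed[OF X] fin by blast
    show "is_functor (subcat X) GC (subdiag N)" by (rule subdiag_functor[OF N X])
    show "is_colimit GC (subcat X) (subdiag N) X (subinc N X)" by (rule subdiag_colimit[OF N X])
    show "\<forall>j\<in>Ob (subcat X). fob (subdiag N) j \<in> S"
    proof
      fix A assume "A \<in> Ob (subcat X)"
      then have A: "A \<in> subobs X" by (simp add: obs)
      have "VV (ren N A) \<subseteq> N" using ren(2)[OF N X A] rho(2)[OF N X A] by simp
      then show "fob (subdiag N) A \<in> S"
        using ren(1)[OF N X A] subdiag_def[OF N X] by (simp add: S_def)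
    qed
  qed
  moreover have "S \<subseteq> Ob GC" by (auto simp: S_def fin_obs_def)
  ultimately show ?thesis
    unfolding locally_presentable_def using category_GC cocomplete_GC reg S pres by blast
qed

end

section \<open>Rigid well-orders and Vopenka's principle for sequences of graphs\<close>

context universe
begin

text \<open>\<open>z\<close> is the least strict upper bound of the terms, which may come in any
  order and repeat. Besides the points of cofinality omega this admits successors.\<close>

definition is_ladder :: "(nat \<Rightarrow> 'v) \<Rightarrow> 'v \<Rightarrow> bool" where
  "is_ladder c z \<longleftrightarrow> (\<forall>n. below (c n) z) \<and> (\<forall>x. below x z \<longrightarrow> (\<exists>n. \<not> below (c n) x))"

text \<open>One fixed ladder at each point that has any is the extra structure by which
  homomorphisms are forced to respect suprema of sequences.\<close>

definition ladder :: "'v \<Rightarrow> nat \<Rightarrow> 'v" where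
  "ladder z = (SOME c. is_ladder c z)"

definition segment :: "'v \<Rightarrow> 'v set" where
  "segment z = {x. \<not> below z x}"

lemma ladder: "is_ladder c z \<Longrightarrow> is_ladder (ladder z) z"
  unfolding ladder_def by (rule someI[of "\<lambda>c. is_ladder c z"])

lemma segment_down: "x \<in> segment z \<Longrightarrow> below y x \<Longrightarrow> y \<in> segment z"
  using below_trans unfolding segment_def by blast

text \<open>At a least \<open>x\<close> with \<open>j x\<close> below \<open>x\<close>, monotonicity
  makes \<open>j x\<close> a smaller point of the same kind.\<close>

lemma increasing_ge:
  assumes inc: "\<And>x y. x \<in> segment z \<Longrightarrow> y \<in> segment z \<Longrightarrow> below x y \<Longrightarrow> below (j x) (j y)"
    and x: "x \<in> segment z"
  shows "\<not> below (j x) x"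
  using x
proof (induction x rule: wf_induct_rule[OF wf_below])
  case (1 x)
  show ?case
  proof
    assume b: "below (j x) x"
    then have "j x \<in> segment z" using segment_down[OF 1(2)] by blast
    then show False using 1 b inc[of "j x" x] by auto
  qed
qed

text \<open>
  A non-identity self-embedding moves some \<open>x\<close> upwards; the supremum of its iterates
  \<open>x, j x, j (j x), \<dots>\<close> is a fixed point of cofinality \<open>\<omega>\<close>, and its ladder would consist of
  fixed points, although no fixed point lies between \<open>x\<close> and the supremum.
\<close>

lemma rigid_segment:
  assumes inc: "\<And>x y. x \<in> segment o' \<Longrightarrow> y \<in> segment o' \<Longrightarrow> below x y \<Longrightarrow> below (j x) (j y)"
    and seg: "\<And>x. x \<in> segment o' \<Longrightarrow> j x \<in> segment o'"
    and lad: "\<And>z c n. z \<in> segment o' \<Longrightarrow> is_ladder c z \<Longrightarrow>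
      is_ladder (ladder (j z)) (j z) \<and> ladder (j z) n = j (ladder z n)"
    and x: "x \<in> segment o'"
  shows "j x = x"
proof (rule ccontr)
  assume "j x \<noteq> x"
  then have x1: "below x (j x)" using increasing_ge[of o' j x] inc x below_linear by blast
  define \<kappa> where "\<kappa> n = (j ^^ n) x" for n
  have \<kappa>S: "\<kappa> (Suc n) = j (\<kappa> n)" for n by (simp add: \<kappa>_def)
  have \<kappa>seg: "\<kappa> n \<in> segment o'" for n by (induction n) (auto simp: \<kappa>_def x seg)
  have \<kappa>inc: "below (\<kappa> n) (\<kappa> (Suc n))" for n
  proof (induction n)
    case 0 then show ?case using x1 by (simp add: \<kappa>_def)
  next
    case (Suc n) then show ?case using inc[OF \<kappa>seg \<kappa>seg Suc] by (simp only: \<kappa>S)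
  qed
  have "below (\<kappa> n) o'" for n
    using \<kappa>inc[of n] \<kappa>seg[of "Suc n"] below_linear below_trans unfolding segment_def by blast
  then have "{z. \<forall>n. below (\<kappa> n) z} \<noteq> {}" by blast
  \<comment> \<open>\<open>z\<close> is the supremum of the orbit of \<open>x\<close>, so the orbit
    itself is a ladder at \<open>z\<close>.\<close>
  then obtain z where z: "\<And>n. below (\<kappa> n) z" and zmin: "\<And>y. below y z \<Longrightarrow> \<exists>n. \<not> below (\<kappa> n) y"
    using wfE_min'[OF wf_below, of "{z. \<forall>n. below (\<kappa> n) z}"] by auto
  have zseg: "z \<in> segment o'"
    using zmin \<open>\<And>n. below (\<kappa> n) o'\<close> by (auto simp: segment_def)
  have l: "is_ladder \<kappa> z" using z zmin by (auto simp: is_ladder_def)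
  note lz = ladder[OF l] and lj = lad[OF zseg l]
  have cseg: "ladder z n \<in> segment o'" for n
    using lz segment_down[OF zseg] by (auto simp: is_ladder_def)
  have least: "\<exists>m. \<not> below (\<kappa> m) y \<and> (\<forall>k<m. below (\<kappa> k) y)" if "below y z" for y
    using zmin[OF that] exists_least_iff[of "\<lambda>m. \<not> below (\<kappa> m) y"] by blast
  have jc: "below (j (ladder z n)) z" for n
  proof -
    have "below (ladder z n) z" using lz by (simp add: is_ladder_def)
    then obtain m where "\<not> below (\<kappa> m) (ladder z n)" using zmin by blast
    then have "below (ladder z n) (\<kappa> (Suc m))" using below_linear below_trans \<kappa>inc by metis
    then have "below (j (ladder z n)) (\<kappa> (Suc (Suc m)))" using inc[OF cseg \<kappa>seg] unfolding \<kappa>S[of "Suc m"] by blast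
    then show ?thesis using z below_trans by blast
  qed
  \<comment> \<open>If \<open>j z\<close> were above \<open>z\<close>, some ladder point of
    \<open>j z\<close> would not be below \<open>z\<close>; but the ladder points of
    \<open>j z\<close> are the images of those of \<open>z\<close>, which stay below
    \<open>z\<close> by \<open>jc\<close>.\<close>
  have jz: "j z = z"
  proof (rule ccontr)
    assume "j z \<noteq> z"
    then have "below z (j z)" using increasing_ge[of o' j z] inc zseg below_linear by blast
    then obtain n where "\<not> below (ladder (j z) n) z" using lj unfolding is_ladder_def by blast
    then show False using jc lj by metis
  qed
  have fixp: "j (ladder z n) = ladder z n" for n using lj jz by metis
  obtain n where n: "\<not> below (ladder z n) (\<kappa> 0)"
    using lz z[of 0] unfolding is_ladder_def by blast
  have "below (ladder z n) z" using lz by (simp add: is_ladder_def)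
  \<comment> \<open>\<open>m\<close> is the first index at which the orbit is no longer below the
    fixed point \<open>ladder z n\<close>. If \<open>m = 0\<close>, the fixed point is
    \<open>x\<close> itself; otherwise applying \<open>j\<close> to the previous index contradicts
    the choice of \<open>m\<close>.\<close>
  then obtain m where m: "\<not> below (\<kappa> m) (ladder z n)" "\<forall>k<m. below (\<kappa> k) (ladder z n)"
    using least by blast
  show False
  proof (cases m)
    case 0
    then have "ladder z n = \<kappa> 0" using n m(1) below_linear by blast
    then show False using fixp[of n] \<kappa>inc[of 0] \<kappa>S[of 0] below_irrefl by auto
  next
    case (Suc k)
    then have "below (\<kappa> k) (ladder z n)" using m by simp
    then have "below (\<kappa> m) (ladder z n)" using inc[OF \<kappa>seg cseg] fixp \<kappa>S Suc by metis
    then show False using m by simp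
  qed
qed

text \<open>To each \<open>G x\<close> a segment of the well-order is attached, with its order, its
  ladders and a mark on the vertices of \<open>G x\<close>. The enlarged graphs are rigid and have
  no maps to members of smaller index; if all the asserted maps were missing as well, they would
  form a large discrete full subcategory of a category of graphs.\<close>

lemma vopenka_graphs:
  fixes G :: "'v \<Rightarrow> 'v graph"
  assumes vop: "vopenka TYPE('v)" and L: "small L" and N0: "\<not> small N0"
    and G: "\<And>x. x \<in> N0 \<Longrightarrow> G x \<in> graphs L"
  shows "\<exists>x\<in>N0. \<exists>y\<in>N0. below x y \<and> ghom (G x) (G y) \<noteq> {}"
proof (rule ccontr)
  assume none: "\<not> ?thesis"
  obtain tg :: "nat \<times> 'v \<Rightarrow> 'v" where tg: "inj tg"
    using inj_exists[of "UNIV :: (nat \<times> 'v) set"] card_prod_UNIV[OF card_UNIV_self(2) card_UNIV_self(1)] by blast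
  have tge: "tg p = tg p' \<longleftrightarrow> p = p'" for p p' using tg by (simp add: inj_eq)
  define V where "V x = (if x \<in> N0 then fst (G x) else {})" for x
  have smV: "small (V x)" for x using G[of x] sm_finite[of "{} :: 'v set"] by (auto simp: V_def graphs_def simp flip: sm_small)
  \<comment> \<open>The heights increase strictly with the index and exceed all vertices of
    \<open>G x\<close>, so that the attached segment contains these vertices.\<close>
  have "\<exists>f. \<forall>x. (\<forall>y. below y x \<longrightarrow> below (f y) (f x)) \<and> (\<forall>v\<in>V x. below v (f x))"
  proof (rule dependent_wf_choice[OF wf_below, where P = "\<lambda>f x r.
      (\<forall>y. below y x \<longrightarrow> below (f y) r) \<and> (\<forall>v\<in>V x. below v r)"])
    fix x f
    have "small (f ` {y. below y x} \<union> V x)"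
      unfolding sm_small[symmetric]
      by (intro sm_Un sm_image) (simp_all add: sm_small small_below smV)
    then obtain b where "\<And>a. a \<in> f ` {y. below y x} \<union> V x \<Longrightarrow> below a b" using small_bounded by blast
    then show "\<exists>r. (\<forall>y. below y x \<longrightarrow> below (f y) r) \<and> (\<forall>v\<in>V x. below v r)" by blast
  qed auto
  then obtain ht where ht: "\<And>x y. below y x \<Longrightarrow> below (ht y) (ht x)" and htV: "\<And>x v. v \<in> V x \<Longrightarrow> below v (ht x)"
    by blast
  define d0 :: 'v where "d0 = undefined"
  define L' where "L' = tg ` ({0} \<times> L) \<union> range (\<lambda>n. tg (Suc n, d0))"
  have L': "small L'"
    unfolding L'_def sm_small[symmetric]
    by (intro sm_Un sm_image sm_Sigma sm_nat) (auto simp: sm_small[symmetric] sm_finite L[folded sm_small])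
  \<comment> \<open>Tag 0 keeps the old labels, tag 1 marks the vertices of \<open>G x\<close> by
    loops, tag 2 is the order, and tag \<open>n + 3\<close> joins the \<open>n\<close>-th ladder
    point of \<open>z\<close> to \<open>z\<close>. The component \<open>d0\<close> is a
    dummy.\<close>
  define E where "E x = {(tg (0, l), a, b) | l a b. (l, a, b) \<in> snd (G x)}
      \<union> {(tg (1, d0), a, a) | a. a \<in> V x}
      \<union> {(tg (2, d0), a, b) | a b. a \<in> segment (ht x) \<and> b \<in> segment (ht x) \<and> below a b}
      \<union> {(tg (n + 3, d0), ladder z n, z) | n z. z \<in> segment (ht x) \<and> is_ladder (ladder z) z}" for x
  define R where "R x = (segment (ht x), E x)" for x
  have seg_small: "small (segment z)" for z
  proof -
    have "segment z = insert z {x. below x z}"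
      using below_linear below_asym below_irrefl by (auto simp: segment_def)
    then show ?thesis
      using sm_insert[of "{x. below x z}" z] small_below[of z] by (simp add: sm_small)
  qed
  have Vseg: "V x \<subseteq> segment (ht x)" for x
    using htV below_asym by (auto simp: segment_def)
  have lab: "tg (1, d0) \<in> L'" "tg (2, d0) \<in> L'" "tg (n + 3, d0) \<in> L'" for n
    unfolding L'_def by (auto simp: numeral_eq_Suc)
  have Rg: "R x \<in> graphs L'" if x: "x \<in> N0" for x
  proof -
    have "snd (G x) \<subseteq> L \<times> V x \<times> V x" using G[OF x] x by (auto simp: graphs_def V_def)
    then have "{(tg (0, l), a, b) | l a b. (l, a, b) \<in> snd (G x)} \<subseteq> L' \<times> segment (ht x) \<times> segment (ht x)"
      using Vseg[of x] by (fastforce simp: L'_def)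
    moreover have "{(tg (n + 3, d0), ladder z n, z) | n z. z \<in> segment (ht x) \<and> is_ladder (ladder z) z}
        \<subseteq> L' \<times> segment (ht x) \<times> segment (ht x)"
      using lab segment_down unfolding is_ladder_def by fastforce
    ultimately have "E x \<subseteq> L' \<times> segment (ht x) \<times> segment (ht x)"
      unfolding E_def using Vseg[of x] lab by blast
    then show ?thesis by (simp add: R_def graphs_def seg_small)
  qed
  have bnd: "x = y \<and> (\<forall>v\<in>segment (ht x). f v = v) \<or> below x y \<and> ghom (G x) (G y) \<noteq> {}"
    if x: "x \<in> N0" "y \<in> N0" and f: "f \<in> ghom (R x) (R y)" for x y f
  proof -
    have fE: "(l, f a, f b) \<in> E y" if "(l, a, b) \<in> E x" for l a b
      using f that by (auto simp: ghom_def R_def)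
    have fs: "f a \<in> segment (ht y)" if "a \<in> segment (ht x)" for a
      using f that by (auto simp: ghom_def R_def)
    have inc: "below (f a) (f b)" if "a \<in> segment (ht x)" "b \<in> segment (ht x)" "below a b" for a b
    proof -
      have "(tg (2, d0), a, b) \<in> E x" using that by (auto simp: E_def)
      from fE[OF this] show ?thesis by (auto simp: E_def tge)
    qed
    have fV: "f v \<in> V y" if "v \<in> V x" for v
    proof -
      have "(tg (1, d0), v, v) \<in> E x" using that by (auto simp: E_def)
      from fE[OF this] show ?thesis by (auto simp: E_def tge)
    qed
    have fG: "(l, f a, f b) \<in> snd (G y)" if "(l, a, b) \<in> snd (G x)" for l a b
    proof -
      have "(tg (0, l), a, b) \<in> E x" using that by (auto simp: E_def)
      from fE[OF this] show ?thesis by (auto simp: E_def tge)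
    qed
    have lad: "is_ladder (ladder (f z)) (f z) \<and> ladder (f z) n = f (ladder z n)"
      if "z \<in> segment (ht x)" "is_ladder c z" for z c n
    proof -
      have "(tg (n + 3, d0), ladder z n, z) \<in> E x" using that ladder by (auto simp: E_def)
      from fE[OF this] show ?thesis by (auto simp: E_def tge)
    qed
    have hom: "restrict f (V x) \<in> ghom (G x) (G y)"
    proof -
      have "(l, a, b) \<in> snd (G x) \<Longrightarrow> a \<in> V x \<and> b \<in> V x" for l a b
        using G[OF x(1)] x by (auto simp: graphs_def V_def)
      then show ?thesis using fV fG x unfolding ghom_def by (auto simp: V_def)
    qed
    consider "x = y" | "below x y" | "below y x" using below_linear by blast
    then show ?thesis
    proof cases
      case 1
      have "f v = v" if "v \<in> segment (ht x)" for v
        by (rule rigid_segment[of "ht x" f]) (use inc fs lad that 1 in auto)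
      then show ?thesis using 1 by blast
    next
      case 2 then show ?thesis using hom by blast
    next
      \<comment> \<open>The target segment is too short: a strictly increasing map sends
        \<open>ht y\<close>, its top element, to a point not below \<open>ht y\<close>, and so it
        sends the larger \<open>ht x\<close> out of the segment.\<close>
      case 3
      have h: "below (ht y) (ht x)" using ht 3 by blast
      have s: "ht y \<in> segment (ht x)" "ht x \<in> segment (ht x)"
        using h below_asym below_irrefl by (auto simp: segment_def)
      have "\<not> below (f (ht y)) (ht y)" using increasing_ge[of "ht x" f] inc s(1) by blast
      moreover have "below (f (ht y)) (f (ht x))" using inc s h by blast
      moreover have "\<not> below (ht y) (f (ht x))" using fs[OF s(2)] by (simp add: segment_def)
      ultimately show ?thesis using below_linear below_trans by metis
    qed
  qed
  have "|UNIV :: (nat \<times> 'v \<times> 'v \<times> 'v) set| \<le>o |UNIV :: 'v set|"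
    by (intro card_prod_UNIV card_UNIV_self)
  then obtain enc :: "(nat \<times> 'v \<times> 'v \<times> 'v) set \<Rightarrow> 'v" where enc: "inj_on enc {A. sm A}"
    using inj_exists card_small_subsets by metis
  have smE: "sm (snd g)" "sm (fst g)" if "g \<in> graphs L'" for g
  proof -
    show "sm (fst g)" using that by (auto simp: graphs_def sm_small)
    have "snd g \<subseteq> L' \<times> fst g \<times> fst g" using that by (auto simp: graphs_def)
    moreover have "sm (L' \<times> fst g \<times> fst g)"
      using \<open>sm (fst g)\<close> L' by (intro sm_Sigma) (auto simp: sm_small)
    ultimately show "sm (snd g)" using sm_mono by blast
  qed
  \<comment> \<open>A graph is coded on the levels \<open>k\<close> (vertices) and
    \<open>k + 1\<close> (edges). In the code of an arrow the source thus occupies levels 0 and 1,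
    the target 2 and 3, and the function level 4, so that the parts can be separated again.\<close>
  define cg where "cg k g = (\<lambda>v. (k, v, v, v)) ` fst g \<union> Pair (Suc k) ` snd g" for k :: nat and g :: "'v graph"
  have smcg: "sm (cg k g)" if "g \<in> graphs L'" for k g
    unfolding cg_def using smE[OF that] by (intro sm_Un sm_image)
  have cg_inj: "g = h" if "cg k g = cg k h" for k g h
  proof (rule prod_eqI)
    have F: "fst g = {v. (k, v, v, v) \<in> cg k g}" and S: "snd g = {e. (Suc k, e) \<in> cg k g}" for g
      by (auto simp: cg_def)
    show "fst g = fst h" unfolding F[of g] F[of h] that ..
    show "snd g = snd h" unfolding S[of g] S[of h] that ..
  qed
  define ch where "ch t = (case t of (g, h, f) \<Rightarrow> cg 0 g \<union> cg 2 h \<union> (\<lambda>v. (4, v, f v, f v)) ` fst g)"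
    for t :: "'v graph \<times> 'v graph \<times> ('v \<Rightarrow> 'v)"
  have ch_inj: "t = t'" if t: "t \<in> garrows L'" "t' \<in> garrows L'" "ch t = ch t'" for t t'
  proof -
    obtain g h f g' h' f' where e: "t = (g, h, f)" "t' = (g', h', f')" by (cases t, cases t')
    have c0: "cg 0 g = {p. p \<in> ch (g, h, f) \<and> fst p < 2}"
      and c2: "cg 2 h = {p. p \<in> ch (g, h, f) \<and> 2 \<le> fst p \<and> fst p < 4}" for g h f
      by (auto simp: ch_def cg_def)
    have "cg 0 g = cg 0 g'" by (simp only: c0[of g h f] c0[of g' h' f'] t(3)[unfolded e])
    moreover have "cg 2 h = cg 2 h'" by (simp only: c2[of h g f] c2[of h' g' f'] t(3)[unfolded e])
    ultimately have gh: "g = g'" "h = h'" using cg_inj by blast+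
    have f: "f \<in> fst g \<rightarrow>\<^sub>E fst h" "f' \<in> fst g \<rightarrow>\<^sub>E fst h"
      using t(1,2) gh unfolding e garrows_def ghom_def by auto
    have "f = f'"
    proof (rule PiE_ext[OF f])
      fix v assume "v \<in> fst g"
      then have "(4, v, f v, f v) \<in> ch t" by (auto simp: e ch_def)
      then have "(4, v, f v, f v) \<in> ch t'" using t(3) by simp
      then show "f v = f' v" by (auto simp: e ch_def cg_def)
    qed
    then show ?thesis using gh by (simp add: e)
  qed
  have smch: "sm (ch t)" if "t \<in> garrows L'" for t
    using that smcg smE unfolding garrows_def ch_def by (auto intro!: sm_Un sm_image)
  obtain pr :: "'v \<times> 'v \<Rightarrow> 'v" where pr: "inj pr"
    using inj_exists[of "UNIV :: ('v \<times> 'v) set"] card_prod_UNIV[OF card_UNIV_self(1) card_UNIV_self(1)] by blast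
  interpret GC: graph_category universe_type L' "\<lambda>g. enc (cg 0 g)" "\<lambda>t. enc (ch t)" pr
  proof
    show "small L'" by (rule L')
    show "inj_on (\<lambda>g. enc (cg 0 g)) (graphs L')"
      using enc smcg cg_inj unfolding inj_on_def by (metis mem_Collect_eq)
    show "inj_on (\<lambda>t. enc (ch t)) (garrows L')"
      using enc smch ch_inj unfolding inj_on_def by (metis mem_Collect_eq)
    show "inj pr" by (rule pr)
  qed
  let ?K = "GC.GC"
  define ob where "ob x = enc (cg 0 (R x))" for x
  have obOb: "ob x \<in> Ob ?K" and gr_ob: "GC.gr (ob x) = R x" if "x \<in> N0" for x
    using GC.co_Ob[OF Rg[OF that]] GC.gr_co[OF Rg[OF that]] by (auto simp: ob_def)
  have inj: "inj_on ob N0"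
  proof (rule inj_onI)
    fix x y assume x: "x \<in> N0" "y \<in> N0" "ob x = ob y"
    have "(\<lambda>v\<in>fst (R x). v) \<in> ghom (R x) (R y)"
      using gr_ob[OF x(1)] gr_ob[OF x(2)] x(3) ghom_id[OF Rg[OF x(1)]] by simp
    then show "x = y" using bnd[OF x(1,2)] none x by blast
  qed
  have "discrete_full_on ?K (ob ` N0)"
    unfolding discrete_full_on_def
  proof (intro conjI ballI)
    show "ob ` N0 \<subseteq> Ob ?K" using obOb by auto
    fix X Y m assume "X \<in> ob ` N0" "Y \<in> ob ` N0" and m: "m \<in> Hom ?K X Y"
    then obtain x y where x: "x \<in> N0" "y \<in> N0" "X = ob x" "Y = ob y" by auto
    have "GC.fn m \<in> ghom (R x) (R y)"
      using GC.Hom_fn(6)[OF m] gr_ob x by simp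
    then have xy: "x = y" "\<And>v. v \<in> segment (ht x) \<Longrightarrow> GC.fn m v = v" using bnd[OF x(1,2)] none x by blast+
    then show "X = Y" by (simp add: x)
    have "GC.VV X = segment (ht x)" unfolding GC.VV_def x gr_ob[OF x(1)] by (simp add: R_def)
    then show "m = ide ?K X"
      using GC.Hom_eqI[of m X X "ide ?K X"] GC.ide_GC[of X] m xy x obOb[OF x(1)] by auto
  qed
  moreover have "\<not> small (ob ` N0)"
    using N0 sm_inj[OF inj subset_refl] by (auto simp flip: sm_small)
  ultimately show False
    using vop GC.locally_presentable_GC unfolding vopenka_def by blast
qed

end

section \<open>Vopenka's principle for squares in a locally presentable category\<close>

lemma ex1_unique: "\<exists>!x. P x \<Longrightarrow> P a \<Longrightarrow> P b \<Longrightarrow> a = b"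
  by blast

text \<open>The functor that sends an object to its presheaf of maps from \<open>S\<close> is full
  (first clause) and faithful (second clause). One function \<phi> serves for all \<open>s\<close>
  because an arrow determines its source.\<close>

definition dense_objects :: "('v, 'm) cat_scheme \<Rightarrow> 'v set \<Rightarrow> bool" where
  "dense_objects M S \<longleftrightarrow>
     (\<forall>X\<in>Ob M. \<forall>Y\<in>Ob M. \<forall>\<phi>. (\<forall>s\<in>S. \<forall>f\<in>Hom M s X. \<phi> f \<in> Hom M s Y) \<and>
        (\<forall>s\<in>S. \<forall>s'\<in>S. \<forall>m\<in>Hom M s s'. \<forall>f\<in>Hom M s' X. \<phi> (f \<cdot>\<^bsub>M\<^esub> m) = \<phi> f \<cdot>\<^bsub>M\<^esub> m) \<longrightarrow>
        (\<exists>h\<in>Hom M X Y. \<forall>s\<in>S. \<forall>f\<in>Hom M s X. h \<cdot>\<^bsub>M\<^esub> f = \<phi> f)) \<and>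
     (\<forall>X Y. \<forall>h\<in>Hom M X Y. \<forall>k\<in>Hom M X Y.
        (\<forall>s\<in>S. \<forall>f\<in>Hom M s X. h \<cdot>\<^bsub>M\<^esub> f = k \<cdot>\<^bsub>M\<^esub> f) \<longrightarrow> h = k)"

context universe
begin

text \<open>The colimit property is tested on a set with two elements: if \<open>f\<close> did not
  factor, the constant function and the one that differs from it only at \<open>f\<close> would both
  extend the constant family.\<close>

lemma presentable_factors:
  fixes M :: "('v, 'm) cat_scheme" and J :: "'v cat"
  assumes pres: "presentable_ob M r A" and J: "directed_poset_category r J" "is_functor J M D"
    "is_colimit M J D Y \<iota>" and f: "f \<in> Hom M A Y" and cat: "category M"
  shows "\<exists>j\<in>Ob J. \<exists>g\<in>Hom M A (fob D j). f = \<iota> j \<cdot>\<^bsub>M\<^esub> g"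
proof (rule ccontr)
  assume nf: "\<not> ?thesis"
  interpret category M by (rule cat)
  obtain a b :: 'v where ab: "a \<noteq> b"
    using infinite_UNIV ex_new_if_finite[of "{undefined :: 'v}"] by auto
  have H: "hom_preserves_colimit M A J D Y \<iota>" using pres J unfolding presentable_ob_def by blast
  let ?Q = "\<lambda>h. h \<in> Hom M A Y \<rightarrow>\<^sub>E {a, b} \<and> (\<forall>j\<in>Ob J. \<forall>g\<in>Hom M A (fob D j). h (\<iota> j \<cdot>\<^bsub>M\<^esub> g) = a)"
  have "small {a, b}" using sm_finite[of "{a, b}"] by (simp add: sm_small)
  then have ex1: "\<exists>!h. ?Q h"
    using H unfolding hom_preserves_colimit_def by (elim allE[of _ "{a, b}"] allE[of _ "\<lambda>_ _. a"]) simp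
  have iH: "\<iota> j \<cdot>\<^bsub>M\<^esub> g \<in> Hom M A Y" if "j \<in> Ob J" "g \<in> Hom M A (fob D j)" for j g
    using comp_in[OF that(2)] J(3) that(1) by (auto simp: is_colimit_def is_cocone_def)
  have nf': "\<iota> j \<cdot>\<^bsub>M\<^esub> g \<noteq> f" if "j \<in> Ob J" "g \<in> Hom M A (fob D j)" for j g
    using nf that by blast
  have Q1: "?Q (\<lambda>x\<in>Hom M A Y. a)" using iH by auto
  have Q2: "?Q (\<lambda>x\<in>Hom M A Y. if x = f then b else a)"
    unfolding restrict_PiE_iff using iH nf' by simp
  have "(\<lambda>x\<in>Hom M A Y. a) = (\<lambda>x\<in>Hom M A Y. if x = f then b else a)"
    by (rule ex1_unique[of ?Q, OF ex1 Q1 Q2])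
  from fun_cong[OF this, of f] show False using f ab by simp
qed

text \<open>A natural \<phi> applied to the legs of a colimit presentation of \<open>X\<close> is a
  cocone and induces \<open>h\<close>. That \<open>h\<close> agrees with \<phi> on every map from
  \<open>S\<close>, and not only on the legs, holds because such a map factors through a leg by
  presentability.\<close>

lemma dense_generator:
  fixes M :: "('v, 'm) cat_scheme"
  assumes lp: "locally_presentable M"
  shows "\<exists>S\<subseteq>Ob M. small S \<and> dense_objects M S"
proof -
  interpret category M using lp by (simp add: locally_presentable_def)
  obtain r S where S: "S \<subseteq> Ob M" "small S" and pres: "\<And>A. A \<in> S \<Longrightarrow> presentable_ob M r A"
    and dense: "\<And>X. X \<in> Ob M \<Longrightarrow> \<exists>(J :: 'v cat) D \<iota>. directed_poset_category r J \<and> is_functor J M D \<and>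
           (\<forall>j\<in>Ob J. fob D j \<in> S) \<and> is_colimit M J D X \<iota>"
    using lp unfolding locally_presentable_def by blast
  have "dense_objects M S"
    unfolding dense_objects_def
  proof (intro conjI ballI allI impI, goal_cases)
    case (1 X Y \<phi>)
    then have XY: "X \<in> Ob M" "Y \<in> Ob M" and \<phi>: "\<And>s f. s \<in> S \<Longrightarrow> f \<in> Hom M s X \<Longrightarrow> \<phi> f \<in> Hom M s Y"
      and nat: "\<And>s s' m f. s \<in> S \<Longrightarrow> s' \<in> S \<Longrightarrow> m \<in> Hom M s s' \<Longrightarrow> f \<in> Hom M s' X \<Longrightarrow> \<phi> (f \<cdot>\<^bsub>M\<^esub> m) = \<phi> f \<cdot>\<^bsub>M\<^esub> m"
      by auto
    obtain J :: "'v cat" and D \<iota> where J: "directed_poset_category r J" "is_functor J M D"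
      "\<And>j. j \<in> Ob J \<Longrightarrow> fob D j \<in> S" "is_colimit M J D X \<iota>" using dense[OF XY(1)] by blast
    have cc: "is_cocone M J D X \<iota>" using J(4) by (simp add: is_colimit_def)
    have catJ: "category J"
      using J(1) by (simp add: directed_poset_category_def poset_category_def small_category_def)
    have "is_cocone M J D Y (\<lambda>j. \<phi> (\<iota> j))"
      unfolding is_cocone_def
    proof (intro conjI ballI XY(2))
      show "\<phi> (\<iota> j) \<in> Hom M (fob D j) Y" if "j \<in> Ob J" for j
        using \<phi> J(3) cc that by (auto simp: is_cocone_def)
      fix u assume u: "u \<in> Ar J"
      have o: "src J u \<in> Ob J" "tgt J u \<in> Ob J" using category.src_tgt[OF catJ u] by auto
      have "far D u \<in> Hom M (fob D (src J u)) (fob D (tgt J u))"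
        using J(2) u by (auto simp: is_functor_def)
      then have "\<phi> (\<iota> (tgt J u)) \<cdot>\<^bsub>M\<^esub> far D u = \<phi> (\<iota> (tgt J u) \<cdot>\<^bsub>M\<^esub> far D u)"
        using nat[OF J(3)[OF o(1)] J(3)[OF o(2)]] cc o by (auto simp: is_cocone_def)
      then show "\<phi> (\<iota> (tgt J u)) \<cdot>\<^bsub>M\<^esub> far D u = \<phi> (\<iota> (src J u))"
        using cc u by (simp add: is_cocone_def)
    qed
    then obtain h where h: "h \<in> Hom M X Y" "\<And>j. j \<in> Ob J \<Longrightarrow> h \<cdot>\<^bsub>M\<^esub> \<iota> j = \<phi> (\<iota> j)"
      using J(4) unfolding is_colimit_def by blast
    have "h \<cdot>\<^bsub>M\<^esub> f = \<phi> f" if s: "s \<in> S" and f: "f \<in> Hom M s X" for s f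
    proof -
      obtain j g where j: "j \<in> Ob J" "g \<in> Hom M s (fob D j)" "f = \<iota> j \<cdot>\<^bsub>M\<^esub> g"
        using presentable_factors[OF pres[OF s] J(1,2,4) f] category_axioms by blast
      have ij: "\<iota> j \<in> Hom M (fob D j) X" using cc j by (auto simp: is_cocone_def)
      have "\<phi> f = \<phi> (\<iota> j) \<cdot>\<^bsub>M\<^esub> g" using nat[OF s J(3)[OF j(1)] j(2) ij] j by simp
      then show ?thesis using h(2)[OF j(1)] assoc[OF j(2) ij h(1)] j(3) by simp
    qed
    then show "\<exists>h\<in>Hom M X Y. \<forall>s\<in>S. \<forall>f\<in>Hom M s X. h \<cdot>\<^bsub>M\<^esub> f = \<phi> f" using h by blast
  next
    case (2 X Y h k)
    then have hk: "h \<in> Hom M X Y" "k \<in> Hom M X Y" and eq: "\<And>s f. s \<in> S \<Longrightarrow> f \<in> Hom M s X \<Longrightarrow> h \<cdot>\<^bsub>M\<^esub> f = k \<cdot>\<^bsub>M\<^esub> f"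
      by auto
    have X: "X \<in> Ob M" "Y \<in> Ob M" using src_tgt[of h] hk by (auto simp: Hom_def)
    obtain J :: "'v cat" and D \<iota> where J: "directed_poset_category r J" "is_functor J M D"
      "\<And>j. j \<in> Ob J \<Longrightarrow> fob D j \<in> S" "is_colimit M J D X \<iota>" using dense[OF X(1)] by blast
    have cc: "is_cocone M J D X \<iota>" using J(4) by (simp add: is_colimit_def)
    then have iH: "\<And>j. j \<in> Ob J \<Longrightarrow> \<iota> j \<in> Hom M (fob D j) X" by (simp add: is_cocone_def)
    have catJ: "category J"
      using J(1) by (simp add: directed_poset_category_def poset_category_def small_category_def)
    have "is_cocone M J D Y (\<lambda>j. h \<cdot>\<^bsub>M\<^esub> \<iota> j)"
      unfolding is_cocone_def
    proof (intro conjI ballI X(2))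
      show "h \<cdot>\<^bsub>M\<^esub> \<iota> j \<in> Hom M (fob D j) Y" if "j \<in> Ob J" for j using comp_in[OF iH[OF that] hk(1)] .
      fix u assume u: "u \<in> Ar J"
      have o: "src J u \<in> Ob J" "tgt J u \<in> Ob J" using category.src_tgt[OF catJ u] by auto
      have "far D u \<in> Hom M (fob D (src J u)) (fob D (tgt J u))"
        using J(2) u by (auto simp: is_functor_def)
      then show "h \<cdot>\<^bsub>M\<^esub> \<iota> (tgt J u) \<cdot>\<^bsub>M\<^esub> far D u = h \<cdot>\<^bsub>M\<^esub> \<iota> (src J u)"
        using assoc[OF _ iH[OF o(2)] hk(1)] cc u by (simp add: is_cocone_def)
    qed
    moreover have "k \<cdot>\<^bsub>M\<^esub> \<iota> j = h \<cdot>\<^bsub>M\<^esub> \<iota> j" if "j \<in> Ob J" for j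
      using eq[OF J(3)[OF that] iH[OF that]] by simp
    moreover have "\<exists>!g. g \<in> Hom M X Y \<and> (\<forall>j\<in>Ob J. g \<cdot>\<^bsub>M\<^esub> \<iota> j = h \<cdot>\<^bsub>M\<^esub> \<iota> j)"
      using J(4) calculation(1) by (simp add: is_colimit_def)
    ultimately show "h = k"
      using hk ex1_unique[of "\<lambda>g. g \<in> Hom M X Y \<and> (\<forall>j\<in>Ob J. g \<cdot>\<^bsub>M\<^esub> \<iota> j = h \<cdot>\<^bsub>M\<^esub> \<iota> j)" h k] by simp
  qed
  then show ?thesis using S by blast
qed

text \<open>A graph whose vertices are the maps from a dense set into the two ends of
  \<open>p x\<close>, with edges for precomposition and for \<open>p x\<close>, has natural
  transformations as its homomorphisms. Density turns these into maps \<open>h\<close> and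
  \<open>k\<close>; the order \<open>below x y\<close> is inherited from the graph version.\<close>

lemma vopenka_squares:
  fixes M :: "('v, 'm) cat_scheme"
  assumes vop: "vopenka TYPE('v)" and lp: "locally_presentable M" and N0: "\<not> small N0"
    and sq: "\<And>x. x \<in> N0 \<Longrightarrow> square M i (p x) (a x) (b x)"
  shows "\<exists>x\<in>N0. \<exists>y\<in>N0. below x y \<and> (\<exists>h\<in>Hom M (src M (p x)) (src M (p y)).
    \<exists>k\<in>Hom M (tgt M (p x)) (tgt M (p y)). k \<cdot>\<^bsub>M\<^esub> p x = p y \<cdot>\<^bsub>M\<^esub> h \<and> h \<cdot>\<^bsub>M\<^esub> a x = a y \<and> k \<cdot>\<^bsub>M\<^esub> b x = b y)"
proof -
  obtain S where S: "S \<subseteq> Ob M" "small S" "dense_objects M S" using dense_generator[OF lp] by blast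
  have dn: "\<exists>h\<in>Hom M X Y. \<forall>s\<in>S. \<forall>f\<in>Hom M s X. h \<cdot>\<^bsub>M\<^esub> f = \<phi> f"
    if "X \<in> Ob M" "Y \<in> Ob M" "\<And>s f. s \<in> S \<Longrightarrow> f \<in> Hom M s X \<Longrightarrow> \<phi> f \<in> Hom M s Y"
      "\<And>s s' m f. s \<in> S \<Longrightarrow> s' \<in> S \<Longrightarrow> m \<in> Hom M s s' \<Longrightarrow> f \<in> Hom M s' X \<Longrightarrow> \<phi> (f \<cdot>\<^bsub>M\<^esub> m) = \<phi> f \<cdot>\<^bsub>M\<^esub> m"
    for X Y \<phi>
    using S(3) that unfolding dense_objects_def by simp
  have gen: "h = k" if "h \<in> Hom M X Y" "k \<in> Hom M X Y"
      "\<And>s f. s \<in> S \<Longrightarrow> f \<in> Hom M s X \<Longrightarrow> h \<cdot>\<^bsub>M\<^esub> f = k \<cdot>\<^bsub>M\<^esub> f" for X Y h k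
    using S(3) that unfolding dense_objects_def by blast
  interpret category M using lp by (simp add: locally_presentable_def)
  define D E where "D x = src M (p x)" and "E x = tgt M (p x)" for x
  define U V where "U = src M i" and "V = tgt M i"
  have pH: "p x \<in> Hom M (D x) (E x)" and aH: "a x \<in> Hom M U (D x)" and bH: "b x \<in> Hom M V (E x)"
    and DE: "D x \<in> Ob M" "E x \<in> Ob M" "U \<in> Ob M" "V \<in> Ob M" if "x \<in> N0" for x
    using sq[OF that] src_tgt[of "p x"] src_tgt[of i] by (auto simp: square_def D_def E_def U_def V_def Hom_def)
  obtain tg :: "nat \<times> 'v \<Rightarrow> 'v" where tg: "inj tg"
    using inj_exists[of "UNIV :: (nat \<times> 'v) set"] card_prod_UNIV[OF card_UNIV_self(2) card_UNIV_self(1)] by blast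
  have tge: "tg q = tg q' \<longleftrightarrow> q = q'" for q q' using tg by (simp add: inj_eq)
  define HS where "HS X = (\<Union>s\<in>S. Hom M s X)" for X
  have smHS: "sm (HS X)" if "X \<in> Ob M" for X
    unfolding HS_def using S that locally_small by (intro sm_UNION) (auto simp: sm_small)
  have HSc: "f \<cdot>\<^bsub>M\<^esub> m \<in> HS X" if "s \<in> S" "m \<in> Hom M s s'" "f \<in> Hom M s' X" for f m s s' X
    using comp_in[OF that(2,3)] that(1) by (auto simp: HS_def)
  have HSp: "g \<cdot>\<^bsub>M\<^esub> f \<in> HS Y" if "f \<in> HS X" "g \<in> Hom M X Y" for f g X Y
    using that comp_in unfolding HS_def by blast
  define d0 :: 'v where "d0 = undefined"
  define MS where "MS = (\<Union>s'\<in>S. HS s')"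
  \<comment> \<open>Labels 0 and 1 record precomposition with maps inside the dense set, for source
    and target of \<open>p x\<close>; 2 records \<open>p x\<close> itself; 3 and 4 name the maps
    into the two ends of \<open>i\<close>, and the loops with these labels fix \<open>a x\<close>
    and \<open>b x\<close>. No label depends on \<open>x\<close>.\<close>
  define L where "L = (\<lambda>m. tg (0, m)) ` MS \<union> (\<lambda>m. tg (1, m)) ` MS \<union> {tg (2, d0)}
     \<union> (\<lambda>m. tg (3, m)) ` HS U \<union> (\<lambda>m. tg (4, m)) ` HS V"
  define Ed where "Ed x = {(tg (0, m), tg (0, f \<cdot>\<^bsub>M\<^esub> m), tg (0, f)) | m f s s'. s \<in> S \<and> s' \<in> S \<and> m \<in> Hom M s s' \<and> f \<in> Hom M s' (D x)}
      \<union> {(tg (1, m), tg (1, f \<cdot>\<^bsub>M\<^esub> m), tg (1, f)) | m f s s'. s \<in> S \<and> s' \<in> S \<and> m \<in> Hom M s s' \<and> f \<in> Hom M s' (E x)}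
      \<union> {(tg (2, d0), tg (0, f), tg (1, p x \<cdot>\<^bsub>M\<^esub> f)) | f. f \<in> HS (D x)}
      \<union> {(tg (3, g), tg (0, a x \<cdot>\<^bsub>M\<^esub> g), tg (0, a x \<cdot>\<^bsub>M\<^esub> g)) | g. g \<in> HS U}
      \<union> {(tg (4, g), tg (1, b x \<cdot>\<^bsub>M\<^esub> g), tg (1, b x \<cdot>\<^bsub>M\<^esub> g)) | g. g \<in> HS V}" for x
  define G where "G x = ((\<lambda>f. tg (0, f)) ` HS (D x) \<union> (\<lambda>f. tg (1, f)) ` HS (E x), Ed x)" for x
  have "N0 \<noteq> {}" using N0 sm_finite[of "{} :: 'v set"] by (auto simp: sm_small)
  then have UV: "U \<in> Ob M" "V \<in> Ob M" using DE by auto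
  have L: "small L"
    unfolding L_def MS_def sm_small[symmetric]
    using S UV by (intro sm_Un sm_image sm_UNION smHS) (auto simp: sm_small[symmetric] sm_finite)
  have Gg: "G x \<in> graphs L" if x: "x \<in> N0" for x
  proof -
    have "sm (fst (G x))" unfolding G_def fst_conv using DE[OF x] by (intro sm_Un sm_image smHS)
    moreover have "Ed x \<subseteq> L \<times> fst (G x) \<times> fst (G x)"
    proof -
      have *: "(tg (k, m), tg (k, f \<cdot>\<^bsub>M\<^esub> m), tg (k, f)) \<in> ((\<lambda>m. tg (k, m)) ` MS) \<times> ((\<lambda>m. tg (k, m)) ` HS X) \<times> ((\<lambda>m. tg (k, m)) ` HS X)"
        if "s \<in> S" "s' \<in> S" "m \<in> Hom M s s'" "f \<in> Hom M s' X" for k m f s s' X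
        using that HSc[OF that(1,3,4)] by (auto simp: MS_def HS_def)
      have "a x \<cdot>\<^bsub>M\<^esub> g \<in> HS (D x)" if "g \<in> HS U" for g using HSp[OF that aH[OF x]] .
      moreover have "b x \<cdot>\<^bsub>M\<^esub> g \<in> HS (E x)" if "g \<in> HS V" for g using HSp[OF that bH[OF x]] .
      moreover have "p x \<cdot>\<^bsub>M\<^esub> g \<in> HS (E x)" if "g \<in> HS (D x)" for g using HSp[OF that pH[OF x]] .
      ultimately show ?thesis
        unfolding Ed_def G_def fst_conv L_def
        using *[of _ _ _ _ "D x" 0] *[of _ _ _ _ "E x" 1] by (intro Un_least) blast+
    qed
    ultimately show ?thesis by (simp add: G_def graphs_def sm_small)
  qed
  obtain x y f where x: "x \<in> N0" "y \<in> N0" "below x y" and f: "f \<in> ghom (G x) (G y)"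
    using vopenka_graphs[OF vop L N0, of G] Gg by blast
  have fE: "(l, f u, f v) \<in> Ed y" if "(l, u, v) \<in> Ed x" for l u v
    using f that by (auto simp: ghom_def G_def)
  define \<phi> where "\<phi> k g = (SOME g'. f (tg (k, g)) = tg (k, g'))" for k g
  have \<phi>: "\<phi> k g = g'" if "f (tg (k, g)) = tg (k, g')" for k g g'
    unfolding \<phi>_def using that by (rule someI2) (simp add: that tge)
  \<comment> \<open>The loop labelled by the identity of \<open>s\<close> forces the image of a map
    out of \<open>s\<close> to be again a map out of \<open>s\<close>, into the same kind of
    end.\<close>
  have arrow0: "f (tg (0, g)) = tg (0, \<phi> 0 g) \<and> \<phi> 0 g \<in> Hom M s (D y)"
    if "s \<in> S" "g \<in> Hom M s (D x)" for s g
  proof -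
    have i: "ide M s \<in> Hom M s s" "g \<cdot>\<^bsub>M\<^esub> ide M s = g" using ide_in that S ide_right by auto
    have "(tg (0, ide M s), tg (0, g \<cdot>\<^bsub>M\<^esub> ide M s), tg (0, g)) \<in> Ed x" using that i(1) unfolding Ed_def by blast
    then have "(tg (0, ide M s), f (tg (0, g)), f (tg (0, g))) \<in> Ed y" using fE i(2) by metis
    then obtain g' s' s'' where g': "f (tg (0, g)) = tg (0, g')" "ide M s \<in> Hom M s'' s'" "g' \<in> Hom M s' (D y)"
      by (auto simp: Ed_def tge)
    then have "s' = s" using i(1) by (simp add: Hom_def)
    then show ?thesis using \<phi>[OF g'(1)] g' by simp
  qed
  have arrow1: "f (tg (1, g)) = tg (1, \<phi> 1 g) \<and> \<phi> 1 g \<in> Hom M s (E y)"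
    if "s \<in> S" "g \<in> Hom M s (E x)" for s g
  proof -
    have i: "ide M s \<in> Hom M s s" "g \<cdot>\<^bsub>M\<^esub> ide M s = g" using ide_in that S ide_right by auto
    have "(tg (1, ide M s), tg (1, g \<cdot>\<^bsub>M\<^esub> ide M s), tg (1, g)) \<in> Ed x" using that i(1) unfolding Ed_def by blast
    then have "(tg (1, ide M s), f (tg (1, g)), f (tg (1, g))) \<in> Ed y" using fE i(2) by metis
    then obtain g' s' s'' where g': "f (tg (1, g)) = tg (1, g')" "ide M s \<in> Hom M s'' s'" "g' \<in> Hom M s' (E y)"
      by (auto simp: Ed_def tge)
    then have "s' = s" using i(1) by (simp add: Hom_def)
    then show ?thesis using \<phi>[OF g'(1)] g' by simp
  qed
  have nat0: "\<phi> 0 (g \<cdot>\<^bsub>M\<^esub> m) = \<phi> 0 g \<cdot>\<^bsub>M\<^esub> m" if "s \<in> S" "s' \<in> S" "m \<in> Hom M s s'" "g \<in> Hom M s' (D x)" for s s' m g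
  proof -
    have "(tg (0, m), tg (0, g \<cdot>\<^bsub>M\<^esub> m), tg (0, g)) \<in> Ed x" using that unfolding Ed_def by blast
    then have "(tg (0, m), tg (0, \<phi> 0 (g \<cdot>\<^bsub>M\<^esub> m)), tg (0, \<phi> 0 g)) \<in> Ed y"
      using fE arrow0[OF that(2,4)] arrow0[OF that(1) comp_in[OF that(3,4)]] by metis
    then show ?thesis by (auto simp: Ed_def tge)
  qed
  have nat1: "\<phi> 1 (g \<cdot>\<^bsub>M\<^esub> m) = \<phi> 1 g \<cdot>\<^bsub>M\<^esub> m" if "s \<in> S" "s' \<in> S" "m \<in> Hom M s s'" "g \<in> Hom M s' (E x)" for s s' m g
  proof -
    have "(tg (1, m), tg (1, g \<cdot>\<^bsub>M\<^esub> m), tg (1, g)) \<in> Ed x" using that unfolding Ed_def by blast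
    then have "(tg (1, m), tg (1, \<phi> 1 (g \<cdot>\<^bsub>M\<^esub> m)), tg (1, \<phi> 1 g)) \<in> Ed y"
      using fE arrow1[OF that(2,4)] arrow1[OF that(1) comp_in[OF that(3,4)]] by metis
    then show ?thesis by (auto simp: Ed_def tge)
  qed
  obtain h where h: "h \<in> Hom M (D x) (D y)" "\<And>s g. s \<in> S \<Longrightarrow> g \<in> Hom M s (D x) \<Longrightarrow> h \<cdot>\<^bsub>M\<^esub> g = \<phi> 0 g"
    using dn[OF DE(1)[OF x(1)] DE(1)[OF x(2)], of "\<phi> 0"] arrow0 nat0 by blast
  obtain k where k: "k \<in> Hom M (E x) (E y)" "\<And>s g. s \<in> S \<Longrightarrow> g \<in> Hom M s (E x) \<Longrightarrow> k \<cdot>\<^bsub>M\<^esub> g = \<phi> 1 g"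
    using dn[OF DE(2)[OF x(1)] DE(2)[OF x(2)], of "\<phi> 1"] arrow1 nat1 by blast
  note pX = pH[OF x(1)] and pY = pH[OF x(2)] and aX = aH[OF x(1)] and bX = bH[OF x(1)]
  have "k \<cdot>\<^bsub>M\<^esub> p x = p y \<cdot>\<^bsub>M\<^esub> h"
  proof (rule gen[OF comp_in[OF pX k(1)] comp_in[OF h(1) pY]])
    fix s g assume s: "s \<in> S" "g \<in> Hom M s (D x)"
    then have "g \<in> HS (D x)" by (auto simp: HS_def)
    then have "(tg (2, d0), tg (0, g), tg (1, p x \<cdot>\<^bsub>M\<^esub> g)) \<in> Ed x" unfolding Ed_def by blast
    then have "(tg (2, d0), tg (0, \<phi> 0 g), tg (1, \<phi> 1 (p x \<cdot>\<^bsub>M\<^esub> g))) \<in> Ed y"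
      using fE arrow0[OF s] arrow1[OF s(1) comp_in[OF s(2) pX]] by metis
    then have "\<phi> 1 (p x \<cdot>\<^bsub>M\<^esub> g) = p y \<cdot>\<^bsub>M\<^esub> \<phi> 0 g" by (auto simp: Ed_def tge)
    then show "k \<cdot>\<^bsub>M\<^esub> p x \<cdot>\<^bsub>M\<^esub> g = p y \<cdot>\<^bsub>M\<^esub> h \<cdot>\<^bsub>M\<^esub> g"
      using assoc[OF s(2) pX k(1)] assoc[OF s(2) h(1) pY] h(2)[OF s] k(2)[OF s(1) comp_in[OF s(2) pX]] by simp
  qed
  moreover have "h \<cdot>\<^bsub>M\<^esub> a x = a y"
  proof (rule gen[OF comp_in[OF aX h(1)] aH[OF x(2)]])
    fix s g assume s: "s \<in> S" "g \<in> Hom M s U"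
    then have "g \<in> HS U" by (auto simp: HS_def)
    then have "(tg (3, g), tg (0, a x \<cdot>\<^bsub>M\<^esub> g), tg (0, a x \<cdot>\<^bsub>M\<^esub> g)) \<in> Ed x" unfolding Ed_def by blast
    then have "(tg (3, g), tg (0, \<phi> 0 (a x \<cdot>\<^bsub>M\<^esub> g)), tg (0, \<phi> 0 (a x \<cdot>\<^bsub>M\<^esub> g))) \<in> Ed y"
      using fE arrow0[OF s(1) comp_in[OF s(2) aX]] by metis
    then have "\<phi> 0 (a x \<cdot>\<^bsub>M\<^esub> g) = a y \<cdot>\<^bsub>M\<^esub> g" by (auto simp: Ed_def tge)
    then show "h \<cdot>\<^bsub>M\<^esub> a x \<cdot>\<^bsub>M\<^esub> g = a y \<cdot>\<^bsub>M\<^esub> g"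
      using assoc[OF s(2) aX h(1)] h(2)[OF s(1) comp_in[OF s(2) aX]] by simp
  qed
  moreover have "k \<cdot>\<^bsub>M\<^esub> b x = b y"
  proof (rule gen[OF comp_in[OF bX k(1)] bH[OF x(2)]])
    fix s g assume s: "s \<in> S" "g \<in> Hom M s V"
    then have "g \<in> HS V" by (auto simp: HS_def)
    then have "(tg (4, g), tg (1, b x \<cdot>\<^bsub>M\<^esub> g), tg (1, b x \<cdot>\<^bsub>M\<^esub> g)) \<in> Ed x" unfolding Ed_def by blast
    then have "(tg (4, g), tg (1, \<phi> 1 (b x \<cdot>\<^bsub>M\<^esub> g)), tg (1, \<phi> 1 (b x \<cdot>\<^bsub>M\<^esub> g))) \<in> Ed y"
      using fE arrow1[OF s(1) comp_in[OF s(2) bX]] by metis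
    then have "\<phi> 1 (b x \<cdot>\<^bsub>M\<^esub> g) = b y \<cdot>\<^bsub>M\<^esub> g" by (auto simp: Ed_def tge)
    then show "k \<cdot>\<^bsub>M\<^esub> b x \<cdot>\<^bsub>M\<^esub> g = b y \<cdot>\<^bsub>M\<^esub> g"
      using assoc[OF s(2) bX k(1)] k(2)[OF s(1) comp_in[OF s(2) bX]] by simp
  qed
  ultimately show ?thesis using x h(1) k(1) unfolding D_def E_def by blast
qed

end

section \<open>Geometric realization\<close>

definition rcls :: "'a sset \<Rightarrow> 'a rpoint \<Rightarrow> 'a rpoint set" where
  "rcls X p = realization_rel X `` {p}"

lemma topspace_simplex_space: "topspace (simplex_space n) = standard_simplex n"
  by (simp add: simplex_space_def)

lemma topspace_presum:
  "topspace (presum X) = {((n, x), t). x \<in> simplices X n \<and> t \<in> standard_simplex n}"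
  by (auto simp: presum_def topspace_simplex_space)

lemma Delta_le: "\<theta> \<in> Delta m n \<Longrightarrow> i \<le> m \<Longrightarrow> \<theta> i \<le> n"
  by (auto simp: Delta_def)

lemma push_simplex_in:
  assumes \<theta>: "\<theta> \<in> Delta m n" and t: "t \<in> standard_simplex m"
  shows "push_simplex m \<theta> t \<in> standard_simplex n"
proof -
  have t0: "\<And>i. 0 \<le> t i" and t1: "(\<Sum>i\<le>m. t i) = 1" using t by (auto simp: standard_simplex_def)
  have le: "push_simplex m \<theta> t j \<le> 1" for j
    unfolding push_simplex_def t1[symmetric] by (rule sum_mono2) (auto simp: t0)
  have "(\<Sum>j\<le>n. \<Sum>i | i \<le> m \<and> \<theta> i = j. t i) = (\<Sum>i\<in>{..m}. t i)"
    using sum.group[of "{..m}" "{..n}" \<theta> t] Delta_le[OF \<theta>] by (auto simp: Collect_conj_eq atMost_def)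
  moreover have "push_simplex m \<theta> t j = 0" if "j > n" for j
  proof -
    have e: "{i. i \<le> m \<and> \<theta> i = j} = {}" using Delta_le[OF \<theta>] that by fastforce
    show ?thesis unfolding push_simplex_def e by simp
  qed
  ultimately show ?thesis
    using le t1 by (auto simp: standard_simplex_def push_simplex_def t0 intro: sum_nonneg)
qed

lemma rel_refl: "p \<in> topspace (presum X) \<Longrightarrow> (p, p) \<in> realization_rel X"
  by (simp add: realization_rel_def)

lemma rel_step:
  assumes "simplicial_set X" "\<theta> \<in> Delta m n" "x \<in> simplices X n" "t \<in> standard_simplex m"
  shows "(((m, pull X m n \<theta> x), t), ((n, x), push_simplex m \<theta> t)) \<in> realization_rel X"
  using assms push_simplex_in simplicial_set.pull_in[OF assms(1,2,3)]
  unfolding realization_rel_def realization_step_def topspace_presum by blast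

text \<open>The way to define data on points of the realization: invariance under one generating
  step suffices.\<close>

lemma rel_invariant:
  assumes r: "(p, p') \<in> realization_rel X"
    and step: "\<And>m n \<theta> x t. \<theta> \<in> Delta m n \<Longrightarrow> x \<in> simplices X n \<Longrightarrow> t \<in> standard_simplex m \<Longrightarrow>
      f ((m, pull X m n \<theta> x), t) = f ((n, x), push_simplex m \<theta> t)"
  shows "f p = f p'"
proof -
  have "(p, p') \<in> (realization_step X \<union> (realization_step X)\<inverse>)\<^sup>*" using r by (simp add: realization_rel_def)
  then show ?thesis
  proof (induction rule: rtrancl_induct)
    case (step y z)
    then have "f y = f z" using assms(2) by (auto simp: realization_step_def)
    then show ?case using step by simp
  qed simp
qed

lemma rcls_eq_iff:
  assumes "p \<in> topspace (presum X)" "p' \<in> topspace (presum X)"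
  shows "rcls X p = rcls X p' \<longleftrightarrow> (p, p') \<in> realization_rel X"
  unfolding rcls_def using eq_equiv_class_iff[OF realization_rel_equiv assms] by blast

lemma rcls_self: "p \<in> topspace (presum X) \<Longrightarrow> p \<in> rcls X p"
  unfolding rcls_def using rel_refl by blast

lemma mem_rcls: "p' \<in> rcls X p \<longleftrightarrow> (p, p') \<in> realization_rel X"
  by (simp add: rcls_def)

lemma rcls_topspace: "p \<in> topspace (presum X) \<Longrightarrow> rcls X p \<in> topspace (realization X)"
  unfolding topspace_realization rcls_def by (rule quotientI)

lemma realization_cases:
  assumes "c \<in> topspace (realization X)"
  obtains n x t where "x \<in> simplices X n" "t \<in> standard_simplex n" "c = rcls X ((n, x), t)"
  using assms unfolding topspace_realization rcls_def quotient_def topspace_presum by auto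

lemma openin_realization:
  "openin (realization X) U \<longleftrightarrow> U \<subseteq> topspace (presum X) // realization_rel X \<and> openin (presum X) (\<Union>U)"
  unfolding realization_def using istopology_realization[of X] by (simp add: topology_inverse')

lemma openin_presum:
  "openin (presum X) U \<longleftrightarrow> U \<subseteq> topspace (presum X) \<and>
     (\<forall>n. \<forall>x\<in>simplices X n. openin (simplex_space n) {t. ((n, x), t) \<in> U})"
  unfolding presum_def openin_sum_topology by (auto simp: topspace_simplex_space)

lemma openin_realization_iff:
  assumes "U \<subseteq> topspace (realization X)"
  shows "openin (realization X) U \<longleftrightarrow> (\<forall>n. \<forall>x\<in>simplices X n.
    openin (simplex_space n) {t \<in> standard_simplex n. rcls X ((n, x), t) \<in> U})"
proof -
  have U: "U \<subseteq> topspace (presum X) // realization_rel X" using assms by (simp add: topspace_realization)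
  have eq: "((n, x), t) \<in> \<Union>U \<longleftrightarrow> t \<in> standard_simplex n \<and> rcls X ((n, x), t) \<in> U"
    if x: "x \<in> simplices X n" for n x t
  proof
    assume "((n, x), t) \<in> \<Union>U"
    then obtain c where c: "c \<in> U" "((n, x), t) \<in> c" by blast
    have top: "((n, x), t) \<in> topspace (presum X)"
      using c U Union_quotient[OF realization_rel_equiv[of X]] by blast
    have "c = rcls X ((n, x), t)"
      using c U quotient_eq_iff[OF realization_rel_equiv[of X], of c "rcls X ((n, x), t)" "((n, x), t)" "((n, x), t)"]
        rcls_topspace[OF top] rcls_self[OF top] rel_refl[OF top] unfolding topspace_realization by blast
    then show "t \<in> standard_simplex n \<and> rcls X ((n, x), t) \<in> U" using c top by (simp add: topspace_presum)
  next
    assume "t \<in> standard_simplex n \<and> rcls X ((n, x), t) \<in> U"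
    then show "((n, x), t) \<in> \<Union>U" using rcls_self[of "((n, x), t)" X] x by (auto simp: topspace_presum)
  qed
  have "\<Union>U \<subseteq> topspace (presum X)"
    using U Union_quotient[OF realization_rel_equiv[of X]] by blast
  then show ?thesis
    unfolding openin_realization openin_presum using U eq by (simp add: Collect_conj_eq)
qed

text \<open>The universal property of a quotient of a disjoint sum: continuity is tested on single
  simplices.\<close>

lemma continuous_map_realization:
  "continuous_map (realization X) Y h \<longleftrightarrow>
     (\<forall>n. \<forall>x\<in>simplices X n. continuous_map (simplex_space n) Y (\<lambda>t. h (rcls X ((n, x), t))))"
proof
  assume h: "continuous_map (realization X) Y h"
  have "continuous_map (simplex_space n) (realization X) (\<lambda>t. rcls X ((n, x), t))"
    if x: "x \<in> simplices X n" for n x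
    unfolding continuous_map_def
  proof (intro conjI allI impI)
    show "(\<lambda>t. rcls X ((n, x), t)) \<in> topspace (simplex_space n) \<rightarrow> topspace (realization X)"
      using rcls_topspace[of "((n, x), _)" X] x by (auto simp: topspace_simplex_space topspace_presum)
    fix U assume "openin (realization X) U"
    then show "openin (simplex_space n) {t \<in> topspace (simplex_space n). rcls X ((n, x), t) \<in> U}"
      using openin_realization_iff[OF openin_subset] x by (auto simp: topspace_simplex_space)
  qed
  from continuous_map_compose[OF this h]
  show "\<forall>n. \<forall>x\<in>simplices X n. continuous_map (simplex_space n) Y (\<lambda>t. h (rcls X ((n, x), t)))"
    by (simp add: o_def)
next
  assume h: "\<forall>n. \<forall>x\<in>simplices X n. continuous_map (simplex_space n) Y (\<lambda>t. h (rcls X ((n, x), t)))"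
  show "continuous_map (realization X) Y h"
    unfolding continuous_map_def
  proof (intro conjI allI impI)
    show "h \<in> topspace (realization X) \<rightarrow> topspace Y"
    proof
      fix c assume "c \<in> topspace (realization X)"
      then obtain n x t where "x \<in> simplices X n" "t \<in> standard_simplex n" "c = rcls X ((n, x), t)"
        by (rule realization_cases)
      then show "h c \<in> topspace Y" using h by (auto simp: continuous_map_def topspace_simplex_space)
    qed
    fix U assume U: "openin Y U"
    have "openin (simplex_space n) {t \<in> standard_simplex n. h (rcls X ((n, x), t)) \<in> U}"
      if "x \<in> simplices X n" for n x
      using h that U by (auto simp: continuous_map_def topspace_simplex_space)
    moreover have "{t \<in> standard_simplex n. h (rcls X ((n, x), t)) \<in> U} =
        {t \<in> standard_simplex n. rcls X ((n, x), t) \<in> {c \<in> topspace (realization X). h c \<in> U}}"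
      if "x \<in> simplices X n" for n x
    proof -
      have "rcls X ((n, x), t) \<in> topspace (realization X)" if "t \<in> standard_simplex n" for t
        using rcls_topspace[of "((n, x), t)" X] \<open>x \<in> simplices X n\<close> that by (simp add: topspace_presum)
      then show ?thesis by auto
    qed
    ultimately show "openin (realization X) {c \<in> topspace (realization X). h c \<in> U}"
      by (subst openin_realization_iff) auto
  qed
qed

lemma continuous_map_rcls:
  "x \<in> simplices X n \<Longrightarrow> continuous_map (simplex_space n) (realization X) (\<lambda>t. rcls X ((n, x), t))"
  using continuous_map_id[of "realization X"] unfolding continuous_map_realization id_def by blast

text \<open>\<open>realization_map\<close> saturates the image of a class. That image lies in one
  class because simplicial maps commute with the operators that generate the relation.\<close>

lemma realization_map_rcls:
  assumes Y: "simplicial_set Y" and f: "simplicial_fun X Y f"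
    and x: "x \<in> simplices X n" and t: "t \<in> standard_simplex n"
  shows "realization_map Y f (rcls X ((n, x), t)) = rcls Y ((n, f n x), t)"
proof -
  define F where "F = ((\<lambda>((n, x), t). ((n, f n x), t)) :: _ \<Rightarrow> _ rpoint)"
  have F: "F ((n, x), t) = ((n, f n x), t)" for n x t by (simp add: F_def)
  have top: "F p \<in> topspace (presum Y)" if "p \<in> topspace (presum X)" for p
    using that f by (auto simp: topspace_presum F simplicial_fun_def)
  have pX: "((n, x), t) \<in> topspace (presum X)" using x t by (simp add: topspace_presum)
  have rel: "(F ((n, x), t), F p') \<in> realization_rel Y" if "(((n, x), t), p') \<in> realization_rel X" for p'
  proof -
    have "rcls Y (F ((n, x), t)) = rcls Y (F p')"
      using that
    proof (rule rel_invariant)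
      fix m n \<theta> x t assume a: "\<theta> \<in> Delta m n" "x \<in> simplices X n" "t \<in> standard_simplex m"
      have fx: "f n x \<in> simplices Y n" "f m (pull X m n \<theta> x) = pull Y m n \<theta> (f n x)"
        using f a by (auto simp: simplicial_fun_def)
      have "(((m, pull Y m n \<theta> (f n x)), t), ((n, f n x), push_simplex m \<theta> t)) \<in> realization_rel Y"
        using rel_step[OF Y a(1) fx(1) a(3)] .
      then show "rcls Y (F ((m, pull X m n \<theta> x), t)) = rcls Y (F ((n, x), push_simplex m \<theta> t))"
        unfolding F fx(2) by (subst rcls_eq_iff) (auto simp: realization_rel_def)
    qed
    moreover have "p' \<in> topspace (presum X)" using that by (auto simp: realization_rel_def)
    ultimately show ?thesis using rcls_eq_iff top[OF pX] top by blast
  qed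
  have "realization_map Y f (rcls X ((n, x), t)) = realization_rel Y `` (F ` rcls X ((n, x), t))"
    unfolding realization_map_def F_def ..
  also have "\<dots> = rcls Y (F ((n, x), t))"
  proof
    show "realization_rel Y `` (F ` rcls X ((n, x), t)) \<subseteq> rcls Y (F ((n, x), t))"
      using rel realization_rel_equiv[of Y] unfolding mem_rcls rcls_def equiv_def by (blast dest: transD)
    show "rcls Y (F ((n, x), t)) \<subseteq> realization_rel Y `` (F ` rcls X ((n, x), t))"
      unfolding rcls_def[of Y] using rcls_self[OF pX] by blast
  qed
  finally show ?thesis by (simp add: F)
qed

lemma continuous_realization_map:
  assumes Y: "simplicial_set Y" and f: "simplicial_fun X Y f"
  shows "continuous_map (realization X) (realization Y) (realization_map Y f)"
  unfolding continuous_map_realization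
proof (intro allI ballI)
  fix n x assume x: "x \<in> simplices X n"
  have "f n x \<in> simplices Y n" using f x by (auto simp: simplicial_fun_def)
  from continuous_map_rcls[OF this]
  show "continuous_map (simplex_space n) (realization Y) (\<lambda>t. realization_map Y f (rcls X ((n, x), t)))"
    by (rule continuous_map_eq) (simp add: topspace_simplex_space realization_map_rcls[OF Y f x])
qed

lemma simplicial_fun_comp:
  "simplicial_fun X Y f \<Longrightarrow> simplicial_fun Y Z g \<Longrightarrow> simplicial_fun X Z (\<lambda>n x. g n (f n x))"
  unfolding simplicial_fun_def by simp

lemma realization_map_comp:
  assumes "simplicial_set Y" "simplicial_set Z" "simplicial_fun X Y f" "simplicial_fun Y Z g"
    and c: "c \<in> topspace (realization X)"
  shows "realization_map Z (\<lambda>n x. g n (f n x)) c = realization_map Z g (realization_map Y f c)"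
proof -
  obtain n x t where x: "x \<in> simplices X n" "t \<in> standard_simplex n" "c = rcls X ((n, x), t)"
    using c by (rule realization_cases)
  have fx: "f n x \<in> simplices Y n" using assms(3) x by (auto simp: simplicial_fun_def)
  show ?thesis
    unfolding x(3) using realization_map_rcls[OF assms(2) simplicial_fun_comp[OF assms(3,4)] x(1,2)]
      realization_map_rcls[OF assms(1,3) x(1,2)] realization_map_rcls[OF assms(2,4) fx x(2)] by simp
qed

lemma realization_map_cong:
  assumes "simplicial_set Y" "simplicial_fun X Y f" "\<And>n x. x \<in> simplices X n \<Longrightarrow> f n x = g n x"
    and c: "c \<in> topspace (realization X)"
  shows "realization_map Y f c = realization_map Y g c"
proof -
  obtain n x t where x: "x \<in> simplices X n" "t \<in> standard_simplex n" "c = rcls X ((n, x), t)"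
    using c by (rule realization_cases)
  have "simplicial_set X \<Longrightarrow> simplicial_fun X Y g" for X' :: "'a sset"
    using assms(2,3) simplicial_set.pull_in unfolding simplicial_fun_def by metis
  have "(\<lambda>((n, x), t). ((n, f n x), t)) ` c = (\<lambda>((n, x), t). ((n, g n x), t)) ` c"
  proof (rule image_cong)
    fix p assume "p \<in> c"
    then have "p \<in> topspace (presum X)" unfolding x(3) mem_rcls by (auto simp: realization_rel_def)
    then show "(\<lambda>((n, x), t). ((n, f n x), t)) p = (\<lambda>((n, x), t). ((n, g n x), t)) p"
      using assms(3) by (auto simp: topspace_presum)
  qed simp
  then show ?thesis by (simp add: realization_map_def)
qed

section \<open>Weak homotopy equivalences\<close>

lemma cm_in: "continuous_map X Y f \<Longrightarrow> x \<in> topspace X \<Longrightarrow> f x \<in> topspace Y"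
  by (auto simp: continuous_map_def)

lemma cm_empty: "continuous_map X Y f \<Longrightarrow> topspace Y = {} \<Longrightarrow> topspace X = {}"
  using cm_in by (metis ex_in_conv)

lemma sphere_in: "pointed_sphere n X x a \<Longrightarrow> y \<in> topspace (nsphere n) \<Longrightarrow> a y \<in> topspace X"
  by (auto simp: pointed_sphere_def dest: cm_in)

lemma pointed_sphere_comp:
  "pointed_sphere n X x a \<Longrightarrow> continuous_map X Y f \<Longrightarrow> pointed_sphere n Y (f x) (f \<circ> a)"
  unfolding pointed_sphere_def using continuous_map_compose by auto

lemma pointed_homotopic_comp:
  "pointed_homotopic n X x a b \<Longrightarrow> continuous_map X Y f \<Longrightarrow> pointed_homotopic n Y (f x) (f \<circ> a) (f \<circ> b)"
  unfolding pointed_homotopic_def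
  by (erule homotopic_with_compose_continuous_map_left) auto

lemma pointed_homotopic_trans:
  "pointed_homotopic n X x a b \<Longrightarrow> pointed_homotopic n X x b c \<Longrightarrow> pointed_homotopic n X x a c"
  unfolding pointed_homotopic_def by (rule homotopic_with_trans)

lemma pointed_homotopic_refl: "pointed_sphere n X x a \<Longrightarrow> pointed_homotopic n X x a a"
  unfolding pointed_homotopic_def pointed_sphere_def by (simp add: homotopic_with_refl)

lemma pointed_homotopic_cong:
  assumes "pointed_homotopic n X x a b" "\<And>y. y \<in> topspace (nsphere n) \<Longrightarrow> a y = a' y"
    "\<And>y. y \<in> topspace (nsphere n) \<Longrightarrow> b y = b' y"
  shows "pointed_homotopic n X x a' b'"
proof -
  have "sphere_base \<in> topspace (nsphere n)"
    by (simp add: nsphere sphere_base_def topspace_Euclidean_space power2_eq_square if_distrib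
        if_distribR sum.delta cong: if_cong)
  then show ?thesis
    using assms unfolding pointed_homotopic_def
    by (elim homotopic_with_eq) auto
qed

text \<open>The two halves of being bijective on \<open>\<pi>\<^sub>n\<close> at one base point are
  kept apart because the cancellation laws below use injectivity of one factor to obtain
  surjectivity of another.\<close>

definition pi_inj :: "'a topology \<Rightarrow> 'b topology \<Rightarrow> ('a \<Rightarrow> 'b) \<Rightarrow> 'a \<Rightarrow> nat \<Rightarrow> bool" where
  "pi_inj X Y f x n \<longleftrightarrow> (\<forall>a a'. pointed_sphere n X x a \<and> pointed_sphere n X x a' \<and>
           pointed_homotopic n Y (f x) (f \<circ> a) (f \<circ> a') \<longrightarrow> pointed_homotopic n X x a a')"

definition pi_surj :: "'a topology \<Rightarrow> 'b topology \<Rightarrow> ('a \<Rightarrow> 'b) \<Rightarrow> 'a \<Rightarrow> nat \<Rightarrow> bool" where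
  "pi_surj X Y f x n \<longleftrightarrow> (\<forall>b. pointed_sphere n Y (f x) b \<longrightarrow>
           (\<exists>a. pointed_sphere n X x a \<and> pointed_homotopic n Y (f x) (f \<circ> a) b))"

lemma whe_iff: "weak_homotopy_equivalence X Y f \<longleftrightarrow> continuous_map X Y f \<and>
     (topspace X = {} \<longrightarrow> topspace Y = {}) \<and> (\<forall>x\<in>topspace X. \<forall>n. pi_surj X Y f x n \<and> pi_inj X Y f x n)"
  unfolding weak_homotopy_equivalence_def pi_inj_def pi_surj_def ..

lemma pi_inj_comp:
  assumes "continuous_map X Y f" "pi_inj X Y f x n" "pi_inj Y Z g (f x) n"
  shows "pi_inj X Z (g \<circ> f) x n"
  using assms pointed_sphere_comp[OF _ assms(1)] unfolding pi_inj_def by (simp add: comp_assoc)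

lemma pi_inj_first:
  assumes "continuous_map X Y f" "continuous_map Y Z g" "pi_inj X Z (g \<circ> f) x n"
  shows "pi_inj X Y f x n"
  using assms pointed_homotopic_comp[OF _ assms(2), of n "f x"] unfolding pi_inj_def
  by (simp add: comp_assoc)

lemma pi_surj_comp:
  assumes "continuous_map X Y f" "continuous_map Y Z g" "pi_surj X Y f x n" "pi_surj Y Z g (f x) n"
  shows "pi_surj X Z (g \<circ> f) x n"
  unfolding pi_surj_def
proof (intro allI impI)
  fix b assume "pointed_sphere n Z ((g \<circ> f) x) b"
  then obtain c where c: "pointed_sphere n Y (f x) c" "pointed_homotopic n Z (g (f x)) (g \<circ> c) b"
    using assms(4) unfolding pi_surj_def by auto
  then obtain a where a: "pointed_sphere n X x a" "pointed_homotopic n Y (f x) (f \<circ> a) c"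
    using assms(3) unfolding pi_surj_def by auto
  then have "pointed_homotopic n Z (g (f x)) (g \<circ> (f \<circ> a)) (g \<circ> c)"
    using pointed_homotopic_comp[OF a(2) assms(2)] by simp
  then show "\<exists>a. pointed_sphere n X x a \<and> pointed_homotopic n Z ((g \<circ> f) x) (g \<circ> f \<circ> a) b"
    using a(1) c(2) pointed_homotopic_trans by (fastforce simp: comp_assoc)
qed

lemma pi_surj_first:
  assumes "continuous_map X Y f" "continuous_map Y Z g" "pi_surj X Z (g \<circ> f) x n" "pi_inj Y Z g (f x) n"
  shows "pi_surj X Y f x n"
  unfolding pi_surj_def
proof (intro allI impI)
  fix b assume b: "pointed_sphere n Y (f x) b"
  then have "pointed_sphere n Z ((g \<circ> f) x) (g \<circ> b)" using pointed_sphere_comp[OF b assms(2)] by simp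
  then obtain a where a: "pointed_sphere n X x a" "pointed_homotopic n Z (g (f x)) (g \<circ> (f \<circ> a)) (g \<circ> b)"
    using assms(3) unfolding pi_surj_def by (auto simp: comp_assoc)
  then have "pointed_homotopic n Y (f x) (f \<circ> a) b"
    using assms(4) b pointed_sphere_comp[OF a(1) assms(1)] unfolding pi_inj_def by blast
  then show "\<exists>a. pointed_sphere n X x a \<and> pointed_homotopic n Y (f x) (f \<circ> a) b" using a(1) by blast
qed

lemma whe_comp:
  assumes "weak_homotopy_equivalence X Y f" "weak_homotopy_equivalence Y Z g"
  shows "weak_homotopy_equivalence X Z (g \<circ> f)"
proof -
  have c: "continuous_map X Y f" "continuous_map Y Z g" using assms by (auto simp: whe_iff)
  have "f x \<in> topspace Y" if "x \<in> topspace X" for x using c(1) that by (auto simp: continuous_map_def)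
  then show ?thesis
    using assms pi_inj_comp[OF c(1)] pi_surj_comp[OF c] continuous_map_compose[OF c]
    unfolding whe_iff by blast
qed

text \<open>Every base point of \<open>Y\<close> that occurs is the image of a point of
  \<open>X\<close>, so no change of base point is involved.\<close>

lemma whe_first:
  assumes "continuous_map X Y f" "weak_homotopy_equivalence Y Z g" "weak_homotopy_equivalence X Z (g \<circ> f)"
  shows "weak_homotopy_equivalence X Y f"
proof -
  have c: "continuous_map Y Z g" using assms by (auto simp: whe_iff)
  have f: "f x \<in> topspace Y" if "x \<in> topspace X" for x using assms(1) that by (auto simp: continuous_map_def)
  have "topspace Y = {}" if "topspace X = {}"
    using assms(3) that cm_empty[OF c] unfolding whe_iff by blast
  then show ?thesis
    using assms pi_inj_first[OF assms(1) c] pi_surj_first[OF assms(1) c] f unfolding whe_iff by blast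
qed

text \<open>\<open>g\<close> is injective on homotopy groups because \<open>h \<circ> g\<close> is,
  and this is all that cancelling \<open>g\<close> from \<open>g \<circ> f\<close> requires.\<close>

lemma whe_2of6_first:
  assumes "continuous_map X Y f" "continuous_map Y Z g" "continuous_map Z V h"
    "weak_homotopy_equivalence X Z (g \<circ> f)" "weak_homotopy_equivalence Y V (h \<circ> g)"
  shows "weak_homotopy_equivalence X Y f"
proof -
  have f: "f x \<in> topspace Y" if "x \<in> topspace X" for x using assms(1) that by (auto simp: continuous_map_def)
  have e: "topspace Y = {}" if "topspace X = {}"
    using assms(4) that cm_empty[OF assms(2)] unfolding whe_iff by blast
  have "pi_inj Y Z g (f x) n" if "x \<in> topspace X" for x n
    using assms(5) f[OF that] pi_inj_first[OF assms(2,3)] unfolding whe_iff by blast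
  then have "pi_surj X Y f x n \<and> pi_inj X Y f x n" if "x \<in> topspace X" for x n
    using assms(4) that pi_inj_first[OF assms(1,2)] pi_surj_first[OF assms(1,2)] unfolding whe_iff by blast
  then show ?thesis using assms(1) e unfolding whe_iff by blast
qed

lemma whe_cong:
  assumes w: "weak_homotopy_equivalence X Y f" and e: "\<And>x. x \<in> topspace X \<Longrightarrow> f x = g x"
  shows "weak_homotopy_equivalence X Y g"
proof -
  have c: "continuous_map X Y g"
    using w continuous_map_eq[of X Y f g] e by (auto simp: whe_iff)
  have g: "\<And>y. y \<in> topspace (nsphere n) \<Longrightarrow> (f \<circ> a) y = (g \<circ> a) y" if "pointed_sphere n X x a" for n x a
    using sphere_in[OF that] e by simp
  have "pi_surj X Y g x n \<and> pi_inj X Y g x n" if x: "x \<in> topspace X" for x n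
  proof
    show "pi_surj X Y g x n"
      unfolding pi_surj_def
    proof (intro allI impI)
      fix b assume "pointed_sphere n Y (g x) b"
      then obtain a where a: "pointed_sphere n X x a" "pointed_homotopic n Y (f x) (f \<circ> a) b"
        using w x e[OF x] unfolding whe_iff pi_surj_def by metis
      have "pointed_homotopic n Y (g x) (g \<circ> a) b"
        by (rule pointed_homotopic_cong[OF a(2)[unfolded e[OF x]]]) (use g[OF a(1)] in auto)
      then show "\<exists>a. pointed_sphere n X x a \<and> pointed_homotopic n Y (g x) (g \<circ> a) b" using a(1) by blast
    qed
    show "pi_inj X Y g x n"
      unfolding pi_inj_def
    proof (intro allI impI, elim conjE)
      fix a a' assume a: "pointed_sphere n X x a" "pointed_sphere n X x a'"
        "pointed_homotopic n Y (g x) (g \<circ> a) (g \<circ> a')"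
      have "pointed_homotopic n Y (f x) (f \<circ> a) (f \<circ> a')"
        by (rule pointed_homotopic_cong[OF a(3)[folded e[OF x]]]) (use g[OF a(1)] g[OF a(2)] in auto)
      then show "pointed_homotopic n X x a a'" using w x a unfolding whe_iff pi_inj_def by blast
    qed
  qed
  then show ?thesis using c w unfolding whe_iff by blast
qed

lemma whe_homeo:
  assumes f: "continuous_map X Y f" and g: "continuous_map Y X g"
    and fg: "\<And>y. y \<in> topspace Y \<Longrightarrow> f (g y) = y" and gf: "\<And>x. x \<in> topspace X \<Longrightarrow> g (f x) = x"
  shows "weak_homotopy_equivalence X Y f"
proof -
  have "pi_surj X Y f x n \<and> pi_inj X Y f x n" if x: "x \<in> topspace X" for x n
  proof
    show "pi_surj X Y f x n"
      unfolding pi_surj_def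
    proof (intro allI impI)
      fix b assume b: "pointed_sphere n Y (f x) b"
      have "pointed_sphere n X x (g \<circ> b)" using pointed_sphere_comp[OF b g] gf[OF x] by simp
      moreover have "\<And>y. y \<in> topspace (nsphere n) \<Longrightarrow> b y = (f \<circ> (g \<circ> b)) y"
        using sphere_in[OF b] fg by simp
      then have "pointed_homotopic n Y (f x) (f \<circ> (g \<circ> b)) b"
        using pointed_homotopic_cong[OF pointed_homotopic_refl[OF b]] by blast
      ultimately show "\<exists>a. pointed_sphere n X x a \<and> pointed_homotopic n Y (f x) (f \<circ> a) b" by blast
    qed
    show "pi_inj X Y f x n"
      unfolding pi_inj_def
    proof (intro allI impI, elim conjE)
      fix a a' assume a: "pointed_sphere n X x a" "pointed_sphere n X x a'"
        "pointed_homotopic n Y (f x) (f \<circ> a) (f \<circ> a')"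
      have "pointed_homotopic n X x (g \<circ> (f \<circ> a)) (g \<circ> (f \<circ> a'))"
        using pointed_homotopic_comp[OF a(3) g] gf[OF x] by simp
      then show "pointed_homotopic n X x a a'"
        by (rule pointed_homotopic_cong) (use sphere_in[OF a(1)] sphere_in[OF a(2)] gf in auto)
    qed
  qed
  moreover have "topspace X = {} \<Longrightarrow> topspace Y = {}" using cm_empty[OF g] .
  ultimately show ?thesis using f unfolding whe_iff by blast
qed

text \<open>
  The situation of an augmentation \<open>\<phi>\<close> with a construction \<open>c\<close> that is inverse to it up to the
  equivalences \<open>\<phi>' c\<close>, \<open>\<kappa> c'\<close> and \<open>k\<close>.
\<close>

lemma whe_augmentation:
  assumes cont: "continuous_map X0 X1 \<phi>" "continuous_map X1 X2 c" "continuous_map X2 X3 \<phi>'"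
      "continuous_map X0 X0' c'" "continuous_map X0' X2 k" "continuous_map X0' X3' \<kappa>" "continuous_map X3' X3 \<rho>"
    and comm: "\<And>x. x \<in> topspace X0 \<Longrightarrow> c (\<phi> x) = k (c' x)" "\<And>x. x \<in> topspace X0' \<Longrightarrow> \<phi>' (k x) = \<rho> (\<kappa> x)"
    and w: "weak_homotopy_equivalence X1 X3 (\<phi>' \<circ> c)" "weak_homotopy_equivalence X0 X3' (\<kappa> \<circ> c')"
      "weak_homotopy_equivalence X0' X2 k"
    and ne: "topspace X0 = {} \<longrightarrow> topspace X1 = {}"
  shows "weak_homotopy_equivalence X0 X1 \<phi>"
proof -
  have "pi_surj X0 X1 \<phi> x n \<and> pi_inj X0 X1 \<phi> x n" if x: "x \<in> topspace X0" for x n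
  proof
    have tx: "\<phi> x \<in> topspace X1" "c' x \<in> topspace X0'" using cont x by (auto simp: continuous_map_def)
    have kc: "weak_homotopy_equivalence X0 X3' (\<kappa> \<circ> c')" by (rule w)
    \<comment> \<open>Injectivity of \<phi> follows from that of \<open>k \<circ> c'\<close>, which
      coincides with \<open>c \<circ> \<phi>\<close>.\<close>
    have "pi_inj X0 X0' c' x n" using pi_inj_first[OF cont(4,6)] w(2) x unfolding whe_iff by blast
    then have "pi_inj X0 X2 (k \<circ> c') x n" using pi_inj_comp[OF cont(4)] w(3) tx unfolding whe_iff by blast
    have sph: "\<And>y. y \<in> topspace (nsphere n) \<Longrightarrow> (k \<circ> c' \<circ> a) y = (c \<circ> \<phi> \<circ> a) y" if "pointed_sphere n X0 x a" for a
      using sphere_in[OF that] comm(1) by simp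
    show "pi_inj X0 X1 \<phi> x n"
      unfolding pi_inj_def
    proof (intro allI impI, elim conjE)
      fix a a' assume a: "pointed_sphere n X0 x a" "pointed_sphere n X0 x a'"
        "pointed_homotopic n X1 (\<phi> x) (\<phi> \<circ> a) (\<phi> \<circ> a')"
      have "pointed_homotopic n X2 (c (\<phi> x)) (c \<circ> (\<phi> \<circ> a)) (c \<circ> (\<phi> \<circ> a'))"
        by (rule pointed_homotopic_comp[OF a(3) cont(2)])
      then have "pointed_homotopic n X2 ((k \<circ> c') x) (k \<circ> c' \<circ> a) (k \<circ> c' \<circ> a')"
        using pointed_homotopic_cong[of n X2 _ "c \<circ> \<phi> \<circ> a" "c \<circ> \<phi> \<circ> a'" "k \<circ> c' \<circ> a" "k \<circ> c' \<circ> a'"]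
          sph[OF a(1)] sph[OF a(2)] comm(1)[OF x] by (simp add: comp_assoc)
      then show "pointed_homotopic n X0 x a a'"
        using \<open>pi_inj X0 X2 (k \<circ> c') x n\<close> a unfolding pi_inj_def by blast
    qed
    show "pi_surj X0 X1 \<phi> x n"
      unfolding pi_surj_def
    proof (intro allI impI)
      fix b assume b: "pointed_sphere n X1 (\<phi> x) b"
      have cb: "pointed_sphere n X2 (k (c' x)) (c \<circ> b)"
        using pointed_sphere_comp[OF b cont(2)] comm(1)[OF x] by simp
      \<comment> \<open>Surjectivity is a chase: push \<open>b\<close> to \<open>X2\<close>, lift it
        along \<open>k\<close>, map it to \<open>X3'\<close> and lift it along
        \<open>\<kappa> \<circ> c'\<close>. The resulting \<open>a\<close> has the right image
        because \<open>\<phi>' \<circ> c\<close> is injective on homotopy groups.\<close>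
      obtain b' where b': "pointed_sphere n X0' (c' x) b'" "pointed_homotopic n X2 (k (c' x)) (k \<circ> b') (c \<circ> b)"
        using w(3) tx cb unfolding whe_iff pi_surj_def by blast
      have "pointed_sphere n X3' ((\<kappa> \<circ> c') x) (\<kappa> \<circ> b')" using pointed_sphere_comp[OF b'(1) cont(6)] by simp
      then obtain a where a: "pointed_sphere n X0 x a" "pointed_homotopic n X3' ((\<kappa> \<circ> c') x) (\<kappa> \<circ> c' \<circ> a) (\<kappa> \<circ> b')"
        using w(2) x unfolding whe_iff pi_surj_def by blast
      have bp: "\<rho> ((\<kappa> \<circ> c') x) = (\<phi>' \<circ> c) (\<phi> x)" using comm(1)[OF x] comm(2)[OF tx(2)] by simp
      have "pointed_homotopic n X3 (\<rho> ((\<kappa> \<circ> c') x)) (\<rho> \<circ> (\<kappa> \<circ> c' \<circ> a)) (\<rho> \<circ> (\<kappa> \<circ> b'))"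
        by (rule pointed_homotopic_comp[OF a(2) cont(7)])
      then have 1: "pointed_homotopic n X3 ((\<phi>' \<circ> c) (\<phi> x)) (\<phi>' \<circ> c \<circ> (\<phi> \<circ> a)) (\<phi>' \<circ> k \<circ> b')"
        unfolding bp
      proof (rule pointed_homotopic_cong)
        fix y assume y: "y \<in> topspace (nsphere n)"
        have ay: "a y \<in> topspace X0" using a(1) y by (auto simp: pointed_sphere_def continuous_map_def)
        then have "c' (a y) \<in> topspace X0'" using cont(4) by (auto simp: continuous_map_def)
        then show "(\<rho> \<circ> (\<kappa> \<circ> c' \<circ> a)) y = (\<phi>' \<circ> c \<circ> (\<phi> \<circ> a)) y" using comm ay by simp
        have "b' y \<in> topspace X0'" using b'(1) y by (auto simp: pointed_sphere_def continuous_map_def)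
        then show "(\<rho> \<circ> (\<kappa> \<circ> b')) y = (\<phi>' \<circ> k \<circ> b') y" using comm by simp
      qed
      have "pointed_homotopic n X3 ((\<phi>' \<circ> c) (\<phi> x)) (\<phi>' \<circ> k \<circ> b') (\<phi>' \<circ> c \<circ> b)"
        using pointed_homotopic_comp[OF b'(2) cont(3)] comm(1)[OF x] by (simp add: comp_assoc)
      from pointed_homotopic_trans[OF 1 this]
      have "pointed_homotopic n X1 (\<phi> x) (\<phi> \<circ> a) b"
        using w(1) tx(1) b pointed_sphere_comp[OF a(1) cont(1)] unfolding whe_iff pi_inj_def by blast
      then show "\<exists>a. pointed_sphere n X0 x a \<and> pointed_homotopic n X1 (\<phi> x) (\<phi> \<circ> a) b" using a(1) by blast
    qed
  qed
  then show ?thesis using cont(1) ne unfolding whe_iff by blast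
qed

section \<open>Local systems and step functions\<close>

text \<open>
  A point \<open>t\<close> of the \<open>n\<close>-simplex is read as a partition of \<open>[0, 1)\<close> into intervals of lengths
  \<open>t 0, \<dots>, t n\<close>; \<open>idx t u\<close> is the number of the interval containing \<open>u\<close>. This description of the
  points is compatible with faces and degeneracies, so that a section of a local system over a
  point of the realization is a step function on \<open>[0, 1)\<close>. Two different sections over the same
  point differ everywhere, which makes the measure of the set where two sections differ a
  substitute for a covering space.
\<close>

definition psum :: "(nat \<Rightarrow> real) \<Rightarrow> nat \<Rightarrow> real" where "psum t i = (\<Sum>j\<le>i. t j)"

definition idx :: "(nat \<Rightarrow> real) \<Rightarrow> real \<Rightarrow> nat" where "idx t u = (LEAST i. u < psum t i)"

lemma psum_mono: "t \<in> standard_simplex n \<Longrightarrow> i \<le> j \<Longrightarrow> psum t i \<le> psum t j"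
  unfolding psum_def by (rule sum_mono2) (auto simp: standard_simplex_def)

lemma psum_top: "t \<in> standard_simplex n \<Longrightarrow> psum t n = 1"
  by (simp add: psum_def standard_simplex_def)

lemma idx_le: "t \<in> standard_simplex n \<Longrightarrow> u < 1 \<Longrightarrow> idx t u \<le> n"
  unfolding idx_def by (rule Least_le) (simp add: psum_top)

lemma idx_less: "t \<in> standard_simplex n \<Longrightarrow> u < 1 \<Longrightarrow> u < psum t (idx t u)"
  unfolding idx_def by (rule LeastI[of _ n]) (simp add: psum_top)

lemma idx_below: "i < idx t u \<Longrightarrow> psum t i \<le> u"
  unfolding idx_def using not_less_Least by fastforce

lemma idx_eq_iff:
  assumes "t \<in> standard_simplex n" "u < 1"
  shows "idx t u = i \<longleftrightarrow> (i = 0 \<or> psum t (i - 1) \<le> u) \<and> u < psum t i"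
proof
  assume i: "idx t u = i"
  then show "(i = 0 \<or> psum t (i - 1) \<le> u) \<and> u < psum t i"
    using idx_less[OF assms] idx_below[of "i - 1" t u] by (cases i) auto
next
  assume i: "(i = 0 \<or> psum t (i - 1) \<le> u) \<and> u < psum t i"
  have "u < psum t i" using i by simp
  then have "idx t u \<le> i" unfolding idx_def by (rule Least_le)
  moreover have "\<not> idx t u < i"
  proof
    assume l: "idx t u < i"
    then have "psum t (idx t u) \<le> psum t (i - 1)" by (intro psum_mono[OF assms(1)]) auto
    then show False using idx_less[OF assms] i l by auto
  qed
  ultimately show "idx t u = i" by simp
qed

text \<open>A monotone \<theta> keeps the order of the intervals: those with equal value are
  adjacent and merge, and values that are missed receive empty intervals. Hence the partial sums of
  the new point are sums over initial pieces of the old one.\<close>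

lemma idx_push:
  assumes \<theta>: "\<theta> \<in> Delta m n" and t: "t \<in> standard_simplex m" and u: "0 \<le> u" "u < 1"
  shows "idx (push_simplex m \<theta> t) u = \<theta> (idx t u)"
proof -
  have mono: "\<And>i j. i \<le> j \<Longrightarrow> j \<le> m \<Longrightarrow> \<theta> i \<le> \<theta> j"
    using \<theta> by (auto simp: Delta_def mono_on_def)
  have t0: "\<And>i. 0 \<le> t i" using t by (auto simp: standard_simplex_def)
  have ps: "psum (push_simplex m \<theta> t) j = (\<Sum>i | i \<le> m \<and> \<theta> i \<le> j. t i)" for j
  proof -
    have "(\<Sum>k\<in>{..j}. \<Sum>i | i \<in> {i. i \<le> m \<and> \<theta> i \<le> j} \<and> \<theta> i = k. t i) = (\<Sum>i | i \<le> m \<and> \<theta> i \<le> j. t i)"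
      by (rule sum.group) auto
    moreover have "{i. i \<in> {i. i \<le> m \<and> \<theta> i \<le> j} \<and> \<theta> i = k} = {i. i \<le> m \<and> \<theta> i = k}" if "k \<le> j" for k
      using that by auto
    ultimately show ?thesis unfolding psum_def push_simplex_def by simp
  qed
  let ?i = "idx t u"
  have im: "?i \<le> m" using idx_le[OF t u(2)] .
  have "(LEAST j. u < psum (push_simplex m \<theta> t) j) = \<theta> ?i"
  proof (rule Least_equality)
    have "u < psum t ?i" by (rule idx_less[OF t u(2)])
    also have "\<dots> \<le> psum (push_simplex m \<theta> t) (\<theta> ?i)"
      unfolding ps unfolding psum_def using mono im by (intro sum_mono2) (auto simp: t0)
    finally show "u < psum (push_simplex m \<theta> t) (\<theta> ?i)" .
    fix j assume j: "u < psum (push_simplex m \<theta> t) j"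
    show "\<theta> ?i \<le> j"
    proof (rule ccontr)
      assume nle: "\<not> \<theta> ?i \<le> j"
      have sub: "{i. i \<le> m \<and> \<theta> i \<le> j} \<subseteq> {..<?i}"
      proof
        fix i assume i: "i \<in> {i. i \<le> m \<and> \<theta> i \<le> j}"
        show "i \<in> {..<?i}"
        proof (rule ccontr)
          assume "i \<notin> {..<?i}"
          then have "\<theta> ?i \<le> \<theta> i" using i by (intro mono) auto
          then show False using i nle by auto
        qed
      qed
      have "psum (push_simplex m \<theta> t) j \<le> (\<Sum>i<?i. t i)"
        unfolding ps by (rule sum_mono2[OF _ sub]) (auto simp: t0)
      also have "\<dots> \<le> u"
      proof (cases "?i")
        case 0 then show ?thesis using u by simp
      next
        case (Suc k)
        then show ?thesis using idx_below[of k t u] by (simp add: psum_def lessThan_Suc_atMost)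
      qed
      finally show False using j by simp
    qed
  qed
  then show ?thesis by (simp add: idx_def)
qed

section \<open>The distance between step functions\<close>

definition dst :: "(real \<Rightarrow> 'l) \<Rightarrow> (real \<Rightarrow> 'l) \<Rightarrow> real" where
  "dst \<sigma> \<tau> = measure lborel {u \<in> {0..<1}. \<sigma> u \<noteq> \<tau> u}"

definition step_fun :: "(real \<Rightarrow> 'l) \<Rightarrow> bool" where
  "step_fun \<sigma> \<longleftrightarrow> finite (\<sigma> ` {0..<1}) \<and> (\<forall>l. {u \<in> {0..<1}. \<sigma> u = l} \<in> sets lborel)"

lemma dst_meas:
  assumes "step_fun \<sigma>" "step_fun \<tau>"
  shows "{u \<in> {0..<1}. \<sigma> u \<noteq> \<tau> u} \<in> fmeasurable lborel"
proof -
  have "{u \<in> {0..<1}. \<sigma> u \<noteq> \<tau> u} =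
      {0..<1} - (\<Union>l\<in>\<sigma> ` {0..<1}. {u \<in> {0..<1}. \<sigma> u = l} \<inter> {u \<in> {0..<1}. \<tau> u = l})" by auto
  moreover have "\<dots> \<in> sets lborel"
    using assms by (intro sets.Diff sets.finite_UN sets.Int) (auto simp: step_fun_def)
  ultimately have "{u \<in> {0..<1}. \<sigma> u \<noteq> \<tau> u} \<in> sets lborel" by simp
  moreover have "{0..<1 :: real} \<in> fmeasurable lborel" by (rule fmeasurableI) auto
  ultimately show ?thesis by (elim fmeasurableI2[rotated 2]) auto
qed

lemma dst_same: "dst \<sigma> \<sigma> = 0" by (simp add: dst_def)
lemma dst_sym: "dst \<sigma> \<tau> = dst \<tau> \<sigma>" unfolding dst_def by (metis (no_types, lifting))

lemma dst_triangle:
  assumes "step_fun \<sigma>" "step_fun \<tau>" "step_fun \<upsilon>"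
  shows "dst \<sigma> \<upsilon> \<le> dst \<sigma> \<tau> + dst \<tau> \<upsilon>"
proof -
  have "dst \<sigma> \<upsilon> \<le> measure lborel ({u \<in> {0..<1}. \<sigma> u \<noteq> \<tau> u} \<union> {u \<in> {0..<1}. \<tau> u \<noteq> \<upsilon> u})"
    unfolding dst_def
    by (rule measure_mono_fmeasurable[OF _ fmeasurableD[OF dst_meas[OF assms(1,3)]]
          fmeasurable.Un[OF dst_meas[OF assms(1,2)] dst_meas[OF assms(2,3)]]]) auto
  also have "\<dots> \<le> dst \<sigma> \<tau> + dst \<tau> \<upsilon>"
    unfolding dst_def
    by (rule measure_Un_le[OF fmeasurableD[OF dst_meas[OF assms(1,2)]] fmeasurableD[OF dst_meas[OF assms(2,3)]]])
  finally show ?thesis .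
qed

lemma dst_agree:
  assumes "dst \<sigma> \<tau> < 1" obtains u where "0 \<le> u" "u < 1" "\<sigma> u = \<tau> u"
proof (rule ccontr)
  assume "\<not> thesis"
  then have "{u \<in> {0..<1}. \<sigma> u \<noteq> \<tau> u} = {0..<1 :: real}" using that by auto
  then have "dst \<sigma> \<tau> = measure lborel {0..<1 :: real}" by (simp add: dst_def)
  then show False using assms by simp
qed

text \<open>Outside the unit interval the value is \<open>undefined\<close>, so that agreement on
  the interval is equality of functions.\<close>

definition sfun :: "(nat \<Rightarrow> 'l) \<Rightarrow> (nat \<Rightarrow> real) \<Rightarrow> real \<Rightarrow> 'l" where
  "sfun s t u = (if 0 \<le> u \<and> u < 1 then s (idx t u) else undefined)"

lemma idx_level:
  assumes "t \<in> standard_simplex n"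
  shows "{u \<in> {0..<1}. idx t u = i} = {max 0 (if i = 0 then 0 else psum t (i - 1))..<min 1 (psum t i)}"
proof -
  have "{u \<in> {0..<1}. idx t u = i} = {u \<in> {0..<1}. (i = 0 \<or> psum t (i - 1) \<le> u) \<and> u < psum t i}"
    by (intro Collect_cong conj_cong refl idx_eq_iff[OF assms]) auto
  also have "\<dots> = {max 0 (if i = 0 then 0 else psum t (i - 1))..<min 1 (psum t i)}" by auto
  finally show ?thesis .
qed

lemma step_sfun:
  assumes t: "t \<in> standard_simplex n" shows "step_fun (sfun s t)"
  unfolding step_fun_def
proof (intro conjI allI)
  have "sfun s t ` {0..<1} \<subseteq> s ` {..n}" using idx_le[OF t] by (auto simp: sfun_def)
  then show "finite (sfun s t ` {0..<1})" using finite_subset by blast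
  fix l
  have "{u \<in> {0..<1}. sfun s t u = l} = (\<Union>i\<in>{i. i \<le> n \<and> s i = l}. {u \<in> {0..<1}. idx t u = i})"
    using idx_le[OF t] by (auto simp: sfun_def)
  then show "{u \<in> {0..<1}. sfun s t u = l} \<in> sets lborel"
    unfolding idx_level[OF t] by (simp add: sets.finite_UN)
qed

text \<open>The interval numbers at \<open>u\<close> differ only if \<open>u\<close> lies between
  the two values of some partial sum, so the set of disagreement is covered by the intervals spanned
  by these pairs.\<close>

lemma dst_sfun:
  assumes t: "t \<in> standard_simplex n" "t' \<in> standard_simplex n"
  shows "dst (sfun s t) (sfun s t') \<le> (\<Sum>i\<le>n. \<bar>psum t i - psum t' i\<bar>)"
proof -
  let ?I = "\<lambda>i. {min (psum t i) (psum t' i)..<max (psum t i) (psum t' i)}"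
  have sub: "{u \<in> {0..<1}. sfun s t u \<noteq> sfun s t' u} \<subseteq> (\<Union>i\<le>n. ?I i)"
  proof
    fix u assume u: "u \<in> {u \<in> {0..<1}. sfun s t u \<noteq> sfun s t' u}"
    then have u1: "u < 1" and ne: "idx t u \<noteq> idx t' u" by (auto simp: sfun_def)
    then consider "idx t u < idx t' u" | "idx t' u < idx t u" by linarith
    then show "u \<in> (\<Union>i\<le>n. ?I i)"
    proof cases
      case 1
      then have "psum t' (idx t u) \<le> u" "u < psum t (idx t u)" "idx t u \<le> n"
        using idx_below[OF 1] idx_less[OF t(1) u1] idx_le[OF t(1) u1] by auto
      then show ?thesis by (intro UN_I[of "idx t u"]) auto
    next
      case 2
      then have "psum t (idx t' u) \<le> u" "u < psum t' (idx t' u)" "idx t' u \<le> n"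
        using idx_below[OF 2] idx_less[OF t(2) u1] idx_le[OF t(2) u1] by auto
      then show ?thesis by (intro UN_I[of "idx t' u"]) auto
    qed
  qed
  have fin: "?I i \<in> fmeasurable lborel" for i by (rule fmeasurableI) auto
  have "dst (sfun s t) (sfun s t') \<le> measure lborel (\<Union>i\<le>n. ?I i)"
    unfolding dst_def using fin
    by (intro measure_mono_fmeasurable[OF sub fmeasurableD[OF dst_meas[OF step_sfun[OF t(1)] step_sfun[OF t(2)]]]]
        fmeasurable.finite_UN) auto
  also have "\<dots> \<le> (\<Sum>i\<le>n. measure lborel (?I i))"
    by (rule measure_UNION_le) auto
  also have "\<dots> = (\<Sum>i\<le>n. \<bar>psum t i - psum t' i\<bar>)" by (intro sum.cong) auto
  finally show ?thesis .
qed

section \<open>Vertices, edges and triangles of a simplex\<close>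

definition vtx :: "'a sset \<Rightarrow> nat \<Rightarrow> 'a \<Rightarrow> nat \<Rightarrow> 'a" where
  "vtx K n x i = pull K 0 n (\<lambda>_\<in>{..0}. i) x"

definition edg :: "'a sset \<Rightarrow> nat \<Rightarrow> 'a \<Rightarrow> nat \<Rightarrow> nat \<Rightarrow> 'a" where
  "edg K n x i j = pull K 1 n (\<lambda>k\<in>{..1}. if k = 0 then i else j) x"

definition tri :: "'a sset \<Rightarrow> nat \<Rightarrow> 'a \<Rightarrow> nat \<Rightarrow> nat \<Rightarrow> nat \<Rightarrow> 'a" where
  "tri K n x i j k = pull K 2 n (\<lambda>q\<in>{..2}. if q = 0 then i else if q = 1 then j else k) x"

lemma vtx_Delta: "i \<le> n \<Longrightarrow> (\<lambda>_\<in>{..0}. i) \<in> Delta 0 n"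
  by (auto simp: Delta_def mono_on_def)
lemma edg_Delta: "i \<le> j \<Longrightarrow> j \<le> n \<Longrightarrow> (\<lambda>k\<in>{..1}. if k = 0 then i else j) \<in> Delta 1 n"
  by (auto simp: Delta_def mono_on_def)
lemma tri_Delta: "i \<le> j \<Longrightarrow> j \<le> k \<Longrightarrow> k \<le> n \<Longrightarrow>
    (\<lambda>q\<in>{..2}. if q = 0 then i else if q = 1 then j else k) \<in> Delta 2 n"
  by (auto simp: Delta_def mono_on_def)

context simplicial_set
begin

lemma vtx_in: "x \<in> simplices X n \<Longrightarrow> i \<le> n \<Longrightarrow> vtx X n x i \<in> simplices X 0"
  unfolding vtx_def by (rule pull_in[OF vtx_Delta])
lemma edg_in: "x \<in> simplices X n \<Longrightarrow> i \<le> j \<Longrightarrow> j \<le> n \<Longrightarrow> edg X n x i j \<in> simplices X 1"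
  unfolding edg_def by (rule pull_in[OF edg_Delta])
lemma tri_in: "x \<in> simplices X n \<Longrightarrow> i \<le> j \<Longrightarrow> j \<le> k \<Longrightarrow> k \<le> n \<Longrightarrow> tri X n x i j k \<in> simplices X 2"
  unfolding tri_def by (rule pull_in[OF tri_Delta])

lemma vtx_pull:
  assumes "\<theta> \<in> Delta m n" "x \<in> simplices X n" "i \<le> m"
  shows "vtx X m (pull X m n \<theta> x) i = vtx X n x (\<theta> i)"
proof -
  have "compose {..0} \<theta> (\<lambda>_\<in>{..0}. i) = (\<lambda>_\<in>{..0}. \<theta> i)" by (auto simp: compose_def restrict_def)
  from pull_comp[OF vtx_Delta[OF assms(3)] assms(1,2), unfolded this]
  show ?thesis unfolding vtx_def by (rule sym)
qed

lemma edg_pull: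
  assumes "\<theta> \<in> Delta m n" "x \<in> simplices X n" "i \<le> j" "j \<le> m"
  shows "edg X m (pull X m n \<theta> x) i j = edg X n x (\<theta> i) (\<theta> j)"
proof -
  have "compose {..1} \<theta> (\<lambda>k\<in>{..1}. if k = 0 then i else j) = (\<lambda>k\<in>{..1}. if k = 0 then \<theta> i else \<theta> j)"
    by (auto simp: compose_def restrict_def fun_eq_iff)
  from pull_comp[OF edg_Delta[OF assms(3,4)] assms(1,2), unfolded this]
  show ?thesis unfolding edg_def by (rule sym)
qed

lemma vtx_edg: "x \<in> simplices X n \<Longrightarrow> i \<le> j \<Longrightarrow> j \<le> n \<Longrightarrow>
    vtx X 1 (edg X n x i j) 0 = vtx X n x i \<and> vtx X 1 (edg X n x i j) 1 = vtx X n x j"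
  using vtx_pull[OF edg_Delta, of i j n x 0] vtx_pull[OF edg_Delta, of i j n x 1] by (simp add: edg_def)

lemma edg_vtx: "x \<in> simplices X n \<Longrightarrow> i \<le> n \<Longrightarrow> edg X 0 (vtx X n x i) 0 0 = edg X n x i i"
  using edg_pull[OF vtx_Delta, of i n x 0 0] by (simp add: vtx_def)

lemma edg_tri:
  assumes "x \<in> simplices X n" "i \<le> j" "j \<le> k" "k \<le> n"
  shows "edg X 2 (tri X n x i j k) 0 1 = edg X n x i j" "edg X 2 (tri X n x i j k) 1 2 = edg X n x j k"
    "edg X 2 (tri X n x i j k) 0 2 = edg X n x i k"
  using edg_pull[OF tri_Delta[OF assms(2,3,4)] assms(1), of 0 1]
    edg_pull[OF tri_Delta[OF assms(2,3,4)] assms(1), of 1 2]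
    edg_pull[OF tri_Delta[OF assms(2,3,4)] assms(1), of 0 2] by (simp_all add: tri_def)

lemma edg_self: "x \<in> simplices X 1 \<Longrightarrow> edg X 1 x 0 1 = x"
proof -
  have e: "(\<lambda>k\<in>{..1}. if k = 0 then 0 else 1) = (\<lambda>i\<in>{..1::nat}. i)" by (auto simp: restrict_def fun_eq_iff)
  show "x \<in> simplices X 1 \<Longrightarrow> edg X 1 x 0 1 = x" unfolding edg_def e by (rule pull_id)
qed

lemma vtx_self: "x \<in> simplices X 0 \<Longrightarrow> vtx X 0 x 0 = x"
proof -
  have "(\<lambda>_\<in>{..0::nat}. 0) = (\<lambda>i\<in>{..0::nat}. i)" by (auto simp: restrict_def)
  then show "x \<in> simplices X 0 \<Longrightarrow> vtx X 0 x 0 = x" using pull_id[of x 0] by (simp add: vtx_def)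
qed

end

text \<open>\<open>T e a b\<close>: the transport along the edge \<open>e\<close> sends the label \<open>a\<close> to the label \<open>b\<close>.\<close>

locale local_system = simplicial_set K for K :: "'a sset" +
  fixes T :: "'a \<Rightarrow> 'l \<Rightarrow> 'l \<Rightarrow> bool"
  assumes T_fun: "e \<in> simplices K 1 \<Longrightarrow> T e a b \<Longrightarrow> T e a b' \<Longrightarrow> b = b'"
    and T_inj: "e \<in> simplices K 1 \<Longrightarrow> T e a b \<Longrightarrow> T e a' b \<Longrightarrow> a = a'"
    and T_fwd: "e \<in> simplices K 1 \<Longrightarrow> T (edg K 1 e 0 0) a a \<Longrightarrow> \<exists>b. T e a b"
    and T_bwd: "e \<in> simplices K 1 \<Longrightarrow> T (edg K 1 e 1 1) b b \<Longrightarrow> \<exists>a. T e a b"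
    and T_tri1: "x \<in> simplices K 2 \<Longrightarrow> T (edg K 2 x 0 1) a b \<Longrightarrow> T (edg K 2 x 1 2) b c \<Longrightarrow> T (edg K 2 x 0 2) a c"
    and T_tri0: "x \<in> simplices K 2 \<Longrightarrow> T (edg K 2 x 0 1) a b \<Longrightarrow> T (edg K 2 x 0 2) a c \<Longrightarrow> T (edg K 2 x 1 2) b c"
    and T_tri2: "x \<in> simplices K 2 \<Longrightarrow> T (edg K 2 x 0 2) a c \<Longrightarrow> T (edg K 2 x 1 2) b c \<Longrightarrow> T (edg K 2 x 0 1) a b"
begin

text \<open>The degenerate edges \<open>i = j\<close> are included on purpose: a label related to
  itself by a degenerate edge is what counts as a label over that vertex.\<close>

definition lifts :: "nat \<Rightarrow> 'a \<Rightarrow> (nat \<Rightarrow> 'l) set" where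
  "lifts n x = {s \<in> extensional {..n}. \<forall>i j. i \<le> j \<and> j \<le> n \<longrightarrow> T (edg K n x i j) (s i) (s j)}"

text \<open>Transport is functional forwards and injective backwards, so one label determines all
  the others.\<close>

lemma lifts_unique:
  assumes x: "x \<in> simplices K n" and s: "s \<in> lifts n x" "s' \<in> lifts n x" and i: "i \<le> n" "s i = s' i"
  shows "s = s'"
proof (rule extensionalityI)
  show "s \<in> extensional {..n}" "s' \<in> extensional {..n}" using s by (auto simp: lifts_def)
  fix j assume "j \<in> {..n}"
  then have j: "j \<le> n" by simp
  show "s j = s' j"
  proof (cases "i \<le> j")
    case True
    then show ?thesis using T_fun[OF edg_in[OF x True j]] s i j unfolding lifts_def by (metis (no_types, lifting) mem_Collect_eq)
  next
    case False
    then have ji: "j \<le> i" by simp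
    show ?thesis using T_inj[OF edg_in[OF x ji i(1)]] s i ji unfolding lifts_def by (metis (no_types, lifting) mem_Collect_eq)
  qed
qed

text \<open>The given label is transported from the vertex \<open>i\<close> to all vertices,
  forwards or backwards; compatibility along an edge not through \<open>i\<close> comes from the
  triangle spanned by that edge and \<open>i\<close>. The three cases of the proof are the positions
  of \<open>i\<close> relative to the edge.\<close>

lemma lifts_exist:
  assumes x: "x \<in> simplices K n" and i: "i \<le> n" and a: "T (edg K n x i i) a a"
  shows "\<exists>s\<in>lifts n x. s i = a"
proof -
  have f: "\<exists>b. T (edg K n x i j) a b" if "i \<le> j" "j \<le> n" for j
  proof (rule T_fwd[OF edg_in[OF x that]])
    have "edg K 1 (edg K n x i j) 0 0 = edg K n x i i"
      using edg_pull[OF edg_Delta[OF that] x, of 0 0] by (simp add: edg_def)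
    then show "T (edg K 1 (edg K n x i j) 0 0) a a" using a by simp
  qed
  have g: "\<exists>b. T (edg K n x j i) b a" if "j \<le> i" for j
  proof (rule T_bwd[OF edg_in[OF x that i]])
    have "edg K 1 (edg K n x j i) 1 1 = edg K n x i i"
      using edg_pull[OF edg_Delta[OF that i] x, of 1 1] by (simp add: edg_def)
    then show "T (edg K 1 (edg K n x j i) 1 1) a a" using a by simp
  qed
  define s where "s = (\<lambda>j\<in>{..n}. if i \<le> j then SOME b. T (edg K n x i j) a b else SOME b. T (edg K n x j i) b a)"
  have s1: "T (edg K n x i j) a (s j)" if "i \<le> j" "j \<le> n" for j
    using someI_ex[OF f[OF that]] that by (simp add: s_def)
  have si: "s i = a" using T_fun[OF edg_in[OF x _ i] s1[OF _ i] a] by simp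
  have s2: "T (edg K n x j i) (s j) a" if "j \<le> i" for j
    using someI_ex[OF g[OF that]] that i si a by (cases "j = i") (auto simp: s_def)
  have "T (edg K n x j k) (s j) (s k)" if jk: "j \<le> k" "k \<le> n" for j k
  proof -
    consider "i \<le> j" | "j \<le> i" "i \<le> k" | "k \<le> i" by linarith
    then show ?thesis
    proof cases
      case 1
      note e = edg_tri[OF x 1 jk] and t = tri_in[OF x 1 jk]
      have "j \<le> n" "i \<le> k" using 1 jk by auto
      show ?thesis
        using T_tri0[OF t, unfolded e] s1[OF 1 \<open>j \<le> n\<close>] s1[OF \<open>i \<le> k\<close> jk(2)] by blast
    next
      case 2
      note e = edg_tri[OF x 2 jk(2)] and t = tri_in[OF x 2 jk(2)]
      show ?thesis using T_tri1[OF t, unfolded e] s2[OF 2(1)] s1[OF 2(2) jk(2)] by blast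
    next
      case 3
      note e = edg_tri[OF x jk(1) 3 i] and t = tri_in[OF x jk(1) 3 i]
      have "j \<le> i" using 3 jk by auto
      show ?thesis using T_tri2[OF t, unfolded e] s2[OF \<open>j \<le> i\<close>] s2[OF 3] by blast
    qed
  qed
  then have "s \<in> lifts n x" by (auto simp: lifts_def s_def)
  then show ?thesis using si by blast
qed

definition secp :: "'a rpoint \<Rightarrow> (real \<Rightarrow> 'l) set" where
  "secp p = (case p of ((n, x), t) \<Rightarrow> (\<lambda>s. sfun s t) ` lifts n x)"

definition Sec :: "'a rpoint set \<Rightarrow> (real \<Rightarrow> 'l) set" where
  "Sec c = (\<Union>p\<in>c. secp p)"

lemma lifts_pull:
  assumes "\<theta> \<in> Delta m n" "x \<in> simplices K n" "s \<in> lifts n x"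
  shows "(\<lambda>i\<in>{..m}. s (\<theta> i)) \<in> lifts m (pull K m n \<theta> x)"
proof -
  have "\<theta> i \<le> \<theta> j \<and> \<theta> j \<le> n" if "i \<le> j" "j \<le> m" for i j
    using assms(1) that by (auto simp: Delta_def mono_on_def)
  then show ?thesis using assms edg_pull[OF assms(1,2)] by (auto simp: lifts_def)
qed

lemma sfun_pull:
  assumes "\<theta> \<in> Delta m n" "t \<in> standard_simplex m"
  shows "sfun (\<lambda>i\<in>{..m}. s (\<theta> i)) t = sfun s (push_simplex m \<theta> t)"
proof
  fix u show "sfun (\<lambda>i\<in>{..m}. s (\<theta> i)) t u = sfun s (push_simplex m \<theta> t) u"
    using idx_push[OF assms, of u] idx_le[OF assms(2), of u] by (simp add: sfun_def)
qed

text \<open>A labelling of a face or degeneracy extends to the whole simplex, because the label at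
  the vertex \<open>\<theta> 0\<close> does, and restricts back to itself by uniqueness;
  \<open>idx_push\<close> then shows that both labellings give the same step function.\<close>

lemma secp_step:
  assumes \<theta>: "\<theta> \<in> Delta m n" and x: "x \<in> simplices K n" and t: "t \<in> standard_simplex m"
  shows "secp ((m, pull K m n \<theta> x), t) = secp ((n, x), push_simplex m \<theta> t)"
proof
  show "secp ((n, x), push_simplex m \<theta> t) \<subseteq> secp ((m, pull K m n \<theta> x), t)"
  proof
    fix \<sigma> assume "\<sigma> \<in> secp ((n, x), push_simplex m \<theta> t)"
    then obtain s where s: "s \<in> lifts n x" "\<sigma> = sfun s (push_simplex m \<theta> t)" by (auto simp: secp_def)
    show "\<sigma> \<in> secp ((m, pull K m n \<theta> x), t)"
      using lifts_pull[OF \<theta> x s(1)] unfolding s(2) sfun_pull[OF \<theta> t, symmetric] by (simp add: secp_def)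
  qed
  show "secp ((m, pull K m n \<theta> x), t) \<subseteq> secp ((n, x), push_simplex m \<theta> t)"
  proof
    fix \<sigma> assume "\<sigma> \<in> secp ((m, pull K m n \<theta> x), t)"
    then obtain s where s: "s \<in> lifts m (pull K m n \<theta> x)" "\<sigma> = sfun s t" by (auto simp: secp_def)
    have \<theta>0: "\<theta> 0 \<le> n" using Delta_le[OF \<theta>] by simp
    have "T (edg K n x (\<theta> 0) (\<theta> 0)) (s 0) (s 0)"
      using s(1) edg_pull[OF \<theta> x, of 0 0] by (fastforce simp: lifts_def)
    then obtain s' where s': "s' \<in> lifts n x" "s' (\<theta> 0) = s 0" using lifts_exist[OF x \<theta>0] by blast
    have "(\<lambda>i\<in>{..m}. s' (\<theta> i)) = s"
      using lifts_unique[OF pull_in[OF \<theta> x] lifts_pull[OF \<theta> x s'(1)] s(1), of 0] s'(2) by simp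
    then show "\<sigma> \<in> secp ((n, x), push_simplex m \<theta> t)"
      using s'(1) s(2) sfun_pull[OF \<theta> t] unfolding secp_def by auto
  qed
qed

lemma Sec_rcls:
  assumes "x \<in> simplices K n" "t \<in> standard_simplex n"
  shows "Sec (rcls K ((n, x), t)) = (\<lambda>s. sfun s t) ` lifts n x"
proof -
  have "secp p' = secp ((n, x), t)" if "p' \<in> rcls K ((n, x), t)" for p'
    using rel_invariant[of "((n, x), t)" p' K secp] that secp_step unfolding mem_rcls by simp
  moreover have "((n, x), t) \<in> rcls K ((n, x), t)" using assms by (intro rcls_self) (simp add: topspace_presum)
  ultimately show ?thesis unfolding Sec_def by (auto simp: secp_def)
qed

lemma Sec_step_fun: "z \<in> topspace (realization K) \<Longrightarrow> \<sigma> \<in> Sec z \<Longrightarrow> step_fun \<sigma>"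
  by (erule realization_cases) (auto simp: Sec_rcls step_sfun)

text \<open>Functions at distance below 1 agree somewhere, and labellings of one simplex that agree
  at one vertex are equal. So the sections over a point are discrete with a gap of 1, which all
  later estimates exploit.\<close>

lemma Sec_eq:
  assumes z: "z \<in> topspace (realization K)" and s: "\<sigma> \<in> Sec z" "\<tau> \<in> Sec z" and d: "dst \<sigma> \<tau> < 1"
  shows "\<sigma> = \<tau>"
proof -
  obtain n x t where x: "x \<in> simplices K n" "t \<in> standard_simplex n" "z = rcls K ((n, x), t)"
    using z by (rule realization_cases)
  obtain s s' where s': "\<sigma> = sfun s t" "\<tau> = sfun s' t" "s \<in> lifts n x" "s' \<in> lifts n x"
    using s by (auto simp: x Sec_rcls[OF x(1,2)])
  obtain u where u: "0 \<le> u" "u < 1" "\<sigma> u = \<tau> u" using dst_agree[OF d] .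
  then have "s (idx t u) = s' (idx t u)" by (simp add: s' sfun_def)
  then show ?thesis using lifts_unique[OF x(1) s'(3,4) idx_le[OF x(2) u(2)]] s' by simp
qed

text \<open>The fibres of sections have Hausdorff distance at most \<epsilon>.\<close>

definition close :: "real \<Rightarrow> 'a rpoint set \<Rightarrow> 'a rpoint set \<Rightarrow> bool" where
  "close \<epsilon> z z' \<longleftrightarrow> (\<forall>\<sigma>\<in>Sec z. \<exists>\<tau>\<in>Sec z'. dst \<sigma> \<tau> \<le> \<epsilon>) \<and> (\<forall>\<tau>\<in>Sec z'. \<exists>\<sigma>\<in>Sec z. dst \<sigma> \<tau> \<le> \<epsilon>)"

lemma close_refl: "0 \<le> \<epsilon> \<Longrightarrow> close \<epsilon> z z"
  unfolding close_def using dst_same by metis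

lemma close_sym: "close \<epsilon> z z' \<Longrightarrow> close \<epsilon> z' z"
  unfolding close_def using dst_sym by metis

lemma close_mono: "close \<epsilon> z z' \<Longrightarrow> \<epsilon> \<le> \<epsilon>' \<Longrightarrow> close \<epsilon>' z z'"
  unfolding close_def by (meson order_trans)

lemma close_trans:
  assumes z: "z \<in> topspace (realization K)" "z' \<in> topspace (realization K)" "z'' \<in> topspace (realization K)"
    and c: "close \<epsilon> z z'" "close \<epsilon>' z' z''"
  shows "close (\<epsilon> + \<epsilon>') z z''"
proof -
  have d: "dst \<sigma> \<upsilon> \<le> \<epsilon> + \<epsilon>'" if "\<sigma> \<in> Sec z" "\<tau> \<in> Sec z'" "\<upsilon> \<in> Sec z''" "dst \<sigma> \<tau> \<le> \<epsilon>" "dst \<tau> \<upsilon> \<le> \<epsilon>'" for \<sigma> \<tau> \<upsilon>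
    using dst_triangle[of \<sigma> \<tau> \<upsilon>] Sec_step_fun z that by fastforce
  show ?thesis
    unfolding close_def
  proof (intro conjI ballI)
    show "\<exists>\<upsilon>\<in>Sec z''. dst \<sigma> \<upsilon> \<le> \<epsilon> + \<epsilon>'" if s: "\<sigma> \<in> Sec z" for \<sigma>
    proof -
      obtain \<tau> where t: "\<tau> \<in> Sec z'" "dst \<sigma> \<tau> \<le> \<epsilon>" using c(1) s unfolding close_def by blast
      then obtain \<upsilon> where "\<upsilon> \<in> Sec z''" "dst \<tau> \<upsilon> \<le> \<epsilon>'" using c(2) unfolding close_def by blast
      then show ?thesis using d[OF s t(1)] t(2) by blast
    qed
    show "\<exists>\<sigma>\<in>Sec z. dst \<sigma> \<upsilon> \<le> \<epsilon> + \<epsilon>'" if s: "\<upsilon> \<in> Sec z''" for \<upsilon>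
    proof -
      obtain \<tau> where t: "\<tau> \<in> Sec z'" "dst \<tau> \<upsilon> \<le> \<epsilon>'" using c(2) s unfolding close_def by blast
      then obtain \<sigma> where "\<sigma> \<in> Sec z" "dst \<sigma> \<tau> \<le> \<epsilon>" using c(1) unfolding close_def by blast
      then show ?thesis using d[OF _ t(1) s] t(2) by blast
    qed
  qed
qed

lemma close_simplex:
  assumes x: "x \<in> simplices K n" and t: "t \<in> standard_simplex n" "t' \<in> standard_simplex n"
  shows "close (\<Sum>i\<le>n. \<bar>psum t i - psum t' i\<bar>) (rcls K ((n, x), t)) (rcls K ((n, x), t'))"
  unfolding close_def Sec_rcls[OF x t(1)] Sec_rcls[OF x t(2)] using dst_sfun[OF t] by blast

text \<open>The strictly smaller \<epsilon>' leaves room to move: within a simplex the fibres vary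
  by at most the sum of the differences of partial sums, which is continuous.\<close>

lemma openin_close:
  assumes z0: "z0 \<in> topspace (realization K)"
  shows "openin (realization K) {z \<in> topspace (realization K). \<exists>\<epsilon>'<\<epsilon>. close \<epsilon>' z0 z}" (is "openin _ ?U")
proof (subst openin_realization_iff, blast, intro allI ballI)
  fix n x assume x: "x \<in> simplices K n"
  have top: "rcls K ((n, x), t) \<in> topspace (realization K)" if "t \<in> standard_simplex n" for t
    using that x by (intro rcls_topspace) (simp add: topspace_presum)
  show "openin (simplex_space n) {t \<in> standard_simplex n. rcls K ((n, x), t) \<in> ?U}"
  proof (subst openin_subopen, intro ballI)
    fix t assume "t \<in> {t \<in> standard_simplex n. rcls K ((n, x), t) \<in> ?U}"
    then obtain \<epsilon>' where t: "t \<in> standard_simplex n" "\<epsilon>' < \<epsilon>" "close \<epsilon>' z0 (rcls K ((n, x), t))" by auto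
    have "continuous_map (powertop_real UNIV) euclideanreal (\<lambda>t'. \<Sum>i\<le>n. \<bar>psum t i - psum t' i\<bar>)"
      unfolding psum_def by (intro continuous_intros continuous_map_product_projection) auto
    then have c: "continuous_map (simplex_space n) euclideanreal (\<lambda>t'. \<Sum>i\<le>n. \<bar>psum t i - psum t' i\<bar>)"
      unfolding simplex_space_def by (rule continuous_map_from_subtopology)
    have "openin (simplex_space n) {t' \<in> topspace (simplex_space n). (\<Sum>i\<le>n. \<bar>psum t i - psum t' i\<bar>) \<in> {..<\<epsilon> - \<epsilon>'}}"
      by (rule openin_continuous_map_preimage[OF c]) auto
    moreover have "rcls K ((n, x), t') \<in> ?U" if "t' \<in> standard_simplex n" "(\<Sum>i\<le>n. \<bar>psum t i - psum t' i\<bar>) < \<epsilon> - \<epsilon>'" for t'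
    proof -
      have "close (\<epsilon>' + (\<Sum>i\<le>n. \<bar>psum t i - psum t' i\<bar>)) z0 (rcls K ((n, x), t'))"
        by (rule close_trans[OF z0 top[OF t(1)] top[OF that(1)] t(3) close_simplex[OF x t(1) that(1)]])
      moreover have "\<epsilon>' + (\<Sum>i\<le>n. \<bar>psum t i - psum t' i\<bar>) < \<epsilon>" using that(2) by simp
      ultimately show ?thesis using top[OF that(1)] by blast
    qed
    ultimately show "\<exists>W. openin (simplex_space n) W \<and> t \<in> W \<and> W \<subseteq> {t \<in> standard_simplex n. rcls K ((n, x), t) \<in> ?U}"
      using t by (intro exI[of _ "{t' \<in> topspace (simplex_space n). (\<Sum>i\<le>n. \<bar>psum t i - psum t' i\<bar>) \<in> {..<\<epsilon> - \<epsilon>'}}"])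
        (auto simp: topspace_simplex_space)
  qed
qed

text \<open>A Lebesgue number for the preimages of balls of radius \<open>\<epsilon>/2\<close>: two
  parameters at small distance lie in the preimage of a common ball and are compared through its
  centre.\<close>

lemma uniformly_close:
  fixes P :: "'p::metric_space set"
  assumes P: "compact P" and H: "continuous_map (top_of_set P) (realization K) H" and \<epsilon>: "0 < \<epsilon>"
  obtains \<delta> where "0 < \<delta>" "\<And>a b. a \<in> P \<Longrightarrow> b \<in> P \<Longrightarrow> dist a b < \<delta> \<Longrightarrow> close \<epsilon> (H a) (H b)"
proof -
  have Ht: "H a \<in> topspace (realization K)" if "a \<in> P" for a using cm_in[OF H] that by simp
  define U where "U c = {z \<in> topspace (realization K). \<exists>\<epsilon>'<\<epsilon>/2. close \<epsilon>' (H c) z}" for c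
  have "\<exists>B. open B \<and> {a \<in> P. H a \<in> U c} = P \<inter> B" if c: "c \<in> P" for c
    using openin_continuous_map_preimage[OF H openin_close[OF Ht[OF c], of "\<epsilon>/2"]]
    unfolding U_def openin_open by simp
  then obtain B where B: "\<And>c. c \<in> P \<Longrightarrow> open (B c) \<and> {a \<in> P. H a \<in> U c} = P \<inter> B c" by metis
  have self: "c \<in> B c" if c: "c \<in> P" for c
  proof -
    have "H c \<in> U c"
      unfolding U_def using Ht[OF c] close_refl[of 0 "H c"] \<epsilon> by (auto intro!: exI[of _ 0])
    then show ?thesis using B[OF c] c by blast
  qed
  have cl: "close \<epsilon> (H a) (H b)" if c: "c \<in> P" and ab: "a \<in> P" "b \<in> P" "a \<in> B c" "b \<in> B c" for a b c
  proof -
    have "H a \<in> U c" "H b \<in> U c" using B[OF c] ab by blast+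
    then obtain e e' where e: "e < \<epsilon>/2" "close e (H c) (H a)" "e' < \<epsilon>/2" "close e' (H c) (H b)" by (auto simp: U_def)
    have "close (e + e') (H a) (H b)" using close_trans[OF Ht Ht Ht close_sym[OF e(2)] e(4)] ab c by blast
    then show ?thesis by (rule close_mono) (use e in simp)
  qed
  show thesis
  proof (cases "P = {}")
    case True then show ?thesis using that[of 1] by simp
  next
    case False
    obtain \<delta> where \<delta>: "0 < \<delta>" "\<And>T. T \<subseteq> P \<Longrightarrow> diameter T < \<delta> \<Longrightarrow> \<exists>C\<in>B ` P. T \<subseteq> C"
      by (rule Lebesgue_number_lemma[OF P, of "B ` P"]) (use False self B in auto)
    show ?thesis
    proof (rule that[OF \<delta>(1)])
      fix a b assume ab: "a \<in> P" "b \<in> P" "dist a b < \<delta>"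
      have "diameter {a, b} \<le> dist a b"
      proof -
        have "(SUP (x, y)\<in>{a, b} \<times> {a, b}. dist x y) \<le> dist a b"
          by (rule cSUP_least) (auto simp: dist_commute)
        then show ?thesis unfolding diameter_def by simp
      qed
      then have "diameter {a, b} < \<delta>" using ab by simp
      then obtain c where "c \<in> P" "{a, b} \<subseteq> B c" using \<delta>(2)[of "{a, b}"] ab by auto
      then show "close \<epsilon> (H a) (H b)" using cl ab by blast
    qed
  qed
qed

end

section \<open>Paths and loops in topological spaces\<close>

lemma pathin_reparam:
  assumes "pathin X \<gamma>" "continuous_map S (top_of_set {0..1}) f"
  shows "continuous_map S X (\<lambda>v. \<gamma> (f v))"
  using continuous_map_compose[OF assms(2) assms(1)[unfolded pathin_def]] unfolding o_def .

lemma pathin_reverse: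
  assumes "pathin X \<gamma>" shows "pathin X (\<lambda>v. \<gamma> (1 - v))"
proof -
  have "continuous_map (top_of_set {0..1}) (top_of_set {0..1}) (\<lambda>v. 1 - v :: real)"
    by (auto simp: continuous_map_in_subtopology intro!: continuous_intros)
  then show ?thesis
    unfolding pathin_def by (rule pathin_reparam[OF assms])
qed

definition join3 :: "(real \<Rightarrow> 'a) \<Rightarrow> (real \<Rightarrow> 'a) \<Rightarrow> (real \<Rightarrow> 'a) \<Rightarrow> real \<Rightarrow> 'a" where
  "join3 \<alpha> \<beta> \<gamma> v = (if v \<le> 1/3 then \<alpha> (3 * v) else if v \<le> 2/3 then \<beta> (3 * v - 1) else \<gamma> (3 * v - 2))"

lemma pathin_join3:
  assumes p: "pathin X \<alpha>" "pathin X \<beta>" "pathin X \<gamma>" and e: "\<alpha> 1 = \<beta> 0" "\<beta> 1 = \<gamma> 0"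
  shows "pathin X (join3 \<alpha> \<beta> \<gamma>)"
proof -
  have aff: "continuous_map (top_of_set S) X (\<lambda>v. \<delta> (3 * v - c))"
    if "pathin X \<delta>" "\<And>v. v \<in> S \<Longrightarrow> 0 \<le> 3 * v - c \<and> 3 * v - c \<le> 1" for S \<delta> and c :: real
  proof -
    have "continuous_map (top_of_set S) (top_of_set {0..1}) (\<lambda>v. 3 * v - c)"
      using that(2) by (auto simp: continuous_map_in_subtopology intro!: continuous_intros)
    then show ?thesis
      by (rule pathin_reparam[OF that(1)])
  qed
  have id: "continuous_map (top_of_set S) euclideanreal (\<lambda>v. v)" for S :: "real set"
    by (auto intro!: continuous_intros)
  have 1: "continuous_map (top_of_set {1/3..1}) X (\<lambda>v. if v \<le> 2/3 then \<beta> (3 * v - 1) else \<gamma> (3 * v - 2))"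
  proof (rule continuous_map_cases_le[OF id])
    show "continuous_map (subtopology (top_of_set {1/3..1}) {v \<in> topspace (top_of_set {1/3..1}). v \<le> 2/3}) X (\<lambda>v. \<beta> (3 * v - 1))"
      unfolding subtopology_subtopology by (rule aff[OF p(2)]) auto
    show "continuous_map (subtopology (top_of_set {1/3..1}) {v \<in> topspace (top_of_set {1/3..1}). 2/3 \<le> v}) X (\<lambda>v. \<gamma> (3 * v - 2))"
      unfolding subtopology_subtopology by (rule aff[OF p(3)]) auto
    show "\<beta> (3 * v - 1) = \<gamma> (3 * v - 2)" if "v = 2/3" for v :: real
      unfolding that using e(2) by simp
  qed simp
  show ?thesis
    unfolding pathin_def join3_def[abs_def]
  proof (rule continuous_map_cases_le[OF id])
    show "continuous_map (subtopology (top_of_set {0..1}) {v \<in> topspace (top_of_set {0..1}). v \<le> 1/3}) X (\<lambda>v. \<alpha> (3 * v))"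
    proof -
      have "continuous_map (top_of_set ({0..1} \<inter> {v \<in> topspace (top_of_set {0..1}). v \<le> 1/3})) X (\<lambda>v. \<alpha> (3 * v - 0))"
        by (rule aff[OF p(1)]) auto
      then show ?thesis unfolding subtopology_subtopology by simp
    qed
    have "{0..1} \<inter> {v \<in> topspace (top_of_set {0..1}). 1/3 \<le> v} = {1/3..1 :: real}" by auto
    then show "continuous_map (subtopology (top_of_set {0..1}) {v \<in> topspace (top_of_set {0..1}). 1/3 \<le> v}) X
        (\<lambda>v. if v \<le> 2/3 then \<beta> (3 * v - 1) else \<gamma> (3 * v - 2))"
      unfolding subtopology_subtopology using 1 by simp
    show "\<alpha> (3 * v) = (if v \<le> 2/3 then \<beta> (3 * v - 1) else \<gamma> (3 * v - 2))" if "v = 1/3" for v :: real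
      unfolding that using e(1) by simp
  qed simp
qed

lemma join3_pieces:
  assumes "\<alpha> 1 = \<beta> 0" "\<beta> 1 = \<gamma> 0" "0 \<le> v" "v \<le> 1"
  shows "join3 \<alpha> \<beta> \<gamma> (1/3 * v + 0) = \<alpha> v" "join3 \<alpha> \<beta> \<gamma> (1/3 * v + 1/3) = \<beta> v"
    "join3 \<alpha> \<beta> \<gamma> (1/3 * v + 2/3) = \<gamma> v"
proof -
  show "join3 \<alpha> \<beta> \<gamma> (1/3 * v + 0) = \<alpha> v" using assms by (simp add: join3_def)
  show "join3 \<alpha> \<beta> \<gamma> (1/3 * v + 1/3) = \<beta> v" using assms by (cases "v = 0") (auto simp: join3_def)
  show "join3 \<alpha> \<beta> \<gamma> (1/3 * v + 2/3) = \<gamma> v" using assms by (cases "v = 0") (auto simp: join3_def)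
qed

section \<open>What weak equivalences say about paths and loops\<close>

lemma pointed_homotopicD:
  assumes "pointed_homotopic n X x a b"
  shows "\<exists>h. continuous_map (prod_topology (top_of_set {0..1 :: real}) (nsphere n)) X h \<and> (\<forall>z. h (0, z) = a z) \<and>
    (\<forall>z. h (1, z) = b z) \<and> (\<forall>t\<in>{0..1}. h (t, sphere_base) = x)"
  using assms by (simp add: pointed_homotopic_def homotopic_with_def)

definition anti_base :: "nat \<Rightarrow> real" where "anti_base = (\<lambda>i. if i = 0 then -1 else 0)"

lemma topspace_nsphere0: "z \<in> topspace (nsphere 0) \<longleftrightarrow> z = sphere_base \<or> z = anti_base"
proof
  assume "z \<in> topspace (nsphere 0)"
  then have z: "(z 0)\<^sup>2 = 1" "\<And>i. i \<ge> 1 \<Longrightarrow> z i = 0"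
    by (auto simp: nsphere_def topspace_Euclidean_space)
  then have "z 0 = 1 \<or> z 0 = -1" by (simp add: power2_eq_1_iff)
  then show "z = sphere_base \<or> z = anti_base"
    using z(2) unfolding sphere_base_def anti_base_def fun_eq_iff by (metis One_nat_def Suc_leI neq0_conv)
qed (auto simp: nsphere_def topspace_Euclidean_space sphere_base_def anti_base_def)

lemma proj0_continuous: "continuous_map (nsphere n) euclideanreal (\<lambda>z. z i)"
  unfolding nsphere_def Euclidean_space_def
  by (intro continuous_map_from_subtopology continuous_map_product_projection) auto

definition two_points :: "'a \<Rightarrow> 'a \<Rightarrow> (nat \<Rightarrow> real) \<Rightarrow> 'a" where
  "two_points x y z = (if z 0 \<le> 0 then y else x)"

lemma two_points_eq: "two_points x y sphere_base = x" "two_points x y anti_base = y"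
  by (auto simp: two_points_def sphere_base_def anti_base_def)

lemma two_points_sphere:
  assumes "x \<in> topspace X" "y \<in> topspace X" shows "pointed_sphere 0 X x (two_points x y)"
proof -
  have "z 0 \<noteq> 0" if "z \<in> topspace (nsphere 0)" for z
    using that by (auto simp: topspace_nsphere0 sphere_base_def anti_base_def)
  then have "continuous_map (nsphere 0) X (\<lambda>z. if z 0 \<le> 0 then y else x)"
    by (intro continuous_map_cases_le proj0_continuous) (use assms in auto)
  then show ?thesis
    unfolding pointed_sphere_def two_points_eq(1) by (simp add: two_points_def[abs_def])
qed

text \<open>Two points are a pointed map from the 0-sphere. The path \<gamma> is a pointed homotopy
  that is constant at the base point, and the homotopy obtained in \<open>X\<close>, restricted to
  the other point of the sphere, is the desired path.\<close>

lemma pi0_injective: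
  assumes w: "weak_homotopy_equivalence X Y f" and x: "x \<in> topspace X" "x' \<in> topspace X"
    and \<gamma>: "pathin Y \<gamma>" "\<gamma> 0 = f x" "\<gamma> 1 = f x'"
  shows "\<exists>\<alpha>. pathin X \<alpha> \<and> \<alpha> 0 = x \<and> \<alpha> 1 = x'"
proof -
  have fc: "continuous_map X Y f" using w by (simp add: whe_iff)
  have ne: "z 0 \<noteq> 0" if "z \<in> topspace (nsphere 0)" for z
    using that by (auto simp: topspace_nsphere0 sphere_base_def anti_base_def)
  let ?S = "prod_topology (top_of_set {0..1 :: real}) (nsphere 0)"
  have "continuous_map ?S Y (\<lambda>p. if snd p 0 \<le> 0 then \<gamma> (fst p) else f x)"
  proof (intro continuous_map_cases_le)
    show "continuous_map ?S euclideanreal (\<lambda>p. snd p 0)"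
      using continuous_map_compose[OF continuous_map_snd proj0_continuous[of 0 0]] by (simp add: o_def)
    show "continuous_map (subtopology ?S {p \<in> topspace ?S. snd p 0 \<le> 0}) Y (\<lambda>p. \<gamma> (fst p))"
      using continuous_map_compose[OF continuous_map_fst \<gamma>(1)[unfolded pathin_def]]
      by (intro continuous_map_from_subtopology) (simp add: o_def)
    show "continuous_map (subtopology ?S {p \<in> topspace ?S. 0 \<le> snd p 0}) Y (\<lambda>p. f x)"
      using cm_in[OF fc x(1)] by simp
  qed (use ne in auto)
  moreover have "(if (z :: nat \<Rightarrow> real) 0 \<le> 0 then \<gamma> (0 :: real) else f x) = (f \<circ> two_points x x) z"
    and "(if z 0 \<le> 0 then \<gamma> 1 else f x) = (f \<circ> two_points x x') z" for z
    by (simp_all add: two_points_def \<gamma>)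
  ultimately have "pointed_homotopic 0 Y (f x) (f \<circ> two_points x x) (f \<circ> two_points x x')"
    unfolding pointed_homotopic_def homotopic_with_def
    by (intro exI[of _ "\<lambda>p. if snd p 0 \<le> 0 then \<gamma> (fst p) else f x"])
      (simp only: fst_conv snd_conv, simp add: sphere_base_def)
  then have ph: "pointed_homotopic 0 X x (two_points x x) (two_points x x')"
    using w two_points_sphere[OF x(1) x(1)] two_points_sphere[OF x] x(1) unfolding whe_iff pi_inj_def by blast
  obtain h where h: "continuous_map ?S X h" "\<forall>z. h (0, z) = two_points x x z" "\<forall>z. h (1, z) = two_points x x' z"
    using pointed_homotopicD[OF ph] by blast
  have "continuous_map (top_of_set {0..1}) ?S (\<lambda>v. (v, anti_base))"
    by (auto simp: continuous_map_pairwise o_def topspace_nsphere0)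
  from continuous_map_compose[OF this h(1)] have "pathin X (\<lambda>v. h (v, anti_base))" by (simp add: pathin_def o_def)
  then show ?thesis by (intro exI[of _ "\<lambda>v. h (v, anti_base)"]) (simp add: h(2,3) two_points_eq)
qed

text \<open>The 0-sphere with second point \<open>y\<close> comes, up to homotopy, from
  \<open>X\<close>; the second point of the sphere in \<open>X\<close> and the trace of the homotopy
  there are the witnesses.\<close>

lemma pi0_surjective:
  assumes w: "weak_homotopy_equivalence X Y f" and y: "y \<in> topspace Y"
  shows "\<exists>x\<in>topspace X. \<exists>\<alpha>. pathin Y \<alpha> \<and> \<alpha> 0 = f x \<and> \<alpha> 1 = y"
proof -
  have fc: "continuous_map X Y f" using w by (simp add: whe_iff)
  obtain x0 where x0: "x0 \<in> topspace X" using w y unfolding whe_iff by blast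
  obtain a where a: "pointed_sphere 0 X x0 a" "pointed_homotopic 0 Y (f x0) (f \<circ> a) (two_points (f x0) y)"
    using w x0 two_points_sphere[OF cm_in[OF fc x0] y] unfolding whe_iff pi_surj_def by blast
  let ?S = "prod_topology (top_of_set {0..1 :: real}) (nsphere 0)"
  obtain h where h: "continuous_map ?S Y h" "\<forall>z. h (0, z) = (f \<circ> a) z" "\<forall>z. h (1, z) = two_points (f x0) y z"
    using pointed_homotopicD[OF a(2)] by blast
  have "continuous_map (top_of_set {0..1}) ?S (\<lambda>v. (v, anti_base))"
    by (auto simp: continuous_map_pairwise o_def topspace_nsphere0)
  from continuous_map_compose[OF this h(1)] have "pathin Y (\<lambda>v. h (v, anti_base))" by (simp add: pathin_def o_def)
  moreover have "a anti_base \<in> topspace X" using sphere_in[OF a(1)] by (simp add: topspace_nsphere0)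
  ultimately show ?thesis
    by (intro bexI[of _ "a anti_base"] exI[of _ "\<lambda>v. h (v, anti_base)"]) (simp_all add: h(2,3) two_points_eq)
qed

definition circ :: "real \<Rightarrow> nat \<Rightarrow> real" where
  "circ v = (\<lambda>i. if i = 0 then cos (2 * pi * v) else if i = 1 then sin (2 * pi * v) else 0)"

lemma circ_ends: "circ 0 = sphere_base" "circ 1 = sphere_base"
  by (auto simp: circ_def sphere_base_def)

lemma circ_continuous: "continuous_map (top_of_set {0..1}) (nsphere 1) circ"
proof -
  have "continuous_map (top_of_set {0..1}) euclideanreal (\<lambda>v. circ v i)" for i
    unfolding circ_def by (cases "i = 0"; cases "i = 1") (auto intro!: continuous_intros)
  then show ?thesis
    unfolding nsphere
    by (auto simp: continuous_map_in_subtopology Euclidean_space_def continuous_map_componentwise_UNIV circ_def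
        sin_cos_squared_add3 power2_eq_square)
qed

lemma circ_surj: "circ ` {0..1} = topspace (nsphere 1)"
proof
  show "circ ` {0..1} \<subseteq> topspace (nsphere 1)" using cm_in[OF circ_continuous] by auto
  show "topspace (nsphere 1) \<subseteq> circ ` {0..1}"
  proof
    fix z assume z: "z \<in> topspace (nsphere 1)"
    then have z2: "(z 0)\<^sup>2 + (z 1)\<^sup>2 = 1" and z0: "\<And>i. i \<ge> 2 \<Longrightarrow> z i = 0"
      by (auto simp: nsphere_def topspace_Euclidean_space numeral_2_eq_2)
    obtain t where t: "0 \<le> t" "t < 2 * pi" "z 0 = cos t" "z 1 = sin t" using sincos_total_2pi[OF z2] .
    have "z = circ (t / (2 * pi))"
    proof
      fix i show "z i = circ (t / (2 * pi)) i"
        using t z0[of i] by (cases "i = 0"; cases "i = 1") (auto simp: circ_def)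
    qed
    moreover have "t / (2 * pi) \<in> {0..1}" using t by (simp add: divide_le_eq)
    ultimately show "z \<in> circ ` {0..1}" by blast
  qed
qed

lemma circ_inj:
  assumes "0 \<le> v" "v \<le> w" "w \<le> 1" "circ v = circ w" shows "v = w \<or> v = 0 \<and> w = 1"
proof -
  have c: "cos (2 * pi * v) = cos (2 * pi * w)" "sin (2 * pi * v) = sin (2 * pi * w)"
    using fun_cong[OF assms(4), of 0] fun_cong[OF assms(4), of 1] by (auto simp: circ_def)
  have "cos (2 * pi * w - 2 * pi * v) = 1"
    using c sin_cos_squared_add3[of "2 * pi * v"] by (simp add: cos_diff)
  then obtain n :: int where n: "2 * pi * w - 2 * pi * v = of_int n * 2 * pi" using cos_one_2pi_int by blast
  then have "2 * pi * (w - v) = 2 * pi * of_int n" by (simp add: algebra_simps)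
  then have "w - v = of_int n" by simp
  moreover have "0 \<le> w - v" "w - v \<le> 1" using assms by auto
  ultimately have "0 \<le> n" "n \<le> 1" by linarith+
  then have "n = 0 \<or> n = 1" by auto
  then show ?thesis using \<open>w - v = of_int n\<close> assms by auto
qed

text \<open>\<open>circ\<close> maps a compact space onto a Hausdorff one, hence is a quotient map,
  and it identifies only the two ends of the interval.\<close>

lemma loop_as_sphere:
  assumes \<omega>: "pathin X \<omega>" "\<omega> 0 = x" "\<omega> 1 = x"
  shows "\<exists>b. pointed_sphere 1 X x b \<and> (\<forall>v\<in>{0..1}. b (circ v) = \<omega> v)"
proof -
  have H: "Hausdorff_space (nsphere 1)"
    unfolding nsphere_def Euclidean_space_def
    by (intro Hausdorff_space_subtopology) (simp add: Hausdorff_space_product_topology)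
  have qm: "quotient_map (top_of_set {0..1}) (nsphere 1) circ"
    by (rule continuous_imp_quotient_map[OF circ_continuous _ H])
      (use circ_surj in \<open>auto simp: compact_space_subtopology\<close>)
  have inv: "\<omega> v = \<omega> w" if v: "v \<in> topspace (top_of_set {0..1})" and w: "w \<in> topspace (top_of_set {0..1})"
    and c: "circ v = circ w" for v w
  proof (cases "v \<le> w")
    case True
    then have "v = w \<or> v = 0 \<and> w = 1" using v w by (intro circ_inj[OF _ _ _ c]) auto
    then show ?thesis using \<omega> by auto
  next
    case False
    then have "w = v \<or> w = 0 \<and> v = 1" using v w by (intro circ_inj[OF _ _ _ c[symmetric]]) auto
    then show ?thesis using \<omega> by auto
  qed
  obtain b where b: "continuous_map (nsphere 1) X b" "\<forall>v\<in>topspace (top_of_set {0..1}). b (circ v) = \<omega> v"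
    by (rule quotient_map_lift_exists[OF qm \<omega>(1)[unfolded pathin_def] inv]) auto
  moreover have "b sphere_base = x" using bspec[OF b(2), of 0] \<omega> by (simp add: circ_ends)
  ultimately show ?thesis unfolding pointed_sphere_def by auto
qed

text \<open>The pointed homotopy over the circle is unrolled to a square. Its first coordinate is
  the loop parameter, so the sides where that coordinate is 0 or 1 are constant at the base
  point.\<close>

lemma pi1_surjective:
  assumes w: "weak_homotopy_equivalence X Y f" and x: "x \<in> topspace X"
    and \<omega>: "pathin Y \<omega>" "\<omega> 0 = f x" "\<omega> 1 = f x"
  shows "\<exists>\<alpha> H. pathin X \<alpha> \<and> \<alpha> 0 = x \<and> \<alpha> 1 = x \<and>
    continuous_map (top_of_set ({0..1} \<times> {0..1})) Y H \<and>
    (\<forall>v\<in>{0..1}. H (v, 0) = f (\<alpha> v) \<and> H (v, 1) = \<omega> v \<and> H (0, v) = f x \<and> H (1, v) = f x)"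
proof -
  obtain b where b: "pointed_sphere 1 Y (f x) b" "\<And>v. v \<in> {0..1} \<Longrightarrow> b (circ v) = \<omega> v"
    using loop_as_sphere[OF \<omega>] by blast
  obtain a where a: "pointed_sphere 1 X x a" "pointed_homotopic 1 Y (f x) (f \<circ> a) b"
    using w x b(1) unfolding whe_iff pi_surj_def by blast
  let ?S = "prod_topology (top_of_set {0..1 :: real}) (nsphere 1)"
  obtain h where h: "continuous_map ?S Y h" "\<forall>z. h (0, z) = (f \<circ> a) z" "\<forall>z. h (1, z) = b z"
      "\<forall>t\<in>{0..1}. h (t, sphere_base) = f x"
    using pointed_homotopicD[OF a(2)] by blast
  have "continuous_map (top_of_set ({0..1} \<times> {0..1})) ?S (\<lambda>p. (snd p, circ (fst p)))"
    unfolding continuous_map_pairwise o_def fst_conv snd_conv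
  proof
    show "continuous_map (top_of_set ({0..1} \<times> {0..1})) (top_of_set {0..1}) (\<lambda>p. snd p :: real)"
      by (auto simp: continuous_map_in_subtopology intro!: continuous_intros)
    have "continuous_map (top_of_set ({0..1} \<times> {0..1})) (top_of_set {0..1}) (\<lambda>p. fst p :: real)"
      by (auto simp: continuous_map_in_subtopology intro!: continuous_intros)
    from continuous_map_compose[OF this circ_continuous]
    show "continuous_map (top_of_set ({0..1} \<times> {0..1})) (nsphere 1) (\<lambda>p. circ (fst p))" by (simp add: o_def)
  qed
  from continuous_map_compose[OF this h(1)]
  have H: "continuous_map (top_of_set ({0..1} \<times> {0..1})) Y (\<lambda>p. h (snd p, circ (fst p)))" by (simp add: o_def)
  have "pathin X (\<lambda>v. a (circ v))"
    using continuous_map_compose[OF circ_continuous, of X a] a(1) unfolding pathin_def pointed_sphere_def o_def by blast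
  then show ?thesis
    using H h b a(1)
    by (intro exI[of _ "\<lambda>v. a (circ v)"] exI[of _ "\<lambda>p. h (snd p, circ (fst p))"])
      (simp add: circ_ends pointed_sphere_def)
qed

section \<open>Transport along paths\<close>

context local_system
begin

text \<open>A lift of a path to sections, with a uniform bound on small moves in place of
  continuity. The bound 1/5 is chosen so that a chain of four such distances, as in
  \<open>clift_ladder\<close>, stays below the gap 1 of \<open>Sec_eq\<close>.\<close>

definition clift :: "(real \<Rightarrow> 'a rpoint set) \<Rightarrow> (real \<Rightarrow> real \<Rightarrow> 'l) \<Rightarrow> bool" where
  "clift \<gamma> s \<longleftrightarrow> (\<forall>v\<in>{0..1}. s v \<in> Sec (\<gamma> v)) \<and>
     (\<exists>\<delta>>0. \<forall>a\<in>{0..1}. \<forall>b\<in>{0..1}. \<bar>a - b\<bar> < \<delta> \<longrightarrow> dst (s a) (s b) \<le> 1/5)"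

lemma path_top: "pathin (realization K) \<gamma> \<Longrightarrow> v \<in> {0..1} \<Longrightarrow> \<gamma> v \<in> topspace (realization K)"
  unfolding pathin_def by (auto dest: cm_in)

text \<open>Two lifts over close paths are compared along a fine subdivision: at each rung the
  closeness of the fibres forces the lifts to stay partners.\<close>

lemma clift_ladder:
  assumes \<gamma>: "pathin (realization K) \<gamma>" "pathin (realization K) \<gamma>'" and s: "clift \<gamma> s" "clift \<gamma>' s'"
    and c: "\<And>v. v \<in> {0..1} \<Longrightarrow> close (1/5) (\<gamma> v) (\<gamma>' v)" and d0: "dst (s 0) (s' 0) \<le> 1/5"
  shows "dst (s 1) (s' 1) \<le> 1/5"
proof -
  obtain \<delta> where \<delta>: "0 < \<delta>" "\<And>a b. a \<in> {0..1} \<Longrightarrow> b \<in> {0..1} \<Longrightarrow> \<bar>a - b\<bar> < \<delta> \<Longrightarrow> dst (s a) (s b) \<le> 1/5"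
    using s(1) unfolding clift_def by blast
  obtain \<delta>' where \<delta>': "0 < \<delta>'" "\<And>a b. a \<in> {0..1} \<Longrightarrow> b \<in> {0..1} \<Longrightarrow> \<bar>a - b\<bar> < \<delta>' \<Longrightarrow> dst (s' a) (s' b) \<le> 1/5"
    using s(2) unfolding clift_def by blast
  obtain N :: nat where N: "0 < N" "inverse (real N) < min \<delta> \<delta>'"
    using real_arch_inverse[of "min \<delta> \<delta>'"] \<delta>(1) \<delta>'(1) by auto
  have sS: "s v \<in> Sec (\<gamma> v)" "s' v \<in> Sec (\<gamma>' v)" if "v \<in> {0..1}" for v
    using s that unfolding clift_def by auto
  have sf: "step_fun (s v)" "step_fun (s' v)" if "v \<in> {0..1}" for v
    using Sec_step_fun[OF path_top[OF \<gamma>(1) that] sS(1)[OF that]] Sec_step_fun[OF path_top[OF \<gamma>(2) that] sS(2)[OF that]] by auto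
  have "dst (s (k / N)) (s' (k / N)) \<le> 1/5" if "k \<le> N" for k
    using that
  proof (induction k)
    case 0 then show ?case using d0 by simp
  next
    case (Suc k)
    let ?a = "real k / N" and ?b = "real (Suc k) / N"
    have ab: "?a \<in> {0..1}" "?b \<in> {0..1}" using Suc.prems N(1) by auto
    have "\<bar>?a - ?b\<bar> = inverse (real N)" using N(1) by (simp add: field_simps)
    then have st: "dst (s ?a) (s ?b) \<le> 1/5" "dst (s' ?a) (s' ?b) \<le> 1/5" using \<delta>(2)[OF ab] \<delta>'(2)[OF ab] N(2) by auto
    have IH: "dst (s ?a) (s' ?a) \<le> 1/5" using Suc by simp
    \<comment> \<open>\<tau> is the partner of \<open>s ?b\<close> in the other fibre. Going from
      \<tau> back along the ladder to \<open>s' ?b\<close> costs at most 4/5, so \<tau> equals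
      \<open>s' ?b\<close>.\<close>
    obtain \<tau> where \<tau>: "\<tau> \<in> Sec (\<gamma>' ?b)" "dst (s ?b) \<tau> \<le> 1/5"
      using c[OF ab(2)] sS(1)[OF ab(2)] unfolding close_def by blast
    have \<tau>f: "step_fun \<tau>" using Sec_step_fun[OF path_top[OF \<gamma>(2) ab(2)] \<tau>(1)] .
    have "dst \<tau> (s' ?b) \<le> dst \<tau> (s ?b) + (dst (s ?b) (s ?a) + (dst (s ?a) (s' ?a) + dst (s' ?a) (s' ?b)))"
      using dst_triangle[OF \<tau>f sf(1)[OF ab(2)] sf(2)[OF ab(2)]]
        dst_triangle[OF sf(1)[OF ab(2)] sf(1)[OF ab(1)] sf(2)[OF ab(2)]]
        dst_triangle[OF sf(1)[OF ab(1)] sf(2)[OF ab(1)] sf(2)[OF ab(2)]] by linarith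
    also have "\<dots> < 1"
      using \<tau>(2) st IH dst_sym[of \<tau> "s ?b"] dst_sym[of "s ?b" "s ?a"] by linarith
    finally have "\<tau> = s' ?b" using Sec_eq[OF path_top[OF \<gamma>(2) ab(2)] \<tau>(1) sS(2)[OF ab(2)]] by blast
    then show ?case using \<tau>(2) by simp
  qed
  from this[of N] show ?thesis using N(1) by simp
qed

lemma clift_unique:
  assumes \<gamma>: "pathin (realization K) \<gamma>" and s: "clift \<gamma> s" "clift \<gamma> s'" "s 0 = s' 0"
  shows "s 1 = s' 1"
proof (rule Sec_eq)
  show "\<gamma> 1 \<in> topspace (realization K)" using path_top[OF \<gamma>] by simp
  show "s 1 \<in> Sec (\<gamma> 1)" "s' 1 \<in> Sec (\<gamma> 1)" using s unfolding clift_def by auto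
  have "dst (s 1) (s' 1) \<le> 1/5"
    by (rule clift_ladder[OF \<gamma> \<gamma> s(1,2)]) (auto simp: close_refl s(3) dst_same)
  then show "dst (s 1) (s' 1) < 1" by simp
qed

lemma clift_reverse:
  assumes "clift \<gamma> s" shows "clift (\<lambda>v. \<gamma> (1 - v)) (\<lambda>v. s (1 - v))"
proof -
  obtain \<delta> where \<delta>: "0 < \<delta>" "\<forall>a\<in>{0..1}. \<forall>b\<in>{0..1}. \<bar>a - b\<bar> < \<delta> \<longrightarrow> dst (s a) (s b) \<le> 1/5"
    using assms unfolding clift_def by blast
  have "dst (s (1 - a)) (s (1 - b)) \<le> 1/5" if "a \<in> {0..1}" "b \<in> {0..1}" "\<bar>a - b\<bar> < \<delta>" for a b
  proof -
    have "1 - a \<in> {0..1}" "1 - b \<in> {0..1}" "\<bar>(1 - a) - (1 - b)\<bar> < \<delta>" using that by auto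
    then show ?thesis using \<delta>(2) by blast
  qed
  then show ?thesis using assms \<delta>(1) unfolding clift_def by auto
qed

lemma clift_affine:
  assumes s: "clift \<gamma> s" and c: "0 \<le> c" "0 \<le> d" "c + d \<le> 1"
  shows "clift (\<lambda>v. \<gamma> (c * v + d)) (\<lambda>v. s (c * v + d))"
proof -
  obtain \<delta> where \<delta>: "0 < \<delta>" "\<forall>a\<in>{0..1}. \<forall>b\<in>{0..1}. \<bar>a - b\<bar> < \<delta> \<longrightarrow> dst (s a) (s b) \<le> 1/5"
    using s unfolding clift_def by blast
  have in01: "c * v + d \<in> {0..1}" if "v \<in> {0..1}" for v
    using mult_left_mono[of v 1 c] c that by auto
  have "dst (s (c * a + d)) (s (c * b + d)) \<le> 1/5" if "a \<in> {0..1}" "b \<in> {0..1}" "\<bar>a - b\<bar> < \<delta>" for a b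
  proof -
    have "\<bar>c * a + d - (c * b + d)\<bar> = c * \<bar>a - b\<bar>" using c by (simp add: abs_mult flip: right_diff_distrib)
    also have "\<dots> \<le> 1 * \<bar>a - b\<bar>" using c by (intro mult_right_mono) auto
    finally show ?thesis using \<delta>(2) in01[OF that(1)] in01[OF that(2)] that(3) by simp
  qed
  then show ?thesis using s \<delta>(1) in01 unfolding clift_def by blast
qed

text \<open>Sections are chosen along a fine grid and then at every parameter near the grid point to
  its left. The constant is 1/15 because comparing two nearby parameters passes through three such
  errors, which must sum to 1/5.\<close>

lemma clift_exists:
  assumes \<gamma>: "pathin (realization K) \<gamma>" and s0: "\<sigma>0 \<in> Sec (\<gamma> 0)"
  shows "\<exists>s. clift \<gamma> s \<and> s 0 = \<sigma>0"
proof -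
  obtain \<delta> where \<delta>: "0 < \<delta>" "\<And>a b. a \<in> {0..1} \<Longrightarrow> b \<in> {0..1} \<Longrightarrow> dist a b < \<delta> \<Longrightarrow> close (1/15) (\<gamma> a) (\<gamma> b)"
    using uniformly_close[OF _ \<gamma>[unfolded pathin_def], of "1/15"] by (auto simp: compact_Icc)
  obtain N :: nat where N: "0 < N" "inverse (real N) < \<delta>" using real_arch_inverse[of \<delta>] \<delta>(1) by auto
  have close: "close (1/15) (\<gamma> a) (\<gamma> b)" if "a \<in> {0..1}" "b \<in> {0..1}" "\<bar>a - b\<bar> \<le> inverse N" for a b
    using \<delta>(2) that N(2) by (simp add: dist_real_def)
  \<comment> \<open>The grid is continued for all natural numbers by stopping at parameter 1, so
    that plain recursion can be used.\<close>
  let ?P = "\<lambda>k \<sigma>. \<sigma> \<in> Sec (\<gamma> (min 1 (real k / N)))"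
  have "\<exists>g. (\<forall>k. ?P k (g k)) \<and> g 0 = \<sigma>0 \<and> (\<forall>k. dst (g k) (g (Suc k)) \<le> 1/15)"
  proof -
    have ex: "\<exists>\<tau>. ?P (Suc k) \<tau> \<and> dst \<sigma> \<tau> \<le> 1/15" if "?P k \<sigma>" for k \<sigma>
    proof -
      have "\<bar>min 1 (real k / N) - min 1 (real (Suc k) / N)\<bar> \<le> inverse N"
        using N(1) by (auto simp: field_simps min_def)
      then have "close (1/15) (\<gamma> (min 1 (real k / N))) (\<gamma> (min 1 (real (Suc k) / N)))" by (intro close) auto
      then show ?thesis using that unfolding close_def by blast
    qed
    define nx where "nx k \<sigma> = (SOME \<tau>. ?P (Suc k) \<tau> \<and> dst \<sigma> \<tau> \<le> 1/15)" for k \<sigma>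
    have nx: "?P (Suc k) (nx k \<sigma>) \<and> dst \<sigma> (nx k \<sigma>) \<le> 1/15" if "?P k \<sigma>" for k \<sigma>
      unfolding nx_def by (rule someI_ex[of "\<lambda>\<tau>. ?P (Suc k) \<tau> \<and> dst \<sigma> \<tau> \<le> 1/15", OF ex[OF that]])
    define g where "g = rec_nat \<sigma>0 nx"
    have "?P k (g k)" for k
    proof (induction k)
      case 0 then show ?case using s0 by (simp add: g_def)
    next
      case (Suc k) then show ?case using nx[OF Suc] by (simp add: g_def)
    qed
    moreover from this have "dst (g k) (g (Suc k)) \<le> 1/15" for k using nx[of "g k" k] by (simp add: g_def)
    ultimately show ?thesis by (intro exI[of _ g]) (simp add: g_def)
  qed
  then obtain g where g: "\<And>k. ?P k (g k)" "g 0 = \<sigma>0" "\<And>k. dst (g k) (g (Suc k)) \<le> 1/15" by blast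
  \<comment> \<open>\<open>f v\<close> is the index of the last grid point not beyond
    \<open>v\<close>; parameters closer than the mesh have equal or adjacent indices.\<close>
  define f where "f v = nat \<lfloor>v * N\<rfloor>" for v :: real
  have f: "real (f v) \<le> v * N" "v * N < real (f v) + 1" "f v \<le> N" "real (f v) / N \<in> {0..1}" "\<bar>v - real (f v) / N\<bar> \<le> inverse N"
    if "v \<in> {0..1}" for v :: real
  proof -
    have "0 \<le> v * N" using that by simp
    then have r: "real (f v) = of_int \<lfloor>v * N\<rfloor>" by (simp add: f_def)
    show 1: "real (f v) \<le> v * N" "v * N < real (f v) + 1" unfolding r by linarith+
    have "v * N \<le> 1 * real N" using that by (intro mult_right_mono) auto
    then show 2: "f v \<le> N" using 1 by simp
    then show "real (f v) / N \<in> {0..1}" using N(1) by (simp add: divide_le_eq)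
    have e: "v - real (f v) / N = (v * N - real (f v)) / N" using N(1) by (simp add: field_simps)
    have "(v * N - real (f v)) / N \<le> 1 / N" using 1 by (intro divide_right_mono) auto
    moreover have "0 \<le> (v * N - real (f v)) / N" using 1 by simp
    ultimately show "\<bar>v - real (f v) / N\<bar> \<le> inverse N" unfolding e by (simp add: inverse_eq_divide)
  qed
  have gf: "g (f v) \<in> Sec (\<gamma> (real (f v) / N))" if "v \<in> {0..1}" for v :: real
    using g(1)[of "f v"] f(4)[OF that] by (simp add: min_absorb2)
  have "\<forall>v\<in>{0..1}. \<exists>\<tau>. \<tau> \<in> Sec (\<gamma> v) \<and> dst (g (f v)) \<tau> \<le> 1/15"
  proof
    fix v :: real assume v: "v \<in> {0..1}"
    have "close (1/15) (\<gamma> (real (f v) / N)) (\<gamma> v)" using f(4,5)[OF v] v by (intro close) (auto simp: abs_minus_commute)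
    then show "\<exists>\<tau>. \<tau> \<in> Sec (\<gamma> v) \<and> dst (g (f v)) \<tau> \<le> 1/15" using gf[OF v] unfolding close_def by blast
  qed
  from bchoice[OF this] obtain s where s: "\<And>v. v \<in> {0..1} \<Longrightarrow> s v \<in> Sec (\<gamma> v) \<and> dst (g (f v)) (s v) \<le> 1/15" by blast
  have sf: "step_fun (s v)" "step_fun (g (f v))" if "v \<in> {0..1}" for v :: real
    using Sec_step_fun[OF path_top[OF \<gamma> that]] Sec_step_fun[OF path_top[OF \<gamma> f(4)[OF that]] gf[OF that]] s[OF that] by auto
  have "dst (s a) (s b) \<le> 1/5" if ab: "a \<in> {0..1}" "b \<in> {0..1}" "\<bar>a - b\<bar> < inverse N" for a b
  proof -
    have "\<bar>a * N - b * N\<bar> = \<bar>a - b\<bar> * real N" by (simp add: abs_mult flip: left_diff_distrib)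
    also have "\<dots> < inverse N * real N" using ab(3) N(1) by (intro mult_strict_right_mono) auto
    also have "\<dots> = 1" using N(1) by simp
    finally have "\<bar>a * N - b * N\<bar> < 1" .
    then have "f a = f b \<or> f a = Suc (f b) \<or> f b = Suc (f a)" using f(1,2)[OF ab(1)] f(1,2)[OF ab(2)] by linarith
    then have "dst (g (f a)) (g (f b)) \<le> 1/15" 
      using g(3)[of "f a"] g(3)[of "f b"] dst_sym[of "g (f a)" "g (f b)"] dst_same[of "g (f a)"] by auto
    then show ?thesis
      using dst_triangle[OF sf(1)[OF ab(1)] sf(2)[OF ab(1)] sf(1)[OF ab(2)]]
        dst_triangle[OF sf(2)[OF ab(1)] sf(2)[OF ab(2)] sf(1)[OF ab(2)]]
        s[OF ab(1)] s[OF ab(2)] dst_sym[of "s a" "g (f a)"] by linarith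
  qed
  then have "clift \<gamma> s" using s N(1) unfolding clift_def by (auto intro!: exI[of _ "inverse (real N)"])
  moreover have "s 0 = \<sigma>0"
    using Sec_eq[OF path_top[OF \<gamma>, of 0], of "s 0" \<sigma>0] s[of 0] s0 g(2) dst_sym[of \<sigma>0 "s 0"] by (simp add: f_def)
  ultimately show ?thesis by blast
qed

text \<open>Each row of the square is lifted from the same starting section. The final sections of
  neighbouring rows lie over the same point and are close, so they are equal; hence nothing changes
  from the bottom row to the top row.\<close>

lemma clift_homotopy:
  assumes H: "continuous_map (top_of_set ({0..1::real} \<times> {0..1::real})) (realization K) H"
    and base: "\<And>v. v \<in> {0..1} \<Longrightarrow> H (0, v) = z0" "\<And>v. v \<in> {0..1} \<Longrightarrow> H (1, v) = z1"
    and s: "clift (\<lambda>v. H (v, 0)) s" "clift (\<lambda>v. H (v, 1)) s'" "s 0 = s' 0"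
  shows "s 1 = s' 1"
proof -
  have P: "compact ({0..1::real} \<times> {0..1::real})" by (intro compact_Times compact_Icc)
  obtain \<delta> where \<delta>: "0 < \<delta>" "\<And>a b. a \<in> {0..1} \<times> {0..1} \<Longrightarrow> b \<in> {0..1} \<times> {0..1} \<Longrightarrow> dist a b < \<delta> \<Longrightarrow> close (1/5) (H a) (H b)"
    using uniformly_close[OF P H, of "1/5"] by auto
  obtain N :: nat where N: "0 < N" "inverse (real N) < \<delta>" using real_arch_inverse[of \<delta>] \<delta>(1) by auto
  have row: "pathin (realization K) (\<lambda>v. H (v, w))" if "w \<in> {0..1}" for w
  proof -
    have "continuous_map (top_of_set {0..1}) (top_of_set ({0..1} \<times> {0..1})) (\<lambda>v. (v, w))"
      using that by (auto simp: continuous_map_in_subtopology intro!: continuous_intros)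
    from continuous_map_compose[OF this H] show ?thesis unfolding pathin_def o_def .
  qed
  have s0: "s 0 \<in> Sec z0" using s(1) base(1)[of 0] unfolding clift_def by auto
  have "\<exists>S. clift (\<lambda>v. H (v, w)) S \<and> S 0 = s 0" if "w \<in> {0..1}" for w
    using clift_exists[OF row[OF that]] s0 base(1)[OF that] by simp
  then obtain S where S: "\<And>w. w \<in> {0..1} \<Longrightarrow> clift (\<lambda>v. H (v, w)) (S w) \<and> S w 0 = s 0" by metis
  have t1: "z1 \<in> topspace (realization K)" using path_top[OF row[of 0], of 1] base(2)[of 0] by simp
  have "S (k / N) 1 = s 1" if "k \<le> N" for k
    using that
  proof (induction k)
    case 0
    then show ?case using clift_unique[OF row[of 0], of "S 0" s] S[of 0] s(1) by simp
  next
    case (Suc k)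
    let ?a = "real k / N" and ?b = "real (Suc k) / N"
    have ab: "?a \<in> {0..1}" "?b \<in> {0..1}" using Suc.prems N(1) by auto
    have "\<bar>?a - ?b\<bar> = inverse (real N)" using N(1) by (simp add: field_simps)
    then have "close (1/5) (H (v, ?a)) (H (v, ?b))" if "v \<in> {0..1}" for v
      using \<delta>(2)[of "(v, ?a)" "(v, ?b)"] that ab N(2) by (simp add: dist_Pair_Pair dist_real_def)
    then have "dst (S ?a 1) (S ?b 1) \<le> 1/5"
      using clift_ladder[OF row[OF ab(1)] row[OF ab(2)], of "S ?a" "S ?b"] S[OF ab(1)] S[OF ab(2)] by (simp add: dst_same)
    moreover have "S w 1 \<in> Sec z1" if "w \<in> {0..1}" for w
    proof -
      have "\<forall>v\<in>{0..1}. S w v \<in> Sec (H (v, w))" using S[OF that] unfolding clift_def by blast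
      then have "S w 1 \<in> Sec (H (1, w))" by simp
      then show ?thesis using base(2)[OF that] by simp
    qed
    then have "S ?a 1 \<in> Sec z1" "S ?b 1 \<in> Sec z1" using ab by blast+
    ultimately have "S ?a 1 = S ?b 1" using Sec_eq[OF t1] by force
    then show ?case using Suc by simp
  qed
  from this[of N] have "S 1 1 = s 1" using N(1) by simp
  moreover have "S 1 1 = s' 1" using clift_unique[OF row[of 1], of "S 1" s'] S[of 1] s(2,3) by simp
  ultimately show ?thesis by simp
qed

text \<open>The partition belonging to a vertex consists of one interval, so its sections are the
  constant functions given by the labels over it.\<close>

lemma Sec_vertex:
  assumes v: "v \<in> simplices K 0" and t: "t \<in> standard_simplex 0"
  shows "Sec (rcls K ((0, v), t)) = {\<sigma>. \<exists>a. T (edg K 0 v 0 0) a a \<and> \<sigma> = (\<lambda>u. if 0 \<le> u \<and> u < 1 then a else undefined)}"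
proof -
  have i: "idx t u = 0" if "u < 1" for u using idx_le[OF t that] by simp
  have e: "sfun s t = (\<lambda>u. if 0 \<le> u \<and> u < 1 then s 0 else undefined)" for s :: "nat \<Rightarrow> 'l"
    by (auto simp: sfun_def i)
  have "lifts 0 v = {s \<in> extensional {..0::nat}. T (edg K 0 v 0 0) (s 0) (s 0)}" by (auto simp: lifts_def)
  moreover have "\<exists>s\<in>{s \<in> extensional {..0::nat}. T (edg K 0 v 0 0) (s 0) (s 0)}. s 0 = a" if "T (edg K 0 v 0 0) a a" for a
    using that by (intro bexI[of _ "\<lambda>_\<in>{..0::nat}. a"]) auto
  ultimately show ?thesis unfolding Sec_rcls[OF v t] by (fastforce simp: e)
qed

end

section \<open>Kan fibrations that are weak equivalences\<close>

lemma simplicial_fun_in: "simplicial_fun X Y f \<Longrightarrow> x \<in> simplices X n \<Longrightarrow> f n x \<in> simplices Y n"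
  by (simp add: simplicial_fun_def)

lemma simplicial_fun_pull:
  "simplicial_fun X Y f \<Longrightarrow> \<theta> \<in> Delta m n \<Longrightarrow> x \<in> simplices X n \<Longrightarrow> f m (pull X m n \<theta> x) = pull Y m n \<theta> (f n x)"
  by (simp add: simplicial_fun_def)

lemma simplicial_fun_vtx:
  "simplicial_fun X Y f \<Longrightarrow> x \<in> simplices X n \<Longrightarrow> i \<le> n \<Longrightarrow> f 0 (vtx X n x i) = vtx Y n (f n x) i"
  unfolding vtx_def by (rule simplicial_fun_pull[OF _ vtx_Delta])

lemma simplicial_fun_edg:
  "simplicial_fun X Y f \<Longrightarrow> x \<in> simplices X n \<Longrightarrow> i \<le> j \<Longrightarrow> j \<le> n \<Longrightarrow> f 1 (edg X n x i j) = edg Y n (f n x) i j"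
  unfolding edg_def by (rule simplicial_fun_pull[OF _ edg_Delta])

lemma id_Delta: "(\<lambda>i\<in>{..n}. i) \<in> Delta n n"
  by (auto simp: Delta_def mono_on_def)

lemma const_Delta: "k \<le> n \<Longrightarrow> (\<lambda>_\<in>{..m}. k) \<in> Delta m n"
  by (auto simp: Delta_def mono_on_def)

lemma comp_Delta: "\<phi> \<in> Delta l m \<Longrightarrow> \<theta> \<in> Delta m n \<Longrightarrow> compose {..l} \<theta> \<phi> \<in> Delta l n"
  unfolding Delta_def mono_on_def by (auto simp: compose_def PiE_def Pi_def)

lemma std_sset_simps: "simplices (std_sset n) m = Delta m n" "pull (std_sset n) l m \<phi> \<theta> = compose {..l} \<theta> \<phi>"
  by (simp_all add: std_sset_def)

lemma yoneda_simplicial: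
  assumes "simplicial_set Y" "y \<in> simplices Y n"
  shows "simplicial_fun (std_sset n) Y (\<lambda>m \<theta>. pull Y m n \<theta> y)"
  using simplicial_set.pull_in[OF assms(1) _ assms(2)] simplicial_set.pull_comp[OF assms(1) _ _ assms(2)]
  by (simp add: simplicial_fun_def std_sset_simps)

lemma yoneda_value:
  assumes c: "simplicial_fun (std_sset n) Y c" and \<theta>: "\<theta> \<in> Delta m n"
  shows "pull Y m n \<theta> (c n (\<lambda>i\<in>{..n}. i)) = c m \<theta>"
proof -
  have "compose {..m} (\<lambda>i\<in>{..n}. i) \<theta> = \<theta>"
    using \<theta> by (auto simp: Delta_def compose_def PiE_def Pi_def extensional_def fun_eq_iff)
  then show ?thesis
    using simplicial_fun_pull[OF c \<theta>, of "\<lambda>i\<in>{..n}. i"] id_Delta by (simp add: std_sset_simps)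
qed

context simplicial_set
begin

lemma pull_const:
  assumes x: "x \<in> simplices X n" and k: "k \<le> n"
  shows "pull X m n (\<lambda>_\<in>{..m}. k) x = pull X m 0 (\<lambda>_\<in>{..m}. 0) (vtx X n x k)"
proof -
  have "compose {..m} (\<lambda>_\<in>{..0::nat}. k) (\<lambda>_\<in>{..m}. 0) = (\<lambda>_\<in>{..m}. k)"
    by (auto simp: compose_def restrict_def fun_eq_iff)
  from pull_comp[OF const_Delta[of 0 0 m] vtx_Delta[OF k] x, unfolded this]
  show ?thesis by (simp add: vtx_def)
qed

end

text \<open>Every simplex of the horn in the 1-simplex is constant at \<open>k\<close>, so a map out
  of the horn amounts to the vertex \<open>z\<close>, and the filler over \<open>e\<close> is an
  edge with that end.\<close>

lemma kan_path_lifting: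
  assumes Z: "simplicial_set Z" and W: "simplicial_set W" and g: "Kan_fibration Z W g"
    and k: "k \<le> 1" and z: "z \<in> simplices Z 0" and e: "e \<in> simplices W 1" "vtx W 1 e k = g 0 z"
  shows "\<exists>\<zeta>\<in>simplices Z 1. g 1 \<zeta> = e \<and> vtx Z 1 \<zeta> k = z"
proof -
  interpret Z: simplicial_set Z by (rule Z)
  interpret W: simplicial_set W by (rule W)
  have gs: "simplicial_fun Z W g" using g by (simp add: Kan_fibration_def)
  define a where "a m \<theta> = pull Z m 0 (\<lambda>_\<in>{..m}. 0) z" for m and \<theta> :: "nat \<Rightarrow> nat"
  have hs: "simplices (horn 1 k) m = {\<theta> \<in> Delta m 1. \<exists>i\<le>1. i \<noteq> k \<and> i \<notin> \<theta> ` {..m}}" for m by (simp add: horn_def)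
  have hp: "pull (horn 1 k) l m \<phi> \<theta> = compose {..l} \<theta> \<phi>" for l m \<phi> \<theta> by (simp add: horn_def std_sset_simps)
  have hc: "\<theta> = (\<lambda>_\<in>{..m}. k)" if h: "\<theta> \<in> simplices (horn 1 k) m" for \<theta> m
  proof -
    obtain i where i: "\<theta> \<in> Delta m 1" "i \<le> 1" "i \<noteq> k" "i \<notin> \<theta> ` {..m}" using h unfolding hs by blast
    have "\<theta> j = k" if "j \<le> m" for j
    proof -
      have "\<theta> j \<le> 1" "\<theta> j \<noteq> i" using Delta_le[OF i(1) that] i(4) that by auto
      then show ?thesis using i(2,3) k by linarith
    qed
    then show ?thesis using i(1) by (auto simp: Delta_def PiE_def extensional_def restrict_def fun_eq_iff)
  qed
  have as: "simplicial_fun (horn 1 k) Z a"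
    unfolding simplicial_fun_def hp
  proof (intro conjI allI ballI)
    show "a n x \<in> simplices Z n" for n x unfolding a_def by (rule Z.pull_in[OF const_Delta z]) simp
    fix l m \<phi> \<theta> assume \<phi>: "\<phi> \<in> Delta l m"
    have "compose {..l} (\<lambda>_\<in>{..m}. 0 :: nat) \<phi> = (\<lambda>_\<in>{..l}. 0)"
      using Delta_le[OF \<phi>] by (auto simp: compose_def restrict_def fun_eq_iff)
    then show "a l (compose {..l} \<theta> \<phi>) = pull Z l m \<phi> (a m \<theta>)"
      unfolding a_def using Z.pull_comp[OF \<phi> const_Delta[of 0 0 m] z] by simp
  qed
  have agree: "g m (a m \<theta>) = pull W m 1 \<theta> e" if "\<theta> \<in> simplices (horn 1 k) m" for m \<theta>
  proof -
    have "g m (a m \<theta>) = pull W m 0 (\<lambda>_\<in>{..m}. 0) (vtx W 1 e k)"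
      unfolding a_def e(2) by (rule simplicial_fun_pull[OF gs const_Delta z]) simp
    then show ?thesis using W.pull_const[OF e(1) k] hc[OF that] by simp
  qed
  obtain c where c: "simplicial_fun (std_sset 1) Z c" "\<forall>m. \<forall>\<theta>\<in>simplices (horn 1 k) m. c m \<theta> = a m \<theta>"
      "\<forall>m. \<forall>\<theta>\<in>Delta m 1. g m (c m \<theta>) = pull W m 1 \<theta> e"
    using g[unfolded Kan_fibration_def, THEN conjunct2, rule_format, of 1 k a "\<lambda>m \<theta>. pull W m 1 \<theta> e"]
      as yoneda_simplicial[OF W e(1)] agree k by blast
  let ?\<zeta> = "c 1 (\<lambda>i\<in>{..1}. i)"
  have "?\<zeta> \<in> simplices Z 1" using simplicial_fun_in[OF c(1)] id_Delta[of 1] by (simp add: std_sset_simps)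
  moreover have "g 1 ?\<zeta> = e" using c(3) id_Delta[of 1] W.pull_id[OF e(1)] by simp
  moreover have "vtx Z 1 ?\<zeta> k = z"
  proof -
    have kD: "(\<lambda>_\<in>{..0::nat}. k) \<in> Delta 0 1" by (rule vtx_Delta[OF k])
    have kh: "(\<lambda>_\<in>{..0::nat}. k) \<in> simplices (horn 1 k) 0"
    proof -
      have "1 - k \<le> 1 \<and> 1 - k \<noteq> k \<and> 1 - k \<notin> (\<lambda>_\<in>{..0::nat}. k) ` {..0}"
        using k by (cases "k = 0") auto
      then show ?thesis unfolding hs using kD by blast
    qed
    have "vtx Z 1 ?\<zeta> k = a 0 (\<lambda>_\<in>{..0::nat}. k)"
      unfolding vtx_def using yoneda_value[OF c(1) kD] c(2) kh by simp
    also have "\<dots> = vtx Z 0 z 0" by (simp add: a_def vtx_def)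
    finally show ?thesis using Z.vtx_self[OF z] by simp
  qed
  ultimately show ?thesis by blast
qed

definition face2 :: "nat \<Rightarrow> nat \<Rightarrow> nat" where
  "face2 i = (\<lambda>j\<in>{..1}. if j < i then j else Suc j)"

definition coll :: "nat \<Rightarrow> nat \<Rightarrow> nat" where
  "coll i j = (if j < i then j else j - 1)"

lemma face2_Delta: "face2 i \<in> Delta 1 2"
  by (auto simp: face2_def Delta_def mono_on_def)

lemma face2_image: "i \<le> 2 \<Longrightarrow> face2 i ` {..1} = {..2} - {i}"
  by (auto simp: face2_def image_iff atMost_Suc numeral_2_eq_2)

lemma face2_edg: "pull X 1 2 (face2 0) s = edg X 2 s 1 2" "pull X 1 2 (face2 1) s = edg X 2 s 0 2"
  "pull X 1 2 (face2 2) s = edg X 2 s 0 1"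
proof -
  have "face2 0 = (\<lambda>k\<in>{..1}. if k = 0 then 1 else 2)" "face2 1 = (\<lambda>k\<in>{..1}. if k = 0 then 0 else 2)"
    "face2 2 = (\<lambda>k\<in>{..1}. if k = 0 then 0 else 1)"
    by (auto simp: face2_def fun_eq_iff restrict_def le_Suc_eq)
  then show "pull X 1 2 (face2 0) s = edg X 2 s 1 2" "pull X 1 2 (face2 1) s = edg X 2 s 0 2"
    "pull X 1 2 (face2 2) s = edg X 2 s 0 1" by (simp_all only: edg_def)
qed

text \<open>The horn consists of the faces \<open>i1\<close> and \<open>i2\<close>; \<open>coll i k\<close> is the position of the vertex \<open>k\<close> in the face \<open>i\<close>.\<close>

lemma kan_triangle_lifting:
  assumes Z: "simplicial_set Z" and W: "simplicial_set W" and g: "Kan_fibration Z W g"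
    and k: "k \<le> 2" "i1 \<le> 2" "i2 \<le> 2" "i1 \<noteq> k" "i2 \<noteq> k" "i1 \<noteq> i2"
    and s: "s \<in> simplices W 2" and x: "x1 \<in> simplices Z 1" "x2 \<in> simplices Z 1"
    and gx: "g 1 x1 = pull W 1 2 (face2 i1) s" "g 1 x2 = pull W 1 2 (face2 i2) s"
    and v: "vtx Z 1 x1 (coll i1 k) = vtx Z 1 x2 (coll i2 k)"
  shows "\<exists>\<tau>\<in>simplices Z 2. g 2 \<tau> = s \<and> pull Z 1 2 (face2 i1) \<tau> = x1 \<and> pull Z 1 2 (face2 i2) \<tau> = x2"
proof -
  interpret Z: simplicial_set Z by (rule Z)
  interpret W: simplicial_set W by (rule W)
  have gs: "simplicial_fun Z W g" using g by (simp add: Kan_fibration_def)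
  define col where "col i m \<theta> = (\<lambda>j\<in>{..m}. coll i (\<theta> j))" for i m and \<theta> :: "nat \<Rightarrow> nat"
  have colD: "col i m \<theta> \<in> Delta m 1" if "\<theta> \<in> Delta m 2" "i \<notin> \<theta> ` {..m}" "i \<le> 2" for i m \<theta>
  proof -
    have le: "\<theta> j \<le> 2" "\<theta> j \<noteq> i" if "j \<le> m" for j using Delta_le[OF \<open>\<theta> \<in> Delta m 2\<close> that] \<open>i \<notin> \<theta> ` {..m}\<close> that by auto
    have mo: "\<theta> j \<le> \<theta> j'" if "j \<le> j'" "j' \<le> m" for j j'
      using \<open>\<theta> \<in> Delta m 2\<close> that by (auto simp: Delta_def mono_on_def)
    have "coll i (\<theta> j) \<le> 1" if "j \<le> m" for j
      using le[OF that] \<open>i \<le> 2\<close> by (auto simp: coll_def)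
    moreover have "coll i (\<theta> j) \<le> coll i (\<theta> j')" if "j \<le> j'" "j' \<le> m" for j j'
      using mo[OF that] le[OF that(2)] by (auto simp: coll_def)
    ultimately show ?thesis unfolding col_def Delta_def mono_on_def by auto
  qed
  have colc: "compose {..l} (col i m \<theta>) \<phi> = col i l (compose {..l} \<theta> \<phi>)" if "\<phi> \<in> Delta l m" for i l m \<theta> \<phi>
    using Delta_le[OF that] by (auto simp: col_def compose_def restrict_def fun_eq_iff)
  have coli: "compose {..m} (face2 i) (col i m \<theta>) = \<theta>" if "\<theta> \<in> Delta m 2" "i \<notin> \<theta> ` {..m}" "i \<le> 2" for i m \<theta>
  proof (rule extensionalityI)
    show "\<theta> \<in> extensional {..m}" using that by (auto simp: Delta_def PiE_def)
    fix j assume j: "j \<in> {..m}"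
    have "\<theta> j \<le> 2" "\<theta> j \<noteq> i" using Delta_le[OF that(1)] that(2) j by auto
    then show "compose {..m} (face2 i) (col i m \<theta>) j = \<theta> j"
      using j that(3) by (auto simp: compose_def col_def face2_def coll_def)
  qed (auto simp: compose_def)
  have fcol: "col i 1 (face2 i) = (\<lambda>j\<in>{..1}. j)" if "i \<le> 2" for i
    by (auto simp: col_def face2_def coll_def fun_eq_iff restrict_def)
  have hs: "simplices (horn 2 k) m = {\<theta> \<in> Delta m 2. i1 \<notin> \<theta> ` {..m} \<or> i2 \<notin> \<theta> ` {..m}}" for m
  proof -
    have "(\<exists>i\<le>2. i \<noteq> k \<and> P i) \<longleftrightarrow> P i1 \<or> P i2" for P
    proof -
      have "i = i1 \<or> i = i2" if "i \<le> 2" "i \<noteq> k" for i using that k by linarith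
      then show ?thesis using k by metis
    qed
    then show ?thesis by (simp add: horn_def)
  qed
  have hp: "pull (horn 2 k) l m \<phi> \<theta> = compose {..l} \<theta> \<phi>" for l m \<phi> \<theta> by (simp add: horn_def std_sset_simps)
  define a where "a m \<theta> = (if i1 \<notin> \<theta> ` {..m} then pull Z m 1 (col i1 m \<theta>) x1 else pull Z m 1 (col i2 m \<theta>) x2)"
    for m and \<theta> :: "nat \<Rightarrow> nat"
  have a1: "a m \<theta> = pull Z m 1 (col i1 m \<theta>) x1" if "i1 \<notin> \<theta> ` {..m}" for m \<theta> using that by (simp add: a_def)
  \<comment> \<open>The two faces meet in the constant simplices at \<open>k\<close>, where both
    formulas give the degenerate simplex on the common vertex of \<open>x1\<close> and
    \<open>x2\<close>.\<close>
  have a2: "a m \<theta> = pull Z m 1 (col i2 m \<theta>) x2" if \<theta>: "\<theta> \<in> Delta m 2" "i2 \<notin> \<theta> ` {..m}" for m \<theta>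
  proof (cases "i1 \<notin> \<theta> ` {..m}")
    case True
    have tk: "\<theta> j = k" if "j \<le> m" for j
    proof -
      have "\<theta> j \<le> 2" "\<theta> j \<noteq> i1" "\<theta> j \<noteq> i2" using Delta_le[OF \<theta>(1) that] True \<theta>(2) that by auto
      then show ?thesis using k by linarith
    qed
    have ck: "col i m \<theta> = (\<lambda>_\<in>{..m}. coll i k)" for i using tk by (auto simp: col_def restrict_def fun_eq_iff)
    have "coll i1 k \<le> 1" "coll i2 k \<le> 1" using k by (auto simp: coll_def)
    then show ?thesis unfolding a1[OF True] ck using Z.pull_const x v by metis
  next
    case False then show ?thesis by (simp add: a_def)
  qed
  have as: "simplicial_fun (horn 2 k) Z a"
    unfolding simplicial_fun_def hp
  proof (intro conjI allI ballI)
    show "a m \<theta> \<in> simplices Z m" if "\<theta> \<in> simplices (horn 2 k) m" for m \<theta>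
      using that colD[of \<theta> m] Z.pull_in x k unfolding hs a_def by auto
    fix l m \<phi> \<theta> assume \<phi>: "\<phi> \<in> Delta l m" and \<theta>: "\<theta> \<in> simplices (horn 2 k) m"
    have \<theta>D: "\<theta> \<in> Delta m 2" using \<theta> by (simp add: hs)
    have sub: "compose {..l} \<theta> \<phi> ` {..l} \<subseteq> \<theta> ` {..m}" using Delta_le[OF \<phi>] by (auto simp: compose_def)
    have cD: "compose {..l} \<theta> \<phi> \<in> Delta l 2" by (rule comp_Delta[OF \<phi> \<theta>D])
    show "a l (compose {..l} \<theta> \<phi>) = pull Z l m \<phi> (a m \<theta>)"
    proof (cases "i1 \<notin> \<theta> ` {..m}")
      case True
      then have "i1 \<notin> compose {..l} \<theta> \<phi> ` {..l}" using sub by blast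
      then show ?thesis
        using a1[OF True] a1[of "compose {..l} \<theta> \<phi>" l] Z.pull_comp[OF \<phi> colD[OF \<theta>D True k(2)] x(1)] colc[OF \<phi>] by simp
    next
      case False
      then have i2: "i2 \<notin> \<theta> ` {..m}" using \<theta> by (simp add: hs)
      then have "i2 \<notin> compose {..l} \<theta> \<phi> ` {..l}" using sub by blast
      then show ?thesis
        using a2[OF \<theta>D i2] a2[OF cD] Z.pull_comp[OF \<phi> colD[OF \<theta>D i2 k(3)] x(2)] colc[OF \<phi>] by simp
    qed
  qed
  have ag: "g m (pull Z m 1 (col i m \<theta>) x) = pull W m 2 \<theta> s"
    if "\<theta> \<in> Delta m 2" "i \<notin> \<theta> ` {..m}" "i \<le> 2" "x \<in> simplices Z 1" "g 1 x = pull W 1 2 (face2 i) s" for i m \<theta> x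
    using simplicial_fun_pull[OF gs colD[OF that(1,2,3)] that(4)] that(5)
      W.pull_comp[OF colD[OF that(1,2,3)] face2_Delta s, of i] coli[OF that(1,2,3)] by simp
  have agree: "g m (a m \<theta>) = pull W m 2 \<theta> s" if "\<theta> \<in> simplices (horn 2 k) m" for m \<theta>
    using that ag[OF _ _ k(2) x(1) gx(1)] ag[OF _ _ k(3) x(2) gx(2)] unfolding hs a_def by auto
  obtain c where c: "simplicial_fun (std_sset 2) Z c" "\<forall>m. \<forall>\<theta>\<in>simplices (horn 2 k) m. c m \<theta> = a m \<theta>"
      "\<forall>m. \<forall>\<theta>\<in>Delta m 2. g m (c m \<theta>) = pull W m 2 \<theta> s"
    using g[unfolded Kan_fibration_def, THEN conjunct2, rule_format, of 2 k a "\<lambda>m \<theta>. pull W m 2 \<theta> s"]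
      as yoneda_simplicial[OF W s] agree k(1) by auto
  let ?\<tau> = "c 2 (\<lambda>i\<in>{..2}. i)"
  have "?\<tau> \<in> simplices Z 2" using simplicial_fun_in[OF c(1)] id_Delta[of 2] by (simp add: std_sset_simps)
  moreover have "g 2 ?\<tau> = s" using c(3) id_Delta[of 2] W.pull_id[OF s] by simp
  moreover have "pull Z 1 2 (face2 i1) ?\<tau> = x1"
  proof -
    have m: "i1 \<notin> face2 i1 ` {..1}" using face2_image[OF k(2)] by auto
    then have "face2 i1 \<in> simplices (horn 2 k) 1" unfolding hs using face2_Delta by auto
    then show ?thesis
      using yoneda_value[OF c(1) face2_Delta] c(2) a1[OF m] fcol[OF k(2)] Z.pull_id[OF x(1)] by simp
  qed
  moreover have "pull Z 1 2 (face2 i2) ?\<tau> = x2"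
  proof -
    have m: "i2 \<notin> face2 i2 ` {..1}" using face2_image[OF k(3)] by auto
    then have "face2 i2 \<in> simplices (horn 2 k) 1" unfolding hs using face2_Delta by auto
    then show ?thesis
      using yoneda_value[OF c(1) face2_Delta] c(2) a2[OF face2_Delta m] fcol[OF k(3)] Z.pull_id[OF x(2)] by simp
  qed
  ultimately show ?thesis by blast
qed

section \<open>Components of the fibres of a Kan fibration\<close>

lemma std0: "(\<lambda>i. if i = 0 then 1 else 0) \<in> standard_simplex 0"
  by (simp add: standard_simplex_def)

definition pt :: "'c sset \<Rightarrow> 'c \<Rightarrow> 'c rpoint set" where
  "pt X v = rcls X ((0, v), (\<lambda>i. if i = 0 then 1 else 0))"

lemma pt_top: "v \<in> simplices X 0 \<Longrightarrow> pt X v \<in> topspace (realization X)"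
  unfolding pt_def using std0 by (intro rcls_topspace) (simp add: topspace_presum)

text \<open>
  The components of the fibres of a Kan fibration form a local system, in which the points of the
  total space provide tautological sections.
\<close>

locale kan_fib = Z: simplicial_set Z + W: simplicial_set W
  for Z :: "'a sset" and W :: "'b sset" +
  fixes g :: "nat \<Rightarrow> 'a \<Rightarrow> 'b"
  assumes kan: "Kan_fibration Z W g"
begin

lemma gs: "simplicial_fun Z W g" using kan by (simp add: Kan_fibration_def)

text \<open>Over a degenerate edge this is the relation of being joined by an edge within the fibre;
  the Kan condition makes it an equivalence relation there.\<close>

definition R :: "'b \<Rightarrow> 'a \<Rightarrow> 'a \<Rightarrow> bool" where
  "R e z z' \<longleftrightarrow> (\<exists>\<zeta>\<in>simplices Z 1. g 1 \<zeta> = e \<and> vtx Z 1 \<zeta> 0 = z \<and> vtx Z 1 \<zeta> 1 = z')"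

definition dg :: "'b \<Rightarrow> 'b" where "dg w = edg W 0 w 0 0"

lemma edges2: "x \<in> simplices Z 2 \<Longrightarrow> i \<le> j \<Longrightarrow> j \<le> 2 \<Longrightarrow> edg Z 2 x i j \<in> simplices Z 1 \<and>
    vtx Z 1 (edg Z 2 x i j) 0 = vtx Z 2 x i \<and> vtx Z 1 (edg Z 2 x i j) 1 = vtx Z 2 x j \<and>
    g 1 (edg Z 2 x i j) = edg W 2 (g 2 x) i j"
  using Z.edg_in Z.vtx_edg simplicial_fun_edg[OF gs] by simp

lemma R_in: "R e z z' \<Longrightarrow> z \<in> simplices Z 0 \<and> z' \<in> simplices Z 0 \<and> g 0 z = vtx W 1 e 0 \<and> g 0 z' = vtx W 1 e 1"
  unfolding R_def using Z.vtx_in simplicial_fun_vtx[OF gs] by fastforce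

text \<open>The two given edges form a horn over \<open>s\<close>, and the remaining face of a
  filler is the edge sought. The two lemmas that follow do the same with the horns at the outer
  vertices 0 and 2.\<close>

lemma R_tri1:
  assumes s: "s \<in> simplices W 2" and r: "R (edg W 2 s 0 1) a b" "R (edg W 2 s 1 2) b c"
  shows "R (edg W 2 s 0 2) a c"
proof -
  obtain x1 x2 where x: "x1 \<in> simplices Z 1" "g 1 x1 = edg W 2 s 0 1" "vtx Z 1 x1 0 = a" "vtx Z 1 x1 1 = b"
      "x2 \<in> simplices Z 1" "g 1 x2 = edg W 2 s 1 2" "vtx Z 1 x2 0 = b" "vtx Z 1 x2 1 = c"
    using r unfolding R_def by blast
  have "\<exists>\<tau>\<in>simplices Z 2. g 2 \<tau> = s \<and> pull Z 1 2 (face2 2) \<tau> = x1 \<and> pull Z 1 2 (face2 0) \<tau> = x2"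
    by (rule kan_triangle_lifting[OF Z.simplicial_set_axioms W.simplicial_set_axioms kan, where k = 1])
      (use s x in \<open>simp_all add: face2_edg[unfolded One_nat_def] coll_def\<close>)
  then obtain \<tau> where \<tau>: "\<tau> \<in> simplices Z 2" "g 2 \<tau> = s" "edg Z 2 \<tau> 0 1 = x1" "edg Z 2 \<tau> 1 2 = x2"
    unfolding face2_edg by blast
  show ?thesis
    unfolding R_def
    by (intro bexI[of _ "edg Z 2 \<tau> 0 2"])
      (use edges2[OF \<tau>(1), of 0 2] edges2[OF \<tau>(1), of 0 1] edges2[OF \<tau>(1), of 1 2] \<tau> x in auto)
qed

lemma R_tri0:
  assumes s: "s \<in> simplices W 2" and r: "R (edg W 2 s 0 1) a b" "R (edg W 2 s 0 2) a c"
  shows "R (edg W 2 s 1 2) b c"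
proof -
  obtain x1 x2 where x: "x1 \<in> simplices Z 1" "g 1 x1 = edg W 2 s 0 1" "vtx Z 1 x1 0 = a" "vtx Z 1 x1 1 = b"
      "x2 \<in> simplices Z 1" "g 1 x2 = edg W 2 s 0 2" "vtx Z 1 x2 0 = a" "vtx Z 1 x2 1 = c"
    using r unfolding R_def by blast
  have "\<exists>\<tau>\<in>simplices Z 2. g 2 \<tau> = s \<and> pull Z 1 2 (face2 2) \<tau> = x1 \<and> pull Z 1 2 (face2 1) \<tau> = x2"
    by (rule kan_triangle_lifting[OF Z.simplicial_set_axioms W.simplicial_set_axioms kan, where k = 0])
      (use s x in \<open>simp_all add: face2_edg[unfolded One_nat_def] coll_def\<close>)
  then obtain \<tau> where \<tau>: "\<tau> \<in> simplices Z 2" "g 2 \<tau> = s" "edg Z 2 \<tau> 0 1 = x1" "edg Z 2 \<tau> 0 2 = x2"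
    unfolding face2_edg by blast
  show ?thesis
    unfolding R_def
    by (intro bexI[of _ "edg Z 2 \<tau> 1 2"])
      (use edges2[OF \<tau>(1), of 0 2] edges2[OF \<tau>(1), of 0 1] edges2[OF \<tau>(1), of 1 2] \<tau> x in auto)
qed

lemma R_tri2:
  assumes s: "s \<in> simplices W 2" and r: "R (edg W 2 s 0 2) a c" "R (edg W 2 s 1 2) b c"
  shows "R (edg W 2 s 0 1) a b"
proof -
  obtain x1 x2 where x: "x1 \<in> simplices Z 1" "g 1 x1 = edg W 2 s 0 2" "vtx Z 1 x1 0 = a" "vtx Z 1 x1 1 = c"
      "x2 \<in> simplices Z 1" "g 1 x2 = edg W 2 s 1 2" "vtx Z 1 x2 0 = b" "vtx Z 1 x2 1 = c"
    using r unfolding R_def by blast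
  have "\<exists>\<tau>\<in>simplices Z 2. g 2 \<tau> = s \<and> pull Z 1 2 (face2 1) \<tau> = x1 \<and> pull Z 1 2 (face2 0) \<tau> = x2"
    by (rule kan_triangle_lifting[OF Z.simplicial_set_axioms W.simplicial_set_axioms kan, where k = 2])
      (use s x in \<open>simp_all add: face2_edg[unfolded One_nat_def] coll_def\<close>)
  then obtain \<tau> where \<tau>: "\<tau> \<in> simplices Z 2" "g 2 \<tau> = s" "edg Z 2 \<tau> 0 2 = x1" "edg Z 2 \<tau> 1 2 = x2"
    unfolding face2_edg by blast
  show ?thesis
    unfolding R_def
    by (intro bexI[of _ "edg Z 2 \<tau> 0 1"])
      (use edges2[OF \<tau>(1), of 0 2] edges2[OF \<tau>(1), of 0 1] edges2[OF \<tau>(1), of 1 2] \<tau> x in auto)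
qed

lemma R_fwd: "e \<in> simplices W 1 \<Longrightarrow> z \<in> simplices Z 0 \<Longrightarrow> g 0 z = vtx W 1 e 0 \<Longrightarrow> \<exists>z'. R e z z'"
  using kan_path_lifting[OF Z.simplicial_set_axioms W.simplicial_set_axioms kan, of 0 z e] unfolding R_def by auto

lemma R_bwd: "e \<in> simplices W 1 \<Longrightarrow> z \<in> simplices Z 0 \<Longrightarrow> g 0 z = vtx W 1 e 1 \<Longrightarrow> \<exists>z'. R e z' z"
  using kan_path_lifting[OF Z.simplicial_set_axioms W.simplicial_set_axioms kan, of 1 z e] unfolding R_def by auto

lemma R_edge: "x \<in> simplices Z 1 \<Longrightarrow> R (g 1 x) (vtx Z 1 x 0) (vtx Z 1 x 1)"
  unfolding R_def by blast

lemma R_refl: "z \<in> simplices Z 0 \<Longrightarrow> R (dg (g 0 z)) z z"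
proof -
  assume z: "z \<in> simplices Z 0"
  have "R (g 1 (edg Z 0 z 0 0)) (vtx Z 1 (edg Z 0 z 0 0) 0) (vtx Z 1 (edg Z 0 z 0 0) 1)"
    by (rule R_edge) (use Z.edg_in[OF z] in simp)
  then show ?thesis
    using Z.vtx_edg[OF z, of 0 0] Z.vtx_self[OF z] simplicial_fun_edg[OF gs z, of 0 0] by (simp add: dg_def)
qed

text \<open>These are the triangle rules applied to the two degenerate triangles over
  \<open>e\<close>, which repeat the vertex 0 or the vertex 1.\<close>

lemma R_transport:
  assumes e: "e \<in> simplices W 1"
  shows "R (dg (vtx W 1 e 0)) z y \<Longrightarrow> R e z z' \<Longrightarrow> R e y z'"
    and "R e z z' \<Longrightarrow> R (dg (vtx W 1 e 1)) z' y \<Longrightarrow> R e z y"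
    and "R e z z' \<Longrightarrow> R e z y \<Longrightarrow> R (dg (vtx W 1 e 1)) z' y"
    and "R e z y \<Longrightarrow> R e z' y \<Longrightarrow> R (dg (vtx W 1 e 0)) z z'"
proof -
  note t0 = W.tri_in[OF e, of 0 0 1] and t1 = W.tri_in[OF e, of 0 1 1]
  note e0 = W.edg_tri[OF e, of 0 0 1] and e1 = W.edg_tri[OF e, of 0 1 1]
  have d: "edg W 1 e 0 0 = dg (vtx W 1 e 0)" "edg W 1 e 1 1 = dg (vtx W 1 e 1)" "edg W 1 e 0 1 = e"
    using W.edg_vtx[OF e] W.edg_self[OF e] by (simp_all add: dg_def)
  show "R (dg (vtx W 1 e 0)) z y \<Longrightarrow> R e z z' \<Longrightarrow> R e y z'"
    using R_tri0[OF t0, of z y z'] e0 d by simp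
  show "R e z z' \<Longrightarrow> R (dg (vtx W 1 e 1)) z' y \<Longrightarrow> R e z y"
    using R_tri1[OF t1, of z z' y] e1 d by simp
  show "R e z z' \<Longrightarrow> R e z y \<Longrightarrow> R (dg (vtx W 1 e 1)) z' y"
    using R_tri0[OF t1, of z z' y] e1 d by simp
  show "R e z y \<Longrightarrow> R e z' y \<Longrightarrow> R (dg (vtx W 1 e 0)) z z'"
    using R_tri2[OF t0, of z y z'] e0 d by simp
qed

definition cl :: "'a \<Rightarrow> 'a set" where "cl z = {y. R (dg (g 0 z)) z y}"

lemma cl_eq: "z \<in> simplices Z 0 \<Longrightarrow> y \<in> simplices Z 0 \<Longrightarrow> g 0 z = g 0 y \<Longrightarrow> cl z = cl y \<longleftrightarrow> R (dg (g 0 z)) z y"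
proof -
  assume z: "z \<in> simplices Z 0" "y \<in> simplices Z 0" "g 0 z = g 0 y"
  let ?w = "g 0 z"
  have w: "?w \<in> simplices W 0" using simplicial_fun_in[OF gs z(1)] .
  have e: "dg ?w \<in> simplices W 1" using W.edg_in[OF w] by (simp add: dg_def)
  have v: "vtx W 1 (dg ?w) 0 = ?w" "vtx W 1 (dg ?w) 1 = ?w"
    using W.vtx_edg[OF w, of 0 0] W.vtx_self[OF w] by (simp_all add: dg_def)
  note t = R_transport[OF e, unfolded v]
  show ?thesis
  proof
    assume "cl z = cl y"
    then have "y \<in> cl z" using R_refl[OF z(2)] by (simp add: cl_def)
    then show "R (dg (g 0 z)) z y" by (simp add: cl_def)
  next
    assume r: "R (dg (g 0 z)) z y"
    have "R (dg ?w) z x \<longleftrightarrow> R (dg ?w) y x" for x using t(1)[OF r] t(2)[OF r] by blast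
    then show "cl z = cl y" using z(3) by (auto simp: cl_def)
  qed
qed

definition T :: "'b \<Rightarrow> 'a set \<Rightarrow> 'a set \<Rightarrow> bool" where
  "T e a b \<longleftrightarrow> (\<exists>z z'. R e z z' \<and> a = cl z \<and> b = cl z')"

lemma T_cl:
  assumes e: "e \<in> simplices W 1" and T: "T e (cl z) b" and z: "z \<in> simplices Z 0" "g 0 z = vtx W 1 e 0"
  shows "\<exists>z'. R e z z' \<and> b = cl z'"
proof -
  obtain y z' where y: "R e y z'" "cl z = cl y" "b = cl z'" using T unfolding T_def by blast
  have "R (dg (vtx W 1 e 0)) y z" using cl_eq[of y z] y(2) R_in[OF y(1)] z by simp
  then show ?thesis using R_transport(1)[OF e _ y(1)] y(3) by blast
qed

lemma T_cl':
  assumes e: "e \<in> simplices W 1" and T: "T e a (cl z)" and z: "z \<in> simplices Z 0" "g 0 z = vtx W 1 e 1"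
  shows "\<exists>z'. R e z' z \<and> a = cl z'"
proof -
  obtain y z' where y: "R e y z'" "a = cl y" "cl z = cl z'" using T unfolding T_def by blast
  have "R (dg (vtx W 1 e 1)) z' z" using cl_eq[of z' z] y(3) R_in[OF y(1)] z by simp
  then show ?thesis using R_transport(2)[OF e y(1)] y(2) by blast
qed

sublocale F: local_system W T
proof
  fix e assume e: "e \<in> simplices W 1"
  have dv: "edg W 1 e 0 0 = dg (vtx W 1 e 0)" "edg W 1 e 1 1 = dg (vtx W 1 e 1)"
    using W.edg_vtx[OF e] by (simp_all add: dg_def)
  have dvv: "vtx W 1 (dg w) 0 = w" if "w \<in> simplices W 0" for w
    using W.vtx_edg[OF that, of 0 0] W.vtx_self[OF that] by (simp add: dg_def)
  show "b = b'" if ab: "T e a b" "T e a b'" for a b b'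
  proof -
    obtain z z' where z: "R e z z'" "a = cl z" "b = cl z'" using ab(1) unfolding T_def by blast
    obtain y where y: "R e z y" "b' = cl y" using T_cl[OF e] ab(2) R_in[OF z(1)] z(2) by blast
    show ?thesis using R_transport(3)[OF e z(1) y(1)] cl_eq[of z' y] R_in[OF z(1)] R_in[OF y(1)] z y by simp
  qed
  show "a = a'" if ab: "T e a b" "T e a' b" for a a' b
  proof -
    obtain z z' where z: "R e z z'" "a = cl z" "b = cl z'" using ab(1) unfolding T_def by blast
    obtain y where y: "R e y z'" "a' = cl y" using T_cl'[OF e] ab(2) R_in[OF z(1)] z(3) by blast
    show ?thesis using R_transport(4)[OF e z(1) y(1)] cl_eq[of z y] R_in[OF z(1)] R_in[OF y(1)] z y by simp
  qed
  show "\<exists>b. T e a b" if h: "T (edg W 1 e 0 0) a a" for a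
  proof -
    obtain z z' where z: "R (dg (vtx W 1 e 0)) z z'" "a = cl z" using h unfolding T_def dv by blast
    have "g 0 z = vtx W 1 e 0" using R_in[OF z(1)] dvv[OF W.vtx_in[OF e, of 0]] by simp
    then show ?thesis using R_fwd[OF e, of z] R_in[OF z(1)] z(2) unfolding T_def by blast
  qed
  show "\<exists>a. T e a b" if h: "T (edg W 1 e 1 1) b b" for b
  proof -
    obtain z z' where z: "R (dg (vtx W 1 e 1)) z z'" "b = cl z" using h unfolding T_def dv by blast
    have "g 0 z = vtx W 1 e 1" using R_in[OF z(1)] dvv[OF W.vtx_in[OF e, of 1]] by simp
    then show ?thesis using R_bwd[OF e, of z] R_in[OF z(1)] z(2) unfolding T_def by blast
  qed
next
  fix x assume x: "x \<in> simplices W 2"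
  have in1: "edg W 2 x 0 1 \<in> simplices W 1" "edg W 2 x 1 2 \<in> simplices W 1" "edg W 2 x 0 2 \<in> simplices W 1"
    using W.edg_in[OF x] by auto
  have v: "vtx W 1 (edg W 2 x i j) 0 = vtx W 2 x i" "vtx W 1 (edg W 2 x i j) 1 = vtx W 2 x j" if "i \<le> j" "j \<le> 2" for i j
    using W.vtx_edg[OF x that] by auto
  show "T (edg W 2 x 0 2) a c" if ab: "T (edg W 2 x 0 1) a b" "T (edg W 2 x 1 2) b c" for a b c
  proof -
    obtain z z' where z: "R (edg W 2 x 0 1) z z'" "a = cl z" "b = cl z'" using ab(1) unfolding T_def by blast
    obtain y where y: "R (edg W 2 x 1 2) z' y" "c = cl y"
      using T_cl[OF in1(2), of z' c] ab(2) R_in[OF z(1)] v z by auto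
    show ?thesis using R_tri1[OF x z(1) y(1)] z y unfolding T_def by blast
  qed
  show "T (edg W 2 x 1 2) b c" if ab: "T (edg W 2 x 0 1) a b" "T (edg W 2 x 0 2) a c" for a b c
  proof -
    obtain z z' where z: "R (edg W 2 x 0 1) z z'" "a = cl z" "b = cl z'" using ab(1) unfolding T_def by blast
    obtain y where y: "R (edg W 2 x 0 2) z y" "c = cl y"
      using T_cl[OF in1(3), of z c] ab(2) R_in[OF z(1)] v z by auto
    show ?thesis using R_tri0[OF x z(1) y(1)] z y unfolding T_def by blast
  qed
  show "T (edg W 2 x 0 1) a b" if ab: "T (edg W 2 x 0 2) a c" "T (edg W 2 x 1 2) b c" for a b c
  proof -
    obtain z z' where z: "R (edg W 2 x 0 2) z z'" "a = cl z" "c = cl z'" using ab(1) unfolding T_def by blast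
    obtain y where y: "R (edg W 2 x 1 2) y z'" "b = cl y"
      using T_cl'[OF in1(2), of b z'] ab(2) R_in[OF z(1)] v z by auto
    show ?thesis using R_tri2[OF x z(1) y(1)] z y unfolding T_def by blast
  qed
qed

text \<open>The tautological local system on the total space: each vertex carries one label, the
  component to which it belongs. Every point of the realization therefore has exactly one section,
  and mapping to the base turns it into a section of \<open>T\<close>.\<close>

definition T0 :: "'a \<Rightarrow> 'a set \<Rightarrow> 'a set \<Rightarrow> bool" where
  "T0 e a b \<longleftrightarrow> a = cl (vtx Z 1 e 0) \<and> b = cl (vtx Z 1 e 1)"

sublocale E: local_system Z T0
proof
  fix e assume e: "e \<in> simplices Z 1"
  show "\<exists>b. T0 e a b" if h: "T0 (edg Z 1 e 0 0) a a" for a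
    using h Z.vtx_edg[OF e, of 0 0] unfolding T0_def by simp
  show "\<exists>a. T0 e a b" if h: "T0 (edg Z 1 e 1 1) b b" for b
    using h Z.vtx_edg[OF e, of 1 1] unfolding T0_def by simp
  show "b = b'" if "T0 e a b" "T0 e a b'" for a b b' using that by (simp add: T0_def)
  show "a = a'" if "T0 e a b" "T0 e a' b" for a a' b using that by (simp add: T0_def)
next
  fix x assume x: "x \<in> simplices Z 2"
  have v: "vtx Z 1 (edg Z 2 x i j) 0 = vtx Z 2 x i" "vtx Z 1 (edg Z 2 x i j) 1 = vtx Z 2 x j" if "i \<le> j" "j \<le> 2" for i j
    using Z.vtx_edg[OF x that] by auto
  show "T0 (edg Z 2 x 0 2) a c" if "T0 (edg Z 2 x 0 1) a b" "T0 (edg Z 2 x 1 2) b c" for a b c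
    using that v[of 0 1] v[of 1 2] v[of 0 2] by (simp add: T0_def)
  show "T0 (edg Z 2 x 1 2) b c" if "T0 (edg Z 2 x 0 1) a b" "T0 (edg Z 2 x 0 2) a c" for a b c
    using that v[of 0 1] v[of 1 2] v[of 0 2] by (simp add: T0_def)
  show "T0 (edg Z 2 x 0 1) a b" if "T0 (edg Z 2 x 0 2) a c" "T0 (edg Z 2 x 1 2) b c" for a b c
    using that v[of 0 1] v[of 1 2] v[of 0 2] by (simp add: T0_def)
qed

lemma E_single: "c \<in> topspace (realization Z) \<Longrightarrow> \<exists>!\<sigma>. \<sigma> \<in> E.Sec c"
proof -
  assume "c \<in> topspace (realization Z)"
  then obtain n x t where x: "x \<in> simplices Z n" "t \<in> standard_simplex n" "c = rcls Z ((n, x), t)"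
    by (rule realization_cases)
  define s where "s = (\<lambda>i\<in>{..n}. cl (vtx Z n x i))"
  have "E.lifts n x = {s}"
  proof
    have "T0 (edg Z n x i j) (s i) (s j)" if "i \<le> j" "j \<le> n" for i j
      using Z.vtx_edg[OF x(1) that] that by (simp add: T0_def s_def)
    then show "{s} \<subseteq> E.lifts n x" by (auto simp: E.lifts_def s_def)
    show "E.lifts n x \<subseteq> {s}"
    proof
      fix s' assume s': "s' \<in> E.lifts n x"
      have "s' = s"
      proof (rule extensionalityI[of _ "{..n}"])
        show "s' \<in> extensional {..n}" using s' by (simp add: E.lifts_def)
        show "s \<in> extensional {..n}" by (simp add: s_def)
        fix i assume "i \<in> {..n}"
        then have i: "i \<le> n" by simp
        have "T0 (edg Z n x i i) (s' i) (s' i)" using s' i by (simp add: E.lifts_def)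
        then show "s' i = s i" using Z.vtx_edg[OF x(1), of i i] i by (simp add: T0_def s_def)
      qed
      then show "s' \<in> {s}" by simp
    qed
  qed
  then show ?thesis unfolding x(3) E.Sec_rcls[OF x(1,2)] by auto
qed

lemma E_F:
  assumes c: "c \<in> topspace (realization Z)" shows "E.Sec c \<subseteq> F.Sec (realization_map W g c)"
proof -
  obtain n x t where x: "x \<in> simplices Z n" "t \<in> standard_simplex n" "c = rcls Z ((n, x), t)"
    using c by (rule realization_cases)
  have "E.lifts n x \<subseteq> F.lifts n (g n x)"
  proof
    fix s assume s: "s \<in> E.lifts n x"
    have "T (edg W n (g n x) i j) (s i) (s j)" if "i \<le> j" "j \<le> n" for i j
    proof -
      have "T0 (edg Z n x i j) (s i) (s j)" using s that by (simp add: E.lifts_def)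
      then show ?thesis
        using R_edge[OF Z.edg_in[OF x(1) that]] simplicial_fun_edg[OF gs x(1) that]
        unfolding T0_def T_def by auto
    qed
    then show "s \<in> F.lifts n (g n x)" using s by (auto simp: F.lifts_def E.lifts_def)
  qed
  then show ?thesis
    unfolding x(3) realization_map_rcls[OF W.simplicial_set_axioms gs x(1,2)] E.Sec_rcls[OF x(1,2)]
      F.Sec_rcls[OF simplicial_fun_in[OF gs x(1)] x(2)] by blast
qed

definition taut :: "'a rpoint set \<Rightarrow> real \<Rightarrow> 'a set" where "taut c = (THE \<sigma>. \<sigma> \<in> E.Sec c)"

lemma taut: "c \<in> topspace (realization Z) \<Longrightarrow> \<sigma> \<in> E.Sec c \<longleftrightarrow> \<sigma> = taut c"
  unfolding taut_def using E_single by (metis theI_unique)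

lemma taut_F: "c \<in> topspace (realization Z) \<Longrightarrow> taut c \<in> F.Sec (realization_map W g c)"
  using E_F taut by blast

lemma taut_clift:
  assumes \<gamma>: "pathin (realization Z) \<gamma>"
  shows "F.clift (\<lambda>v. realization_map W g (\<gamma> v)) (\<lambda>v. taut (\<gamma> v))"
proof -
  have top: "\<gamma> v \<in> topspace (realization Z)" if "v \<in> {0..1}" for v by (rule E.path_top[OF \<gamma> that])
  obtain s where s: "E.clift \<gamma> s" using E.clift_exists[OF \<gamma>, of "taut (\<gamma> 0)"] taut top[of 0] by auto
  then have e: "s v = taut (\<gamma> v)" if "v \<in> {0..1}" for v using taut[OF top[OF that]] that unfolding E.clift_def by blast
  show ?thesis using s taut_F[OF top] e unfolding E.clift_def F.clift_def by simp
qed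

lemma taut_vertex:
  assumes h: "h \<in> simplices Z 0" shows "taut (pt Z h) = (\<lambda>u. if 0 \<le> u \<and> u < 1 then cl h else undefined)"
proof -
  have "pt Z h \<in> topspace (realization Z)"
    unfolding pt_def using h std0 by (intro rcls_topspace) (simp add: topspace_presum)
  moreover have "T0 (edg Z 0 h 0 0) (cl h) (cl h)"
    using Z.vtx_edg[OF h, of 0 0] Z.vtx_self[OF h] by (simp add: T0_def)
  then have "(\<lambda>u. if 0 \<le> u \<and> u < 1 then cl h else undefined) \<in> E.Sec (pt Z h)"
    unfolding pt_def E.Sec_vertex[OF h std0] by blast
  ultimately show ?thesis using taut by metis
qed

lemma pt_map: "h \<in> simplices Z 0 \<Longrightarrow> realization_map W g (pt Z h) = pt W (g 0 h)"
  unfolding pt_def using realization_map_rcls[OF W.simplicial_set_axioms gs _ std0] .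

text \<open>
  It is enough that \<open>g\<close> becomes a weak equivalence after restriction along a weak
  equivalence \<open>j\<close>.
\<close>

lemma weq_lifting:
  assumes Y: "simplicial_fun Y Z j" and wj: "sset_weq Y Z j" and wg: "sset_weq Y W (\<lambda>n y. g n (j n y))"
  shows "w \<in> simplices W 0 \<Longrightarrow> \<exists>z\<in>simplices Z 0. g 0 z = w"
    and "h \<in> simplices Z 0 \<Longrightarrow> h' \<in> simplices Z 0 \<Longrightarrow> g 0 h = g 0 h' \<Longrightarrow> R (dg (g 0 h)) h h'"
proof -
  let ?j = "realization_map Z j" and ?g = "realization_map W g" and ?f = "realization_map W (\<lambda>n y. g n (j n y))"
  have W0: "weak_homotopy_equivalence (realization Y) (realization Z) ?j"
    "weak_homotopy_equivalence (realization Y) (realization W) ?f"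
    using wj wg by (simp_all add: sset_weq_def)
  have f: "?f y = ?g (?j y)" if "y \<in> topspace (realization Y)" for y
    by (rule realization_map_comp[OF Z.simplicial_set_axioms W.simplicial_set_axioms Y gs that])
  have gc: "continuous_map (realization Z) (realization W) ?g"
    by (rule continuous_realization_map[OF W.simplicial_set_axioms gs])
  have jc: "continuous_map (realization Y) (realization Z) ?j"
    by (rule continuous_realization_map[OF Z.simplicial_set_axioms Y])
  have jt: "?j y \<in> topspace (realization Z)" if "y \<in> topspace (realization Y)" for y
    by (rule cm_in[OF jc that])
  have gp: "pathin (realization W) (\<lambda>v. ?g (\<gamma> v))" if "pathin (realization Z) \<gamma>" for \<gamma>
    using continuous_map_compose[OF that[unfolded pathin_def] gc] unfolding pathin_def o_def .
  show "\<exists>z\<in>simplices Z 0. g 0 z = w" if w: "w \<in> simplices W 0"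
  proof -
    \<comment> \<open>Some point in the image of \<open>Y\<close> is joined to \<open>w\<close>.
      Transport of its tautological section along the path puts a label over \<open>w\<close>, so
      the fibre over \<open>w\<close> contains a vertex.\<close>
    obtain y \<alpha> where y: "y \<in> topspace (realization Y)" "pathin (realization W) \<alpha>" "\<alpha> 0 = ?f y" "\<alpha> 1 = pt W w"
      using pi0_surjective[OF W0(2) pt_top[OF w]] by blast
    have "taut (?j y) \<in> F.Sec (\<alpha> 0)" using taut_F[OF jt[OF y(1)]] f[OF y(1)] y(3) by simp
    then obtain s where s: "F.clift \<alpha> s" using F.clift_exists[OF y(2)] by blast
    have "s 1 \<in> F.Sec (\<alpha> 1)" using s unfolding F.clift_def by simp
    then have "s 1 \<in> F.Sec (pt W w)" unfolding y(4) .
    then obtain a where "T (edg W 0 w 0 0) a a" unfolding pt_def F.Sec_vertex[OF w std0] by blast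
    then obtain z z' where "R (dg w) z z'" unfolding T_def dg_def by blast
    then have "z \<in> simplices Z 0" "g 0 z = vtx W 1 (dg w) 0" using R_in by auto
    then show ?thesis using W.vtx_edg[OF w, of 0 0] W.vtx_self[OF w] by (auto simp: dg_def)
  qed
  show "R (dg (g 0 h)) h h'" if h: "h \<in> simplices Z 0" "h' \<in> simplices Z 0" "g 0 h = g 0 h'"
  proof -
    obtain y0 c0 where y0: "y0 \<in> topspace (realization Y)" "pathin (realization Z) c0" "c0 0 = ?j y0" "c0 1 = pt Z h"
      using pi0_surjective[OF W0(1) pt_top[OF h(1)]] by blast
    obtain y1 c1 where y1: "y1 \<in> topspace (realization Y)" "pathin (realization Z) c1" "c1 0 = ?j y1" "c1 1 = pt Z h'"
      using pi0_surjective[OF W0(1) pt_top[OF h(2)]] by blast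
    have geq: "?g (pt Z h) = ?g (pt Z h')" using pt_map h by simp
    define d0 where "d0 v = c0 (1 - v)" for v :: real
    have d0: "pathin (realization Z) d0" unfolding d0_def by (rule pathin_reverse[OF y0(2)])
    have d1: "pathin (realization Z) (\<lambda>v. c1 (1 - v))" by (rule pathin_reverse[OF y1(2)])
    \<comment> \<open>In the base, the images of \<open>y0\<close> and \<open>y1\<close> are joined
      through the common image of \<open>h\<close> and \<open>h'\<close>; injectivity on components
      lifts this to a path in \<open>Y\<close>. The constant third piece fits the shape of
      \<open>join3\<close>.\<close>
    have cont: "pathin (realization W) (join3 (\<lambda>v. ?g (c0 v)) (\<lambda>v. ?g (c1 (1 - v))) (\<lambda>v. ?g (c1 0)))"
    proof (rule pathin_join3[OF gp[OF y0(2)] gp[OF d1]])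
      show "pathin (realization W) (\<lambda>v. ?g (c1 0))"
        using cm_in[OF gc jt[OF y1(1)]] y1(3) by (simp add: pathin_def)
      show "?g (c0 1) = ?g (c1 (1 - 0))" using geq y0(4) y1(4) by simp
    qed simp
    have "\<exists>\<alpha>. pathin (realization Y) \<alpha> \<and> \<alpha> 0 = y0 \<and> \<alpha> 1 = y1"
      by (rule pi0_injective[OF W0(2) y0(1) y1(1) cont])
        (use y0 y1 f in \<open>simp_all add: join3_def\<close>)
    then obtain \<alpha> where \<alpha>: "pathin (realization Y) \<alpha>" "\<alpha> 0 = y0" "\<alpha> 1 = y1" by blast
    have \<alpha>t: "\<alpha> v \<in> topspace (realization Y)" if "v \<in> {0..1}" for v
      using \<alpha>(1) that unfolding pathin_def by (auto dest: cm_in)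
    have j\<alpha>: "pathin (realization Z) (\<lambda>v. ?j (\<alpha> v))"
      using continuous_map_compose[OF \<alpha>(1)[unfolded pathin_def] jc] unfolding pathin_def o_def .
    let ?A = "\<lambda>v. ?g (?j (\<alpha> v))" and ?B = "\<lambda>v. ?g (c1 v)" and ?C = "\<lambda>v. ?g (d0 v)"
    \<comment> \<open>The loop at the image of \<open>y0\<close> that runs through \<alpha>, then
      \<open>c1\<close>, then \<open>c0\<close> backwards. Transport around it has to be shown
      trivial.\<close>
    define \<omega> where "\<omega> = join3 ?A ?B ?C"
    have AB: "?A 1 = ?B 0" "?B 1 = ?C 0" using \<alpha> y1 y0 geq by (simp_all add: d0_def)
    have \<omega>p: "pathin (realization W) \<omega>" unfolding \<omega>_def by (rule pathin_join3[OF gp[OF j\<alpha>] gp[OF y1(2)] gp[OF d0] AB])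
    have \<omega>e: "\<omega> 0 = ?f y0" "\<omega> 1 = ?f y0"
      unfolding \<omega>_def join3_def using \<alpha> y0 f[OF y0(1)] by (simp_all add: d0_def)
    obtain \<beta> H where \<beta>: "pathin (realization Y) \<beta>" "\<beta> 0 = y0" "\<beta> 1 = y0"
        and H: "continuous_map (top_of_set ({0..1} \<times> {0..1})) (realization W) H"
          "\<forall>v\<in>{0..1}. H (v, 0) = ?f (\<beta> v) \<and> H (v, 1) = \<omega> v \<and> H (0, v) = ?f y0 \<and> H (1, v) = ?f y0"
      using pi1_surjective[OF W0(2) y0(1) \<omega>p \<omega>e] by blast
    have \<beta>t: "\<beta> v \<in> topspace (realization Y)" if "v \<in> {0..1}" for v
      using \<beta>(1) that unfolding pathin_def by (auto dest: cm_in)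
    have j\<beta>: "pathin (realization Z) (\<lambda>v. ?j (\<beta> v))"
      using continuous_map_compose[OF \<beta>(1)[unfolded pathin_def] jc] unfolding pathin_def o_def .
    let ?e0 = "taut (?j y0)"
    have clc: "F.clift \<gamma> s \<longleftrightarrow> F.clift \<gamma>' s" if "\<And>v. v \<in> {0..1} \<Longrightarrow> \<gamma> v = \<gamma>' v" for \<gamma> \<gamma>' s
      using that unfolding F.clift_def by auto
    have L0: "F.clift (\<lambda>v. H (v, 0)) (\<lambda>v. taut (?j (\<beta> v)))"
      using taut_clift[OF j\<beta>] by (rule clc[THEN iffD1, rotated]) (use H(2) f[OF \<beta>t] in auto)
    \<comment> \<open>\<omega> is homotopic to the image of a loop \<beta> of \<open>Y\<close>,
      along which the tautological sections close up. So the lift of \<omega> that starts at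
      \<open>?e0\<close> also ends there.\<close>
    have "?e0 \<in> F.Sec (\<omega> 0)" using taut_F[OF jt[OF y0(1)]] \<omega>e f[OF y0(1)] by simp
    then obtain s where s: "F.clift \<omega> s" "s 0 = ?e0" using F.clift_exists[OF \<omega>p] by blast
    have L1: "F.clift (\<lambda>v. H (v, 1)) s"
      using s(1) by (rule clc[THEN iffD1, rotated]) (use H(2) in auto)
    have "taut (?j (\<beta> 1)) = s 1"
      by (rule F.clift_homotopy[OF H(1) _ _ L0 L1]) (use H(2) \<beta>(2) s(2) in auto)
    then have s1: "s 1 = ?e0" using \<beta>(3) by simp
    have third: "F.clift (\<lambda>v. \<omega> (1/3 * v + c)) (\<lambda>v. s (1/3 * v + c))" if "c = 0 \<or> c = 1/3 \<or> c = 2/3" for c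
      by (rule F.clift_affine[OF s(1)]) (use that in auto)
    note pieces = join3_pieces[of ?A ?B ?C, OF AB, folded \<omega>_def]
    have A': "F.clift ?A (\<lambda>v. s (1/3 * v + 0))"
      using third[of 0] by (rule clc[THEN iffD1, rotated]) (use pieces(1) in auto)
    have B': "F.clift ?B (\<lambda>v. s (1/3 * v + 1/3))"
      using third[of "1/3"] by (rule clc[THEN iffD1, rotated]) (use pieces(2) in auto)
    have C': "F.clift ?C (\<lambda>v. s (1/3 * v + 2/3))"
      using third[of "2/3"] by (rule clc[THEN iffD1, rotated]) (use pieces(3) in auto)
    \<comment> \<open>On each third the lift is the tautological one. At parameter 2/3 the second
      third gives the section of \<open>h'\<close>, and the last third, read backwards from
      \<open>?e0\<close>, gives that of \<open>h\<close>.\<close>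
    have a1: "s (1/3) = taut (?j y1)"
      using F.clift_unique[OF gp[OF j\<alpha>] A' taut_clift[OF j\<alpha>]] s(2) \<alpha> by simp
    have b1: "s (2/3) = taut (pt Z h')"
      using F.clift_unique[OF gp[OF y1(2)] B' taut_clift[OF y1(2)]] a1 y1 by simp
    note C1 = F.clift_reverse[OF C'] and C2 = F.clift_reverse[OF taut_clift[OF d0]]
    have "pathin (realization W) (\<lambda>v. ?C (1 - v))" by (rule pathin_reverse[OF gp[OF d0]])
    from F.clift_unique[OF this C1 C2]
    have "s (2/3) = taut (pt Z h)" using s1 y0 by (simp add: d0_def)
    then have "taut (pt Z h) = taut (pt Z h')" using b1 by simp
    then have "cl h = cl h'"
      unfolding taut_vertex[OF h(1)] taut_vertex[OF h(2)] by (auto dest: fun_cong[of _ _ 0])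
    then show ?thesis using cl_eq[OF h] by simp
  qed
qed

end

section \<open>Weak equivalences of simplicial sets\<close>

lemma sset_weq_fun: "sset_weq X Y f \<Longrightarrow> simplicial_fun X Y f"
  by (simp add: sset_weq_def)

lemma sset_weq_comp:
  assumes Y: "simplicial_set Y" and Z: "simplicial_set Z" and f: "sset_weq X Y f" and g: "sset_weq Y Z g"
  shows "sset_weq X Z (\<lambda>n x. g n (f n x))"
proof -
  have fg: "simplicial_fun X Y f" "simplicial_fun Y Z g" using f g by (auto simp: sset_weq_def)
  have "weak_homotopy_equivalence (realization X) (realization Z) (realization_map Z g \<circ> realization_map Y f)"
    by (rule whe_comp) (use f g in \<open>auto simp: sset_weq_def\<close>)
  from whe_cong[OF this, of "realization_map Z (\<lambda>n x. g n (f n x))"] show ?thesis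
    unfolding sset_weq_def using realization_map_comp[OF Y Z fg] simplicial_fun_comp[OF fg] by simp
qed

lemma sset_weq_first:
  assumes Y: "simplicial_set Y" and Z: "simplicial_set Z" and f: "simplicial_fun X Y f"
    and g: "sset_weq Y Z g" and gf: "sset_weq X Z (\<lambda>n x. g n (f n x))"
  shows "sset_weq X Y f"
proof -
  have g': "simplicial_fun Y Z g" by (rule sset_weq_fun[OF g])
  have "weak_homotopy_equivalence (realization X) (realization Z) (realization_map Z (\<lambda>n x. g n (f n x)))"
    using gf by (simp add: sset_weq_def)
  then have "weak_homotopy_equivalence (realization X) (realization Z) (realization_map Z g \<circ> realization_map Y f)"
    by (rule whe_cong) (simp add: realization_map_comp[OF Y Z f g'])
  from whe_first[OF continuous_realization_map[OF Y f] _ this] g show ?thesis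
    using f by (simp add: sset_weq_def)
qed

lemma sset_weq_2of6_first:
  assumes Y: "simplicial_set Y" and Z: "simplicial_set Z" and V: "simplicial_set V"
    and f: "simplicial_fun X Y f" and g: "simplicial_fun Y Z g" and h: "simplicial_fun Z V h"
    and gf: "sset_weq X Z (\<lambda>n x. g n (f n x))" and hg: "sset_weq Y V (\<lambda>n x. h n (g n x))"
  shows "sset_weq X Y f"
proof -
  have "weak_homotopy_equivalence (realization X) (realization Z) (realization_map Z (\<lambda>n x. g n (f n x)))"
    using gf by (simp add: sset_weq_def)
  then have 1: "weak_homotopy_equivalence (realization X) (realization Z) (realization_map Z g \<circ> realization_map Y f)"
    by (rule whe_cong) (simp add: realization_map_comp[OF Y Z f g])
  have "weak_homotopy_equivalence (realization Y) (realization V) (realization_map V (\<lambda>n x. h n (g n x)))"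
    using hg by (simp add: sset_weq_def)
  then have 2: "weak_homotopy_equivalence (realization Y) (realization V) (realization_map V h \<circ> realization_map Z g)"
    by (rule whe_cong) (simp add: realization_map_comp[OF Z V g h])
  from whe_2of6_first[OF continuous_realization_map[OF Y f] continuous_realization_map[OF Z g]
      continuous_realization_map[OF V h] 1 2] show ?thesis using f by (simp add: sset_weq_def)
qed

lemma sset_weq_cong:
  assumes Y: "simplicial_set Y" and X: "simplicial_set X" and f: "sset_weq X Y f"
    and e: "\<And>n x. x \<in> simplices X n \<Longrightarrow> f n x = g n x"
  shows "sset_weq X Y g"
proof -
  have f': "simplicial_fun X Y f" by (rule sset_weq_fun[OF f])
  have g': "simplicial_fun X Y g"
    using f' e simplicial_set.pull_in[OF X] unfolding simplicial_fun_def by fastforce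
  have "weak_homotopy_equivalence (realization X) (realization Y) (realization_map Y f)"
    using f by (simp add: sset_weq_def)
  then have "weak_homotopy_equivalence (realization X) (realization Y) (realization_map Y g)"
    by (rule whe_cong) (rule realization_map_cong[OF Y f' e])
  then show ?thesis using g' by (simp add: sset_weq_def)
qed

lemma sset_weq_iso:
  assumes X: "simplicial_set X" and Y: "simplicial_set Y" and f: "simplicial_fun X Y f" and g: "simplicial_fun Y X g"
    and fg: "\<And>n y. y \<in> simplices Y n \<Longrightarrow> f n (g n y) = y" and gf: "\<And>n x. x \<in> simplices X n \<Longrightarrow> g n (f n x) = x"
  shows "sset_weq X Y f"
proof -
  have inv: "realization_map B f (realization_map A g c) = c"
    if A: "simplicial_set A" and B: "simplicial_set B" and f: "simplicial_fun A B f" and g: "simplicial_fun B A g"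
      and fg: "\<And>n y. y \<in> simplices B n \<Longrightarrow> f n (g n y) = y" and c: "c \<in> topspace (realization B)"
    for A :: "'c sset" and B :: "'d sset" and f g c
  proof -
    obtain n x t where x: "x \<in> simplices B n" "t \<in> standard_simplex n" "c = rcls B ((n, x), t)"
      using c by (rule realization_cases)
    then show ?thesis
      using realization_map_rcls[OF A g x(1,2)]
        realization_map_rcls[OF B f simplicial_fun_in[OF g x(1)] x(2)] fg[OF x(1)] by simp
  qed
  have "weak_homotopy_equivalence (realization X) (realization Y) (realization_map Y f)"
    by (rule whe_homeo[OF continuous_realization_map[OF Y f] continuous_realization_map[OF X g]])
      (use inv[OF X Y f g fg] inv[OF Y X g f gf] in auto)
  then show ?thesis using f by (simp add: sset_weq_def)
qed

lemma Kan_fibration_iso: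
  assumes \<pi>: "simplicial_fun P Y \<pi>" and \<psi>: "simplicial_fun Y P \<psi>"
    and "\<And>n y. y \<in> simplices Y n \<Longrightarrow> \<pi> n (\<psi> n y) = y" and "\<And>n x. x \<in> simplices P n \<Longrightarrow> \<psi> n (\<pi> n x) = x"
    and f: "Kan_fibration X P f"
  shows "Kan_fibration X Y (\<lambda>n x. \<pi> n (f n x))"
  unfolding Kan_fibration_def
proof (intro conjI allI impI; (elim conjE)?)
  have fs: "simplicial_fun X P f" using f by (simp add: Kan_fibration_def)
  show "simplicial_fun X Y (\<lambda>n x. \<pi> n (f n x))" by (rule simplicial_fun_comp[OF fs \<pi>])
  fix n k :: nat and a b
  assume n: "1 \<le> n" "k \<le> n" and a: "simplicial_fun (horn n k) X a" and b: "simplicial_fun (std_sset n) Y b"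
    and ab: "\<forall>m. \<forall>\<theta>\<in>simplices (horn n k) m. \<pi> m (f m (a m \<theta>)) = b m \<theta>"
  have b': "simplicial_fun (std_sset n) P (\<lambda>m \<theta>. \<psi> m (b m \<theta>))" by (rule simplicial_fun_comp[OF b \<psi>])
  have "f m (a m \<theta>) = \<psi> m (b m \<theta>)" if "\<theta> \<in> simplices (horn n k) m" for m \<theta>
    using ab assms(4)[OF simplicial_fun_in[OF fs simplicial_fun_in[OF a that]]] that by auto
  then obtain c where c: "simplicial_fun (std_sset n) X c" "\<forall>m. \<forall>\<theta>\<in>simplices (horn n k) m. c m \<theta> = a m \<theta>"
      "\<forall>m. \<forall>\<theta>\<in>Delta m n. f m (c m \<theta>) = \<psi> m (b m \<theta>)"
    using f[unfolded Kan_fibration_def, THEN conjunct2, rule_format, of n k a "\<lambda>m \<theta>. \<psi> m (b m \<theta>)"] n a b' by blast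
  moreover have "\<pi> m (\<psi> m (b m \<theta>)) = b m \<theta>" if "\<theta> \<in> Delta m n" for m \<theta>
    using assms(3)[OF simplicial_fun_in[OF b]] that by (simp add: std_sset_simps)
  ultimately show "\<exists>c. simplicial_fun (std_sset n) X c \<and>
      (\<forall>m. \<forall>\<theta>\<in>simplices (horn n k) m. c m \<theta> = a m \<theta>) \<and> (\<forall>m. \<forall>\<theta>\<in>Delta m n. \<pi> m (f m (c m \<theta>)) = b m \<theta>)"
    by (intro exI[of _ c]) auto
qed

lemma pullback_simplicial_set:
  assumes "simplicial_set X" "simplicial_set Y" "simplicial_fun X Z f" "simplicial_fun Y Z g"
  shows "simplicial_set (pullback_sset X Y f g)"
proof -
  interpret X: simplicial_set X by fact
  interpret Y: simplicial_set Y by fact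
  show ?thesis
    using simplicial_fun_pull[OF assms(3)] simplicial_fun_pull[OF assms(4)]
    by unfold_locales (auto simp: pullback_sset_def prod_sset_def X.pull_in Y.pull_in X.pull_id Y.pull_id X.pull_comp Y.pull_comp)
qed


section \<open>Simplicial categories\<close>

context category
begin

lemma hom_ob: "f \<in> Hom C X Y \<Longrightarrow> X \<in> Ob C" "f \<in> Hom C X Y \<Longrightarrow> Y \<in> Ob C"
  using src_tgt by (auto simp: Hom_def)

lemma hom_eqs: "f \<in> Hom C X Y \<Longrightarrow> src C f = X" "f \<in> Hom C X Y \<Longrightarrow> tgt C f = Y" "f \<in> Hom C X Y \<Longrightarrow> f \<in> Ar C"
  by (auto simp: Hom_def)

lemma ar_hom: "f \<in> Ar C \<Longrightarrow> f \<in> Hom C (src C f) (tgt C f)" by (simp add: Hom_def)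

end

context simplicial_category
begin

abbreviation mp :: "'v \<Rightarrow> 'v \<Rightarrow> nat \<Rightarrow> 'v set" where "mp X Y \<equiv> simplices (map_sp M X Y)"

lemma map_ss: "X \<in> Ob M \<Longrightarrow> Y \<in> Ob M \<Longrightarrow> simplicial_set (map_sp M X Y)"
  using map_sset by (simp add: small_sset_def)

lemma scomp_in: "X \<in> Ob M \<Longrightarrow> Y \<in> Ob M \<Longrightarrow> Z \<in> Ob M \<Longrightarrow> g \<in> mp Y Z n \<Longrightarrow> f \<in> mp X Y n \<Longrightarrow>
    scomp M X Y Z n g f \<in> mp X Z n"
  using simplicial_fun_in[OF scomp_simplicial, of X Y Z "(g, f)" n] by (simp add: prod_sset_def)

lemma scomp_pull: "X \<in> Ob M \<Longrightarrow> Y \<in> Ob M \<Longrightarrow> Z \<in> Ob M \<Longrightarrow> g \<in> mp Y Z n \<Longrightarrow> f \<in> mp X Y n \<Longrightarrow> \<theta> \<in> Delta m n \<Longrightarrow>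
    pull (map_sp M X Z) m n \<theta> (scomp M X Y Z n g f) =
    scomp M X Y Z m (pull (map_sp M Y Z) m n \<theta> g) (pull (map_sp M X Y) m n \<theta> f)"
  using simplicial_fun_pull[OF scomp_simplicial, of X Y Z \<theta> m n "(g, f)"] by (simp add: prod_sset_def)

lemma mp0: "f \<in> Hom M X Y \<Longrightarrow> f \<in> mp X Y 0"
  using map_vertices[of X Y] hom_ob by auto

lemma degen_eq: "f \<in> Hom M X Y \<Longrightarrow> degen M f n = pull (map_sp M X Y) n 0 (\<lambda>_\<in>{..n}. 0) f"
  by (simp add: degen_def hom_eqs)

lemma degen_in: "f \<in> Hom M X Y \<Longrightarrow> degen M f n \<in> mp X Y n"
  unfolding degen_eq
  by (rule simplicial_set.pull_in[OF map_ss const_Delta mp0]) (auto intro: hom_ob)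

lemma degen_pull:
  assumes f: "f \<in> Hom M X Y" and \<theta>: "\<theta> \<in> Delta m n"
  shows "pull (map_sp M X Y) m n \<theta> (degen M f n) = degen M f m"
proof -
  have "compose {..m} (\<lambda>_\<in>{..n}. 0 :: nat) \<theta> = (\<lambda>_\<in>{..m}. 0)"
    using Delta_le[OF \<theta>] by (auto simp: compose_def restrict_def fun_eq_iff)
  then show ?thesis
    unfolding degen_eq[OF f]
    using simplicial_set.pull_comp[OF map_ss[OF hom_ob[OF f]] \<theta> const_Delta[of 0 0 n] mp0[OF f]] by simp
qed

lemma degen_0: "f \<in> Hom M X Y \<Longrightarrow> degen M f 0 = f"
proof -
  assume f: "f \<in> Hom M X Y"
  have "(\<lambda>_\<in>{..0::nat}. 0) = (\<lambda>i\<in>{..0::nat}. i)" by (auto simp: restrict_def)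
  then show ?thesis unfolding degen_eq[OF f] using simplicial_set.pull_id[OF map_ss[OF hom_ob[OF f]] mp0[OF f]] by simp
qed

lemma degen_comp:
  assumes f: "f \<in> Hom M X Y" and g: "g \<in> Hom M Y Z"
  shows "scomp M X Y Z n (degen M g n) (degen M f n) = degen M (g \<cdot> f) n"
proof -
  note o = hom_ob[OF f] hom_ob[OF g]
  have "pull (map_sp M X Z) n 0 (\<lambda>_\<in>{..n}. 0) (scomp M X Y Z 0 g f) =
      scomp M X Y Z n (degen M g n) (degen M f n)"
    unfolding degen_eq[OF f] degen_eq[OF g]
    by (rule scomp_pull[OF o(1,2,4) mp0[OF g] mp0[OF f] const_Delta]) simp
  then show ?thesis using degen_eq[OF comp_in[OF f g]] scomp_vertices[OF f g] by simp
qed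

lemma postcomp_eq: "p \<in> Hom M X Y \<Longrightarrow> postcomp M W p n g = scomp M W X Y n (degen M p n) g"
  by (simp add: postcomp_def hom_eqs)

lemma precomp_eq: "i \<in> Hom M A B \<Longrightarrow> precomp M i Z n g = scomp M A B Z n g (degen M i n)"
  by (simp add: precomp_def hom_eqs)

lemma postcomp_fun:
  assumes W: "W \<in> Ob M" and p: "p \<in> Hom M X Y"
  shows "simplicial_fun (map_sp M W X) (map_sp M W Y) (postcomp M W p)"
  unfolding simplicial_fun_def postcomp_eq[OF p]
  using scomp_in[OF W hom_ob[OF p] degen_in[OF p]] scomp_pull[OF W hom_ob[OF p] degen_in[OF p]] degen_pull[OF p] by simp

lemma precomp_fun:
  assumes Z: "Z \<in> Ob M" and i: "i \<in> Hom M A B"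
  shows "simplicial_fun (map_sp M B Z) (map_sp M A Z) (precomp M i Z)"
  unfolding simplicial_fun_def precomp_eq[OF i]
  using scomp_in[OF hom_ob[OF i] Z _ degen_in[OF i]] scomp_pull[OF hom_ob[OF i] Z _ degen_in[OF i]] degen_pull[OF i] by simp

lemma postcomp_comp:
  assumes "W \<in> Ob M" and p: "p \<in> Hom M X Y" and q: "q \<in> Hom M Y Z" and g: "g \<in> mp W X n"
  shows "postcomp M W (q \<cdot> p) n g = postcomp M W q n (postcomp M W p n g)"
  unfolding postcomp_eq[OF p] postcomp_eq[OF q] postcomp_eq[OF comp_in[OF p q]] degen_comp[OF p q, symmetric]
  by (rule scomp_assoc) (use assms hom_ob[OF p] hom_ob[OF q] degen_in in auto)

lemma precomp_comp:
  assumes "Z \<in> Ob M" and i: "i \<in> Hom M A B" and j: "j \<in> Hom M B D" and g: "g \<in> mp D Z n"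
  shows "precomp M (j \<cdot> i) Z n g = precomp M i Z n (precomp M j Z n g)"
  unfolding precomp_eq[OF i] precomp_eq[OF j] precomp_eq[OF comp_in[OF i j]] degen_comp[OF i j, symmetric]
  by (rule scomp_assoc[symmetric]) (use assms hom_ob[OF i] hom_ob[OF j] degen_in in auto)

text \<open>Associativity of the enriched composition; this interchange is what makes corner maps
  land in the fibre product.\<close>

lemma pre_post:
  assumes i: "i \<in> Hom M A B" and p: "p \<in> Hom M X Y" and g: "g \<in> mp B X n"
  shows "precomp M i Y n (postcomp M B p n g) = postcomp M A p n (precomp M i X n g)"
  unfolding precomp_eq[OF i] postcomp_eq[OF p]
  by (rule scomp_assoc) (use g hom_ob[OF i] hom_ob[OF p] degen_in[OF i] degen_in[OF p] in auto)

lemma postcomp_0: "p \<in> Hom M X Y \<Longrightarrow> g \<in> Hom M W X \<Longrightarrow> postcomp M W p 0 g = p \<cdot> g"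
  by (simp add: postcomp_eq degen_0 scomp_vertices)

lemma precomp_0: "i \<in> Hom M A B \<Longrightarrow> g \<in> Hom M B Z \<Longrightarrow> precomp M i Z 0 g = g \<cdot> i"
  by (simp add: precomp_eq degen_0 scomp_vertices)

lemma precomp_degen: "i \<in> Hom M A B \<Longrightarrow> f \<in> Hom M B Z \<Longrightarrow> precomp M i Z n (degen M f n) = degen M (f \<cdot> i) n"
  by (simp add: precomp_eq degen_comp)

lemma corner_target_ss:
  assumes "i \<in> Hom M A B" "p \<in> Hom M X Y" shows "simplicial_set (corner_target M i p)"
  unfolding corner_target_def
  by (rule pullback_simplicial_set)
    (use assms in \<open>auto simp: hom_eqs intro!: map_ss postcomp_fun precomp_fun intro: hom_ob\<close>)

end

section \<open>Mapping spaces in simplicial model categories\<close>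

locale model_universe = simplicial_model_category M + universe universe_type
  for M :: "('v, 'm) smodel_scheme" (structure) and universe_type :: "'v itself"
begin

text \<open>The (co)tensor with the empty simplicial set has points as mapping spaces.\<close>

lemma empty_sset: "small_sset (\<lparr>simplices = (\<lambda>_. {}), pull = (\<lambda>_ _ _ x. x)\<rparr> :: 'v sset)"
  using sm_finite[of "{} :: 'v set"] sm_small[of "{}"] by (simp add: small_sset_def simplicial_set_def)

text \<open>Initiality speaks of vertices only. The tensor \<open>E\<close> of \<open>I\<close> with
  the empty simplicial set has points as mapping spaces in all degrees, and \<open>I\<close> is a
  retract of \<open>E\<close>.\<close>

lemma initial_single:
  assumes I: "initial_ob M I" and Y: "Y \<in> Ob M" shows "\<exists>e. mp I Y n = {e}"
proof -
  have IO: "I \<in> Ob M" using I by (simp add: initial_ob_def)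
  obtain E u where E: "is_tensor M I \<lparr>simplices = (\<lambda>_. {}), pull = (\<lambda>_ _ _ x. x)\<rparr> E u"
    using tensors[OF IO empty_sset] by blast
  have EO: "E \<in> Ob M" using E by (simp add: is_tensor_def)
  have uq: "\<exists>!g. g \<in> mp E Z n" if "Z \<in> Ob M" for Z n
    using E[unfolded is_tensor_def, THEN conjunct2, THEN conjunct2, rule_format, OF that, of n "\<lambda>_ _. undefined"]
    by (simp add: simplicial_fun_def prod_sset_def)
  obtain f where f: "f \<in> Hom M I E" using I EO unfolding initial_ob_def by blast
  obtain g where g: "g \<in> Hom M E I" using uq[OF IO, of 0] map_vertices[OF EO IO] by auto
  have gf: "g \<cdot> f = ide M I" using I IO comp_in[OF f g] ide_in[OF IO] unfolding initial_ob_def by blast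
  have r: "precomp M f Y n (precomp M g Y n x) = x" if "x \<in> mp I Y n" for x
    using precomp_comp[OF Y f g that] scomp_ide_right[OF IO Y that] gf by simp
  obtain e where e: "e \<in> mp E Y n" "\<And>e'. e' \<in> mp E Y n \<Longrightarrow> e' = e" using uq[OF Y] by blast
  have "x = precomp M f Y n e" if "x \<in> mp I Y n" for x
    using r[OF that] e(2)[OF simplicial_fun_in[OF precomp_fun[OF Y g] that]] by simp
  moreover have "precomp M f Y n e \<in> mp I Y n" by (rule simplicial_fun_in[OF precomp_fun[OF Y f] e(1)])
  ultimately show ?thesis by (intro exI[of _ "precomp M f Y n e"]) blast
qed

lemma terminal_single:
  assumes T: "terminal_ob M T" and X: "X \<in> Ob M" shows "\<exists>e. mp X T n = {e}"
proof -
  have TO: "T \<in> Ob M" using T by (simp add: terminal_ob_def)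
  obtain E u where E: "is_cotensor M T \<lparr>simplices = (\<lambda>_. {}), pull = (\<lambda>_ _ _ x. x)\<rparr> E u"
    using cotensors[OF TO empty_sset] by blast
  have EO: "E \<in> Ob M" using E by (simp add: is_cotensor_def)
  have uq: "\<exists>!g. g \<in> mp Z E n" if "Z \<in> Ob M" for Z n
    using E[unfolded is_cotensor_def, THEN conjunct2, THEN conjunct2, rule_format, OF that, of n "\<lambda>_ _. undefined"]
    by (simp add: simplicial_fun_def prod_sset_def)
  obtain f where f: "f \<in> Hom M E T" using T EO unfolding terminal_ob_def by blast
  obtain g where g: "g \<in> Hom M T E" using uq[OF TO, of 0] map_vertices[OF TO EO] by auto
  have fg: "f \<cdot> g = ide M T" using T TO comp_in[OF g f] ide_in[OF TO] unfolding terminal_ob_def by blast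
  have r: "postcomp M X f n (postcomp M X g n x) = x" if "x \<in> mp X T n" for x
    using postcomp_comp[OF X g f that] scomp_ide_left[OF X TO that] fg by simp
  obtain e where e: "e \<in> mp X E n" "\<And>e'. e' \<in> mp X E n \<Longrightarrow> e' = e" using uq[OF X] by blast
  have "x = postcomp M X f n e" if "x \<in> mp X T n" for x
    using r[OF that] e(2)[OF simplicial_fun_in[OF postcomp_fun[OF X g] that]] by simp
  moreover have "postcomp M X f n e \<in> mp X T n" by (rule simplicial_fun_in[OF postcomp_fun[OF X f] e(1)])
  ultimately show ?thesis by (intro exI[of _ "postcomp M X f n e"]) blast
qed

text \<open>This is the corner axiom for the cofibration from the initial object to
  \<open>A\<close>: the mapping spaces out of the initial object are points, so the corner target is
  \<open>map(A, Y)\<close>.\<close>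

lemma postcomp_fib:
  assumes A: "cofibrant M A" and p: "p \<in> fib M" "p \<in> Hom M X Y"
  shows "Kan_fibration (map_sp M A X) (map_sp M A Y) (postcomp M A p)"
    and "p \<in> weq M \<Longrightarrow> sset_weq (map_sp M A X) (map_sp M A Y) (postcomp M A p)"
proof -
  obtain I i where I: "initial_ob M I" "i \<in> Hom M I A" "i \<in> cof M" using A unfolding cofibrant_def by blast
  note o = hom_ob[OF I(2)] hom_ob[OF p(2)]
  obtain e where e: "\<And>n. mp I X n = {e n}" using initial_single[OF I(1) o(3)] by metis
  obtain e' where e': "\<And>n. mp I Y n = {e' n}" using initial_single[OF I(1) o(4)] by metis
  let ?P = "corner_target M i p"
  have P: "simplices ?P n = mp I X n \<times> mp A Y n" for n
    using simplicial_fun_in[OF postcomp_fun[OF o(1) p(2)]] simplicial_fun_in[OF precomp_fun[OF o(4) I(2)]] e e'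
    by (fastforce simp: corner_target_def pullback_sset_def hom_eqs[OF I(2)] hom_eqs[OF p(2)])
  have Pp: "pull ?P m n \<theta> x = (pull (map_sp M I X) m n \<theta> (fst x), pull (map_sp M A Y) m n \<theta> (snd x))" for m n \<theta> x
    by (cases x) (simp add: corner_target_def pullback_sset_def prod_sset_def hom_eqs[OF I(2)] hom_eqs[OF p(2)])
  have \<pi>: "simplicial_fun ?P (map_sp M A Y) (\<lambda>_. snd)" unfolding simplicial_fun_def P Pp by auto
  have pe: "pull (map_sp M I X) m n \<theta> (e n) = e m" if "\<theta> \<in> Delta m n" for m n \<theta>
    using simplicial_set.pull_in[OF map_ss[OF o(1,3)] that, of "e n"] e by simp
  have \<psi>: "simplicial_fun (map_sp M A Y) ?P (\<lambda>n y. (e n, y))" unfolding simplicial_fun_def P Pp using e pe by simp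
  have iso: "snd (e n, y) = y" "x \<in> simplices ?P n \<Longrightarrow> (e n, snd x) = x" for x y n
    using e unfolding P by auto
  have c: "corner_map M i p = (\<lambda>n g. (precomp M i X n g, postcomp M A p n g))"
    by (simp add: fun_eq_iff corner_map_def hom_eqs[OF I(2)] hom_eqs[OF p(2)])
  note k = corner[OF I(3) p(1), unfolded c hom_eqs[OF I(2)] hom_eqs[OF p(2)]]
  show "Kan_fibration (map_sp M A X) (map_sp M A Y) (postcomp M A p)"
    using Kan_fibration_iso[OF \<pi> \<psi> iso k[THEN conjunct1]] by simp
  show "sset_weq (map_sp M A X) (map_sp M A Y) (postcomp M A p)" if "p \<in> weq M"
    using sset_weq_comp[OF corner_target_ss[OF I(2) p(2)] map_ss[OF o(2,4)] _
        sset_weq_iso[OF corner_target_ss[OF I(2) p(2)] map_ss[OF o(2,4)] \<pi> \<psi> iso]] k that by fastforce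
qed

text \<open>Dually, the corner axiom for the fibration from \<open>X\<close> to the terminal
  object.\<close>

lemma precomp_cof:
  assumes X: "fibrant M X" and i: "i \<in> cof M" "i \<in> Hom M A B"
  shows "Kan_fibration (map_sp M B X) (map_sp M A X) (precomp M i X)"
    and "i \<in> weq M \<Longrightarrow> sset_weq (map_sp M B X) (map_sp M A X) (precomp M i X)"
proof -
  obtain T p where T: "terminal_ob M T" "p \<in> Hom M X T" "p \<in> fib M" using X unfolding fibrant_def by blast
  note o = hom_ob[OF i(2)] hom_ob[OF T(2)]
  obtain e where e: "\<And>n. mp B T n = {e n}" using terminal_single[OF T(1) o(2)] by metis
  obtain e' where e': "\<And>n. mp A T n = {e' n}" using terminal_single[OF T(1) o(1)] by metis
  let ?P = "corner_target M i p"
  have P: "simplices ?P n = mp A X n \<times> mp B T n" for n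
    using simplicial_fun_in[OF postcomp_fun[OF o(1) T(2)]] simplicial_fun_in[OF precomp_fun[OF o(4) i(2)]] e e'
    by (fastforce simp: corner_target_def pullback_sset_def hom_eqs[OF i(2)] hom_eqs[OF T(2)])
  have Pp: "pull ?P m n \<theta> x = (pull (map_sp M A X) m n \<theta> (fst x), pull (map_sp M B T) m n \<theta> (snd x))" for m n \<theta> x
    by (cases x) (simp add: corner_target_def pullback_sset_def prod_sset_def hom_eqs[OF i(2)] hom_eqs[OF T(2)])
  have \<pi>: "simplicial_fun ?P (map_sp M A X) (\<lambda>_. fst)" unfolding simplicial_fun_def P Pp by auto
  have pe: "pull (map_sp M B T) m n \<theta> (e n) = e m" if "\<theta> \<in> Delta m n" for m n \<theta>
    using simplicial_set.pull_in[OF map_ss[OF o(2,4)] that, of "e n"] e by simp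
  have \<psi>: "simplicial_fun (map_sp M A X) ?P (\<lambda>n y. (y, e n))" unfolding simplicial_fun_def P Pp using e pe by simp
  have iso: "fst (y, e n) = y" "x \<in> simplices ?P n \<Longrightarrow> (fst x, e n) = x" for x y n
    using e unfolding P by auto
  have c: "corner_map M i p = (\<lambda>n g. (precomp M i X n g, postcomp M B p n g))"
    by (simp add: fun_eq_iff corner_map_def hom_eqs[OF i(2)] hom_eqs[OF T(2)])
  note k = corner[OF i(1) T(3), unfolded c hom_eqs[OF i(2)] hom_eqs[OF T(2)]]
  show "Kan_fibration (map_sp M B X) (map_sp M A X) (precomp M i X)"
    using Kan_fibration_iso[OF \<pi> \<psi> iso k[THEN conjunct1]] by simp
  show "sset_weq (map_sp M B X) (map_sp M A X) (precomp M i X)" if "i \<in> weq M"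
    using sset_weq_comp[OF corner_target_ss[OF i(2) T(2)] map_ss[OF o(1,3)] _
        sset_weq_iso[OF corner_target_ss[OF i(2) T(2)] map_ss[OF o(1,3)] \<pi> \<psi> iso]] k that by fastforce
qed

lemma finite_Delta: "finite (Delta m n)"
  by (rule finite_subset[of _ "{..m} \<rightarrow>\<^sub>E {..n}"]) (auto simp: Delta_def intro: finite_PiE)

text \<open>The cotensor with a copy of \<open>\<Delta>[n]\<close> inside the universe represents \<open>n\<close>-simplices.\<close>

lemma representing_object:
  assumes Y: "Y \<in> Ob M"
  shows "\<exists>P\<in>Ob M. \<exists>w\<in>mp P Y n. \<forall>X\<in>Ob M. \<forall>e\<in>mp X Y n. \<exists>!g. g \<in> Hom M X P \<and> precomp M g Y n w = e"
proof -
  \<comment> \<open>Cotensors exist for simplicial sets with simplices in the universe, so the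
    standard simplex is copied there, degree by degree.\<close>
  have "\<exists>c :: (nat \<Rightarrow> nat) \<Rightarrow> 'v. inj_on c (Delta m n)" for m
    by (rule inj_exists[of "Delta m n"]) (use sm_finite[OF finite_Delta] in \<open>auto simp: sm_def intro: ordLess_imp_ordLeq\<close>)
  then obtain c :: "nat \<Rightarrow> (nat \<Rightarrow> nat) \<Rightarrow> 'v" where c: "\<And>m. inj_on (c m) (Delta m n)" by metis
  define d where "d m = inv_into (Delta m n) (c m)" for m
  define K :: "'v sset" where "K = \<lparr>simplices = (\<lambda>m. c m ` Delta m n), pull = (\<lambda>l m \<phi> k. c l (compose {..l} (d m k) \<phi>))\<rparr>"
  have dc: "d m (c m \<theta>) = \<theta>" if "\<theta> \<in> Delta m n" for m \<theta> unfolding d_def using c that by simp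
  have Ks: "simplices K m = c m ` Delta m n" for m by (simp add: K_def)
  have Kp: "pull K l m \<phi> (c m \<theta>) = c l (compose {..l} \<theta> \<phi>)" if "\<theta> \<in> Delta m n" for l m \<phi> \<theta>
    using dc[OF that] by (simp add: K_def)
  have idc: "compose {..m} \<theta> (\<lambda>i\<in>{..m}. i) = \<theta>" if "\<theta> \<in> Delta m n" for m and \<theta> :: "nat \<Rightarrow> nat"
    using that by (auto simp: Delta_def compose_def PiE_def extensional_def fun_eq_iff)
  have cid: "compose {..m} (\<lambda>i\<in>{..n}. i) \<theta> = \<theta>" if "\<theta> \<in> Delta m n" for m and \<theta> :: "nat \<Rightarrow> nat"
    using that Delta_le[OF that] by (auto simp: Delta_def compose_def PiE_def extensional_def fun_eq_iff)
  have cc: "compose {..l} \<theta> (compose {..l} \<phi> \<psi>) = compose {..l} (compose {..m} \<theta> \<phi>) \<psi>" if "\<psi> \<in> Delta l m"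
    for l m and \<theta> \<phi> \<psi> :: "nat \<Rightarrow> nat"
    using Delta_le[OF that] by (auto simp: compose_def fun_eq_iff)
  have "simplicial_set K"
  proof
    show "pull K m n' \<theta> x \<in> simplices K m" if "\<theta> \<in> Delta m n'" "x \<in> simplices K n'" for m n' \<theta> x
      using that comp_Delta[of \<theta> m n' _ n] by (auto simp: Ks Kp)
    show "pull K m m (\<lambda>i\<in>{..m}. i) x = x" if "x \<in> simplices K m" for m x
      using that by (auto simp: Ks Kp idc)
    show "pull K l n' (compose {..l} \<theta> \<phi>) x = pull K l m \<phi> (pull K m n' \<theta> x)"
      if "\<phi> \<in> Delta l m" "\<theta> \<in> Delta m n'" "x \<in> simplices K n'" for l m n' \<phi> \<theta> x
      using that comp_Delta[OF that(2), of _ n] by (auto simp: Ks Kp cc[OF that(1)])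
  qed
  then have Ksm: "small_sset K"
    unfolding small_sset_def Ks using sm_finite[OF finite_imageI[OF finite_Delta]] sm_small by blast
  obtain P u where P: "is_cotensor M Y K P u" using cotensors[OF Y Ksm] by blast
  have PO: "P \<in> Ob M" and u: "simplicial_fun K (map_sp M P Y) u" using P by (auto simp: is_cotensor_def)
  let ?id = "\<lambda>i\<in>{..n}. i :: nat"
  define w where "w = u n (c n ?id)"
  have w: "w \<in> mp P Y n" unfolding w_def by (rule simplicial_fun_in[OF u]) (simp add: Ks id_Delta)
  have uw: "u m (c m \<psi>) = pull (map_sp M P Y) m n \<psi> w" if "\<psi> \<in> Delta m n" for m \<psi>
    unfolding w_def using simplicial_fun_pull[OF u that, of "c n ?id"] by (simp add: Ks Kp id_Delta cid[OF that])
  have "\<exists>!g. g \<in> Hom M X P \<and> precomp M g Y n w = e" if X: "X \<in> Ob M" and e: "e \<in> mp X Y n" for X e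
  proof -
    interpret XY: simplicial_set "map_sp M X Y" by (rule map_ss[OF X Y])
    \<comment> \<open>The universal property is applied in degree 0, where \<open>Delta m 0\<close>
      is a singleton. A map out of the copied simplex is determined by its generic simplex, and this
      turns the property into the bijection between maps to \<open>P\<close> and simplices
      \<open>e\<close>.\<close>
    define h where "h m = (\<lambda>(k, \<theta> :: nat \<Rightarrow> nat). pull (map_sp M X Y) m n (d m k) e)" for m
    have "simplicial_fun (prod_sset K (std_sset 0)) (map_sp M X Y) h"
      unfolding simplicial_fun_def
    proof (intro conjI allI ballI)
      show "h m x \<in> mp X Y m" if "x \<in> simplices (prod_sset K (std_sset 0)) m" for m x
        using that XY.pull_in[OF _ e] by (auto simp: h_def prod_sset_def Ks dc)
      show "h l (pull (prod_sset K (std_sset 0)) l m \<phi> x) = pull (map_sp M X Y) l m \<phi> (h m x)"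
        if "\<phi> \<in> Delta l m" "x \<in> simplices (prod_sset K (std_sset 0)) m" for l m \<phi> x
        using that XY.pull_comp[OF that(1) _ e] comp_Delta[OF that(1), of _ n]
        by (auto simp: h_def prod_sset_def Ks dc Kp)
    qed
    note ex = P[unfolded is_cotensor_def, THEN conjunct2, THEN conjunct2, rule_format, OF X this]
    have D0: "Delta m 0 = {\<lambda>_\<in>{..m}. 0}" for m
      using const_Delta[of 0 0 m] by (auto simp: Delta_def PiE_def extensional_def fun_eq_iff)
    have iff: "(g \<in> mp X P 0 \<and> (\<forall>m. \<forall>k\<in>simplices K m. \<forall>\<theta>\<in>Delta m 0.
        h m (k, \<theta>) = scomp M X P Y m (u m k) (pull (map_sp M X P) m 0 \<theta> g))) \<longleftrightarrow>
        g \<in> Hom M X P \<and> precomp M g Y n w = e" for g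
    proof -
      have "(\<forall>m. \<forall>k\<in>simplices K m. \<forall>\<theta>\<in>Delta m 0.
          h m (k, \<theta>) = scomp M X P Y m (u m k) (pull (map_sp M X P) m 0 \<theta> g)) \<longleftrightarrow> precomp M g Y n w = e"
        if g: "g \<in> Hom M X P"
      proof -
        have "(\<forall>m. \<forall>k\<in>simplices K m. \<forall>\<theta>\<in>Delta m 0.
            h m (k, \<theta>) = scomp M X P Y m (u m k) (pull (map_sp M X P) m 0 \<theta> g)) \<longleftrightarrow>
          (\<forall>m. \<forall>\<psi>\<in>Delta m n. pull (map_sp M X Y) m n \<psi> e = precomp M g Y m (pull (map_sp M P Y) m n \<psi> w))"
          unfolding Ks D0 using uw by (simp add: h_def dc precomp_eq[OF g] degen_eq[OF g])
        also have "\<dots> \<longleftrightarrow> (\<forall>m. \<forall>\<psi>\<in>Delta m n. pull (map_sp M X Y) m n \<psi> e = pull (map_sp M X Y) m n \<psi> (precomp M g Y n w))"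
          using simplicial_fun_pull[OF precomp_fun[OF Y g] _ w] by simp
        also have "\<dots> \<longleftrightarrow> precomp M g Y n w = e"
          using XY.pull_id[OF e] XY.pull_id[OF simplicial_fun_in[OF precomp_fun[OF Y g] w]] id_Delta[of n] by metis
        finally show ?thesis .
      qed
      then show ?thesis unfolding map_vertices[OF X PO] by blast
    qed
    show ?thesis using ex unfolding iff .
  qed
  then show ?thesis using PO w by blast
qed

end

section \<open>Lifting and retract arguments in a model category\<close>

context model_category
begin

lemma weq_comp: "f \<in> weq M \<Longrightarrow> g \<in> weq M \<Longrightarrow> f \<in> Hom M X Y \<Longrightarrow> g \<in> Hom M Y Z \<Longrightarrow> g \<cdot> f \<in> weq M"
  and weq_left: "f \<in> weq M \<Longrightarrow> g \<cdot> f \<in> weq M \<Longrightarrow> f \<in> Hom M X Y \<Longrightarrow> g \<in> Hom M Y Z \<Longrightarrow> g \<in> weq M"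
  and weq_right: "g \<in> weq M \<Longrightarrow> g \<cdot> f \<in> weq M \<Longrightarrow> f \<in> Hom M X Y \<Longrightarrow> g \<in> Hom M Y Z \<Longrightarrow> f \<in> weq M"
  using two_of_three[of f X Y g Z] by blast+

lemma factorization_hom:
  assumes F: "functorial_factorization M \<L> \<R>" and f: "f \<in> Hom M X Y"
  shows "\<exists>Z. \<exists>j\<in>Hom M X Z. \<exists>p\<in>Hom M Z Y. p \<cdot> j = f \<and> j \<in> \<L> \<and> p \<in> \<R>"
proof -
  show ?thesis
    using F unfolding functorial_factorization_def
  proof (elim exE conjE, goal_cases)
    case (1 l r e)
    note h = bspec[OF 1(1) hom_eqs(3)[OF f]]
    have "l f \<in> Hom M X (tgt M (l f))" "r f \<in> Hom M (tgt M (l f)) Y" "r f \<cdot> l f = f" "l f \<in> \<L>" "r f \<in> \<R>"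
      using h unfolding Hom_def hom_eqs(1)[OF f] hom_eqs(2)[OF f] by blast+
    then show ?case by blast
  qed
qed

lemmas factor_cof_tfib = factorization_hom[OF factorization1]
lemmas factor_tcof_fib = factorization_hom[OF factorization2]

text \<open>Factor the identity through a weak equivalence \<open>p\<close>; composing
  \<open>p\<close> with the identity gives \<open>p\<close> again, so two out of three
  applies.\<close>

lemma ide_weq: "X \<in> Ob M \<Longrightarrow> ide M X \<in> weq M"
proof -
  assume "X \<in> Ob M"
  from ide_in[OF this] obtain Z j p where "p \<in> Hom M Z X" "p \<in> weq M"
    using factor_cof_tfib[of "ide M X" X X] by blast
  then show ?thesis using weq_left[of p "ide M X"] ide_left[of p Z X] ide_in[OF \<open>X \<in> Ob M\<close>] by simp
qed

lemma lift:
  assumes "i \<in> cof M" "p \<in> fib M" "i \<in> weq M \<or> p \<in> weq M" "i \<in> Hom M A B" "p \<in> Hom M X Y"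
    "u \<in> Hom M A X" "v \<in> Hom M B Y" "v \<cdot> i = p \<cdot> u"
  shows "\<exists>h\<in>Hom M B X. h \<cdot> i = u \<and> p \<cdot> h = v"
  using lifting[OF assms(1-3)] assms(4-) unfolding has_lifting_def square_def by (simp add: hom_eqs[OF assms(4)] hom_eqs[OF assms(5)])

lemma has_liftingD:
  assumes "has_lifting M i p" "i \<in> Hom M A B" "p \<in> Hom M X Y" "u \<in> Hom M A X" "v \<in> Hom M B Y" "v \<cdot> i = p \<cdot> u"
  shows "\<exists>h\<in>Hom M B X. h \<cdot> i = u \<and> p \<cdot> h = v"
  using assms unfolding has_lifting_def square_def by (simp add: hom_eqs[OF assms(2)] hom_eqs[OF assms(3)])

lemma has_liftingI:
  assumes "i \<in> Hom M A B" "p \<in> Hom M X Y"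
    "\<And>u v. u \<in> Hom M A X \<Longrightarrow> v \<in> Hom M B Y \<Longrightarrow> v \<cdot> i = p \<cdot> u \<Longrightarrow> \<exists>h\<in>Hom M B X. h \<cdot> i = u \<and> p \<cdot> h = v"
  shows "has_lifting M i p"
  using assms(3) unfolding has_lifting_def square_def by (simp add: hom_eqs[OF assms(1)] hom_eqs[OF assms(2)])

text \<open>The retraction is a lift in the square with the identity on top and \<open>p'\<close> at
  the bottom.\<close>

lemma rlp_retract:
  assumes p: "p \<in> Hom M X Y" and j: "j \<in> Hom M X Z" and p': "p' \<in> Hom M Z Y" "p' \<cdot> j = p" and l: "has_lifting M j p"
  shows "is_retract M p p'"
proof -
  note o = hom_ob[OF p]
  obtain h where h: "h \<in> Hom M Z X" "h \<cdot> j = ide M X" "p \<cdot> h = p'"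
    using has_liftingD[OF l j p ide_in[OF o(1)] p'(1)] p' ide_right[OF p] by auto
  have "square M p p' j (ide M Y)" "square M p' p h (ide M Y)"
    unfolding square_def hom_eqs[OF p] hom_eqs[OF p'(1)]
    using p p' j h ide_in[OF o(2)] ide_left[OF p] ide_left[OF p'(1)] hom_eqs[OF p] hom_eqs[OF p'(1)] by simp_all
  moreover have "ide M Y \<cdot> ide M Y = ide M Y" using ide_left[OF ide_in[OF o(2)]] .
  ultimately show ?thesis unfolding is_retract_def using h hom_eqs[OF p] by metis
qed

lemma llp_retract:
  assumes i: "i \<in> Hom M A B" and j: "j \<in> Hom M A Z" and p: "p \<in> Hom M Z B" "p \<cdot> j = i" and l: "has_lifting M i p"
  shows "is_retract M i j"
proof -
  note o = hom_ob[OF i]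
  obtain h where h: "h \<in> Hom M B Z" "h \<cdot> i = j" "p \<cdot> h = ide M B"
    using has_liftingD[OF l i p(1) j ide_in[OF o(2)]] p ide_left[OF i] by auto
  have "square M i j (ide M A) h" "square M j i (ide M A) p"
    unfolding square_def hom_eqs[OF i] hom_eqs[OF j]
    using p i j h ide_in[OF o(1)] ide_right[OF i] ide_right[OF j] hom_eqs[OF i] hom_eqs[OF j] by simp_all
  moreover have "ide M A \<cdot> ide M A = ide M A" using ide_left[OF ide_in[OF o(1)]] .
  ultimately show ?thesis unfolding is_retract_def using h hom_eqs[OF i] by metis
qed

text \<open>In a factorization of \<open>p\<close> into a cofibration and a trivial fibration,
  lifting against the first factor exhibits \<open>p\<close> as a retract of the second.\<close>

lemma tfib_rlp:
  assumes p: "p \<in> Hom M X Y" and l: "\<And>i. i \<in> cof M \<Longrightarrow> has_lifting M i p" shows "p \<in> fib M \<and> p \<in> weq M"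
proof -
  obtain Z j p' where z: "j \<in> Hom M X Z" "p' \<in> Hom M Z Y" "p' \<cdot> j = p" "j \<in> cof M" "p' \<in> fib M \<inter> weq M"
    using factor_cof_tfib[OF p] by blast
  show ?thesis using retracts[OF rlp_retract[OF p z(1-3) l[OF z(4)]]] z(5) by blast
qed

lemma fib_rlp:
  assumes p: "p \<in> Hom M X Y" and l: "\<And>i. i \<in> cof M \<Longrightarrow> i \<in> weq M \<Longrightarrow> has_lifting M i p" shows "p \<in> fib M"
proof -
  obtain Z j p' where z: "j \<in> Hom M X Z" "p' \<in> Hom M Z Y" "p' \<cdot> j = p" "j \<in> cof M \<inter> weq M" "p' \<in> fib M"
    using factor_tcof_fib[OF p] by blast
  have "has_lifting M j p" by (rule l) (use z(4) in auto)
  from retracts[OF rlp_retract[OF p z(1-3) this]] show ?thesis using z(5) by blast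
qed

lemma cof_llp:
  assumes i: "i \<in> Hom M A B" and l: "\<And>p. p \<in> fib M \<Longrightarrow> p \<in> weq M \<Longrightarrow> has_lifting M i p" shows "i \<in> cof M"
proof -
  obtain Z j p where z: "j \<in> Hom M A Z" "p \<in> Hom M Z B" "p \<cdot> j = i" "j \<in> cof M" "p \<in> fib M \<inter> weq M"
    using factor_cof_tfib[OF i] by blast
  have "has_lifting M i p" by (rule l) (use z(5) in auto)
  from retracts[OF llp_retract[OF i z(1-3) this]] show ?thesis using z(4) by blast
qed

lemma cof_comp:
  assumes i: "i \<in> Hom M A B" "i \<in> cof M" and j: "j \<in> Hom M B D" "j \<in> cof M" shows "j \<cdot> i \<in> cof M"
proof (rule cof_llp[OF comp_in[OF i(1) j(1)]])
  fix p assume p: "p \<in> fib M" "p \<in> weq M"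
  then have ph: "p \<in> Hom M (src M p) (tgt M p)" using fib_ar ar_hom by blast
  show "has_lifting M (j \<cdot> i) p"
  proof (rule has_liftingI[OF comp_in[OF i(1) j(1)] ph])
    fix u v assume u: "u \<in> Hom M A (src M p)" and v: "v \<in> Hom M D (tgt M p)" and c: "v \<cdot> (j \<cdot> i) = p \<cdot> u"
    obtain h where h: "h \<in> Hom M B (src M p)" "h \<cdot> i = u" "p \<cdot> h = v \<cdot> j"
      using lift[OF i(2) p(1) _ i(1) ph u comp_in[OF j(1) v]] p(2) c assoc[OF i(1) j(1) v] by auto
    obtain k where k: "k \<in> Hom M D (src M p)" "k \<cdot> j = h" "p \<cdot> k = v"
      using lift[OF j(2) p(1) _ j(1) ph h(1) v] p(2) h(3) by auto
    show "\<exists>h\<in>Hom M D (src M p). h \<cdot> (j \<cdot> i) = u \<and> p \<cdot> h = v"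
      using k h assoc[OF i(1) j(1) k(1)] by (intro bexI[of _ k]) auto
  qed
qed

lemma fib_comp:
  assumes p: "p \<in> Hom M X Y" "p \<in> fib M" and q: "q \<in> Hom M Y Z" "q \<in> fib M" shows "q \<cdot> p \<in> fib M"
proof (rule fib_rlp[OF comp_in[OF p(1) q(1)]])
  fix i assume i: "i \<in> cof M" "i \<in> weq M"
  then have ih: "i \<in> Hom M (src M i) (tgt M i)" using cof_ar ar_hom by blast
  show "has_lifting M i (q \<cdot> p)"
  proof (rule has_liftingI[OF ih comp_in[OF p(1) q(1)]])
    fix u v assume u: "u \<in> Hom M (src M i) X" and v: "v \<in> Hom M (tgt M i) Z" and c: "v \<cdot> i = (q \<cdot> p) \<cdot> u"
    obtain h where h: "h \<in> Hom M (tgt M i) Y" "h \<cdot> i = p \<cdot> u" "q \<cdot> h = v"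
      using lift[OF i(1) q(2) _ ih q(1) comp_in[OF u p(1)] v] i(2) c assoc[OF u p(1) q(1)] by auto
    obtain k where k: "k \<in> Hom M (tgt M i) X" "k \<cdot> i = u" "p \<cdot> k = h"
      using lift[OF i(1) p(2) _ ih p(1) u h(1)] i(2) h(2) by auto
    show "\<exists>h\<in>Hom M (tgt M i) X. h \<cdot> i = u \<and> (q \<cdot> p) \<cdot> h = v"
      using k h assoc[OF k(1) p(1) q(1)] by (intro bexI[of _ k]) auto
  qed
qed

lemma cofibrant_cof: "cofibrant M A \<Longrightarrow> i \<in> Hom M A B \<Longrightarrow> i \<in> cof M \<Longrightarrow> cofibrant M B"
  unfolding cofibrant_def using cof_comp comp_in by blast

lemma fibrant_fib: "fibrant M Y \<Longrightarrow> p \<in> Hom M X Y \<Longrightarrow> p \<in> fib M \<Longrightarrow> fibrant M X"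
  unfolding fibrant_def using fib_comp comp_in by blast

text \<open>The cofibrant \<open>A\<close> supplies an initial object; factoring its map to
  \<open>X\<close> gives the cover.\<close>

lemma cofibrant_cover:
  assumes A: "cofibrant M A" and X: "X \<in> Ob M"
  shows "\<exists>D. cofibrant M D \<and> (\<exists>d\<in>Hom M D X. d \<in> fib M \<and> d \<in> weq M)"
proof -
  obtain I where I: "initial_ob M I" using A unfolding cofibrant_def by blast
  then obtain f where "f \<in> Hom M I X" using X unfolding initial_ob_def by blast
  then show ?thesis using factor_cof_tfib[of f I X] I unfolding cofibrant_def by blast
qed

lemma cofibrant_lift:
  assumes A: "cofibrant M A" and p: "p \<in> fib M" "p \<in> weq M" "p \<in> Hom M X Y" and f: "f \<in> Hom M A Y"
  shows "\<exists>g\<in>Hom M A X. p \<cdot> g = f"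
proof -
  obtain I i where I: "initial_ob M I" "i \<in> Hom M I A" "i \<in> cof M" using A unfolding cofibrant_def by blast
  obtain u where u: "u \<in> Hom M I X" using I(1) hom_ob[OF p(3)] unfolding initial_ob_def by blast
  have "f \<cdot> i = p \<cdot> u"
    using I(1) hom_ob[OF p(3)] comp_in[OF I(2) f] comp_in[OF u p(3)] unfolding initial_ob_def by blast
  then show ?thesis using lift[OF I(3) p(1) _ I(2) p(3) u f] p(2) by blast
qed

lemma fibrant_extend:
  assumes X: "fibrant M X" and j: "j \<in> cof M" "j \<in> weq M" "j \<in> Hom M A B" and f: "f \<in> Hom M A X"
  shows "\<exists>g\<in>Hom M B X. g \<cdot> j = f"
proof -
  obtain T t where T: "terminal_ob M T" "t \<in> Hom M X T" "t \<in> fib M" using X unfolding fibrant_def by blast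
  obtain v where v: "v \<in> Hom M B T" using T(1) hom_ob[OF j(3)] unfolding terminal_ob_def by blast
  have "v \<cdot> j = t \<cdot> f"
    using T(1) hom_ob[OF j(3)] comp_in[OF j(3) v] comp_in[OF f T(2)] unfolding terminal_ob_def by blast
  then show ?thesis using lift[OF j(1) T(3) _ j(3) T(2) f v] j(2) by blast
qed

end

section \<open>Homotopy invariance of mapping spaces\<close>

context model_universe
begin

lemma fibrant_ob: "fibrant M X \<Longrightarrow> X \<in> Ob M" unfolding fibrant_def using hom_ob by blast
lemma cofibrant_ob: "cofibrant M X \<Longrightarrow> X \<in> Ob M" unfolding cofibrant_def using hom_ob by blast

lemma sset_weq_id:
  assumes X: "simplicial_set X" and f: "\<And>n x. x \<in> simplices X n \<Longrightarrow> f n x = x" shows "sset_weq X X f"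
proof -
  have "sset_weq X X (\<lambda>_ x. x)" by (rule sset_weq_iso[OF X X, where g = "\<lambda>_ x. x"]) (auto simp: simplicial_fun_def)
  then show ?thesis by (rule sset_weq_cong[OF X X]) (simp add: f)
qed

text \<open>
  Ken Brown's lemma. Instead of the graph factorization, which needs products, the trivial
  cofibrations are handled by factoring a retraction and by the two-out-of-six property.
\<close>

lemma postcomp_tcof:
  assumes A: "cofibrant M A" and X: "fibrant M X" and Z: "fibrant M Z"
    and j: "j \<in> cof M" "j \<in> weq M" "j \<in> Hom M X Z"
  shows "sset_weq (map_sp M A X) (map_sp M A Z) (postcomp M A j)"
proof -
  have AO: "A \<in> Ob M" by (rule cofibrant_ob[OF A])
  have XO: "X \<in> Ob M" and ZO: "Z \<in> Ob M" using hom_ob[OF j(3)] by auto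
  obtain \<rho> where \<rho>: "\<rho> \<in> Hom M Z X" "\<rho> \<cdot> j = ide M X" using fibrant_extend[OF X j ide_in[OF XO]] by blast
  have \<rho>w: "\<rho> \<in> weq M" using weq_left[OF j(2) _ j(3) \<rho>(1)] \<rho>(2) ide_weq[OF XO] by simp
  \<comment> \<open>The maps \<open>j\<close>, \<open>j'\<close> and \<sigma> are to satisfy two out
    of six: \<open>j' \<cdot> j\<close> is a section of the trivial fibration
    \<open>\<rho>'\<close>, and \<open>\<sigma> \<cdot> j'\<close> is the identity.\<close>
  obtain Z' j' \<rho>' where f: "j' \<in> Hom M Z Z'" "\<rho>' \<in> Hom M Z' X" "\<rho>' \<cdot> j' = \<rho>" "j' \<in> cof M" "j' \<in> weq M" "\<rho>' \<in> fib M"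
    using factor_tcof_fib[OF \<rho>(1)] by blast
  have \<rho>'w: "\<rho>' \<in> weq M" using weq_left[OF f(5) _ f(1,2)] f(3) \<rho>w by simp
  obtain \<sigma> where \<sigma>: "\<sigma> \<in> Hom M Z' Z" "\<sigma> \<cdot> j' = ide M Z" using fibrant_extend[OF Z f(4,5,1) ide_in[OF ZO]] by blast
  have Z'O: "Z' \<in> Ob M" using hom_ob[OF f(1)] by simp
  note sX = map_ss[OF AO XO] and sZ = map_ss[OF AO ZO] and sZ' = map_ss[OF AO Z'O]
  have jj: "j' \<cdot> j \<in> Hom M X Z'" by (rule comp_in[OF j(3) f(1)])
  have "sset_weq (map_sp M A X) (map_sp M A X) (\<lambda>n x. postcomp M A \<rho>' n (postcomp M A (j' \<cdot> j) n x))"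
  proof (rule sset_weq_id[OF sX])
    fix n x assume x: "x \<in> mp A X n"
    have "\<rho>' \<cdot> (j' \<cdot> j) = ide M X" using assoc[OF j(3) f(1,2)] f(3) \<rho>(2) by simp
    then show "postcomp M A \<rho>' n (postcomp M A (j' \<cdot> j) n x) = x"
      using postcomp_comp[OF AO jj f(2) x] scomp_ide_left[OF AO XO x] by simp
  qed
  then have "sset_weq (map_sp M A X) (map_sp M A Z') (postcomp M A (j' \<cdot> j))"
    by (rule sset_weq_first[OF sZ' sX postcomp_fun[OF AO jj] postcomp_fib(2)[OF A f(6,2) \<rho>'w]])
  then have gf: "sset_weq (map_sp M A X) (map_sp M A Z') (\<lambda>n x. postcomp M A j' n (postcomp M A j n x))"
    by (rule sset_weq_cong[OF sZ' sX]) (rule postcomp_comp[OF AO j(3) f(1)])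
  have hg: "sset_weq (map_sp M A Z) (map_sp M A Z) (\<lambda>n x. postcomp M A \<sigma> n (postcomp M A j' n x))"
    by (rule sset_weq_id[OF sZ]) (use postcomp_comp[OF AO f(1) \<sigma>(1)] scomp_ide_left[OF AO ZO] \<sigma>(2) in simp)
  show ?thesis
    by (rule sset_weq_2of6_first[OF sZ sZ' sZ postcomp_fun[OF AO j(3)] postcomp_fun[OF AO f(1)] postcomp_fun[OF AO \<sigma>(1)] gf hg])
qed

lemma postcomp_weq:
  assumes A: "cofibrant M A" and X: "fibrant M X" and Y: "fibrant M Y" and w: "w \<in> weq M" "w \<in> Hom M X Y"
  shows "sset_weq (map_sp M A X) (map_sp M A Y) (postcomp M A w)"
proof -
  have AO: "A \<in> Ob M" by (rule cofibrant_ob[OF A])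
  obtain Z j p where f: "j \<in> Hom M X Z" "p \<in> Hom M Z Y" "p \<cdot> j = w" "j \<in> cof M" "j \<in> weq M" "p \<in> fib M"
    using factor_tcof_fib[OF w(2)] by blast
  have pw: "p \<in> weq M" using weq_left[OF f(5) _ f(1,2)] f(3) w(1) by simp
  have Z: "fibrant M Z" by (rule fibrant_fib[OF Y f(2,6)])
  note s = map_ss[OF AO fibrant_ob[OF X]] map_ss[OF AO fibrant_ob[OF Y]] map_ss[OF AO fibrant_ob[OF Z]]
  have "sset_weq (map_sp M A X) (map_sp M A Y) (\<lambda>n x. postcomp M A p n (postcomp M A j n x))"
    by (rule sset_weq_comp[OF s(3,2) postcomp_tcof[OF A X Z f(4,5,1)] postcomp_fib(2)[OF A f(6,2) pw]])
  then show ?thesis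
    by (rule sset_weq_cong[OF s(2,1)]) (simp add: postcomp_comp[OF AO f(1,2), symmetric] f(3))
qed

lemma precomp_tfib:
  assumes X: "fibrant M X" and Z: "cofibrant M Z" and B: "cofibrant M B"
    and p: "p \<in> fib M" "p \<in> weq M" "p \<in> Hom M Z B"
  shows "sset_weq (map_sp M B X) (map_sp M Z X) (precomp M p X)"
proof -
  have XO: "X \<in> Ob M" by (rule fibrant_ob[OF X])
  have ZO: "Z \<in> Ob M" and BO: "B \<in> Ob M" using hom_ob[OF p(3)] by auto
  obtain \<rho> where \<rho>: "\<rho> \<in> Hom M B Z" "p \<cdot> \<rho> = ide M B" using cofibrant_lift[OF B p ide_in[OF BO]] by blast
  have \<rho>w: "\<rho> \<in> weq M" using weq_right[OF p(2) _ \<rho>(1) p(3)] \<rho>(2) ide_weq[OF BO] by simp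
  \<comment> \<open>The same scheme with arrows reversed: \<open>p \<cdot> p'\<close> has the
    trivial cofibration \<open>j'\<close> as a section, and \<open>p' \<cdot> \<sigma>\<close> is
    the identity.\<close>
  obtain Z' j' p' where f: "j' \<in> Hom M B Z'" "p' \<in> Hom M Z' Z" "p' \<cdot> j' = \<rho>" "j' \<in> cof M" "j' \<in> weq M" "p' \<in> fib M"
    using factor_tcof_fib[OF \<rho>(1)] by blast
  have p'w: "p' \<in> weq M" using weq_left[OF f(5) _ f(1,2)] f(3) \<rho>w by simp
  obtain \<sigma> where \<sigma>: "\<sigma> \<in> Hom M Z Z'" "p' \<cdot> \<sigma> = ide M Z" using cofibrant_lift[OF Z f(6) p'w f(2) ide_in[OF ZO]] by blast
  have Z'O: "Z' \<in> Ob M" using hom_ob[OF f(1)] by simp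
  note sB = map_ss[OF BO XO] and sZ = map_ss[OF ZO XO] and sZ' = map_ss[OF Z'O XO]
  have pp: "p \<cdot> p' \<in> Hom M Z' B" by (rule comp_in[OF f(2) p(3)])
  have "sset_weq (map_sp M B X) (map_sp M B X) (\<lambda>n x. precomp M j' X n (precomp M (p \<cdot> p') X n x))"
  proof (rule sset_weq_id[OF sB])
    fix n x assume x: "x \<in> mp B X n"
    have "(p \<cdot> p') \<cdot> j' = ide M B" using assoc[OF f(1,2) p(3)] f(3) \<rho>(2) by simp
    then show "precomp M j' X n (precomp M (p \<cdot> p') X n x) = x"
      using precomp_comp[OF XO f(1) pp x] scomp_ide_right[OF BO XO x] by simp
  qed
  then have "sset_weq (map_sp M B X) (map_sp M Z' X) (precomp M (p \<cdot> p') X)"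
    by (rule sset_weq_first[OF sZ' sB precomp_fun[OF XO pp] precomp_cof(2)[OF X f(4,1,5)]])
  then have gf: "sset_weq (map_sp M B X) (map_sp M Z' X) (\<lambda>n x. precomp M p' X n (precomp M p X n x))"
    by (rule sset_weq_cong[OF sZ' sB]) (rule precomp_comp[OF XO f(2) p(3)])
  have hg: "sset_weq (map_sp M Z X) (map_sp M Z X) (\<lambda>n x. precomp M \<sigma> X n (precomp M p' X n x))"
    by (rule sset_weq_id[OF sZ]) (use precomp_comp[OF XO \<sigma>(1) f(2)] scomp_ide_right[OF ZO XO] \<sigma>(2) in simp)
  show ?thesis
    by (rule sset_weq_2of6_first[OF sZ sZ' sZ precomp_fun[OF XO p(3)] precomp_fun[OF XO f(2)] precomp_fun[OF XO \<sigma>(1)] gf hg])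
qed

lemma precomp_weq:
  assumes X: "fibrant M X" and A: "cofibrant M A" and B: "cofibrant M B" and w: "w \<in> weq M" "w \<in> Hom M A B"
  shows "sset_weq (map_sp M B X) (map_sp M A X) (precomp M w X)"
proof -
  have XO: "X \<in> Ob M" by (rule fibrant_ob[OF X])
  obtain Z j p where f: "j \<in> Hom M A Z" "p \<in> Hom M Z B" "p \<cdot> j = w" "j \<in> cof M" "j \<in> weq M" "p \<in> fib M"
    using factor_tcof_fib[OF w(2)] by blast
  have pw: "p \<in> weq M" using weq_left[OF f(5) _ f(1,2)] f(3) w(1) by simp
  have Z: "cofibrant M Z" by (rule cofibrant_cof[OF A f(1,4)])
  note s = map_ss[OF cofibrant_ob[OF A] XO] map_ss[OF cofibrant_ob[OF B] XO] map_ss[OF cofibrant_ob[OF Z] XO]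
  have "sset_weq (map_sp M B X) (map_sp M A X) (\<lambda>n x. precomp M j X n (precomp M p X n x))"
    by (rule sset_weq_comp[OF s(3,1) precomp_tfib[OF X Z B f(6) pw f(2)] precomp_cof(2)[OF X f(4,1,5)]])
  then show ?thesis
    by (rule sset_weq_cong[OF s(1,2)]) (simp add: precomp_comp[OF XO f(1,2), symmetric] f(3))
qed

text \<open>The two evaluations of the path object are trivial fibrations.\<close>

lemma edge_weq:
  assumes B: "fibrant M B" and A: "A \<in> Ob M" and e: "e \<in> mp A B 1"
  shows "vtx (map_sp M A B) 1 e 0 \<in> weq M \<longleftrightarrow> vtx (map_sp M A B) 1 e 1 \<in> weq M"
proof -
  have BO: "B \<in> Ob M" by (rule fibrant_ob[OF B])
  obtain P w where P: "P \<in> Ob M" and w: "w \<in> mp P B 1"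
      and rep: "\<And>X e. X \<in> Ob M \<Longrightarrow> e \<in> mp X B 1 \<Longrightarrow> \<exists>!g. g \<in> Hom M X P \<and> precomp M g B 1 w = e"
    using representing_object[OF BO, of 1] by blast
  define ev where "ev k = vtx (map_sp M P B) 1 w k" for k
  have ev: "ev k \<in> Hom M P B" if "k \<le> 1" for k
    using simplicial_set.vtx_in[OF map_ss[OF P BO] w that] map_vertices[OF P BO] by (simp add: ev_def)
  have evg: "vtx (map_sp M X B) 1 (precomp M g B 1 w) k = ev k \<cdot> g" if g: "g \<in> Hom M X P" and k: "k \<le> 1" for X g k
    using simplicial_fun_vtx[OF precomp_fun[OF BO g] w k] precomp_0[OF g ev[OF k]] by (simp add: ev_def)
  have evw: "ev k \<in> weq M" if k: "k \<le> 1" for k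
  proof -
    \<comment> \<open>By representability, lifting \<open>i\<close> against an evaluation is lifting
      a path along the Kan fibration \<open>map(i, B)\<close> with a prescribed end.\<close>
    have "has_lifting M i (ev k)" if i: "i \<in> cof M" for i
    proof -
      have ih: "i \<in> Hom M (src M i) (tgt M i)" using i cof_ar ar_hom by blast
      note io = hom_ob[OF ih]
      show ?thesis
      proof (rule has_liftingI[OF ih ev[OF k]])
        fix u v assume u: "u \<in> Hom M (src M i) P" and v: "v \<in> Hom M (tgt M i) B" and c: "v \<cdot> i = ev k \<cdot> u"
        have "vtx (map_sp M (src M i) B) 1 (precomp M u B 1 w) k = precomp M i B 0 v"
          using evg[OF u k] precomp_0[OF ih v] c by simp
        from kan_path_lifting[OF map_ss[OF io(2) BO] map_ss[OF io(1) BO] precomp_cof(1)[OF B i ih] k mp0[OF v]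
            simplicial_fun_in[OF precomp_fun[OF BO u] w] this]
        obtain \<zeta> where z: "\<zeta> \<in> mp (tgt M i) B 1" "precomp M i B 1 \<zeta> = precomp M u B 1 w" "vtx (map_sp M (tgt M i) B) 1 \<zeta> k = v" by blast
        obtain h where h: "h \<in> Hom M (tgt M i) P" "precomp M h B 1 w = \<zeta>" using rep[OF io(2) z(1)] by blast
        have "precomp M (h \<cdot> i) B 1 w = precomp M u B 1 w" using precomp_comp[OF BO ih h(1) w] h(2) z(2) by simp
        then have "h \<cdot> i = u"
          using rep[OF io(1) simplicial_fun_in[OF precomp_fun[OF BO u] w]] u comp_in[OF ih h(1)] by blast
        moreover have "ev k \<cdot> h = v" using evg[OF h(1) k] h(2) z(3) by simp
        ultimately show "\<exists>h\<in>Hom M (tgt M i) P. h \<cdot> i = u \<and> ev k \<cdot> h = v" using h(1) by blast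
      qed
    qed
    then show ?thesis using tfib_rlp[OF ev[OF k]] by blast
  qed
  obtain g where g: "g \<in> Hom M A P" "precomp M g B 1 w = e" using rep[OF A e] by blast
  have "vtx (map_sp M A B) 1 e k \<in> weq M \<longleftrightarrow> g \<in> weq M" if k: "k \<le> 1" for k
    using evg[OF g(1) k] g(2) weq_comp[OF _ evw[OF k] g(1) ev[OF k]] weq_right[OF evw[OF k] _ g(1) ev[OF k]] by auto
  from this[of 0] this[of 1] show ?thesis by simp
qed

text \<open>The weak equivalences among the vertices define a local system with at most one label,
  because edges preserve and reflect them by \<open>edge_weq\<close>. A section over the start of
  \<gamma> is transported to its end, so the end is a weak equivalence.\<close>

lemma path_weq:
  assumes B: "fibrant M B" and A: "A \<in> Ob M" and f: "f \<in> Hom M A B" "f' \<in> Hom M A B"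
    and \<gamma>: "pathin (realization (map_sp M A B)) \<gamma>" "\<gamma> 0 = pt (map_sp M A B) f" "\<gamma> 1 = pt (map_sp M A B) f'"
    and w: "f \<in> weq M"
  shows "f' \<in> weq M"
proof -
  let ?K = "map_sp M A B"
  interpret K: simplicial_set ?K by (rule map_ss[OF A fibrant_ob[OF B]])
  define T :: "'v \<Rightarrow> unit \<Rightarrow> unit \<Rightarrow> bool" where "T e a b \<longleftrightarrow> vtx ?K 1 e 0 \<in> weq M \<and> vtx ?K 1 e 1 \<in> weq M" for e a b
  interpret L: local_system ?K T
  proof
    fix e assume e: "e \<in> mp A B 1"
    show "\<exists>b. T e a b" if h: "T (edg ?K 1 e 0 0) a a" for a
      using h K.vtx_edg[OF e, of 0 0] edge_weq[OF B A e] unfolding T_def by simp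
    show "\<exists>a. T e a b" if h: "T (edg ?K 1 e 1 1) b b" for b
      using h K.vtx_edg[OF e, of 1 1] edge_weq[OF B A e] unfolding T_def by simp
    show "b = b'" for b b' :: unit by simp
    show "a = a'" for a a' :: unit by simp
  next
    fix x assume x: "x \<in> mp A B 2"
    note v = K.vtx_edg[OF x, of 0 1] K.vtx_edg[OF x, of 1 2] K.vtx_edg[OF x, of 0 2]
    show "T (edg ?K 2 x 0 2) a c" if "T (edg ?K 2 x 0 1) a b" "T (edg ?K 2 x 1 2) b c" for a b c
      using that v by (simp add: T_def)
    show "T (edg ?K 2 x 1 2) b c" if "T (edg ?K 2 x 0 1) a b" "T (edg ?K 2 x 0 2) a c" for a b c
      using that v by (simp add: T_def)
    show "T (edg ?K 2 x 0 1) a b" if "T (edg ?K 2 x 0 2) a c" "T (edg ?K 2 x 1 2) b c" for a b c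
      using that v by (simp add: T_def)
  qed
  have Te: "T (edg ?K 0 h 0 0) a a \<longleftrightarrow> h \<in> weq M" if "h \<in> Hom M A B" for h a
    using K.vtx_edg[OF mp0[OF that], of 0 0] K.vtx_self[OF mp0[OF that]] by (simp add: T_def)
  have "(\<lambda>u. if 0 \<le> u \<and> u < 1 then () else undefined) \<in> L.Sec (\<gamma> 0)"
    unfolding \<gamma>(2) pt_def L.Sec_vertex[OF mp0[OF f(1)] std0] using Te[OF f(1)] w by blast
  then obtain s where s: "L.clift \<gamma> s" using L.clift_exists[OF \<gamma>(1)] by blast
  then have "s 1 \<in> L.Sec (\<gamma> 1)" unfolding L.clift_def by simp
  then show ?thesis
    unfolding \<gamma>(3) pt_def L.Sec_vertex[OF mp0[OF f(2)] std0] using Te[OF f(2)] by blast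
qed

end

section \<open>Saturation of the weak equivalences\<close>

lemma Id_on_right: "S \<subseteq> C \<times> D \<Longrightarrow> S O Id_on D = S"
  by auto

locale replacements = model_universe M universe_type
  for M :: "('v, 'm) smodel_scheme" (structure) and universe_type :: "'v itself" +
  fixes Q R :: "'v cfun" and q r :: "'v \<Rightarrow> 'v"
  assumes Qq: "cofibrant_replacement M Q q" and Rr: "fibrant_replacement M R r"
begin

abbreviation "QO \<equiv> fob Q"
abbreviation "RO \<equiv> fob R"
abbreviation "RA \<equiv> far R"

lemma QO: "X \<in> Ob M \<Longrightarrow> cofibrant M (QO X)" and q_hom: "X \<in> Ob M \<Longrightarrow> q X \<in> Hom M (QO X) X"
  and q_weq: "X \<in> Ob M \<Longrightarrow> q X \<in> weq M"
  using Qq by (auto simp: cofibrant_replacement_def is_nat_trans_def id_fun_def)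

lemma RO: "X \<in> Ob M \<Longrightarrow> fibrant M (RO X)" and r_hom: "X \<in> Ob M \<Longrightarrow> r X \<in> Hom M X (RO X)"
  and r_weq: "X \<in> Ob M \<Longrightarrow> r X \<in> weq M"
  using Rr by (auto simp: fibrant_replacement_def is_nat_trans_def id_fun_def)

lemma QO_ob: "X \<in> Ob M \<Longrightarrow> QO X \<in> Ob M" using QO cofibrant_ob by blast
lemma RO_ob: "X \<in> Ob M \<Longrightarrow> RO X \<in> Ob M" using RO fibrant_ob by blast

lemma RA_hom: "f \<in> Hom M X Y \<Longrightarrow> RA f \<in> Hom M (RO X) (RO Y)"
  using Rr by (auto simp: fibrant_replacement_def is_functor_def Hom_def)

lemma RA_ide: "X \<in> Ob M \<Longrightarrow> RA (ide M X) = ide M (RO X)"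
  using Rr by (auto simp: fibrant_replacement_def is_functor_def)

lemma RA_comp: "f \<in> Hom M X Y \<Longrightarrow> g \<in> Hom M Y Z \<Longrightarrow> RA (g \<cdot> f) = RA g \<cdot> RA f"
  using Rr by (auto simp: fibrant_replacement_def is_functor_def Hom_def)

lemma r_nat: "f \<in> Hom M X Y \<Longrightarrow> r Y \<cdot> f = RA f \<cdot> r X"
  using Rr by (auto simp: fibrant_replacement_def is_nat_trans_def Hom_def id_fun_def)

lemma RA_weq: "f \<in> Hom M X Y \<Longrightarrow> RA f \<in> weq M \<longleftrightarrow> f \<in> weq M"
proof -
  assume f: "f \<in> Hom M X Y"
  note o = hom_ob[OF f] and n = r_nat[OF f]
  have "RA f \<in> weq M \<longleftrightarrow> RA f \<cdot> r X \<in> weq M"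
    using weq_comp[OF r_weq[OF o(1)] _ r_hom[OF o(1)] RA_hom[OF f]]
      weq_left[OF r_weq[OF o(1)] _ r_hom[OF o(1)] RA_hom[OF f]] by blast
  moreover have "f \<in> weq M \<longleftrightarrow> r Y \<cdot> f \<in> weq M"
    using weq_comp[OF _ r_weq[OF o(2)] f r_hom[OF o(2)]] weq_right[OF r_weq[OF o(2)] _ f r_hom[OF o(2)]] by blast
  ultimately show ?thesis using n by simp
qed

text \<open>
  The functor \<open>\<pi>\<^sub>0 map(A, R -)\<close>, extended to zigzags. Its values are read as relations, so that
  formal inverses become converses.
\<close>

definition space :: "'v \<Rightarrow> 'v \<Rightarrow> 'v rpoint set topology" where
  "space A X = realization (map_sp M A (RO X))"

definition push :: "'v \<Rightarrow> 'v \<Rightarrow> 'v rpoint set \<Rightarrow> 'v rpoint set" where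
  "push A f = realization_map (map_sp M A (RO (tgt M f))) (postcomp M A (RA f))"

definition act :: "'v \<Rightarrow> 'v \<Rightarrow> ('v rpoint set set \<times> 'v rpoint set set) set" where
  "act A f = {(path_component_of_set (space A (src M f)) x, path_component_of_set (space A (tgt M f)) (push A f x)) | x.
      x \<in> topspace (space A (src M f))}"

definition components :: "'v \<Rightarrow> 'v \<Rightarrow> 'v rpoint set set set" where
  "components A X = path_component_of_set (space A X) ` topspace (space A X)"

fun zact :: "'v \<Rightarrow> 'v \<Rightarrow> 'v letter list \<Rightarrow> ('v rpoint set set \<times> 'v rpoint set set) set" where
  "zact A X [] = Id_on (components A X)"
| "zact A X (Fwd f # l) = act A f O zact A (tgt M f) l"
| "zact A X (Bwd w # l) = (act A w)\<inverse> O zact A (src M w) l"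

context
  fixes A assumes A: "cofibrant M A"
begin

lemma AO: "A \<in> Ob M" by (rule cofibrant_ob[OF A])

lemma push_fun: "f \<in> Hom M X Y \<Longrightarrow> simplicial_fun (map_sp M A (RO X)) (map_sp M A (RO Y)) (postcomp M A (RA f))"
  by (rule postcomp_fun[OF AO RA_hom])

lemma push_cont: "f \<in> Hom M X Y \<Longrightarrow> continuous_map (space A X) (space A Y) (push A f)"
  unfolding space_def push_def
  using continuous_realization_map[OF map_ss[OF AO RO_ob] push_fun[of f X Y]] hom_ob hom_eqs by metis

lemma push_path:
  assumes f: "f \<in> Hom M X Y" and p: "path_component_of (space A X) x x'"
  shows "path_component_of (space A Y) (push A f x) (push A f x')"
proof -
  obtain \<gamma> where \<gamma>: "pathin (space A X) \<gamma>" "\<gamma> 0 = x" "\<gamma> 1 = x'" using p unfolding path_component_of_def by blast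
  have "pathin (space A Y) (push A f \<circ> \<gamma>)" using \<gamma>(1) push_cont[OF f] unfolding pathin_def by (rule continuous_map_compose)
  then show ?thesis unfolding path_component_of_def using \<gamma>(2,3) by (intro exI[of _ "push A f \<circ> \<gamma>"]) simp
qed

lemma push_comp:
  assumes f: "f \<in> Hom M X Y" and g: "g \<in> Hom M Y Z" and x: "x \<in> topspace (space A X)"
  shows "push A (g \<cdot> f) x = push A g (push A f x)"
proof -
  note o = hom_ob[OF f] hom_ob[OF g]
  have "push A (g \<cdot> f) x = realization_map (map_sp M A (RO Z)) (\<lambda>n x. postcomp M A (RA g) n (postcomp M A (RA f) n x)) x"
    unfolding push_def hom_eqs[OF comp_in[OF f g]]
    by (rule realization_map_cong[OF map_ss[OF AO RO_ob[OF o(4)]] push_fun[OF comp_in[OF f g]] _ x[unfolded space_def]])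
      (simp add: RA_comp[OF f g] postcomp_comp[OF AO RA_hom[OF f] RA_hom[OF g]])
  also have "\<dots> = push A g (push A f x)"
    unfolding push_def hom_eqs[OF f] hom_eqs[OF g]
    by (rule realization_map_comp[OF map_ss[OF AO RO_ob[OF o(2)]] map_ss[OF AO RO_ob[OF o(4)]] push_fun[OF f] push_fun[OF g] x[unfolded space_def]])
  finally show ?thesis .
qed

lemma push_ide: "X \<in> Ob M \<Longrightarrow> x \<in> topspace (space A X) \<Longrightarrow> push A (ide M X) x = x"
proof -
  assume X: "X \<in> Ob M" and x: "x \<in> topspace (space A X)"
  obtain n y t where y: "y \<in> mp A (RO X) n" "t \<in> standard_simplex n" "x = rcls (map_sp M A (RO X)) ((n, y), t)"
    using x unfolding space_def by (rule realization_cases)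
  show ?thesis
    unfolding y(3) push_def hom_eqs[OF ide_in[OF X]]
    using realization_map_rcls[OF map_ss[OF AO RO_ob[OF X]] push_fun[OF ide_in[OF X]] y(1,2)]
      scomp_ide_left[OF AO RO_ob[OF X] y(1)] RA_ide[OF X] by simp
qed

lemma push_whe: "w \<in> weq M \<Longrightarrow> w \<in> Hom M X Y \<Longrightarrow> weak_homotopy_equivalence (space A X) (space A Y) (push A w)"
  using postcomp_weq[OF A RO RO, of X Y "RA w"] RA_weq RA_hom hom_ob
  unfolding sset_weq_def space_def push_def by (metis hom_eqs(2))

lemma comp_eq: "x \<in> topspace (space A X) \<Longrightarrow>
    path_component_of_set (space A X) x = path_component_of_set (space A X) y \<longleftrightarrow> path_component_of (space A X) x y"
proof
  assume x: "x \<in> topspace (space A X)" and e: "path_component_of_set (space A X) x = path_component_of_set (space A X) y"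
  have "x \<in> path_component_of_set (space A X) x" using x by (simp add: path_component_of_refl)
  then have "path_component_of (space A X) y x" unfolding e by simp
  then show "path_component_of (space A X) x y" by (simp add: path_component_of_sym)
next
  assume "path_component_of (space A X) x y"
  then show "path_component_of_set (space A X) x = path_component_of_set (space A X) y"
    using path_component_of_equiv[of "space A X" x y] by simp
qed

lemma act_in: "f \<in> Hom M X Y \<Longrightarrow> act A f \<subseteq> components A X \<times> components A Y"
  unfolding act_def components_def by (auto simp: hom_eqs dest: cm_in[OF push_cont])

lemma act_iff:
  assumes f: "f \<in> Hom M X Y" and x: "x \<in> topspace (space A X)"
  shows "(path_component_of_set (space A X) x, d) \<in> act A f \<longleftrightarrow> d = path_component_of_set (space A Y) (push A f x)"
proof
  assume "(path_component_of_set (space A X) x, d) \<in> act A f"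
  then obtain x' where x': "x' \<in> topspace (space A X)" "path_component_of_set (space A X) x = path_component_of_set (space A X) x'"
      "d = path_component_of_set (space A Y) (push A f x')"
    unfolding act_def hom_eqs(1,2)[OF f] by blast
  have "path_component_of (space A Y) (push A f x) (push A f x')"
    by (rule push_path[OF f]) (use x'(2) comp_eq[OF x] in simp)
  then have "path_component_of_set (space A Y) (push A f x) = path_component_of_set (space A Y) (push A f x')"
    using comp_eq[OF cm_in[OF push_cont[OF f] x]] by blast
  then show "d = path_component_of_set (space A Y) (push A f x)" using x'(3) by simp
next
  assume "d = path_component_of_set (space A Y) (push A f x)"
  then show "(path_component_of_set (space A X) x, d) \<in> act A f" unfolding act_def hom_eqs(1,2)[OF f] using x by blast
qed

lemma act_comp:
  assumes f: "f \<in> Hom M X Y" and g: "g \<in> Hom M Y Z" shows "act A f O act A g = act A (g \<cdot> f)"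
proof -
  have "(c, d) \<in> act A f O act A g \<longleftrightarrow> (c, d) \<in> act A (g \<cdot> f)" for c d
  proof (cases "c \<in> components A X")
    case True
    then obtain x where x: "x \<in> topspace (space A X)" "c = path_component_of_set (space A X) x" unfolding components_def by blast
    have "(c, d) \<in> act A f O act A g \<longleftrightarrow> (\<exists>e. (c, e) \<in> act A f \<and> (e, d) \<in> act A g)" by (simp add: relcomp_unfold)
    also have "\<dots> \<longleftrightarrow> (path_component_of_set (space A Y) (push A f x), d) \<in> act A g"
      by (simp add: x(2) act_iff[OF f x(1)])
    also have "\<dots> \<longleftrightarrow> d = path_component_of_set (space A Z) (push A g (push A f x))"
      by (rule act_iff[OF g cm_in[OF push_cont[OF f] x(1)]])
    also have "\<dots> \<longleftrightarrow> (c, d) \<in> act A (g \<cdot> f)"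
      by (simp only: x(2) act_iff[OF comp_in[OF f g] x(1)] push_comp[OF f g x(1)])
    finally show ?thesis .
  next
    case False then show ?thesis using act_in[OF f] act_in[OF comp_in[OF f g]] by blast
  qed
  then show ?thesis by auto
qed

lemma act_ide: "X \<in> Ob M \<Longrightarrow> act A (ide M X) = Id_on (components A X)"
proof -
  assume X: "X \<in> Ob M"
  have "act A (ide M X) = {(path_component_of_set (space A X) x, path_component_of_set (space A X) x) | x. x \<in> topspace (space A X)}"
    unfolding act_def hom_eqs(1,2)[OF ide_in[OF X]] using push_ide[OF X] by (intro Collect_cong) metis
  then show ?thesis unfolding components_def by auto
qed

text \<open>A weak equivalence induces a bijection on components, and the converse of a bijective
  relation is its inverse.\<close>

lemma act_weq:
  assumes w: "w \<in> weq M" "w \<in> Hom M X Y"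
  shows "act A w O (act A w)\<inverse> = Id_on (components A X)" and "(act A w)\<inverse> O act A w = Id_on (components A Y)"
proof -
  note h = push_whe[OF w]
  have inj: "c = c'" if cd: "(c, d) \<in> act A w" "(c', d) \<in> act A w" for c c' d
  proof -
    obtain x where x: "x \<in> topspace (space A X)" "c = path_component_of_set (space A X) x"
        "d = path_component_of_set (space A Y) (push A w x)"
      using cd(1) unfolding act_def hom_eqs(1,2)[OF w(2)] by blast
    obtain x' where x': "x' \<in> topspace (space A X)" "c' = path_component_of_set (space A X) x'"
        "d = path_component_of_set (space A Y) (push A w x')"
      using cd(2) unfolding act_def hom_eqs(1,2)[OF w(2)] by blast
    have "path_component_of (space A Y) (push A w x) (push A w x')"
      by (rule comp_eq[OF cm_in[OF push_cont[OF w(2)] x(1)], THEN iffD1]) (use x(3) x'(3) in metis)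
    then have "path_component_of (space A X) x x'"
      unfolding path_component_of_def using pi0_injective[OF h x(1) x'(1)] by blast
    then have "path_component_of_set (space A X) x = path_component_of_set (space A X) x'"
      by (rule comp_eq[OF x(1), THEN iffD2])
    then show ?thesis using x(2) x'(2) by simp
  qed
  have sv: "d = d'" if cd: "(c, d) \<in> act A w" "(c, d') \<in> act A w" for c d d'
  proof -
    obtain x where "x \<in> topspace (space A X)" "c = path_component_of_set (space A X) x"
      using cd(1) unfolding act_def hom_eqs(1,2)[OF w(2)] by blast
    then show ?thesis using cd act_iff[OF w(2)] by simp
  qed
  have tot: "\<exists>d. (c, d) \<in> act A w" if "c \<in> components A X" for c
    using that act_iff[OF w(2)] unfolding components_def by blast
  have surj: "\<exists>c. (c, d) \<in> act A w" if d: "d \<in> components A Y" for d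
  proof -
    obtain y where y: "y \<in> topspace (space A Y)" "d = path_component_of_set (space A Y) y" using d unfolding components_def by blast
    obtain x \<alpha> where x: "x \<in> topspace (space A X)" "pathin (space A Y) \<alpha>" "\<alpha> 0 = push A w x" "\<alpha> 1 = y"
      using pi0_surjective[OF h y(1)] by blast
    have "path_component_of (space A Y) (push A w x) y" unfolding path_component_of_def using x by blast
    then have "path_component_of_set (space A Y) (push A w x) = d"
      unfolding y(2) by (rule comp_eq[OF cm_in[OF push_cont[OF w(2)] x(1)], THEN iffD2])
    then show ?thesis using act_iff[OF w(2) x(1)] by blast
  qed
  show "act A w O (act A w)\<inverse> = Id_on (components A X)"
  proof (intro equalityI subrelI)
    fix c c' assume "(c, c') \<in> act A w O (act A w)\<inverse>"
    then obtain d where d: "(c, d) \<in> act A w" "(c', d) \<in> act A w" by blast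
    have "c \<in> components A X" using act_in[OF w(2)] d(1) by blast
    then show "(c, c') \<in> Id_on (components A X)" using inj[OF d] by auto
  next
    fix c c' assume "(c, c') \<in> Id_on (components A X)"
    then show "(c, c') \<in> act A w O (act A w)\<inverse>" using tot by blast
  qed
  show "(act A w)\<inverse> O act A w = Id_on (components A Y)"
  proof (intro equalityI subrelI)
    fix d d' assume "(d, d') \<in> (act A w)\<inverse> O act A w"
    then obtain c where c: "(c, d) \<in> act A w" "(c, d') \<in> act A w" by blast
    have "d \<in> components A Y" using act_in[OF w(2)] c(1) by blast
    then show "(d, d') \<in> Id_on (components A Y)" using sv[OF c] by auto
  next
    fix d d' assume "(d, d') \<in> Id_on (components A Y)"
    then show "(d, d') \<in> (act A w)\<inverse> O act A w" using surj by blast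
  qed
qed

lemma zact_in: "zigzag M X Y l \<Longrightarrow> zact A X l \<subseteq> components A X \<times> components A Y"
proof (induction l arbitrary: X)
  case (Cons a l)
  show ?case
  proof (cases a)
    case (Fwd f) then show ?thesis using Cons act_in[OF ar_hom, of f] by fastforce
  next
    case (Bwd w) then show ?thesis using Cons act_in[OF ar_hom, of w] weq_ar by fastforce
  qed
qed auto

lemma zact_append: "zigzag M X Y l \<Longrightarrow> zigzag M Y Z m \<Longrightarrow> zact A X (l @ m) = zact A X l O zact A Y m \<and> zigzag M X Z (l @ m)"
proof (induction l arbitrary: X)
  case Nil then show ?case using zact_in[of Y Z m] by auto
next
  case (Cons a l) then show ?case by (cases a) (auto simp: O_assoc)
qed

text \<open>Each generator of the congruence becomes an identity between relations. Well-formedness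
  of both zigzags is carried along because the action of a concatenation is computed only for
  matching ends.\<close>

lemma zact_eq: "zigzag_eq M X Y a b \<Longrightarrow> zigzag M X Y a \<and> zigzag M X Y b \<and> zact A X a = zact A X b"
proof (induction rule: zigzag_eq.induct)
  case (zz_cong W X l Y a b Z r)
  then have ab: "zigzag M X Y a" "zigzag M X Y b" "zact A X a = zact A X b" by auto
  have "zact A X (a @ r) = zact A X (b @ r)" "zigzag M X Z (a @ r)" "zigzag M X Z (b @ r)"
    using zact_append[OF ab(1) zz_cong(3)] zact_append[OF ab(2) zz_cong(3)] ab(3) by auto
  then show ?case using zact_append[OF zz_cong(1), of Z "a @ r"] zact_append[OF zz_cong(1), of Z "b @ r"] by simp
next
  case (zz_ide X)
  then show ?case using act_ide[OF zz_ide] ide_in[OF zz_ide] act_in[OF ide_in[OF zz_ide]] by (auto simp: Hom_def)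
next
  case (zz_comp f X Y g Z)
  note fg = zz_comp and gf = comp_in[OF zz_comp]
  have "zact A X [Fwd f, Fwd g] = act A f O (act A g O Id_on (components A Z))" using fg by (simp add: hom_eqs)
  also have "\<dots> = act A (g \<cdot> f) O Id_on (components A Z)"
    using Id_on_right[OF act_in[OF fg(2)]] Id_on_right[OF act_in[OF gf]] act_comp[OF fg] by simp
  finally show ?case using fg gf hom_ob[OF fg(2)] by (simp add: hom_eqs)
next
  case (zz_inv1 w X Y)
  have cv: "(act A w)\<inverse> \<subseteq> components A Y \<times> components A X" using act_in[OF zz_inv1(2)] by blast
  have "zact A X [Fwd w, Bwd w] = act A w O ((act A w)\<inverse> O Id_on (components A X))" using zz_inv1 by (simp add: hom_eqs)
  also have "\<dots> = Id_on (components A X)"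
    using Id_on_right[OF cv] act_weq(1)[OF zz_inv1] by simp
  finally show ?case using zz_inv1 hom_ob[OF zz_inv1(2)] by (simp add: hom_eqs)
next
  case (zz_inv2 w X Y)
  have "zact A Y [Bwd w, Fwd w] = (act A w)\<inverse> O (act A w O Id_on (components A Y))" using zz_inv2 by (simp add: hom_eqs)
  also have "\<dots> = Id_on (components A Y)"
    using Id_on_right[OF act_in[OF zz_inv2(2)]] act_weq(2)[OF zz_inv2] by simp
  finally show ?case using zz_inv2 hom_ob[OF zz_inv2(2)] by (simp add: hom_eqs)
qed auto

end

text \<open>Equal actions on components, evaluated at the weak equivalence \<open>a\<close> from
  \<open>Q X\<close> to \<open>R X\<close>, join \<open>R v \<cdot> a\<close> to
  \<open>R u \<cdot> a\<close> by a path in the mapping space from \<open>Q X\<close> to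
  \<open>R Y\<close>; by \<open>path_weq\<close>, being a weak equivalence is transported along this
  path.\<close>

lemma saturation:
  assumes uv: "agree_in_Ho M X Y u v" and v: "v \<in> weq M"
  shows "u \<in> weq M"
proof -
  have h: "u \<in> Hom M X Y" "v \<in> Hom M X Y" "zigzag_eq M X Y [Fwd u] [Fwd v]" using uv by (auto simp: agree_in_Ho_def)
  note o = hom_ob[OF h(1)]
  let ?A = "QO X"
  note A = QO[OF o(1)]
  have uv: "act ?A u = act ?A v"
    using zact_eq[OF A h(3)] Id_on_right[OF act_in[OF A h(1)]] Id_on_right[OF act_in[OF A h(2)]]
    by (simp add: hom_eqs[OF h(1)] hom_eqs[OF h(2)])
  define a where "a = r X \<cdot> q X"
  have a: "a \<in> Hom M ?A (RO X)" "a \<in> weq M"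
    unfolding a_def using comp_in[OF q_hom[OF o(1)] r_hom[OF o(1)]] weq_comp[OF q_weq[OF o(1)] r_weq[OF o(1)] q_hom[OF o(1)] r_hom[OF o(1)]] by auto
  let ?x = "pt (map_sp M ?A (RO X)) a"
  have x: "?x \<in> topspace (space ?A X)" unfolding space_def by (rule pt_top[OF mp0[OF a(1)]])
  have px: "push ?A f ?x = pt (map_sp M ?A (RO Y)) (RA f \<cdot> a)" if f: "f \<in> Hom M X Y" for f
    unfolding push_def pt_def hom_eqs[OF f]
    using realization_map_rcls[OF map_ss[OF AO[OF A] RO_ob[OF o(2)]] push_fun[OF A f] mp0[OF a(1)] std0]
      postcomp_0[OF RA_hom[OF f] a(1)] by simp
  have "path_component_of_set (space ?A Y) (push ?A v ?x) = path_component_of_set (space ?A Y) (push ?A u ?x)"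
  proof (rule act_iff[OF A h(1) x, THEN iffD1])
    show "(path_component_of_set (space ?A X) ?x, path_component_of_set (space ?A Y) (push ?A v ?x)) \<in> act ?A u"
      unfolding uv by (rule act_iff[OF A h(2) x, THEN iffD2]) (rule refl)
  qed
  then have "path_component_of (space ?A Y) (push ?A v ?x) (push ?A u ?x)"
    by (rule comp_eq[OF A cm_in[OF push_cont[OF A h(2)] x], THEN iffD1])
  then obtain \<gamma> where \<gamma>: "pathin (space ?A Y) \<gamma>" "\<gamma> 0 = push ?A v ?x" "\<gamma> 1 = push ?A u ?x" unfolding path_component_of_def by blast
  have "RA v \<in> weq M" using RA_weq[OF h(2)] v by simp
  then have "RA v \<cdot> a \<in> weq M" using weq_comp[OF a(2) _ a(1) RA_hom[OF h(2)]] by simp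
  from path_weq[OF RO[OF o(2)] AO[OF A] comp_in[OF a(1) RA_hom[OF h(2)]] comp_in[OF a(1) RA_hom[OF h(1)]]
      \<gamma>[unfolded px[OF h(1)] px[OF h(2)] space_def] this]
  have "RA u \<cdot> a \<in> weq M" .
  then show ?thesis using weq_left[OF a(2) _ a(1) RA_hom[OF h(1)]] RA_weq[OF h(1)] by simp
qed

end

section \<open>Augmented homotopy idempotent functors\<close>

locale augmented = replacements M universe_type Q R q r
  for M :: "('v, 'm) smodel_scheme" (structure) and universe_type :: "'v itself"
    and Q R :: "'v cfun" and q r :: "'v \<Rightarrow> 'v" +
  fixes C :: "'v sfun" and \<epsilon> :: "'v \<Rightarrow> 'v"
  assumes aug: "augmented_homotopy_idempotent_simplicial_functor M C \<epsilon>"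
begin

abbreviation "CO \<equiv> sob C"
abbreviation "CA \<equiv> far (underlying_fun M C)"

lemma CA_eq: "f \<in> Hom M X Y \<Longrightarrow> CA f = smor C X Y 0 f"
  by (simp add: underlying_fun_def hom_eqs)

lemma C_functor: "is_functor M M (underlying_fun M C)" and CA_weq: "w \<in> weq M \<Longrightarrow> CA w \<in> weq M"
  using aug by (auto simp: augmented_homotopy_idempotent_simplicial_functor_def homotopy_endofunctor_def)

lemma CO_ob: "X \<in> Ob M \<Longrightarrow> CO X \<in> Ob M"
  using C_functor by (auto simp: is_functor_def underlying_fun_def)

lemma CA_hom: "f \<in> Hom M X Y \<Longrightarrow> CA f \<in> Hom M (CO X) (CO Y)"
  using C_functor hom_eqs[of f X Y] unfolding is_functor_def by (metis cfun.select_convs(1) underlying_fun_def)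

lemma CA_comp: "f \<in> Hom M X Y \<Longrightarrow> g \<in> Hom M Y Z \<Longrightarrow> CA (g \<cdot> f) = CA g \<cdot> CA f"
  using C_functor hom_eqs[of f X Y] hom_eqs[of g Y Z] unfolding is_functor_def by metis

lemma smor_fun: "X \<in> Ob M \<Longrightarrow> Y \<in> Ob M \<Longrightarrow> simplicial_fun (map_sp M X Y) (map_sp M (CO X) (CO Y)) (smor C X Y)"
  using aug by (simp add: augmented_homotopy_idempotent_simplicial_functor_def simplicial_endofunctor_def)

lemma smor_scomp: "X \<in> Ob M \<Longrightarrow> Y \<in> Ob M \<Longrightarrow> Z \<in> Ob M \<Longrightarrow> f \<in> mp X Y n \<Longrightarrow> g \<in> mp Y Z n \<Longrightarrow>
    smor C X Z n (scomp M X Y Z n g f) = scomp M (CO X) (CO Y) (CO Z) n (smor C Y Z n g) (smor C X Y n f)"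
  using aug by (simp add: augmented_homotopy_idempotent_simplicial_functor_def simplicial_endofunctor_def)

lemma \<epsilon>_hom: "X \<in> Ob M \<Longrightarrow> \<epsilon> X \<in> Hom M (CO X) X"
  and \<epsilon>_smor: "X \<in> Ob M \<Longrightarrow> Y \<in> Ob M \<Longrightarrow> g \<in> mp X Y n \<Longrightarrow>
    postcomp M (CO X) (\<epsilon> Y) n (smor C X Y n g) = precomp M (\<epsilon> X) Y n g"
  using aug by (simp_all add: augmented_homotopy_idempotent_simplicial_functor_def simplicial_augmentation_def)

lemma \<epsilon>_nat: "f \<in> Hom M X Y \<Longrightarrow> \<epsilon> Y \<cdot> CA f = f \<cdot> \<epsilon> X"
proof -
  assume f: "f \<in> Hom M X Y"
  note o = hom_ob[OF f]
  show ?thesis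
    using \<epsilon>_smor[OF o mp0[OF f]] postcomp_0[OF \<epsilon>_hom[OF o(2)] CA_hom[OF f]] precomp_0[OF \<epsilon>_hom[OF o(1)] f] CA_eq[OF f] by simp
qed

lemma C\<epsilon>_weq: "X \<in> Ob M \<Longrightarrow> CA (\<epsilon> X) \<in> weq M"
  using aug by (simp add: augmented_homotopy_idempotent_simplicial_functor_def homotopy_idempotent_def)

text \<open>Here the agreement of \<open>\<epsilon> C\<close> with \<open>C \<epsilon>\<close> in
  the homotopy category is turned into a property of the map itself, by saturation.\<close>

lemma \<epsilon>C_weq: "X \<in> Ob M \<Longrightarrow> \<epsilon> (CO X) \<in> weq M"
  by (rule saturation[of "CO (CO X)" "CO X" _ "CA (\<epsilon> X)", OF _ C\<epsilon>_weq])
    (use aug in \<open>auto simp: augmented_homotopy_idempotent_simplicial_functor_def homotopy_idempotent_def underlying_fun_def\<close>)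

text \<open>Cofibrant replacements of values of \<open>C\<close> satisfy the condition imposed on
  \<open>B\<close> below; naturality at \<open>q\<close> carries the property over from the value
  itself.\<close>

lemma \<epsilon>QC_weq:
  assumes U: "U \<in> Ob M" shows "\<epsilon> (QO (CO U)) \<in> weq M"
proof -
  let ?A = "CO U"
  have A: "?A \<in> Ob M" by (rule CO_ob[OF U])
  note h = CA_hom[OF q_hom[OF A]] and e = \<epsilon>_hom[OF A] and e' = \<epsilon>_hom[OF QO_ob[OF A]]
  have "\<epsilon> ?A \<cdot> CA (q ?A) \<in> weq M" by (rule weq_comp[OF CA_weq[OF q_weq[OF A]] \<epsilon>C_weq[OF U] h e])
  then have "q ?A \<cdot> \<epsilon> (QO ?A) \<in> weq M" using \<epsilon>_nat[OF q_hom[OF A]] by simp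
  then show ?thesis by (rule weq_right[OF q_weq[OF A] _ e' q_hom[OF A]])
qed

lemma CRA_weq: "f \<in> Hom M X Y \<Longrightarrow> CA f \<in> weq M \<Longrightarrow> CA (RA f) \<in> weq M"
proof -
  assume f: "f \<in> Hom M X Y" and w: "CA f \<in> weq M"
  note o = hom_ob[OF f]
  note h = CA_hom[OF f] CA_hom[OF r_hom[OF o(2)]] CA_hom[OF r_hom[OF o(1)]] CA_hom[OF RA_hom[OF f]]
  have "CA (r Y) \<cdot> CA f \<in> weq M" by (rule weq_comp[OF w CA_weq[OF r_weq[OF o(2)]] h(1,2)])
  then have "CA (RA f) \<cdot> CA (r X) \<in> weq M"
    using CA_comp[OF f r_hom[OF o(2)]] CA_comp[OF r_hom[OF o(1)] RA_hom[OF f]] r_nat[OF f] by simp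
  then show ?thesis by (rule weq_left[OF CA_weq[OF r_weq[OF o(1)]] _ h(3,4)])
qed

section \<open>The action of \<open>C\<close> on derived mapping spaces\<close>

lemma smor_postcomp:
  assumes f: "f \<in> Hom M X Y" and B: "B \<in> Ob M" and h: "h \<in> mp B X n"
  shows "smor C B Y n (postcomp M B f n h) = postcomp M (CO B) (CA f) n (smor C B X n h)"
proof -
  note o = hom_ob[OF f]
  have "smor C X Y n (degen M f n) = degen M (CA f) n"
    unfolding degen_eq[OF f] degen_eq[OF CA_hom[OF f]]
    using simplicial_fun_pull[OF smor_fun[OF o] const_Delta[of 0 0 n] mp0[OF f]] by (simp add: CA_eq[OF f])
  then show ?thesis
    unfolding postcomp_eq[OF f] postcomp_eq[OF CA_hom[OF f]] using smor_scomp[OF B o h degen_in[OF f]] by simp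
qed

text \<open>The derived form of the action of \<open>C\<close> from \<open>map(B, Y)\<close> to
  \<open>map(C B, C Y)\<close>. Since \<open>C\<close> need not preserve cofibrant or fibrant
  objects, \<open>q\<close> and \<open>r\<close> are inserted on the two sides.\<close>

definition cmap :: "'v \<Rightarrow> 'v \<Rightarrow> nat \<Rightarrow> 'v \<Rightarrow> 'v" where
  "cmap B Y n h = postcomp M (QO (CO B)) (r (CO (RO Y))) n
     (precomp M (q (CO B)) (CO (RO Y)) n (smor C B (RO Y) n h))"

context
  fixes B assumes B: "cofibrant M B" and \<epsilon>B: "\<epsilon> B \<in> weq M"
begin

lemma BO: "B \<in> Ob M" by (rule cofibrant_ob[OF B])
lemma CBO: "CO B \<in> Ob M" by (rule CO_ob[OF BO])
lemma A2O: "QO (CO B) \<in> Ob M" by (rule QO_ob[OF CBO])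

lemma cmap_fun: "Y \<in> Ob M \<Longrightarrow> simplicial_fun (map_sp M B (RO Y)) (map_sp M (QO (CO B)) (RO (CO (RO Y)))) (cmap B Y)"
  unfolding cmap_def
  by (rule simplicial_fun_comp[OF simplicial_fun_comp[OF smor_fun[OF BO] precomp_fun[OF _ q_hom[OF CBO]]] postcomp_fun[OF A2O r_hom]])
    (auto intro: RO_ob CO_ob)

lemma cmap_post:
  assumes f: "f \<in> Hom M X Y" and h: "h \<in> mp B (RO X) n"
  shows "cmap B Y n (postcomp M B (RA f) n h) = postcomp M (QO (CO B)) (RA (CA (RA f))) n (cmap B X n h)"
proof -
  let ?p = "CA (RA f)" and ?s = "smor C B (RO X) n h"
  note o = hom_ob[OF f]
  have p: "?p \<in> Hom M (CO (RO X)) (CO (RO Y))" by (rule CA_hom[OF RA_hom[OF f]])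
  note po = hom_ob[OF p]
  have s: "?s \<in> mp (CO B) (CO (RO X)) n" by (rule simplicial_fun_in[OF smor_fun[OF BO RO_ob[OF o(1)]] h])
  let ?g = "precomp M (q (CO B)) (CO (RO X)) n ?s"
  have g: "?g \<in> mp (QO (CO B)) (CO (RO X)) n" by (rule simplicial_fun_in[OF precomp_fun[OF po(1) q_hom[OF CBO]] s])
  have "cmap B Y n (postcomp M B (RA f) n h) =
      postcomp M (QO (CO B)) (r (CO (RO Y))) n (postcomp M (QO (CO B)) ?p n ?g)"
    unfolding cmap_def smor_postcomp[OF RA_hom[OF f] BO h] pre_post[OF q_hom[OF CBO] p s] ..
  also have "\<dots> = postcomp M (QO (CO B)) (RA ?p \<cdot> r (CO (RO X))) n ?g"
    unfolding postcomp_comp[OF A2O p r_hom[OF po(2)] g, symmetric] r_nat[OF p] ..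
  also have "\<dots> = postcomp M (QO (CO B)) (RA ?p) n (cmap B X n h)"
    unfolding cmap_def by (rule postcomp_comp[OF A2O r_hom[OF po(1)] RA_hom[OF p] g])
  finally show ?thesis .
qed

text \<open>Simplicial naturality moves \<epsilon> past the action of \<open>C\<close>, and what
  remains is precomposition with \<open>\<epsilon> B\<close> and the replacement maps, all of them
  weak equivalences if \<open>\<epsilon> B\<close> is one.\<close>

lemma \<epsilon>_cmap:
  assumes Y: "Y \<in> Ob M" and h: "h \<in> mp B (RO Y) n"
  shows "postcomp M (QO (CO B)) (RA (\<epsilon> (RO Y))) n (cmap B Y n h) =
    postcomp M (QO (CO B)) (r (RO Y)) n (precomp M (\<epsilon> B \<cdot> q (CO B)) (RO Y) n h)"
proof -
  let ?s = "smor C B (RO Y) n h"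
  have RY: "RO Y \<in> Ob M" by (rule RO_ob[OF Y])
  note e = \<epsilon>_hom[OF RY] and po = RY CO_ob[OF RY]
  have s: "?s \<in> mp (CO B) (CO (RO Y)) n" by (rule simplicial_fun_in[OF smor_fun[OF BO RY] h])
  let ?g = "precomp M (q (CO B)) (CO (RO Y)) n ?s"
  have g: "?g \<in> mp (QO (CO B)) (CO (RO Y)) n" by (rule simplicial_fun_in[OF precomp_fun[OF po(2) q_hom[OF CBO]] s])
  have "postcomp M (QO (CO B)) (RA (\<epsilon> (RO Y))) n (cmap B Y n h) =
      postcomp M (QO (CO B)) (r (RO Y) \<cdot> \<epsilon> (RO Y)) n ?g"
    unfolding cmap_def postcomp_comp[OF A2O r_hom[OF po(2)] RA_hom[OF e] g, symmetric] r_nat[OF e] ..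
  also have "\<dots> = postcomp M (QO (CO B)) (r (RO Y)) n (postcomp M (QO (CO B)) (\<epsilon> (RO Y)) n ?g)"
    by (rule postcomp_comp[OF A2O e r_hom[OF RY] g])
  also have "postcomp M (QO (CO B)) (\<epsilon> (RO Y)) n ?g = precomp M (q (CO B)) (RO Y) n (precomp M (\<epsilon> B) (RO Y) n h)"
    unfolding pre_post[OF q_hom[OF CBO] e s, symmetric] \<epsilon>_smor[OF BO RY h] ..
  also have "\<dots> = precomp M (\<epsilon> B \<cdot> q (CO B)) (RO Y) n h"
    by (rule precomp_comp[OF RY q_hom[OF CBO] \<epsilon>_hom[OF BO] h, symmetric])
  finally show ?thesis .
qed

lemma \<epsilon>_cmap_weq:
  assumes Y: "Y \<in> Ob M"
  shows "sset_weq (map_sp M B (RO Y)) (map_sp M (QO (CO B)) (RO (RO Y)))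
    (\<lambda>n h. postcomp M (QO (CO B)) (RA (\<epsilon> (RO Y))) n (cmap B Y n h))"
proof -
  have RY: "RO Y \<in> Ob M" by (rule RO_ob[OF Y])
  have e: "\<epsilon> B \<cdot> q (CO B) \<in> weq M" "\<epsilon> B \<cdot> q (CO B) \<in> Hom M (QO (CO B)) B"
    using weq_comp[OF q_weq[OF CBO] \<epsilon>B q_hom[OF CBO] \<epsilon>_hom[OF BO]] comp_in[OF q_hom[OF CBO] \<epsilon>_hom[OF BO]] by auto
  have "sset_weq (map_sp M B (RO Y)) (map_sp M (QO (CO B)) (RO (RO Y)))
      (\<lambda>n h. postcomp M (QO (CO B)) (r (RO Y)) n (precomp M (\<epsilon> B \<cdot> q (CO B)) (RO Y) n h))"
    by (rule sset_weq_comp[OF map_ss[OF A2O RY] map_ss[OF A2O RO_ob[OF RY]] precomp_weq[OF RO[OF Y] QO[OF CBO] B e]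
      postcomp_weq[OF QO[OF CBO] RO[OF Y] RO[OF RY] r_weq[OF RY] r_hom[OF RY]]])
  then show ?thesis
    by (rule sset_weq_cong[OF map_ss[OF A2O RO_ob[OF RY]] map_ss[OF BO RY]]) (rule \<epsilon>_cmap[OF Y, symmetric])
qed

text \<open>The universal property of the augmentation: up to homotopy, maps from \<open>B\<close>
  to \<open>X\<close> factor uniquely through \<open>C X\<close>. The inverse sends a map to its
  image under \<open>C\<close>; that this is inverse on both sides is what
  \<open>whe_augmentation\<close> extracts, with \<open>cmap\<close> at \<open>X\<close> and at
  \<open>C X\<close> in the roles of \<open>c\<close> and \<open>c'\<close>.\<close>

lemma \<epsilon>_local:
  assumes X: "X \<in> Ob M"
  shows "sset_weq (map_sp M B (RO (CO X))) (map_sp M B (RO X)) (postcomp M B (RA (\<epsilon> X)))"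
proof -
  let ?A2 = "QO (CO B)"
  note CX = CO_ob[OF X] and e = \<epsilon>_hom[OF X]
  note RX = RO_ob[OF X] and RCX = RO_ob[OF CX]
  note Re = RA_hom[OF e]
  note CRe = CA_hom[OF Re] and eRX = \<epsilon>_hom[OF RX] and eRCX = \<epsilon>_hom[OF RCX]
  let ?\<phi> = "postcomp M B (RA (\<epsilon> X))" and ?\<phi>' = "postcomp M ?A2 (RA (\<epsilon> (RO X)))"
    and ?k = "postcomp M ?A2 (RA (CA (RA (\<epsilon> X))))" and ?\<kappa> = "postcomp M ?A2 (RA (\<epsilon> (RO (CO X))))"
    and ?\<rho> = "postcomp M ?A2 (RA (RA (\<epsilon> X)))"
  let ?X0 = "map_sp M B (RO (CO X))" and ?X1 = "map_sp M B (RO X)" and ?X2 = "map_sp M ?A2 (RO (CO (RO X)))"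
    and ?X3 = "map_sp M ?A2 (RO (RO X))" and ?X0' = "map_sp M ?A2 (RO (CO (RO (CO X))))" and ?X3' = "map_sp M ?A2 (RO (RO (CO X)))"
  have s: "simplicial_set ?X0" "simplicial_set ?X1" "simplicial_set ?X2" "simplicial_set ?X3" "simplicial_set ?X0'" "simplicial_set ?X3'"
    using BO A2O X by (auto intro!: map_ss RO_ob CO_ob)
  have f\<phi>: "simplicial_fun ?X0 ?X1 ?\<phi>" by (rule postcomp_fun[OF BO Re])
  have fc: "simplicial_fun ?X1 ?X2 (cmap B X)" by (rule cmap_fun[OF X])
  have f\<phi>': "simplicial_fun ?X2 ?X3 ?\<phi>'" by (rule postcomp_fun[OF A2O RA_hom[OF eRX]])
  have fc': "simplicial_fun ?X0 ?X0' (cmap B (CO X))" by (rule cmap_fun[OF CX])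
  have fk: "simplicial_fun ?X0' ?X2 ?k" by (rule postcomp_fun[OF A2O RA_hom[OF CRe]])
  have f\<kappa>: "simplicial_fun ?X0' ?X3' ?\<kappa>" by (rule postcomp_fun[OF A2O RA_hom[OF eRCX]])
  have f\<rho>: "simplicial_fun ?X3' ?X3 ?\<rho>" by (rule postcomp_fun[OF A2O RA_hom[OF Re]])
  note cont = continuous_realization_map[OF s(2) f\<phi>] continuous_realization_map[OF s(3) fc] continuous_realization_map[OF s(4) f\<phi>']
    continuous_realization_map[OF s(5) fc'] continuous_realization_map[OF s(3) fk] continuous_realization_map[OF s(6) f\<kappa>]
    continuous_realization_map[OF s(4) f\<rho>]
  have w1: "weak_homotopy_equivalence (realization ?X1) (realization ?X3) (realization_map ?X3 ?\<phi>' \<circ> realization_map ?X2 (cmap B X))"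
    by (rule whe_cong[OF \<epsilon>_cmap_weq[OF X, unfolded sset_weq_def, THEN conjunct2]])
      (simp add: realization_map_comp[OF s(3,4) fc f\<phi>'])
  have w2: "weak_homotopy_equivalence (realization ?X0) (realization ?X3') (realization_map ?X3' ?\<kappa> \<circ> realization_map ?X0' (cmap B (CO X)))"
    by (rule whe_cong[OF \<epsilon>_cmap_weq[OF CX, unfolded sset_weq_def, THEN conjunct2]])
      (simp add: realization_map_comp[OF s(5,6) fc' f\<kappa>])
  \<comment> \<open>This is where idempotence enters: \<open>C\<close> sends
    \<open>\<epsilon> X\<close> to a weak equivalence, hence so is the map \<open>k\<close>.\<close>
  have "RA (CA (RA (\<epsilon> X))) \<in> weq M" using RA_weq[OF CRe] CRA_weq[OF e C\<epsilon>_weq[OF X]] by simp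
  then have w3: "weak_homotopy_equivalence (realization ?X0') (realization ?X2) (realization_map ?X2 ?k)"
    using postcomp_weq[OF QO[OF CBO] RO[OF CO_ob[OF RCX]] RO[OF CO_ob[OF RX]] _ RA_hom[OF CRe]] unfolding sset_weq_def by blast
  have c1: "realization_map ?X2 (cmap B X) (realization_map ?X1 ?\<phi> x) = realization_map ?X2 ?k (realization_map ?X0' (cmap B (CO X)) x)"
    if x: "x \<in> topspace (realization ?X0)" for x
    unfolding realization_map_comp[OF s(2,3) f\<phi> fc x, symmetric] realization_map_comp[OF s(5,3) fc' fk x, symmetric]
    by (rule realization_map_cong[OF s(3) simplicial_fun_comp[OF f\<phi> fc] _ x]) (rule cmap_post[OF e])
  have c2: "realization_map ?X3 ?\<phi>' (realization_map ?X2 ?k x) = realization_map ?X3 ?\<rho> (realization_map ?X3' ?\<kappa> x)"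
    if x: "x \<in> topspace (realization ?X0')" for x
    unfolding realization_map_comp[OF s(3,4) fk f\<phi>' x, symmetric] realization_map_comp[OF s(6,4) f\<kappa> f\<rho> x, symmetric]
  proof (rule realization_map_cong[OF s(4) simplicial_fun_comp[OF fk f\<phi>'] _ x])
    fix n y assume y: "y \<in> simplices ?X0' n"
    have "RA (\<epsilon> (RO X)) \<cdot> RA (CA (RA (\<epsilon> X))) = RA (RA (\<epsilon> X)) \<cdot> RA (\<epsilon> (RO (CO X)))"
      using RA_comp[OF CRe eRX] RA_comp[OF eRCX Re] \<epsilon>_nat[OF Re] by simp
    then show "?\<phi>' n (?k n y) = ?\<rho> n (?\<kappa> n y)"
      using postcomp_comp[OF A2O RA_hom[OF CRe] RA_hom[OF eRX] y] postcomp_comp[OF A2O RA_hom[OF eRCX] RA_hom[OF Re] y] by simp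
  qed
  \<comment> \<open>Emptiness travels around the diagram: from \<open>X0\<close> to
    \<open>X3'\<close>, \<open>X0'\<close>, \<open>X2\<close> and finally \<open>X1\<close>.\<close>
  have "topspace (realization ?X1) = {}" if "topspace (realization ?X0) = {}"
  proof -
    have "topspace (realization ?X3') = {}" using w2 that unfolding whe_iff by blast
    then have "topspace (realization ?X0') = {}" using cm_empty[OF cont(6)] by blast
    then have "topspace (realization ?X2) = {}" using w3 unfolding whe_iff by blast
    then show ?thesis using cm_empty[OF cont(2)] by blast
  qed
  then have "weak_homotopy_equivalence (realization ?X0) (realization ?X1) (realization_map ?X1 ?\<phi>)"
    by (intro whe_augmentation[OF cont c1 c2 w1 w2 w3]) blast+
  then show ?thesis using f\<phi> by (simp add: sset_weq_def)
qed

end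

text \<open>In \<open>\<epsilon>_cmap_weq\<close> the last factor is a weak equivalence, by
  \<open>\<epsilon>_local\<close> for the cofibrant replacement of \<open>C B\<close>, and can be
  cancelled.\<close>

lemma cmap_weq:
  assumes B: "cofibrant M B" "\<epsilon> B \<in> weq M" and Y: "Y \<in> Ob M"
  shows "sset_weq (map_sp M B (RO Y)) (map_sp M (QO (CO B)) (RO (CO (RO Y)))) (cmap B Y)"
proof -
  note o = BO[OF B]
  note CB = CO_ob[OF o] and RY = RO_ob[OF Y]
  show ?thesis
    by (rule sset_weq_first[OF map_ss[OF QO_ob[OF CB] RO_ob[OF CO_ob[OF RY]]] map_ss[OF QO_ob[OF CB] RO_ob[OF RY]] cmap_fun[OF B Y]
      \<epsilon>_local[OF QO[OF CB] \<epsilon>QC_weq[OF o] RY] \<epsilon>_cmap_weq[OF B Y]])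
qed

text \<open>Through \<open>cmap\<close> the map induced by \<open>f\<close> on maps from
  \<open>B\<close> is compared with the one induced by \<open>C\<close> of the fibrant replacement
  of \<open>f\<close>, which is a weak equivalence because \<open>C f\<close> is.\<close>

lemma coorthogonal_of_weq:
  assumes U: "U \<in> Ob M" and f: "f \<in> Hom M X Y" and w: "CA f \<in> weq M"
  shows "h_coorthogonal M Q R (CO U) f"
proof -
  let ?B = "QO (CO U)"
  have B: "cofibrant M ?B" "\<epsilon> ?B \<in> weq M" using QO[OF CO_ob[OF U]] \<epsilon>QC_weq[OF U] by auto
  note o = hom_ob[OF f] and BO = cofibrant_ob[OF B(1)]
  note CB = CO_ob[OF BO] and RX = RO_ob[OF o(1)] and RY = RO_ob[OF o(2)]
  note A2 = QO_ob[OF CB] and CR = CA_hom[OF RA_hom[OF f]]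
  note s = map_ss[OF BO RX] map_ss[OF BO RY] map_ss[OF A2 RO_ob[OF CO_ob[OF RX]]] map_ss[OF A2 RO_ob[OF CO_ob[OF RY]]]
  have "RA (CA (RA f)) \<in> weq M" using RA_weq[OF CR] CRA_weq[OF f w] by simp
  then have "sset_weq (map_sp M (QO (CO ?B)) (RO (CO (RO X)))) (map_sp M (QO (CO ?B)) (RO (CO (RO Y)))) (postcomp M (QO (CO ?B)) (RA (CA (RA f))))"
    by (rule postcomp_weq[OF QO[OF CB] RO[OF CO_ob[OF RX]] RO[OF CO_ob[OF RY]] _ RA_hom[OF CR]])
  from sset_weq_comp[OF s(3,4) cmap_weq[OF B o(1)] this]
  have "sset_weq (map_sp M ?B (RO X)) (map_sp M (QO (CO ?B)) (RO (CO (RO Y)))) (\<lambda>n h. cmap ?B Y n (postcomp M ?B (RA f) n h))"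
    by (rule sset_weq_cong[OF s(4,1)]) (rule cmap_post[OF B f, symmetric])
  from sset_weq_first[OF s(2,4) postcomp_fun[OF BO RA_hom[OF f]] cmap_weq[OF B o(2)] this]
  show ?thesis unfolding h_coorthogonal_def hom_eqs(1,2)[OF f] .
qed

lemma coorthogonal_augmentation:
  assumes U: "U \<in> Ob M" and X: "X \<in> Ob M" shows "h_coorthogonal M Q R (CO U) (\<epsilon> X)"
  unfolding h_coorthogonal_def hom_eqs(1,2)[OF \<epsilon>_hom[OF X]]
  by (rule \<epsilon>_local[OF QO[OF CO_ob[OF U]] \<epsilon>QC_weq[OF U] X])

end

section \<open>The generating set\<close>

context augmented
begin

text \<open>The augmentations of \<open>X\<close> and \<open>Y\<close> induce weak equivalences on
  maps from \<open>C U\<close>, so the naturality square carries co-orthogonality from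
  \<open>f\<close> to \<open>C f\<close>.\<close>

lemma coorthogonal_C:
  assumes U: "U \<in> Ob M" and f: "f \<in> Hom M X Y" and h: "h_coorthogonal M Q R (CO U) f"
  shows "h_coorthogonal M Q R (CO U) (CA f)"
proof -
  let ?A = "QO (CO U)"
  note o = hom_ob[OF f]
  note A = QO_ob[OF CO_ob[OF U]] and Cf = CA_hom[OF f] and eX = \<epsilon>_hom[OF o(1)] and eY = \<epsilon>_hom[OF o(2)]
  note RX = RO_ob[OF o(1)] and RY = RO_ob[OF o(2)] and RCX = RO_ob[OF CO_ob[OF o(1)]] and RCY = RO_ob[OF CO_ob[OF o(2)]]
  note hX = coorthogonal_augmentation[OF U o(1), unfolded h_coorthogonal_def hom_eqs(1,2)[OF eX]]
  note hY = coorthogonal_augmentation[OF U o(2), unfolded h_coorthogonal_def hom_eqs(1,2)[OF eY]]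
  have "sset_weq (map_sp M ?A (RO (CO X))) (map_sp M ?A (RO Y)) (\<lambda>n x. postcomp M ?A (RA f) n (postcomp M ?A (RA (\<epsilon> X)) n x))"
    by (rule sset_weq_comp[OF map_ss[OF A RX] map_ss[OF A RY] hX h[unfolded h_coorthogonal_def hom_eqs(1,2)[OF f]]])
  then have "sset_weq (map_sp M ?A (RO (CO X))) (map_sp M ?A (RO Y)) (\<lambda>n x. postcomp M ?A (RA (\<epsilon> Y)) n (postcomp M ?A (RA (CA f)) n x))"
  proof (rule sset_weq_cong[OF map_ss[OF A RY] map_ss[OF A RCX]])
    fix n x assume x: "x \<in> mp ?A (RO (CO X)) n"
    have "RA f \<cdot> RA (\<epsilon> X) = RA (\<epsilon> Y) \<cdot> RA (CA f)"
      using RA_comp[OF eX f] RA_comp[OF Cf eY] \<epsilon>_nat[OF f] by simp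
    then show "postcomp M ?A (RA f) n (postcomp M ?A (RA (\<epsilon> X)) n x) = postcomp M ?A (RA (\<epsilon> Y)) n (postcomp M ?A (RA (CA f)) n x)"
      using postcomp_comp[OF A RA_hom[OF eX] RA_hom[OF f] x] postcomp_comp[OF A RA_hom[OF Cf] RA_hom[OF eY] x] by simp
  qed
  from sset_weq_first[OF map_ss[OF A RCY] map_ss[OF A RY] postcomp_fun[OF A RA_hom[OF Cf]] hY this]
  show ?thesis unfolding h_coorthogonal_def hom_eqs(1,2)[OF Cf] .
qed

text \<open>All that is later used of the fibration from \<open>map(A, D)\<close> to
  \<open>map(A, E)\<close> being a weak equivalence: it is surjective on vertices, and two vertices
  over the same one are joined by an edge in the fibre.\<close>

definition lifts_objects :: "'v \<Rightarrow> 'v \<Rightarrow> 'v \<Rightarrow> 'v \<Rightarrow> bool" where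
  "lifts_objects A D E p \<longleftrightarrow> (\<forall>w\<in>Hom M A E. \<exists>z\<in>Hom M A D. p \<cdot> z = w) \<and>
     (\<forall>h\<in>Hom M A D. \<forall>h'\<in>Hom M A D. p \<cdot> h = p \<cdot> h' \<longrightarrow>
       (\<exists>\<zeta>\<in>mp A D 1. postcomp M A p 1 \<zeta> = degen M (p \<cdot> h) 1 \<and>
          vtx (map_sp M A D) 1 \<zeta> 0 = h \<and> vtx (map_sp M A D) 1 \<zeta> 1 = h'))"

text \<open>\<open>D\<close> and \<open>E\<close> are cofibrant, so that they can serve as test
  objects \<open>A\<close> for later maps; they are fibrant, so that mapping spaces into them are
  homotopy invariant. The maps from \<open>Q C X\<close> and \<open>Q C Y\<close> are what transfers
  co-orthogonality from values of \<open>C\<close> to these test objects.\<close>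

lemma obstruction:
  assumes f: "f \<in> Hom M X Y" and nw: "CA f \<notin> weq M"
  shows "\<exists>D E p. p \<in> Hom M D E \<and> p \<in> fib M \<and> p \<notin> weq M \<and> cofibrant M D \<and> cofibrant M E \<and>
    (\<exists>a\<in>Hom M (QO (CO X)) D. a \<in> weq M) \<and> (\<exists>b\<in>Hom M (QO (CO Y)) E. b \<in> weq M) \<and>
    (\<forall>A U u. cofibrant M A \<and> U \<in> Ob M \<and> u \<in> weq M \<and> u \<in> Hom M (QO (CO U)) A \<and> h_coorthogonal M Q R (CO U) f \<longrightarrow>
      lifts_objects A D E p)"
proof -
  note o = hom_ob[OF f]
  note CX = CO_ob[OF o(1)] and CY = CO_ob[OF o(2)] and Cf = CA_hom[OF f]
  note RCX = RO_ob[OF CX] and RCY = RO_ob[OF CY] and RCf = RA_hom[OF Cf]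
  obtain D0 d where d: "cofibrant M D0" "d \<in> Hom M D0 (RO (CO X))" "d \<in> fib M" "d \<in> weq M"
    using cofibrant_cover[OF QO[OF CX] RCX] by blast
  obtain E e where e: "cofibrant M E" "e \<in> Hom M E (RO (CO Y))" "e \<in> fib M" "e \<in> weq M"
    using cofibrant_cover[OF QO[OF CX] RCY] by blast
  have D0: "fibrant M D0" by (rule fibrant_fib[OF RO[OF CX] d(2,3)])
  have E: "fibrant M E" by (rule fibrant_fib[OF RO[OF CY] e(2,3)])
  obtain m where m: "m \<in> Hom M D0 E" "e \<cdot> m = RA (CA f) \<cdot> d"
    using cofibrant_lift[OF d(1) e(3,4,2) comp_in[OF d(2) RCf]] by blast
  obtain D j p where p: "j \<in> Hom M D0 D" "p \<in> Hom M D E" "p \<cdot> j = m" "j \<in> cof M" "j \<in> weq M" "p \<in> fib M"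
    using factor_tcof_fib[OF m(1)] by blast
  have D: "fibrant M D" "cofibrant M D" by (rule fibrant_fib[OF E p(2,6)], rule cofibrant_cof[OF d(1) p(1,4)])
  have pw: "p \<notin> weq M"
  proof
    assume "p \<in> weq M"
    then have "m \<in> weq M" using weq_comp[OF p(5) _ p(1,2)] p(3) by simp
    then have "RA (CA f) \<cdot> d \<in> weq M" using weq_comp[OF _ e(4) m(1) e(2)] m(2) by simp
    then show False using weq_left[OF d(4) _ d(2) RCf] RA_weq[OF Cf] nw by simp
  qed
  have rq: "r Z \<cdot> q Z \<in> Hom M (QO Z) (RO Z)" "r Z \<cdot> q Z \<in> weq M" if Z: "Z \<in> Ob M" for Z
    using comp_in[OF q_hom[OF Z] r_hom[OF Z]] weq_comp[OF q_weq[OF Z] r_weq[OF Z] q_hom[OF Z] r_hom[OF Z]] by auto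
  obtain b where b: "b \<in> Hom M (QO (CO Y)) E" "e \<cdot> b = r (CO Y) \<cdot> q (CO Y)"
    using cofibrant_lift[OF QO[OF CY] e(3,4,2) rq(1)[OF CY]] by blast
  have bw: "b \<in> weq M" using weq_right[OF e(4) _ b(1) e(2)] b(2) rq(2)[OF CY] by simp
  obtain a where a: "a \<in> Hom M (QO (CO X)) D0" "d \<cdot> a = r (CO X) \<cdot> q (CO X)"
    using cofibrant_lift[OF QO[OF CX] d(3,4,2) rq(1)[OF CX]] by blast
  have aw: "a \<in> weq M" using weq_right[OF d(4) _ a(1) d(2)] a(2) rq(2)[OF CX] by simp
  have ja: "j \<cdot> a \<in> Hom M (QO (CO X)) D" "j \<cdot> a \<in> weq M" using comp_in[OF a(1) p(1)] weq_comp[OF aw p(5) a(1) p(1)] by auto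
  have "lifts_objects A D E p"
    if A: "cofibrant M A" and U: "U \<in> Ob M" and u: "u \<in> weq M" "u \<in> Hom M (QO (CO U)) A" and h: "h_coorthogonal M Q R (CO U) f"
    for A U u
  proof -
    let ?B = "QO (CO U)"
    have AO: "A \<in> Ob M" and BO: "?B \<in> Ob M" using hom_ob[OF u(2)] by auto
    have DO: "D \<in> Ob M" and EO: "E \<in> Ob M" and D0O: "D0 \<in> Ob M" using hom_ob[OF p(2)] hom_ob[OF p(1)] by auto
    note hC = coorthogonal_C[OF U f h, unfolded h_coorthogonal_def hom_eqs(1,2)[OF Cf]]
    \<comment> \<open>Co-orthogonality is given for \<open>?B\<close>. The weak equivalence
      \<open>u\<close> moves it to \<open>A\<close>, and the trivial fibrations \<open>d\<close> and
      \<open>e\<close> then move it from the replacement of \<open>C f\<close> to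
      \<open>m\<close>.\<close>
    have "sset_weq (map_sp M A (RO (CO X))) (map_sp M ?B (RO (CO Y)))
        (\<lambda>n x. postcomp M ?B (RA (CA f)) n (precomp M u (RO (CO X)) n x))"
      by (rule sset_weq_comp[OF map_ss[OF BO RCX] map_ss[OF BO RCY] precomp_weq[OF RO[OF CX] QO[OF CO_ob[OF U]] A u] hC])
    then have "sset_weq (map_sp M A (RO (CO X))) (map_sp M ?B (RO (CO Y)))
        (\<lambda>n x. precomp M u (RO (CO Y)) n (postcomp M A (RA (CA f)) n x))"
      by (rule sset_weq_cong[OF map_ss[OF BO RCY] map_ss[OF AO RCX]]) (rule pre_post[OF u(2) RCf, symmetric])
    then have "sset_weq (map_sp M A (RO (CO X))) (map_sp M A (RO (CO Y))) (postcomp M A (RA (CA f)))"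
      by (rule sset_weq_first[OF map_ss[OF AO RCY] map_ss[OF BO RCY] postcomp_fun[OF AO RCf] precomp_weq[OF RO[OF CY] QO[OF CO_ob[OF U]] A u]])
    then have "sset_weq (map_sp M A D0) (map_sp M A (RO (CO Y))) (\<lambda>n x. postcomp M A (RA (CA f)) n (postcomp M A d n x))"
      by (rule sset_weq_comp[OF map_ss[OF AO RCX] map_ss[OF AO RCY] postcomp_fib(2)[OF A d(3,2,4)]])
    then have "sset_weq (map_sp M A D0) (map_sp M A (RO (CO Y))) (\<lambda>n x. postcomp M A e n (postcomp M A m n x))"
      by (rule sset_weq_cong[OF map_ss[OF AO RCY] map_ss[OF AO D0O]])
        (simp add: postcomp_comp[OF AO d(2) RCf, symmetric] postcomp_comp[OF AO m(1) e(2), symmetric] m(2))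
    then have "sset_weq (map_sp M A D0) (map_sp M A E) (postcomp M A m)"
      by (rule sset_weq_first[OF map_ss[OF AO EO] map_ss[OF AO RCY] postcomp_fun[OF AO m(1)] postcomp_fib(2)[OF A e(3,2,4)]])
    then have wm: "sset_weq (map_sp M A D0) (map_sp M A E) (\<lambda>n x. postcomp M A p n (postcomp M A j n x))"
      by (rule sset_weq_cong[OF map_ss[OF AO EO] map_ss[OF AO D0O]]) (simp add: postcomp_comp[OF AO p(1,2), symmetric] p(3))
    \<comment> \<open>What is known to be a weak equivalence is the map induced by
      \<open>p \<cdot> j\<close>. Since \<open>j\<close> induces one as well,
      \<open>weq_lifting\<close> applies to the fibration induced by \<open>p\<close> with
      \<open>j\<close> as the restriction.\<close>
    interpret K: kan_fib "map_sp M A D" "map_sp M A E" "postcomp M A p"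
      using map_ss[OF AO DO] map_ss[OF AO EO] postcomp_fib(1)[OF A p(6,2)] by (simp add: kan_fib_def kan_fib_axioms_def)
    note wl = K.weq_lifting[OF postcomp_fun[OF AO p(1)] postcomp_weq[OF A D0 D(1) p(5,1)] wm]
    have dg: "K.dg w = degen M w 1" if "w \<in> Hom M A E" for w
      unfolding K.dg_def edg_def degen_eq[OF that] by simp
    show ?thesis
      unfolding lifts_objects_def
    proof (intro conjI ballI impI)
      fix w assume "w \<in> Hom M A E"
      then obtain z where "z \<in> mp A D 0" "postcomp M A p 0 z = w" using wl(1)[OF mp0] by blast
      then show "\<exists>z\<in>Hom M A D. p \<cdot> z = w" using map_vertices[OF AO DO] postcomp_0[OF p(2)] by metis
    next
      fix h h' assume hh: "h \<in> Hom M A D" "h' \<in> Hom M A D" "p \<cdot> h = p \<cdot> h'"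
      have "K.R (K.dg (p \<cdot> h)) h h'"
        using wl(2)[OF mp0[OF hh(1)] mp0[OF hh(2)]] postcomp_0[OF p(2) hh(1)] postcomp_0[OF p(2) hh(2)] hh(3) by simp
      then show "\<exists>\<zeta>\<in>mp A D 1. postcomp M A p 1 \<zeta> = degen M (p \<cdot> h) 1 \<and>
          vtx (map_sp M A D) 1 \<zeta> 0 = h \<and> vtx (map_sp M A D) 1 \<zeta> 1 = h'"
        unfolding K.R_def dg[OF comp_in[OF hh(1) p(2)]] .
    qed
  qed
  then show ?thesis using p(2,6) pw D(2) e(1) ja b(1) bw by blast
qed

text \<open>The path \<open>\<zeta>\<close> turns the strict lift \<open>l b\<close> into a lift for the square with sides \<open>h a\<close> and \<open>k b\<close>.\<close>

lemma lift_along_path: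
  assumes i: "i \<in> cof M" "i \<in> Hom M G G'" and p: "p \<in> fib M" "p \<in> Hom M D E" and p': "p' \<in> Hom M D' E'"
    and l: "l \<in> Hom M E' D" "p \<cdot> l = k" and a: "a \<in> Hom M G D'" and b: "b \<in> Hom M G' E'" and c: "b \<cdot> i = p' \<cdot> a"
    and \<zeta>: "\<zeta> \<in> mp D' D 1" "postcomp M D' p 1 \<zeta> = degen M (k \<cdot> p') 1" "vtx (map_sp M D' D) 1 \<zeta> 0 = l \<cdot> p'"
      "vtx (map_sp M D' D) 1 \<zeta> 1 = h" and h: "h \<in> Hom M D' D"
  shows "\<exists>s\<in>Hom M G' D. s \<cdot> i = h \<cdot> a \<and> p \<cdot> s = k \<cdot> b"
proof -
  have k: "k \<in> Hom M E' E" using comp_in[OF l(1) p(2)] l(2) by simp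
  note o = hom_ob[OF i(2)] hom_ob[OF p(2)] hom_ob[OF p']
  let ?W = "corner_target M i p" and ?Z = "map_sp M G' D"
  have W: "simplices ?W n = {(x, y). x \<in> mp G D n \<and> y \<in> mp G' E n \<and> postcomp M G p n x = precomp M i E n y}" for n
    by (simp add: corner_target_def pullback_sset_def hom_eqs[OF i(2)] hom_eqs[OF p(2)])
  have Wp: "vtx ?W n (x, y) k = (vtx (map_sp M G D) n x k, vtx (map_sp M G' E) n y k)" for n x y k
    by (simp add: vtx_def corner_target_def pullback_sset_def prod_sset_def hom_eqs[OF i(2)] hom_eqs[OF p(2)])
  have cm: "corner_map M i p n g = (precomp M i D n g, postcomp M G' p n g)" for n g
    by (simp add: corner_map_def hom_eqs[OF i(2)] hom_eqs[OF p(2)])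
  have kan: "Kan_fibration ?Z ?W (corner_map M i p)"
    using corner[OF i(1) p(1)] by (simp add: hom_eqs[OF i(2)] hom_eqs[OF p(2)])
  have lb: "l \<cdot> b \<in> Hom M G' D" and kb: "k \<cdot> b \<in> Hom M G' E" and kp: "k \<cdot> p' \<in> Hom M D' E" and lp: "l \<cdot> p' \<in> Hom M D' D"
    using comp_in[OF b l(1)] comp_in[OF b k] comp_in[OF p' k] comp_in[OF p' l(1)] by auto
  have vd: "vtx (map_sp M G' E) 1 (degen M (k \<cdot> b) 1) m = k \<cdot> b" if "m \<le> 1" for m
    using degen_pull[OF kb vtx_Delta[OF that]] degen_0[OF kb] by (simp add: vtx_def)
  \<comment> \<open>An edge of the corner target: over \<open>G\<close> the path from
    \<open>l \<cdot> p' \<cdot> a\<close> to \<open>h \<cdot> a\<close> obtained from \<zeta>, over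
    \<open>G'\<close> the constant path at \<open>k \<cdot> b\<close>. Lifting it from
    \<open>l \<cdot> b\<close> gives the required map at the other end.\<close>
  let ?e = "(precomp M a D 1 \<zeta>, degen M (k \<cdot> b) 1)"
  have va: "vtx (map_sp M G D) 1 (precomp M a D 1 \<zeta>) m = precomp M a D 0 (vtx (map_sp M D' D) 1 \<zeta> m)" if "m \<le> 1" for m
    by (rule simplicial_fun_vtx[OF precomp_fun[OF o(3) a] \<zeta>(1) that, symmetric])
  have "?e \<in> simplices ?W 1"
  proof -
    have "postcomp M G p 1 (precomp M a D 1 \<zeta>) = precomp M a E 1 (degen M (k \<cdot> p') 1)"
      using pre_post[OF a p(2) \<zeta>(1)] \<zeta>(2) by simp
    also have "\<dots> = degen M ((k \<cdot> b) \<cdot> i) 1"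
      using precomp_degen[OF a kp, of 1] assoc[OF a p' k] assoc[OF i(2) b k] c by simp
    finally show ?thesis
      unfolding W using simplicial_fun_in[OF precomp_fun[OF o(3) a] \<zeta>(1)] degen_in[OF kb] precomp_degen[OF i(2) kb, of 1] by simp
  qed
  moreover have "vtx ?W 1 ?e 0 = corner_map M i p 0 (l \<cdot> b)"
    unfolding Wp cm
    using va[of 0] \<zeta>(3) vd[of 0] precomp_0[OF a lp] precomp_0[OF i(2) lb] postcomp_0[OF p(2) lb]
      assoc[OF a p' l(1)] assoc[OF i(2) b l(1)] c assoc[OF b l(1) p(2)] l(2) by simp
  ultimately obtain \<xi> where \<xi>: "\<xi> \<in> mp G' D 1" "corner_map M i p 1 \<xi> = ?e"
    using kan_path_lifting[OF map_ss[OF o(2,3)] corner_target_ss[OF i(2) p(2)] kan, of 0 "l \<cdot> b" ?e] mp0[OF lb] by auto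
  let ?s = "vtx ?Z 1 \<xi> 1"
  have s: "?s \<in> Hom M G' D"
    using simplicial_set.vtx_in[OF map_ss[OF o(2,3)] \<xi>(1), of 1] map_vertices[OF o(2,3)] by simp
  have "?s \<cdot> i = vtx (map_sp M G D) 1 (precomp M i D 1 \<xi>) 1"
    using simplicial_fun_vtx[OF precomp_fun[OF o(3) i(2)] \<xi>(1), of 1] precomp_0[OF i(2) s] by simp
  also have "\<dots> = h \<cdot> a" using \<xi>(2) va[of 1] \<zeta>(4) precomp_0[OF a h] by (simp add: cm)
  finally have 1: "?s \<cdot> i = h \<cdot> a" .
  have "p \<cdot> ?s = vtx (map_sp M G' E) 1 (postcomp M G' p 1 \<xi>) 1"
    using simplicial_fun_vtx[OF postcomp_fun[OF o(2) p(2)] \<xi>(1), of 1] postcomp_0[OF p(2) s] by simp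
  also have "\<dots> = k \<cdot> b" using \<xi>(2) vd[of 1] by (simp add: cm)
  finally show ?thesis using 1 s by blast
qed

lemma small_detecting_set:
  assumes vop: "vopenka TYPE('v)" and comb: "combinatorial M"
  shows "\<exists>\<U>. \<U> \<subseteq> Ob M \<and> small \<U> \<and> (\<forall>f\<in>Ar M. (\<forall>U\<in>\<U>. h_coorthogonal M Q R (CO U) f) \<longrightarrow> CA f \<in> weq M)"
proof (rule ccontr)
  assume neg: "\<not> ?thesis"
  \<comment> \<open>Transfinite recursion: the sources and targets chosen before \<alpha> form a
    small set, so by assumption this set fails to detect some map, which becomes the next
    one.\<close>
  have "\<exists>F. \<forall>\<alpha>. F \<alpha> \<in> Ar M \<and> CA (F \<alpha>) \<notin> weq M \<and> (\<forall>\<beta>. below \<beta> \<alpha> \<longrightarrow>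
      h_coorthogonal M Q R (CO (src M (F \<beta>))) (F \<alpha>) \<and> h_coorthogonal M Q R (CO (tgt M (F \<beta>))) (F \<alpha>))"
  proof (rule dependent_wf_choice[OF wf_below, where P = "\<lambda>F \<alpha> f. f \<in> Ar M \<and> CA f \<notin> weq M \<and> (\<forall>\<beta>. below \<beta> \<alpha> \<longrightarrow>
      h_coorthogonal M Q R (CO (src M (F \<beta>))) f \<and> h_coorthogonal M Q R (CO (tgt M (F \<beta>))) f)"])
    fix \<alpha> F
    assume IH: "\<And>\<beta>. (\<beta>, \<alpha>) \<in> {(a, b). below a b} \<Longrightarrow> F \<beta> \<in> Ar M \<and> CA (F \<beta>) \<notin> weq M \<and> (\<forall>\<gamma>. below \<gamma> \<beta> \<longrightarrow>
      h_coorthogonal M Q R (CO (src M (F \<gamma>))) (F \<beta>) \<and> h_coorthogonal M Q R (CO (tgt M (F \<gamma>))) (F \<beta>))"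
    define \<U> where "\<U> = (\<lambda>\<beta>. src M (F \<beta>)) ` {\<beta>. below \<beta> \<alpha>} \<union> (\<lambda>\<beta>. tgt M (F \<beta>)) ` {\<beta>. below \<beta> \<alpha>}"
    have "small \<U>"
      unfolding \<U>_def sm_small[symmetric] by (intro sm_Un sm_image small_below[folded sm_small])
    moreover have "\<U> \<subseteq> Ob M" unfolding \<U>_def using IH src_tgt by auto
    ultimately obtain f where f: "f \<in> Ar M" "\<forall>U\<in>\<U>. h_coorthogonal M Q R (CO U) f" "CA f \<notin> weq M" using neg by blast
    show "\<exists>f. f \<in> Ar M \<and> CA f \<notin> weq M \<and> (\<forall>\<beta>. below \<beta> \<alpha> \<longrightarrow>
      h_coorthogonal M Q R (CO (src M (F \<beta>))) f \<and> h_coorthogonal M Q R (CO (tgt M (F \<beta>))) f)"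
      by (rule exI[of _ f]) (use f in \<open>auto simp: \<U>_def\<close>)
  qed simp
  then obtain F where F: "\<And>\<alpha>. F \<alpha> \<in> Ar M" "\<And>\<alpha>. CA (F \<alpha>) \<notin> weq M"
      "\<And>\<alpha> \<beta>. below \<beta> \<alpha> \<Longrightarrow> h_coorthogonal M Q R (CO (src M (F \<beta>))) (F \<alpha>)"
      "\<And>\<alpha> \<beta>. below \<beta> \<alpha> \<Longrightarrow> h_coorthogonal M Q R (CO (tgt M (F \<beta>))) (F \<alpha>)" by blast
  note FO = src_tgt[OF F(1)]
  have "\<forall>\<alpha>. \<exists>D E p. p \<in> Hom M D E \<and> p \<in> fib M \<and> p \<notin> weq M \<and> cofibrant M D \<and> cofibrant M E \<and>
    (\<exists>a\<in>Hom M (QO (CO (src M (F \<alpha>)))) D. a \<in> weq M) \<and> (\<exists>b\<in>Hom M (QO (CO (tgt M (F \<alpha>)))) E. b \<in> weq M) \<and>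
    (\<forall>A U u. cofibrant M A \<and> U \<in> Ob M \<and> u \<in> weq M \<and> u \<in> Hom M (QO (CO U)) A \<and> h_coorthogonal M Q R (CO U) (F \<alpha>) \<longrightarrow>
      lifts_objects A D E p)"
    by (intro allI obstruction[OF ar_hom[OF F(1)] F(2)])
  then obtain D E p where P: "\<And>\<alpha>. p \<alpha> \<in> Hom M (D \<alpha>) (E \<alpha>)" "\<And>\<alpha>. p \<alpha> \<in> fib M" "\<And>\<alpha>. p \<alpha> \<notin> weq M"
      "\<And>\<alpha>. cofibrant M (D \<alpha>)" "\<And>\<alpha>. cofibrant M (E \<alpha>)"
      "\<And>\<alpha>. \<exists>a\<in>Hom M (QO (CO (src M (F \<alpha>)))) (D \<alpha>). a \<in> weq M" "\<And>\<alpha>. \<exists>b\<in>Hom M (QO (CO (tgt M (F \<alpha>)))) (E \<alpha>). b \<in> weq M"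
      "\<And>\<alpha> A U u. cofibrant M A \<Longrightarrow> U \<in> Ob M \<Longrightarrow> u \<in> weq M \<Longrightarrow> u \<in> Hom M (QO (CO U)) A \<Longrightarrow>
        h_coorthogonal M Q R (CO U) (F \<alpha>) \<Longrightarrow> lifts_objects A (D \<alpha>) (E \<alpha>) (p \<alpha>)"
    unfolding choice_iff by blast
  have DE: "lifts_objects (D \<beta>) (D \<alpha>) (E \<alpha>) (p \<alpha>)" "lifts_objects (E \<beta>) (D \<alpha>) (E \<alpha>) (p \<alpha>)" if \<beta>: "below \<beta> \<alpha>" for \<alpha> \<beta>
  proof -
    obtain a where "a \<in> Hom M (QO (CO (src M (F \<beta>)))) (D \<beta>)" "a \<in> weq M" using P(6) by blast
    then show "lifts_objects (D \<beta>) (D \<alpha>) (E \<alpha>) (p \<alpha>)" using P(8)[OF P(4) _ _ _ F(3)[OF \<beta>]] FO by blast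
    obtain b where "b \<in> Hom M (QO (CO (tgt M (F \<beta>)))) (E \<beta>)" "b \<in> weq M" using P(7) by blast
    then show "lifts_objects (E \<beta>) (D \<alpha>) (E \<alpha>) (p \<alpha>)" using P(8)[OF P(5) _ _ _ F(4)[OF \<beta>]] FO by blast
  qed
  obtain I where I: "I \<subseteq> Ar M" "small I" "fib M \<inter> weq M = {p \<in> Ar M. \<forall>i\<in>I. has_lifting M i p}"
    using comb unfolding combinatorial_def cofibrantly_generated_def by blast
  have "\<exists>i a b. i \<in> I \<and> square M i (p \<alpha>) a b \<and> \<not> (\<exists>h\<in>Hom M (tgt M i) (src M (p \<alpha>)). h \<cdot> i = a \<and> p \<alpha> \<cdot> h = b)" for \<alpha>
  proof -
    have "p \<alpha> \<in> Ar M" "p \<alpha> \<notin> fib M \<inter> weq M" using hom_eqs[OF P(1)] P(3) by auto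
    then obtain i where "i \<in> I" "\<not> has_lifting M i (p \<alpha>)" unfolding I(3) by blast
    then show ?thesis unfolding has_lifting_def by blast
  qed
  then obtain i a b where sq: "\<And>\<alpha>. i \<alpha> \<in> I" "\<And>\<alpha>. square M (i \<alpha>) (p \<alpha>) (a \<alpha>) (b \<alpha>)"
      "\<And>\<alpha>. \<not> (\<exists>h\<in>Hom M (tgt M (i \<alpha>)) (src M (p \<alpha>)). h \<cdot> i \<alpha> = a \<alpha> \<and> p \<alpha> \<cdot> h = b \<alpha>)"
    by metis
  have "\<exists>i0\<in>I. \<not> small {\<alpha>. i \<alpha> = i0}"
  proof (rule ccontr)
    assume "\<not> ?thesis"
    then have "sm (\<Union>i0\<in>I. {\<alpha>. i \<alpha> = i0})" using I(2) by (intro sm_UNION) (auto simp: sm_small)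
    moreover have "(\<Union>i0\<in>I. {\<alpha>. i \<alpha> = i0}) = UNIV" using sq(1) by blast
    ultimately show False by (simp add: sm_def ordLess_irreflexive)
  qed
  then obtain i0 where i0: "i0 \<in> I" "\<not> small {\<alpha>. i \<alpha> = i0}" by blast
  have ih: "i0 \<in> Hom M (src M i0) (tgt M i0)" using I(1) i0(1) ar_hom by blast
  \<comment> \<open>The generating set is given only through the lifting property that singles out
    the trivial fibrations; that its members are cofibrations is recovered from this.\<close>
  have ic: "i0 \<in> cof M" by (rule cof_llp[OF ih]) (use I(3) i0(1) in blast)
  have lp: "locally_presentable M" using comb by (simp add: combinatorial_def)
  have sq0: "square M i0 (p \<alpha>) (a \<alpha>) (b \<alpha>)" if "\<alpha> \<in> {\<alpha>. i \<alpha> = i0}" for \<alpha> using sq(2)[of \<alpha>] that by simp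
  have "\<exists>x\<in>{\<alpha>. i \<alpha> = i0}. \<exists>y\<in>{\<alpha>. i \<alpha> = i0}. below x y \<and> (\<exists>h\<in>Hom M (src M (p x)) (src M (p y)).
      \<exists>k\<in>Hom M (tgt M (p x)) (tgt M (p y)). k \<cdot> p x = p y \<cdot> h \<and> h \<cdot> a x = a y \<and> k \<cdot> b x = b y)"
    by (rule vopenka_squares[OF vop lp i0(2) sq0])
  then obtain x y h k where xy: "i y = i0" "below x y" "i x = i0"
      and hk: "h \<in> Hom M (D x) (D y)" "k \<in> Hom M (E x) (E y)" "k \<cdot> p x = p y \<cdot> h" "h \<cdot> a x = a y" "k \<cdot> b x = b y"
    unfolding hom_eqs(1)[OF P(1)] hom_eqs(2)[OF P(1)] by blast
  have ab: "a x \<in> Hom M (src M i0) (D x)" "b x \<in> Hom M (tgt M i0) (E x)" "b x \<cdot> i0 = p x \<cdot> a x"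
    using sq0[of x] xy(3) hom_eqs[OF P(1)] by (auto simp: square_def)
  \<comment> \<open>Here the direction of the map of squares matters: \<open>F y\<close> was chosen
    co-orthogonal to the values of \<open>C\<close> on the source and target of \<open>F x\<close>,
    since \<open>x\<close> comes before \<open>y\<close>.\<close>
  obtain l where l: "l \<in> Hom M (E x) (D y)" "p y \<cdot> l = k" using DE(2)[OF xy(2)] hk(2) unfolding lifts_objects_def by blast
  have lp: "l \<cdot> p x \<in> Hom M (D x) (D y)" by (rule comp_in[OF P(1) l(1)])
  have e: "p y \<cdot> (l \<cdot> p x) = k \<cdot> p x" using assoc[OF P(1) l(1) P(1)] l(2) by simp
  then have "p y \<cdot> (l \<cdot> p x) = p y \<cdot> h" using hk(3) by simp
  then obtain \<zeta> where \<zeta>: "\<zeta> \<in> mp (D x) (D y) 1" "postcomp M (D x) (p y) 1 \<zeta> = degen M (k \<cdot> p x) 1"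
      "vtx (map_sp M (D x) (D y)) 1 \<zeta> 0 = l \<cdot> p x" "vtx (map_sp M (D x) (D y)) 1 \<zeta> 1 = h"
    using DE(1)[OF xy(2)] lp hk(1) e unfolding lifts_objects_def by metis
  from lift_along_path[OF ic ih P(2,1,1) l ab \<zeta> hk(1)]
  show False using sq(3)[of y] xy(1) hk(4,5) hom_eqs[OF P(1)] by auto
qed

text \<open>The generating set consists of the values of \<open>C\<close> on a detecting set. A map
  co-orthogonal to these values is inverted by \<open>C\<close>, hence co-orthogonal to all values
  of \<open>C\<close>, which puts every \<open>C X\<close> into the double co-orthogonal
  class.\<close>

lemma cellularization:
  assumes "vopenka TYPE('v)" "combinatorial M"
  shows "\<exists>\<X>. \<X> \<subseteq> Ob M \<and> small \<X> \<and> is_cellularization M Q R \<X> (underlying_fun M C) \<epsilon>"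
proof -
  obtain \<U> where U: "\<U> \<subseteq> Ob M" "small \<U>" "\<And>f. f \<in> Ar M \<Longrightarrow> \<forall>U\<in>\<U>. h_coorthogonal M Q R (CO U) f \<Longrightarrow> CA f \<in> weq M"
    using small_detecting_set[OF assms] by blast
  have "h_coorthogonal M Q R (CO X) f" if f: "f \<in> coorth_maps M Q R (CO ` \<U>)" and X: "X \<in> Ob M" for X f
  proof -
    have fa: "f \<in> Ar M" "\<forall>U\<in>\<U>. h_coorthogonal M Q R (CO U) f" using f by (auto simp: coorth_maps_def)
    show ?thesis by (rule coorthogonal_of_weq[OF X ar_hom[OF fa(1)] U(3)[OF fa]])
  qed
  moreover have "\<epsilon> X \<in> coorth_maps M Q R (CO ` \<U>)" if X: "X \<in> Ob M" for X
    using coorthogonal_augmentation[OF _ X] U(1) hom_eqs[OF \<epsilon>_hom[OF X]] by (auto simp: coorth_maps_def)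
  moreover have "is_nat_trans M M (underlying_fun M C) id_fun \<epsilon>"
    unfolding is_nat_trans_def
  proof (intro conjI ballI)
    show "\<epsilon> X \<in> Hom M (fob (underlying_fun M C) X) (fob id_fun X)" if "X \<in> Ob M" for X
      using \<epsilon>_hom[OF that] by (simp add: underlying_fun_def id_fun_def)
    show "\<epsilon> (tgt M f) \<cdot> CA f = far id_fun f \<cdot> \<epsilon> (src M f)" if "f \<in> Ar M" for f
      using \<epsilon>_nat[OF ar_hom[OF that]] by (simp add: id_fun_def)
  qed
  ultimately have "is_cellularization M Q R (CO ` \<U>) (underlying_fun M C) \<epsilon>"
    using aug CO_ob by (auto simp: is_cellularization_def augmented_homotopy_idempotent_simplicial_functor_def
      coorth_obs_def underlying_fun_def)
  moreover have "CO ` \<U> \<subseteq> Ob M" "small (CO ` \<U>)"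
    using U(1,2) CO_ob sm_image[of \<U> CO] by (auto simp: sm_small)
  ultimately show ?thesis by blast
qed

end

theorem theorem2p1:
  fixes M :: "'v smodel" and Q R :: "'v cfun" and q r :: "'v \<Rightarrow> 'v"
    and C :: "'v sfun" and \<epsilon> :: "'v \<Rightarrow> 'v"
  assumes "inaccessible TYPE('v)"
    and "vopenka TYPE('v)"
    and "simplicial_model_category M" and "combinatorial M"
    and "cofibrant_replacement M Q q" and "fibrant_replacement M R r"
    and "augmented_homotopy_idempotent_simplicial_functor M C \<epsilon>"
  shows "\<exists>\<X>. \<X> \<subseteq> Ob M \<and> small \<X> \<and> is_cellularization M Q R \<X> (underlying_fun M C) \<epsilon>"
proof -
  interpret simplicial_model_category M by fact
  interpret augmented M "TYPE('v)" Q R q r C \<epsilon>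
    by unfold_locales (use assms in auto)
  show ?thesis by (rule cellularization) fact+
qed

end
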